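(* Let $(M,g)$ be an $n$-dimensional ($n\ge 3$) Riemannian manifold of constant sectional curvature $K=c$ with a spin structure, and let $j\ge 0$ be an integer. For the higher spin Dirac operator $D_j$ and the standard Laplacian $\Delta_j$ on $\Gamma(S_j)$, define for $s=0,1,\dots$ the second order operator on $\Gamma(S_j)$ $$B(s;j):=D_j^2-\frac{(n+2s-2)^2}{(n+2j-2)^2}\left(\Delta_j-\left(s(n+s-2)-\frac{n(n-1)}{8}\right)c\right).$$ Then $$\prod_{s=0}^{j}B(s;j)=0 .$$
   Context: Notation: $(x)_k$ means $x$ repeated $k$ times; irreducible representations are labelled by highest weights in standard coordinates. $\mathrm{Spin}(M)$ is the spin structure (a principal $\mathrm{Spin}(n)$-bundle). Bundles. For $n=2m$, $W_j=W_j^+\oplus W_j^-$ where $W_j^{\pm}$ is the irreducible unitary $\mathrm{Spin}(n)$-module of highest weight $(j+1/2,(1/2)_{m-2},\pm 1/2)$; for $n=2m-1$, $W_j$ is the irreducible module of highest weight $(j+1/2,(1/2)_{m-2})$. $S_j:=\mathrm{Spin}(M)\times_{\mathrm{Spin}(n)}W_j$ with its induced Hermitian metric ($S_0$ is the spinor bundle). $\Gamma$ denotes smooth sections and $\nabla$ the covariant derivative induced by the Levi-Civita connection. Operators. Let $\mathrm{Sym}^j_0$ be the bundle of trace-free complex symmetric $j$-tensors. There is an orthogonal decomposition $S_0\otimes \mathrm{Sym}^j_0=S_j\oplus S_{j-1}$ ($S_{-1}=0$), where $S_j$ is the kernel of the Clifford contraction $S_0\otimes\mathrm{Sym}_0^j\to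 S_0\otimes \mathrm{Sym}_0^{j-1}$, $\psi\otimes v^j\mapsto v\cdot\psi\otimes v^{j-1}$ ($v$ null). The twisted Dirac operator is $D(j)=\sum_k (e_k\cdot\otimes \mathrm{id})\circ\nabla_{e_k}$ ($\{e_k\}$ a local orthonormal frame, $e_k\cdot$ Clifford multiplication with $e_k\cdot e_k\cdot=-1$). The higher spin Dirac operator $D_j:\Gamma(S_j)\to\Gamma(S_j)$ is the $S_j\to S_j$ block of $D(j)$. Standard (Lichnerowicz) Laplacian: on a bundle $S_\rho$ associated to a representation $\pi_\rho$, $\Delta_\rho:=\nabla^*\nabla+\frac12 R_\rho$ with $R_\rho=\frac12\sum_{i,j,k,l} R_{ijkl}\,\pi_\rho(e_{ij}e_{kl})$, $R_{ijkl}=g(R(e_i,e_j)e_k,e_l)$, $e_{ij}=e_i\wedge e_j\in\mathfrak{so}(TM)$, the sign convention being such that for constant curvature $c$, $\frac12R_\rho=\frac c2\pi_\rho(c_2)$ with $c_2=\sum_{i,j}e_{ij}e_{ji}$ (a non-negative scalar on irreducibles). $\Delta_j$ is this operator on $S_j$; for constant curvature $c$ it is $\nabla^*\nabla+(j(n+j-1)+\frac{n(n-1)}{8})c$. *)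

theory Defs
  imports "HOL-Analysis.Analysis" "HOL-Library.Multiset"
begin

section \<open>Smooth functions between Euclidean spaces\<close>

text \<open>Only meaningful for open \<open>S\<close>.\<close>

fun Ck_on :: "nat \<Rightarrow> 'a::euclidean_space set \<Rightarrow> ('a \<Rightarrow> 'b::real_normed_vector) \<Rightarrow> bool" where
  "Ck_on 0 S f = continuous_on S f"
| "Ck_on (Suc k) S f =
     ((\<forall>x\<in>S. f differentiable (at x)) \<and> (\<forall>v. Ck_on k S (\<lambda>x. frechet_derivative f (at x) v)))"

definition smooth_on :: "'a::euclidean_space set \<Rightarrow> ('a \<Rightarrow> 'b::real_normed_vector) \<Rightarrow> bool" where
  "smooth_on S f \<longleftrightarrow> (\<forall>k. Ck_on k S f)"


section \<open>Riemannian manifolds\<close>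

text \<open>
  A chart is a pair of a domain and a coordinate map.  A tangent vector at a point is given by its
  components in every chart around that point, subject to the usual transformation law; the
  components in all other charts are set to \<open>0\<close>, so that tangent vectors are equal iff they agree
  as functions.
\<close>

type_synonym ('m, 'n) chart = "'m set \<times> ('m \<Rightarrow> real^'n)"
type_synonym ('m, 'n) tvec = "('m, 'n) chart \<Rightarrow> real^'n"

record ('m, 'n::finite) rmfd =
  Mtop :: "'m topology"
  Atlas :: "('m, 'n) chart set"
  Metric :: "'m \<Rightarrow> ('m, 'n) tvec \<Rightarrow> ('m, 'n) tvec \<Rightarrow> real"

definition cinv :: "('m, 'n::finite) chart \<Rightarrow> real^'n \<Rightarrow> 'm" where
  "cinv c = inv_into (fst c) (snd c)"

definition charts_at :: "('m, 'n::finite) rmfd \<Rightarrow> 'm \<Rightarrow> ('m, 'n) chart set" where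
  "charts_at M x = {c \<in> Atlas M. x \<in> fst c}"

definition smooth_manifold :: "('m, 'n::finite) rmfd \<Rightarrow> bool" where
  "smooth_manifold M \<longleftrightarrow>
     Hausdorff_space (Mtop M) \<and> second_countable (Mtop M) \<and>
     (\<Union>c\<in>Atlas M. fst c) = topspace (Mtop M) \<and>
     (\<forall>c\<in>Atlas M. openin (Mtop M) (fst c) \<and> open (snd c ` fst c) \<and>
        homeomorphic_map (subtopology (Mtop M) (fst c)) (top_of_set (snd c ` fst c)) (snd c)) \<and>
     (\<forall>c\<in>Atlas M. \<forall>d\<in>Atlas M. smooth_on (snd c ` (fst c \<inter> fst d)) (snd d \<circ> cinv c))"

definition smooth_map_on ::
    "('m, 'n::finite) rmfd \<Rightarrow> 'm set \<Rightarrow> ('m \<Rightarrow> 'b::real_normed_vector) \<Rightarrow> bool" where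
  "smooth_map_on M U f \<longleftrightarrow> (\<forall>c\<in>Atlas M. smooth_on (snd c ` (fst c \<inter> U)) (f \<circ> cinv c))"

definition tangent_space :: "('m, 'n::finite) rmfd \<Rightarrow> 'm \<Rightarrow> ('m, 'n) tvec set" where
  "tangent_space M x =
     {X. (\<forall>c\<in>charts_at M x. \<forall>d\<in>charts_at M x.
            X d = frechet_derivative (snd d \<circ> cinv c) (at (snd c x)) (X c)) \<and>
         (\<forall>c. c \<notin> charts_at M x \<longrightarrow> X c = 0)}"

text \<open>The tangent vector at \<open>x\<close> whose components in the chart \<open>c\<close> are \<open>v\<close>.\<close>

definition coord_vec :: "('m, 'n::finite) rmfd \<Rightarrow> ('m, 'n) chart \<Rightarrow> 'm \<Rightarrow> real^'n \<Rightarrow> ('m, 'n) tvec" where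
  "coord_vec M c x v =
     (\<lambda>d. if d \<in> charts_at M x then frechet_derivative (snd d \<circ> cinv c) (at (snd c x)) v else 0)"

text \<open>The metric in the chart \<open>c\<close>, at coordinates \<open>p\<close>.\<close>

definition metric_coord ::
    "('m, 'n::finite) rmfd \<Rightarrow> ('m, 'n) chart \<Rightarrow> real^'n \<Rightarrow> real^'n \<Rightarrow> real^'n \<Rightarrow> real" where
  "metric_coord M c p v w =
     Metric M (cinv c p) (coord_vec M c (cinv c p) v) (coord_vec M c (cinv c p) w)"

definition riemannian_manifold :: "('m, 'n::finite) rmfd \<Rightarrow> bool" where
  "riemannian_manifold M \<longleftrightarrow>
     smooth_manifold M \<and>
     (\<forall>x\<in>topspace (Mtop M). \<forall>X\<in>tangent_space M x. \<forall>Y\<in>tangent_space M x.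
        Metric M x X Y = Metric M x Y X \<and>
        (X \<noteq> (\<lambda>_. 0) \<longrightarrow> Metric M x X X > 0) \<and>
        (\<forall>Z\<in>tangent_space M x. \<forall>a. Metric M x (\<lambda>c. a *\<^sub>R X c + Y c) Z
             = a * Metric M x X Z + Metric M x Y Z)) \<and>
     (\<forall>c\<in>Atlas M. \<forall>v w. smooth_on (snd c ` fst c) (\<lambda>p. metric_coord M c p v w))"

definition chart_at :: "('m, 'n::finite) rmfd \<Rightarrow> 'm \<Rightarrow> ('m, 'n) chart" where
  "chart_at M x = (SOME c. c \<in> charts_at M x)"

text \<open>The derivative of \<open>f\<close> at \<open>x\<close> in the direction of a tangent vector.  Like the next
  definitions, it does not depend on the chosen chart.\<close>

definition dir_deriv ::
    "('m, 'n::finite) rmfd \<Rightarrow> 'm \<Rightarrow> ('m, 'n) tvec \<Rightarrow> ('m \<Rightarrow> 'b::real_normed_vector) \<Rightarrow> 'b" where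
  "dir_deriv M x X f =
     (let c = chart_at M x in frechet_derivative (f \<circ> cinv c) (at (snd c x)) (X c))"

text \<open>
  \<open>christoffel M c p v w\<close> is, in coordinates, the Levi-Civita derivative \<open>\<nabla>\<^sub>v w\<close> of the constant
  coordinate field \<open>w\<close>: the Koszul formula, where the brackets of constant coordinate fields
  vanish.
\<close>

definition christoffel ::
    "('m, 'n::finite) rmfd \<Rightarrow> ('m, 'n) chart \<Rightarrow> real^'n \<Rightarrow> real^'n \<Rightarrow> real^'n \<Rightarrow> real^'n" where
  "christoffel M c p v w =
     (THE y. \<forall>z. 2 * metric_coord M c p y z =
          frechet_derivative (\<lambda>q. metric_coord M c q w z) (at p) v
        + frechet_derivative (\<lambda>q. metric_coord M c q v z) (at p) w
        - frechet_derivative (\<lambda>q. metric_coord M c q v w) (at p) z)"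

text \<open>\<open>\<nabla>\<^sub>X Y\<close> at \<open>x\<close>, for a tangent vector \<open>X\<close> at \<open>x\<close> and a vector field \<open>Y\<close> around \<open>x\<close>.\<close>

definition levi_civita ::
    "('m, 'n::finite) rmfd \<Rightarrow> 'm \<Rightarrow> ('m, 'n) tvec \<Rightarrow> ('m \<Rightarrow> ('m, 'n) tvec) \<Rightarrow> ('m, 'n) tvec" where
  "levi_civita M x X Y =
     (let c = chart_at M x in
      coord_vec M c x (frechet_derivative (\<lambda>p. Y (cinv c p) c) (at (snd c x)) (X c)
                       + christoffel M c (snd c x) (X c) (Y x c)))"

text \<open>
  \<open>R(X,Y)Z = \<nabla>\<^sub>X\<nabla>\<^sub>Y Z - \<nabla>\<^sub>Y\<nabla>\<^sub>X Z - \<nabla>\<^bsub>[X,Y]\<^esub> Z\<close>, computed by extending \<open>X, Y, Z\<close> to constant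
  coordinate fields.
\<close>

definition curvature ::
    "('m, 'n::finite) rmfd \<Rightarrow> 'm \<Rightarrow> ('m, 'n) tvec \<Rightarrow> ('m, 'n) tvec \<Rightarrow> ('m, 'n) tvec \<Rightarrow> ('m, 'n) tvec" where
  "curvature M x X Y Z =
     (let c = chart_at M x; p = snd c x; G = christoffel M c; v = X c; w = Y c; z = Z c in
      coord_vec M c x
        (frechet_derivative (\<lambda>q. G q w z) (at p) v + G p v (G p w z)
         - (frechet_derivative (\<lambda>q. G q v z) (at p) w + G p w (G p v z))))"

definition sectional_curvature ::
    "('m, 'n::finite) rmfd \<Rightarrow> 'm \<Rightarrow> ('m, 'n) tvec \<Rightarrow> ('m, 'n) tvec \<Rightarrow> real" where
  "sectional_curvature M x X Y =
     Metric M x (curvature M x X Y Y) X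
       / (Metric M x X X * Metric M x Y Y - (Metric M x X Y)\<^sup>2)"

definition constant_curvature :: "('m, 'n::finite) rmfd \<Rightarrow> real \<Rightarrow> bool" where
  "constant_curvature M K \<longleftrightarrow>
     (\<forall>x\<in>topspace (Mtop M). \<forall>X\<in>tangent_space M x. \<forall>Y\<in>tangent_space M x.
        (\<forall>a b. (\<lambda>c. a *\<^sub>R X c + b *\<^sub>R Y c) = (\<lambda>_. 0) \<longrightarrow> a = 0 \<and> b = 0) \<longrightarrow>
        sectional_curvature M x X Y = K)"


section \<open>Spinors and the group Spin(n)\<close>

text \<open>
  A spinor module is an irreducible complex module of the Clifford algebra of \<open>\<real>\<^sup>n\<close> (with
  \<open>v \<cdot> v = -|v|\<^sup>2\<close>), given by the skew-Hermitian matrices \<open>\<gamma> k\<close> by which the standard basis acts on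
  \<open>complex^'s\<close> (the index type \<open>'s\<close> then necessarily has \<open>2 ^ (n div 2)\<close> elements).  As a module of Spin(n) it
  is the sum of both half-spin modules for even \<open>n\<close>, and the irreducible spin module for odd \<open>n\<close>.
\<close>

type_synonym ('n, 's) gammas = "'n \<Rightarrow> complex^'s^'s"

definition spinor_module :: "('n::finite, 's::finite) gammas \<Rightarrow> bool" where
  "spinor_module \<gamma> \<longleftrightarrow>
     (\<forall>k l. \<gamma> k ** \<gamma> l + \<gamma> l ** \<gamma> k = (if k = l then mat (- 2) else 0)) \<and>
     (\<forall>k a b. \<gamma> k $ a $ b = - cnj (\<gamma> k $ b $ a)) \<and>
     (\<forall>V. vec.subspace V \<and> (\<forall>k. \<forall>\<psi>\<in>V. \<gamma> k *v \<psi> \<in> V) \<longrightarrow> V = {0} \<or> V = UNIV)"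

definition cliff :: "('n::finite, 's::finite) gammas \<Rightarrow> real^'n \<Rightarrow> complex^'s^'s" where
  "cliff \<gamma> v = (\<Sum>k\<in>UNIV. (v $ k) *\<^sub>R \<gamma> k)"

text \<open>Spin(n) consists of the products of an even number of unit vectors; it acts faithfully on a
  spinor module, so it is realised as a group of matrices.\<close>

definition Spin :: "('n::finite, 's::finite) gammas \<Rightarrow> (complex^'s^'s) set" where
  "Spin \<gamma> = {foldr (\<lambda>v h. cliff \<gamma> v ** h) vs (mat 1) | vs.
               even (length vs) \<and> (\<forall>v\<in>set vs. norm v = 1)}"

text \<open>The double covering of SO(n): \<open>h \<cdot> v \<cdot> h\<^sup>-\<^sup>1 = A v\<close> in the Clifford algebra.\<close>

definition Spin_cover :: "('n::finite, 's::finite) gammas \<Rightarrow> complex^'s^'s \<Rightarrow> real^'n^'n" where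
  "Spin_cover \<gamma> h = (THE A. \<forall>v. h ** cliff \<gamma> v = cliff \<gamma> (A *v v) ** h)"


section \<open>The modules \<open>W\<^sub>j\<close>\<close>

text \<open>
  A spinor-valued tensor is given by its components with respect to the standard basis; an element of
  \<open>W\<^sub>0 \<otimes> (\<complex>\<^sup>n)\<^sup>\<otimes>\<^sup>j\<close> is supported on the index lists of length \<open>j\<close>.  The maps below treat tensors
  of all ranks simultaneously.
\<close>

type_synonym ('n, 's) stensor = "'n list \<Rightarrow> complex^'s"

definition Spin_act ::
    "('n::finite, 's::finite) gammas \<Rightarrow> complex^'s^'s \<Rightarrow> ('n, 's) stensor \<Rightarrow> ('n, 's) stensor" where
  "Spin_act \<gamma> h \<psi> is =
     h *v (\<Sum>ks | length ks = length is.
             (\<Prod>i<length is. Spin_cover \<gamma> h $ (is ! i) $ (ks ! i)) *\<^sub>R \<psi> ks)"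

text \<open>
  The differential of \<open>Spin_act\<close>, as a representation of so(n) (skew matrices).  On spinors, the
  matrix \<open>A\<close> acts by the element \<open>s = 1/4 \<Sum>\<^sub>k\<^sub>,\<^sub>l A\<^sub>l\<^sub>k e\<^sub>k e\<^sub>l\<close> of the Clifford algebra, which
  satisfies \<open>s v - v s = A v\<close>.
\<close>

definition so_act ::
    "('n::finite, 's::finite) gammas \<Rightarrow> real^'n^'n \<Rightarrow> ('n, 's) stensor \<Rightarrow> ('n, 's) stensor" where
  "so_act \<gamma> A \<psi> is =
     (\<Sum>k\<in>UNIV. \<Sum>l\<in>UNIV. ((A $ l $ k) / 4) *\<^sub>R ((\<gamma> k ** \<gamma> l) *v \<psi> is))
     + (\<Sum>i<length is. \<Sum>b\<in>UNIV. (A $ (is ! i) $ b) *\<^sub>R \<psi> (is[i := b]))"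

text \<open>\<open>e\<^sub>k \<and> e\<^sub>l\<close> as a skew matrix, mapping \<open>e\<^sub>k\<close> to \<open>e\<^sub>l\<close> and \<open>e\<^sub>l\<close> to \<open>-e\<^sub>k\<close>.  (The opposite
  identification yields the same curvature endomorphism, which is quadratic.)\<close>

definition wedge :: "'n::finite \<Rightarrow> 'n \<Rightarrow> real^'n^'n" where
  "wedge k l = (\<chi> a b. (if a = l \<and> b = k then 1 else 0) - (if a = k \<and> b = l then 1 else 0))"

definition cliff_contract :: "('n::finite, 's::finite) gammas \<Rightarrow> ('n, 's) stensor \<Rightarrow> ('n, 's) stensor" where
  "cliff_contract \<gamma> \<psi> is = (\<Sum>k\<in>UNIV. \<gamma> k *v \<psi> (k # is))"

text \<open>\<open>W\<^sub>0 \<otimes> Sym\<^sub>0\<^sup>j\<close>, and the kernel of the Clifford contraction in it, which is the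
  unitary module of highest weight \<open>(j + 1/2, 1/2, \<dots>, 1/2)\<close> for odd \<open>n\<close>, and the sum of the two
  modules of highest weights \<open>(j + 1/2, 1/2, \<dots>, \<plusminus>1/2)\<close> for even \<open>n\<close>.\<close>

definition spinor_Sym0 :: "nat \<Rightarrow> ('n::finite, 's::finite) stensor set" where
  "spinor_Sym0 j =
     {\<psi>. (\<forall>is. length is \<noteq> j \<longrightarrow> \<psi> is = 0) \<and>
         (\<forall>is ks. mset is = mset ks \<longrightarrow> \<psi> is = \<psi> ks) \<and>
         (\<forall>is. (\<Sum>k\<in>UNIV. \<psi> (k # k # is)) = 0)}"

definition W :: "('n::finite, 's::finite) gammas \<Rightarrow> nat \<Rightarrow> ('n, 's) stensor set" where
  "W \<gamma> j = {\<psi> \<in> spinor_Sym0 j. cliff_contract \<gamma> \<psi> = (\<lambda>_. 0)}"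

definition herm :: "nat \<Rightarrow> ('n::finite, 's::finite) stensor \<Rightarrow> ('n, 's) stensor \<Rightarrow> complex" where
  "herm j \<psi> \<phi> = (\<Sum>is | length is = j. \<Sum>a\<in>UNIV. \<psi> is $ a * cnj (\<phi> is $ a))"

text \<open>The orthogonal projection of \<open>W\<^sub>0 \<otimes> Sym\<^sub>0\<^sup>j\<close> onto \<open>W\<^sub>j\<close>.\<close>

definition W_proj ::
    "('n::finite, 's::finite) gammas \<Rightarrow> nat \<Rightarrow> ('n, 's) stensor \<Rightarrow> ('n, 's) stensor" where
  "W_proj \<gamma> j \<psi> = (THE \<phi>. \<phi> \<in> W \<gamma> j \<and> (\<forall>\<eta>\<in>W \<gamma> j. herm j (\<lambda>is. \<psi> is - \<phi> is) \<eta> = 0))"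


section \<open>Spin structures\<close>

text \<open>
  A principal Spin(n)-bundle \<open>P\<close> over \<open>M\<close>; its topology and smooth structure are given by a bundle
  atlas \<open>PSecs\<close> of local sections (pairs of a domain and a section), i.e. of local trivialisations
  \<open>(x, h) \<mapsto> \<sigma> x \<cdot> h\<close>.  The map \<open>PFrame\<close> is the covering of the bundle of oriented orthonormal
  frames.
\<close>

record ('m, 'n::finite, 'p, 's::finite) spinstr =
  PTot :: "'p set"
  PBase :: "'p \<Rightarrow> 'm"
  PAct :: "'p \<Rightarrow> complex^'s^'s \<Rightarrow> 'p"
  PSecs :: "('m set \<times> ('m \<Rightarrow> 'p)) set"
  PFrame :: "'p \<Rightarrow> 'n \<Rightarrow> ('m, 'n) tvec"

definition smooth_local_section ::
    "('m, 'n::finite) rmfd \<Rightarrow> ('n, 's::finite) gammas \<Rightarrow> ('m, 'n, 'p, 's) spinstr \<Rightarrow>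
     'm set \<Rightarrow> ('m \<Rightarrow> 'p) \<Rightarrow> bool" where
  "smooth_local_section M \<gamma> P U \<sigma> \<longleftrightarrow>
     openin (Mtop M) U \<and> (\<forall>x\<in>U. \<sigma> x \<in> PTot P \<and> PBase P (\<sigma> x) = x) \<and>
     (\<forall>(V, \<tau>)\<in>PSecs P. \<exists>h. smooth_map_on M (U \<inter> V) h \<and>
        (\<forall>x\<in>U \<inter> V. h x \<in> Spin \<gamma> \<and> \<sigma> x = PAct P (\<tau> x) (h x)))"

definition principal_Spin_bundle ::
    "('m, 'n::finite) rmfd \<Rightarrow> ('n, 's::finite) gammas \<Rightarrow> ('m, 'n, 'p, 's) spinstr \<Rightarrow> bool" where
  "principal_Spin_bundle M \<gamma> P \<longleftrightarrow>
     (\<forall>u\<in>PTot P. PBase P u \<in> topspace (Mtop M)) \<and>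
     (\<forall>u\<in>PTot P. PAct P u (mat 1) = u) \<and>
     (\<forall>u\<in>PTot P. \<forall>h\<in>Spin \<gamma>. PAct P u h \<in> PTot P \<and> PBase P (PAct P u h) = PBase P u \<and>
        (\<forall>k\<in>Spin \<gamma>. PAct P (PAct P u h) k = PAct P u (h ** k))) \<and>
     (\<forall>u\<in>PTot P. \<forall>v\<in>PTot P. PBase P u = PBase P v \<longrightarrow> (\<exists>!h. h \<in> Spin \<gamma> \<and> v = PAct P u h)) \<and>
     (\<Union>(U, \<sigma>)\<in>PSecs P. U) = topspace (Mtop M) \<and>
     (\<forall>(U, \<sigma>)\<in>PSecs P. smooth_local_section M \<gamma> P U \<sigma>)"

definition spin_structure ::
    "('m, 'n::finite) rmfd \<Rightarrow> ('n, 's::finite) gammas \<Rightarrow> ('m, 'n, 'p, 's) spinstr \<Rightarrow> bool" where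
  "spin_structure M \<gamma> P \<longleftrightarrow>
     principal_Spin_bundle M \<gamma> P \<and>
     (\<forall>u\<in>PTot P. \<forall>k. PFrame P u k \<in> tangent_space M (PBase P u)) \<and>
     (\<forall>u\<in>PTot P. \<forall>k l. Metric M (PBase P u) (PFrame P u k) (PFrame P u l) = (if k = l then 1 else 0)) \<and>
     (\<forall>u\<in>PTot P. \<forall>h\<in>Spin \<gamma>. \<forall>k.
        PFrame P (PAct P u h) k = (\<lambda>c. \<Sum>l\<in>UNIV. (Spin_cover \<gamma> h $ l $ k) *\<^sub>R PFrame P u l c)) \<and>
     (\<forall>(U, \<sigma>)\<in>PSecs P. \<forall>c\<in>Atlas M. \<forall>k.
        smooth_on (snd c ` (fst c \<inter> U)) (\<lambda>p. PFrame P (\<sigma> (cinv c p)) k c))"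


section \<open>Sections of \<open>S\<^sub>j\<close> and differential operators\<close>

text \<open>
  A section of the bundle associated to a Spin(n)-module is an equivariant function \<open>f\<close> on \<open>P\<close>
  (\<open>f (u h) = h\<^sup>-\<^sup>1 f u\<close>): \<open>f u\<close> are the components of the section at the base point of \<open>u\<close> with
  respect to \<open>u\<close>.
\<close>

type_synonym ('p, 'n, 's) field = "'p \<Rightarrow> ('n, 's) stensor"

definition S_sections ::
    "('m, 'n::finite) rmfd \<Rightarrow> ('n, 's::finite) gammas \<Rightarrow> ('m, 'n, 'p, 's) spinstr \<Rightarrow> nat \<Rightarrow>
     ('p, 'n, 's) field set" where
  "S_sections M \<gamma> P j =
     {f. (\<forall>u\<in>PTot P. f u \<in> W \<gamma> j) \<and>
         (\<forall>u\<in>PTot P. \<forall>h\<in>Spin \<gamma>. Spin_act \<gamma> h (f (PAct P u h)) = f u) \<and>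
         (\<forall>(U, \<sigma>)\<in>PSecs P. \<forall>is. smooth_map_on M U (\<lambda>x. f (\<sigma> x) is))}"

text \<open>The matrix \<open>\<omega>\<^sub>a\<^sub>b = g(\<nabla>\<^sub>X E\<^sub>b, E\<^sub>a)\<close> of the Levi-Civita connection with respect to the
  orthonormal frame \<open>E\<close> belonging to a local section of \<open>P\<close>.\<close>

definition conn_form ::
    "('m, 'n::finite) rmfd \<Rightarrow> ('m, 'n, 'p, 's::finite) spinstr \<Rightarrow> ('m \<Rightarrow> 'p) \<Rightarrow> 'm \<Rightarrow> ('m, 'n) tvec \<Rightarrow>
     real^'n^'n" where
  "conn_form M P \<sigma> x X =
     (\<chi> a b. Metric M x (levi_civita M x X (\<lambda>y. PFrame P (\<sigma> y) b)) (PFrame P (\<sigma> x) a))"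

definition section_through ::
    "('m, 'n::finite) rmfd \<Rightarrow> ('n, 's::finite) gammas \<Rightarrow> ('m, 'n, 'p, 's) spinstr \<Rightarrow> 'p \<Rightarrow> 'm \<Rightarrow> 'p" where
  "section_through M \<gamma> P u =
     (SOME \<sigma>. \<exists>U. PBase P u \<in> U \<and> smooth_local_section M \<gamma> P U \<sigma> \<and> \<sigma> (PBase P u) = u)"

text \<open>
  The covariant derivative, as a map from fields of rank \<open>j\<close> to fields of rank \<open>j + 1\<close>: the new
  first index \<open>k\<close> is the direction of differentiation, the \<open>k\<close>-th vector of the frame of \<open>u\<close>.  For
  equivariant \<open>f\<close> the value does not depend on the chosen local section through \<open>u\<close>.
\<close>

definition nabla ::
    "('m, 'n::finite) rmfd \<Rightarrow> ('n, 's::finite) gammas \<Rightarrow> ('m, 'n, 'p, 's) spinstr \<Rightarrow>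
     ('p, 'n, 's) field \<Rightarrow> ('p, 'n, 's) field" where
  "nabla M \<gamma> P f u is =
     (case is of [] \<Rightarrow> 0
      | k # ks \<Rightarrow>
          (let x = PBase P u; \<sigma> = section_through M \<gamma> P u; X = PFrame P u k in
           dir_deriv M x X (\<lambda>y. f (\<sigma> y) ks) + so_act \<gamma> (conn_form M P \<sigma> x X) (f u) ks))"

definition twisted_dirac ::
    "('m, 'n::finite) rmfd \<Rightarrow> ('n, 's::finite) gammas \<Rightarrow> ('m, 'n, 'p, 's) spinstr \<Rightarrow>
     ('p, 'n, 's) field \<Rightarrow> ('p, 'n, 's) field" where
  "twisted_dirac M \<gamma> P f u is = (\<Sum>k\<in>UNIV. \<gamma> k *v nabla M \<gamma> P f u (k # is))"

definition higher_spin_dirac ::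
    "('m, 'n::finite) rmfd \<Rightarrow> ('n, 's::finite) gammas \<Rightarrow> ('m, 'n, 'p, 's) spinstr \<Rightarrow> nat \<Rightarrow>
     ('p, 'n, 's) field \<Rightarrow> ('p, 'n, 's) field" where
  "higher_spin_dirac M \<gamma> P j f u = W_proj \<gamma> j (twisted_dirac M \<gamma> P f u)"

text \<open>The connection Laplacian \<open>\<nabla>\<^sup>*\<nabla> = - trace \<nabla>\<^sup>2\<close>; the fields \<open>nabla f\<close> and
  \<open>nabla (nabla f)\<close> are the components of the covariant derivatives with respect to \<open>u\<close>.\<close>

definition bochner_laplacian ::
    "('m, 'n::finite) rmfd \<Rightarrow> ('n, 's::finite) gammas \<Rightarrow> ('m, 'n, 'p, 's) spinstr \<Rightarrow>
     ('p, 'n, 's) field \<Rightarrow> ('p, 'n, 's) field" where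
  "bochner_laplacian M \<gamma> P f u is = - (\<Sum>k\<in>UNIV. nabla M \<gamma> P (nabla M \<gamma> P f) u (k # k # is))"

text \<open>\<open>R\<^sub>\<rho> = 1/2 \<Sum> R\<^sub>i\<^sub>j\<^sub>k\<^sub>l \<pi>(e\<^sub>i\<^sub>j e\<^sub>k\<^sub>l)\<close> with \<open>R\<^sub>i\<^sub>j\<^sub>k\<^sub>l = g (R(e\<^sub>i, e\<^sub>j) e\<^sub>k, e\<^sub>l)\<close>; for constant
  curvature \<open>c\<close>, \<open>R\<^sub>i\<^sub>j\<^sub>k\<^sub>l = c (\<delta>\<^sub>j\<^sub>k \<delta>\<^sub>i\<^sub>l - \<delta>\<^sub>i\<^sub>k \<delta>\<^sub>j\<^sub>l)\<close> and hence \<open>R\<^sub>\<rho> = c \<Sum> \<pi>(e\<^sub>i\<^sub>j e\<^sub>j\<^sub>i)\<close>.\<close>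

definition curvature_endo ::
    "('m, 'n::finite) rmfd \<Rightarrow> ('n, 's::finite) gammas \<Rightarrow> ('m, 'n, 'p, 's) spinstr \<Rightarrow>
     ('p, 'n, 's) field \<Rightarrow> ('p, 'n, 's) field" where
  "curvature_endo M \<gamma> P f u is =
     (let x = PBase P u; E = PFrame P u in
      (1/2) *\<^sub>R (\<Sum>i\<in>UNIV. \<Sum>j\<in>UNIV. \<Sum>k\<in>UNIV. \<Sum>l\<in>UNIV.
         Metric M x (curvature M x (E i) (E j) (E k)) (E l) *\<^sub>R
           so_act \<gamma> (wedge i j) (so_act \<gamma> (wedge k l) (f u)) is))"

definition standard_laplacian ::
    "('m, 'n::finite) rmfd \<Rightarrow> ('n, 's::finite) gammas \<Rightarrow> ('m, 'n, 'p, 's) spinstr \<Rightarrow>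
     ('p, 'n, 's) field \<Rightarrow> ('p, 'n, 's) field" where
  "standard_laplacian M \<gamma> P f u is =
     bochner_laplacian M \<gamma> P f u is + (1/2) *\<^sub>R curvature_endo M \<gamma> P f u is"

definition B_op ::
    "('m, 'n::finite) rmfd \<Rightarrow> ('n, 's::finite) gammas \<Rightarrow> ('m, 'n, 'p, 's) spinstr \<Rightarrow> real \<Rightarrow> nat \<Rightarrow> nat \<Rightarrow>
     ('p, 'n, 's) field \<Rightarrow> ('p, 'n, 's) field" where
  "B_op M \<gamma> P c s j f u is =
     (let n = real CARD('n) in
      higher_spin_dirac M \<gamma> P j (higher_spin_dirac M \<gamma> P j f) u is
      - ((n + 2 * real s - 2)\<^sup>2 / (n + 2 * real j - 2)\<^sup>2) *\<^sub>R
          (standard_laplacian M \<gamma> P f u is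
           - ((real s * (n + real s - 2) - n * (n - 1) / 8) * c) *\<^sub>R f u is))"

end

theory Submission
  imports Defs
begin

text \<open>
  For a section \<open>\<phi>\<close> of \<open>S\<^bsub>j-1\<^esub>\<close> let \<open>E \<phi>\<close> be its image in \<open>S\<^sub>0 \<otimes> Sym\<^sub>0\<^sup>j\<close>, and let \<open>T \<phi>\<close> be the
  component of \<open>D (E \<phi>)\<close> in \<open>S\<^sub>j\<close>, where \<open>D\<close> is the twisted Dirac operator; the other component is
  \<open>- \<alpha> E (D\<^bsub>j-1\<^esub> \<phi>)\<close> with \<open>\<alpha> = (n + 2j - 4) / (n + 2j - 2)\<close>.  In constant curvature \<open>D\<^sup>2\<close> differs from the
  connection Laplacian by a parallel endomorphism, so it preserves the decomposition into \<open>S\<^sub>j\<close> and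
  \<open>S\<^bsub>j-1\<^esub>\<close>.  Comparing components of \<open>D\<^sup>2\<close> and of \<open>D\<^sup>3\<close> shows that \<open>B j j\<close> factors through \<open>T\<close>, that
  \<open>D\<^sub>j T = \<alpha> T D\<^bsub>j-1\<^esub>\<close>, and that \<open>T\<close> intertwines the standard Laplacians; hence
  \<open>B s j T = \<alpha>\<^sup>2 T B s (j - 1)\<close>, and the claim follows by induction on \<open>j\<close>.  The only geometric input
  is the Ricci identity, which is derived from the structure equations of an orthonormal frame.
\<close>

text \<open>\<open>foldr\<close> over \<open>[0..<Suc j]\<close> applies \<open>B j j\<close> first,
  so the other factors act only on values of \<open>T\<close> and are moved behind \<open>T\<close>
  one at a time; the factors are never interchanged. The constants have one source,
  \<open>cc_emb\<close>: on the kernel of the Clifford contraction \<open>cc\<close>, contracting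
  after \<open>emb\<close> is multiplication by -(n + 2j - 2) when the result of \<open>emb\<close>
  has rank j. It gives the coefficient of the projection onto S_j and, together with
  \<open>cc_dirac_emb\<close>, the ratio \<alpha>. The zeroth-order terms of D^2 on S_j and on the
  image of S_(j-1) differ by K (n + 2j - 2), which is also the difference of the curvature terms of
  the two standard Laplacians; this coincidence makes \<open>T\<close> an intertwiner. The geometric
  obstacle is that \<open>nabla\<close> depends on arbitrary choices (\<open>chart_at\<close>,
  \<open>section_through\<close>) which need not vary smoothly with the point, so it cannot be
  iterated before its value is known to be independent of them. Charts are handled by expressing the
  connection matrix through brackets of the frame fields, sections by the logarithmic derivative of
  a Spin-valued map.\<close>

section \<open>Calculus of Frechet derivatives\<close>

abbreviation fder :: "('a::real_normed_vector \<Rightarrow> 'b::real_normed_vector) \<Rightarrow> 'a \<Rightarrow> 'a \<Rightarrow> 'b" where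
  "fder f x \<equiv> frechet_derivative f (at x)"

lemma fder_eq: "(f has_derivative f') (at x) \<Longrightarrow> fder f x = f'"
  by (rule frechet_derivative_at[symmetric])

lemma has_fder: "f differentiable (at x) \<Longrightarrow> (f has_derivative fder f x) (at x)"
  by (simp add: frechet_derivative_works)

lemma linear_fder: "f differentiable (at x) \<Longrightarrow> linear (fder f x)"
  by (rule linear_frechet_derivative)

lemma fder_cong_open:
  assumes "open S" "x \<in> S" "\<And>y. y \<in> S \<Longrightarrow> f y = g y"
  shows "fder f x = fder g x"
proof -
  have "(f has_derivative f') (at x) \<longleftrightarrow> (g has_derivative f') (at x)" for f'
    using assms by (metis has_derivative_transform_within_open)
  then show ?thesis by (simp add: frechet_derivative_def)
qed

lemma differentiable_cong_open:
  assumes "open S" "x \<in> S" "\<And>y. y \<in> S \<Longrightarrow> f y = g y" "f differentiable (at x)"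
  shows "g differentiable (at x)"
  using assms by (metis differentiable_def has_derivative_transform_within_open)

lemma fder_linear_image:
  assumes "bounded_linear L" "f differentiable (at x)"
  shows "fder (\<lambda>y. L (f y)) x v = L (fder f x v)"
  using fder_eq[OF bounded_linear.has_derivative[OF assms(1) has_fder[OF assms(2)]]] by simp

lemma fder_add:
  assumes "f differentiable (at x)" "g differentiable (at x)"
  shows "fder (\<lambda>y. f y + g y) x v = fder f x v + fder g x v"
  using fder_eq[OF has_derivative_add[OF has_fder[OF assms(1)] has_fder[OF assms(2)]]] by simp

lemma fder_sum:
  assumes "\<And>i. i \<in> I \<Longrightarrow> f i differentiable (at x)"
  shows "fder (\<lambda>y. \<Sum>i\<in>I. f i y) x v = (\<Sum>i\<in>I. fder (f i) x v)"
proof -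
  have "((\<lambda>y. \<Sum>i\<in>I. f i y) has_derivative (\<lambda>v. \<Sum>i\<in>I. fder (f i) x v)) (at x)"
    by (intro has_derivative_sum has_fder assms)
  from fder_eq[OF this] show ?thesis by simp
qed

lemma fder_bilinear:
  assumes "bounded_bilinear B" "f differentiable (at x)" "g differentiable (at x)"
  shows "fder (\<lambda>y. B (f y) (g y)) x v = B (f x) (fder g x v) + B (fder f x v) (g x)"
  using fder_eq[OF bounded_bilinear.FDERIV[OF assms(1) has_fder[OF assms(2)] has_fder[OF assms(3)]]] by simp

lemma differentiable_bilinear:
  assumes "bounded_bilinear B" "f differentiable (at x)" "g differentiable (at x)"
  shows "(\<lambda>y. B (f y) (g y)) differentiable (at x)"
  using bounded_bilinear.FDERIV[OF assms(1) has_fder[OF assms(2)] has_fder[OF assms(3)]]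
  by (auto simp: differentiable_def)

lemma differentiable_linear_image:
  assumes "bounded_linear L" "f differentiable (at x)"
  shows "(\<lambda>y. L (f y)) differentiable (at x)"
  using bounded_linear.has_derivative[OF assms(1) has_fder[OF assms(2)]]
  by (auto simp: differentiable_def)

section \<open>Functions of class C^k and smooth functions\<close>

lemma Ck_on_SucD: "Ck_on (Suc k) S f \<Longrightarrow> Ck_on k S f"
proof (induction k arbitrary: f)
  case 0
  then show ?case
    by (auto intro!: differentiable_imp_continuous_on differentiable_at_imp_differentiable_on)
next
  case (Suc k)
  then show ?case by (metis Ck_on.simps(2))
qed

lemma Ck_on_subset: "Ck_on k S f \<Longrightarrow> T \<subseteq> S \<Longrightarrow> Ck_on k T f"
  by (induction k arbitrary: f) (auto intro: continuous_on_subset)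

lemma Ck_on_cong:
  assumes "open S" "\<And>x. x \<in> S \<Longrightarrow> f x = g x" "Ck_on k S f"
  shows "Ck_on k S g"
  using assms(2,3)
proof (induction k arbitrary: f g)
  case 0
  then show ?case by (metis Ck_on.simps(1) continuous_on_cong)
next
  case (Suc k)
  have "fder f x v = fder g x v" if "x \<in> S" for x v
    using fder_cong_open[OF assms(1) that] Suc.prems(1) by metis
  then have "Ck_on k S (\<lambda>x. fder g x v)" for v
    using Suc.IH[of "\<lambda>x. fder f x v" "\<lambda>x. fder g x v"] Suc.prems(2) by simp
  moreover have "g differentiable (at x)" if "x \<in> S" for x
    using differentiable_cong_open[OF assms(1) that] Suc.prems that by (metis Ck_on.simps(2))
  ultimately show ?case by simp
qed

text \<open>Both clauses of \<open>Ck_on\<close> can be tested near each point. This is how fields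
  seen through an arbitrary local section become smooth: near each point they are compared with a
  section of the bundle atlas.\<close>

lemma Ck_on_local:
  assumes "\<And>x. x \<in> S \<Longrightarrow> \<exists>T. open T \<and> x \<in> T \<and> Ck_on k T f"
  shows "Ck_on k S f"
  using assms
proof (induction k arbitrary: f)
  case 0
  have "isCont f x" if "x \<in> S" for x
    using 0[OF that] by (auto simp: continuous_on_eq_continuous_at)
  then show ?case by (simp add: continuous_at_imp_continuous_on)
next
  case (Suc k)
  have "f differentiable (at x)" if "x \<in> S" for x
    using Suc.prems[OF that] by auto
  moreover have "Ck_on k S (\<lambda>x. fder f x v)" for v
    by (rule Suc.IH) (use Suc.prems in \<open>auto; blast\<close>)
  ultimately show ?case by simp
qed

lemma Ck_on_const: "Ck_on k S (\<lambda>x. a)"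
proof (induction k arbitrary: a)
  case (Suc k)
  then show ?case by (simp add: frechet_derivative_const)
qed simp

lemma Ck_on_linear_image:
  assumes "open S" "bounded_linear L" "Ck_on k S f"
  shows "Ck_on k S (\<lambda>x. L (f x))"
  using assms(3)
proof (induction k arbitrary: f)
  case 0
  then show ?case using bounded_linear.continuous_on[OF assms(2)] by simp
next
  case (Suc k)
  have "Ck_on k S (\<lambda>x. fder (\<lambda>y. L (f y)) x v)" for v
    by (rule Ck_on_cong[OF assms(1) _ Suc.IH[of "\<lambda>x. fder f x v"]])
      (use Suc.prems in \<open>auto simp: fder_linear_image[OF assms(2)]\<close>)
  then show ?case using Suc.prems by (simp add: differentiable_linear_image[OF assms(2)])
qed

lemma Ck_on_add:
  assumes "open S" "Ck_on k S f" "Ck_on k S g"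
  shows "Ck_on k S (\<lambda>x. f x + g x)"
  using assms(2,3)
proof (induction k arbitrary: f g)
  case 0
  then show ?case by (simp add: continuous_on_add)
next
  case (Suc k)
  have "Ck_on k S (\<lambda>x. fder (\<lambda>y. f y + g y) x v)" for v
    by (rule Ck_on_cong[OF assms(1) _ Suc.IH[of "\<lambda>x. fder f x v" "\<lambda>x. fder g x v"]])
      (use Suc.prems in \<open>auto simp: fder_add\<close>)
  then show ?case using Suc.prems by simp
qed

text \<open>By the product rule the derivative is a sum of two terms of the same kind and of one
  order less, so the induction generalises over \<open>f\<close> and \<open>g\<close>;
  \<open>Ck_on_SucD\<close> lowers the order of the undifferentiated factor.\<close>

lemma Ck_on_bilinear:
  assumes "open S" "bounded_bilinear B" "Ck_on k S f" "Ck_on k S g"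
  shows "Ck_on k S (\<lambda>x. B (f x) (g x))"
  using assms(3,4)
proof (induction k arbitrary: f g)
  case 0
  then show ?case using bounded_bilinear.continuous_on[OF assms(2)] by simp
next
  case (Suc k)
  have "Ck_on k S (\<lambda>x. B (f x) (fder g x v) + B (fder f x v) (g x))" for v
    by (intro Ck_on_add assms(1) Suc.IH) (use Suc.prems Ck_on_SucD in auto)
  then have "Ck_on k S (\<lambda>x. fder (\<lambda>y. B (f y) (g y)) x v)" for v
    by (rule Ck_on_cong[OF assms(1), rotated])
      (use Suc.prems in \<open>auto simp: fder_bilinear[OF assms(2)]\<close>)
  then show ?case using Suc.prems by (simp add: differentiable_bilinear[OF assms(2)])
qed

lemma smooth_onD: "smooth_on S f \<Longrightarrow> Ck_on k S f"
  by (simp add: smooth_on_def)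

lemma smooth_on_differentiable: "smooth_on S f \<Longrightarrow> x \<in> S \<Longrightarrow> f differentiable (at x)"
  using smooth_onD[of S f "Suc 0"] by simp

lemma smooth_on_fder: "smooth_on S f \<Longrightarrow> smooth_on S (\<lambda>x. fder f x v)"
  by (metis smooth_on_def Ck_on.simps(2))

lemma smooth_on_subset: "smooth_on S f \<Longrightarrow> T \<subseteq> S \<Longrightarrow> smooth_on T f"
  unfolding smooth_on_def using Ck_on_subset by blast

lemma smooth_on_cong: "open S \<Longrightarrow> smooth_on S f \<Longrightarrow> (\<And>x. x \<in> S \<Longrightarrow> f x = g x) \<Longrightarrow> smooth_on S g"
  unfolding smooth_on_def using Ck_on_cong by blast

lemma smooth_on_local:
  "(\<And>x. x \<in> S \<Longrightarrow> \<exists>T. open T \<and> x \<in> T \<and> smooth_on T f) \<Longrightarrow> smooth_on S f"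
  unfolding smooth_on_def by (meson Ck_on_local)

lemma smooth_on_const: "smooth_on S (\<lambda>x. a)"
  by (simp add: smooth_on_def Ck_on_const)

lemma smooth_on_linear_image: "open S \<Longrightarrow> bounded_linear L \<Longrightarrow> smooth_on S f \<Longrightarrow> smooth_on S (\<lambda>x. L (f x))"
  by (simp add: smooth_on_def Ck_on_linear_image)

lemma smooth_on_add: "open S \<Longrightarrow> smooth_on S f \<Longrightarrow> smooth_on S g \<Longrightarrow> smooth_on S (\<lambda>x. f x + g x)"
  by (simp add: smooth_on_def Ck_on_add)

lemma smooth_on_diff: "open S \<Longrightarrow> smooth_on S f \<Longrightarrow> smooth_on S g \<Longrightarrow> smooth_on S (\<lambda>x. f x - g x)"
  using smooth_on_add[OF _ _ smooth_on_linear_image[OF _ bounded_linear_minus[OF bounded_linear_ident]], of S f g]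
  by simp

lemma smooth_on_bilinear:
  "open S \<Longrightarrow> bounded_bilinear B \<Longrightarrow> smooth_on S f \<Longrightarrow> smooth_on S g \<Longrightarrow> smooth_on S (\<lambda>x. B (f x) (g x))"
  by (simp add: smooth_on_def Ck_on_bilinear)

lemma smooth_on_sum:
  "open S \<Longrightarrow> (\<And>i. i \<in> I \<Longrightarrow> smooth_on S (f i)) \<Longrightarrow> smooth_on S (\<lambda>x. \<Sum>i\<in>I. f i x)"
  by (induction I rule: infinite_finite_induct) (auto simp: smooth_on_const smooth_on_add)

lemma bounded_linear_axis: "bounded_linear (axis i :: 'b::euclidean_space \<Rightarrow> 'b^'n)"
  unfolding linear_conv_bounded_linear[symmetric] by (auto simp: linear_iff axis_def vec_eq_iff)

lemma vec_eq_sum_axis: "x = (\<Sum>i\<in>UNIV. axis i (x $ i))" for x :: "'b::comm_monoid_add^'n"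
  by (simp add: vec_eq_iff axis_def sum.delta')

lemma smooth_on_component: "open S \<Longrightarrow> smooth_on S f \<Longrightarrow> smooth_on S (\<lambda>x. f x $ i)"
  by (rule smooth_on_linear_image[OF _ bounded_linear_vec_nth])

lemma smooth_on_vecI:
  fixes f :: "'a::euclidean_space \<Rightarrow> 'b::euclidean_space^'n"
  assumes "open S" "\<And>i. smooth_on S (\<lambda>x. f x $ i)"
  shows "smooth_on S f"
proof -
  have "smooth_on S (\<lambda>x. \<Sum>i\<in>UNIV. axis i (f x $ i))"
    by (intro smooth_on_sum smooth_on_linear_image[OF _ bounded_linear_axis] assms)
  then show ?thesis by (simp flip: vec_eq_sum_axis)
qed

lemma fder_component:
  "f differentiable (at x) \<Longrightarrow> fder (\<lambda>y. f y $ i) x v = fder f x v $ i"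
  by (rule fder_linear_image[OF bounded_linear_vec_nth])

lemma euclid_expand: "x = (\<Sum>i\<in>UNIV. (x $ i) *\<^sub>R axis i 1)" for x :: "real^'n"
  by (simp add: vec_eq_iff axis_def sum.delta' if_distrib cong: if_cong)

lemma linear_expand: "linear L \<Longrightarrow> L x = (\<Sum>i\<in>UNIV. (x $ i) *\<^sub>R L (axis i 1))" for x :: "real^'n"
  by (subst euclid_expand) (simp add: linear_sum linear_scale)

lemma smooth_on_scaleR: "open S \<Longrightarrow> smooth_on S f \<Longrightarrow> smooth_on S g \<Longrightarrow> smooth_on S (\<lambda>x. f x *\<^sub>R g x)"
  by (rule smooth_on_bilinear[OF _ bounded_bilinear_scaleR])

text \<open>Expanding \<open>v x\<close> in the standard basis leaves only constant arguments. The
  metric, the Christoffel symbols and the connection matrix are first known to be smooth for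
  constant arguments and are then evaluated on frame fields.\<close>

lemma smooth_on_linear_family:
  fixes v :: "'a::euclidean_space \<Rightarrow> real^'n"
  assumes "open S" "\<And>x. x \<in> S \<Longrightarrow> linear (L x)" "\<And>w. smooth_on S (\<lambda>x. L x w)" "smooth_on S v"
  shows "smooth_on S (\<lambda>x. L x (v x))"
proof -
  have "smooth_on S (\<lambda>x. \<Sum>i\<in>UNIV. (v x $ i) *\<^sub>R L x (axis i 1))"
    by (intro smooth_on_sum smooth_on_scaleR smooth_on_component assms)
  then show ?thesis
    by (rule smooth_on_cong[OF assms(1)]) (simp add: linear_expand[OF assms(2)])
qed

lemma smooth_on_fder_along:
  fixes v :: "real^'n \<Rightarrow> real^'n"
  assumes "open S" "smooth_on S f" "smooth_on S v"
  shows "smooth_on S (\<lambda>x. fder f x (v x))"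
  by (rule smooth_on_linear_family)
    (use assms smooth_on_fder linear_fder smooth_on_differentiable in blast)+

text \<open>Product rule for a linear map applied to a moving vector, where the map is
  differentiable argument by argument; the basis expansion turns it into a finite sum of
  products.\<close>

lemma fder_linear_family:
  fixes v :: "'a::real_normed_vector \<Rightarrow> real^'n"
  assumes "open S" "x \<in> S" "\<And>y. y \<in> S \<Longrightarrow> linear (L y)"
    "\<And>w. (\<lambda>y. L y w) differentiable (at x)" "v differentiable (at x)"
  shows "fder (\<lambda>y. L y (v y)) x h = fder (\<lambda>y. L y (v x)) x h + L x (fder v x h)"
    and "(\<lambda>y. L y (v y)) differentiable (at x)"
proof -
  have d: "(\<lambda>y. v y $ i) differentiable (at x)" for i
    by (rule differentiable_linear_image[OF bounded_linear_vec_nth assms(5)])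
  have *: "L y w = (\<Sum>i\<in>UNIV. (w $ i) *\<^sub>R L y (axis i 1))" if "y \<in> S" for y w
    by (rule linear_expand[OF assms(3)[OF that]])
  have "fder (\<lambda>y. L y (v y)) x h = fder (\<lambda>y. \<Sum>i\<in>UNIV. (v y $ i) *\<^sub>R L y (axis i 1)) x h"
    by (subst fder_cong_open[OF assms(1,2)]) (rule *, auto)
  also have "\<dots> = (\<Sum>i\<in>UNIV. (v x $ i) *\<^sub>R fder (\<lambda>y. L y (axis i 1)) x h + (fder v x h $ i) *\<^sub>R L x (axis i 1))"
    by (subst fder_sum) (auto simp: fder_bilinear[OF bounded_bilinear_scaleR d assms(4)]
      fder_component[OF assms(5)] intro!: differentiable_bilinear[OF bounded_bilinear_scaleR] d assms(4))
  also have "\<dots> = fder (\<lambda>y. \<Sum>i\<in>UNIV. (v x $ i) *\<^sub>R L y (axis i 1)) x h + L x (fder v x h)"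
    unfolding *[OF assms(2), of "fder v x h"] sum.distrib
    by (subst fder_sum) (auto simp: fder_linear_image[OF bounded_linear_scaleR_right assms(4)]
      intro!: differentiable_linear_image[OF bounded_linear_scaleR_right] assms(4))
  also have "fder (\<lambda>y. \<Sum>i\<in>UNIV. (v x $ i) *\<^sub>R L y (axis i 1)) x h = fder (\<lambda>y. L y (v x)) x h"
    by (subst fder_cong_open[OF assms(1,2), of "\<lambda>y. L y (v x)"]) (rule *, auto)
  finally show "fder (\<lambda>y. L y (v y)) x h = fder (\<lambda>y. L y (v x)) x h + L x (fder v x h)" .
  show "(\<lambda>y. L y (v y)) differentiable (at x)"
    by (rule differentiable_cong_open[OF assms(1,2) *[symmetric]])
      (auto intro!: differentiable_sum differentiable_bilinear[OF bounded_bilinear_scaleR] d assms(4))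
qed

section \<open>Symmetry of second derivatives\<close>

text \<open>The mean value inequality in the direction \<open>w\<close> reduces the second
  difference to a first difference of \<open>\<lambda>y. fder f y w\<close>, which is then expanded
  to first order at \<open>x\<close>.\<close>

lemma second_difference_bound:
  fixes f :: "'a::real_normed_vector \<Rightarrow> 'b::real_inner"
  assumes "open S" "x \<in> S" "\<And>y. y \<in> S \<Longrightarrow> f differentiable (at y)"
    and G: "(\<lambda>y. fder f y w) differentiable (at x)" and "e > 0"
  shows "\<exists>d>0. \<forall>h. 0 < h \<longrightarrow> h < d \<longrightarrow>
    norm (f (x + h *\<^sub>R v + h *\<^sub>R w) - f (x + h *\<^sub>R v) - f (x + h *\<^sub>R w) + f x
      - h\<^sup>2 *\<^sub>R fder (\<lambda>y. fder f y w) x v) \<le> e * h\<^sup>2"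
proof -
  define g where "g y = fder f y w" for y
  define G' where "G' = fder g x"
  have gd: "(g has_derivative G') (at x)"
    unfolding G'_def g_def by (rule has_fder[OF G])
  then have lin: "linear G'" by (simp add: has_derivative_linear)
  define C where "C = norm v + norm w + 1"
  have C: "C > 0" unfolding C_def by (simp add: add_nonneg_pos)
  \<comment> \<open>Two first-order remainders, each at most \<open>e' * (h * C)\<close>, have to
    add up to \<open>e * h\<close>.\<close>
  define e' where "e' = e / (2 * C)"
  have e': "e' > 0" using C assms(5) by (simp add: e'_def)
  obtain d1 where d1: "d1 > 0" "\<And>y. norm (y - x) < d1 \<Longrightarrow> norm (g y - g x - G' (y - x)) \<le> e' * norm (y - x)"
    using gd e' unfolding has_derivative_at_alt by blast
  obtain d2 where d2: "d2 > 0" "ball x d2 \<subseteq> S"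
    using assms(1,2) openE by blast
  define d where "d = min d1 d2 / C"
  have dpos: "d > 0" using d1 d2 C by (simp add: d_def)
  have "norm (f (x + h *\<^sub>R v + h *\<^sub>R w) - f (x + h *\<^sub>R v) - f (x + h *\<^sub>R w) + f x - h\<^sup>2 *\<^sub>R G' v) \<le> e * h\<^sup>2"
    if h: "0 < h" "h < d" for h
  proof -
    have hC: "h * C < min d1 d2" using h C by (simp add: d_def pos_less_divide_eq)
    have small: "norm (s *\<^sub>R v + t *\<^sub>R w) \<le> h * C" if "0 \<le> s" "s \<le> h" "0 \<le> t" "t \<le> h" for s t
    proof -
      have "norm (s *\<^sub>R v + t *\<^sub>R w) \<le> s * norm v + t * norm w"
        using norm_triangle_ineq[of "s *\<^sub>R v" "t *\<^sub>R w"] that by simp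
      also have "\<dots> \<le> h * norm v + h * norm w"
        using that by (intro add_mono mult_right_mono) auto
      also have "\<dots> \<le> h * C" using h by (simp add: C_def algebra_simps)
      finally show ?thesis .
    qed
    have inS: "x + s *\<^sub>R v + t *\<^sub>R w \<in> S" if "0 \<le> s" "s \<le> h" "0 \<le> t" "t \<le> h" for s t
    proof -
      have "dist x (x + s *\<^sub>R v + t *\<^sub>R w) = norm (s *\<^sub>R v + t *\<^sub>R w)"
        unfolding dist_norm by (metis add.assoc add_diff_cancel_left' norm_minus_commute)
      then have "x + s *\<^sub>R v + t *\<^sub>R w \<in> ball x d2"
        using small[OF that] hC by simp
      then show ?thesis using d2 by blast
    qed
    \<comment> \<open>The term linear in \<open>t\<close> is chosen so that
      \<open>\<phi> h - \<phi> 0\<close> is the second difference minus its expected value; the mean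
      value inequality then bounds exactly the error.\<close>
    define \<phi> where "\<phi> t = f (x + h *\<^sub>R v + t *\<^sub>R w) - f (x + t *\<^sub>R w) - (t * h) *\<^sub>R G' v" for t
    define \<phi>' where "\<phi>' t = (\<lambda>r. r *\<^sub>R (g (x + h *\<^sub>R v + t *\<^sub>R w) - g (x + t *\<^sub>R w) - h *\<^sub>R G' v))" for t
    have der: "(\<phi> has_derivative \<phi>' t) (at t)" if t: "0 \<le> t" "t \<le> h" for t
    proof -
      have *: "((\<lambda>t. f (y + t *\<^sub>R w)) has_derivative (\<lambda>r. r *\<^sub>R g (y + t *\<^sub>R w))) (at t)"
        if "y + t *\<^sub>R w \<in> S" for y
      proof -
        have "f differentiable (at (y + t *\<^sub>R w))" by (rule assms(3)[OF that])
        note D = has_fder[OF this]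
        have "((\<lambda>t. y + t *\<^sub>R w) has_derivative (\<lambda>r. r *\<^sub>R w)) (at t)"
          by (auto intro!: derivative_eq_intros)
        from has_derivative_compose[OF this D]
        show ?thesis
          using linear_scale[OF has_derivative_linear[OF D]] by (simp add: g_def)
      qed
      have "((\<lambda>t. f (x + h *\<^sub>R v + t *\<^sub>R w)) has_derivative (\<lambda>r. r *\<^sub>R g (x + h *\<^sub>R v + t *\<^sub>R w))) (at t)"
        by (rule *) (use inS[of h t] t h in auto)
      moreover have "((\<lambda>t. f (x + t *\<^sub>R w)) has_derivative (\<lambda>r. r *\<^sub>R g (x + t *\<^sub>R w))) (at t)"
        by (rule *) (use inS[of 0 t] t h in auto)
      ultimately show ?thesis
        unfolding \<phi>_def \<phi>'_def by (auto intro!: derivative_eq_intros simp: algebra_simps)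
    qed
    have "continuous_on {0..h} \<phi>"
      using der by (meson atLeastAtMost_iff continuous_at_imp_continuous_on has_derivative_continuous)
    then obtain t where t: "t \<in> {0<..<h}" "norm (\<phi> h - \<phi> 0) \<le> norm (\<phi>' t (h - 0))"
      using mvt_general[of 0 h \<phi> \<phi>'] h der by auto
    have "norm (g (x + h *\<^sub>R v + t *\<^sub>R w) - g (x + t *\<^sub>R w) - h *\<^sub>R G' v) \<le> e * h"
    proof -
      have 1: "norm (g (x + h *\<^sub>R v + t *\<^sub>R w) - g x - G' (h *\<^sub>R v + t *\<^sub>R w)) \<le> e' * (h * C)"
      proof -
        have eq: "(x + h *\<^sub>R v + t *\<^sub>R w) - x = h *\<^sub>R v + t *\<^sub>R w" by simp
        have s: "norm (h *\<^sub>R v + t *\<^sub>R w) \<le> h * C" using small[of h t] t h by auto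
        have "norm (g (x + h *\<^sub>R v + t *\<^sub>R w) - g x - G' (h *\<^sub>R v + t *\<^sub>R w)) \<le> e' * norm (h *\<^sub>R v + t *\<^sub>R w)"
          using d1(2)[of "x + h *\<^sub>R v + t *\<^sub>R w"] s hC unfolding eq by auto
        also have "\<dots> \<le> e' * (h * C)" using s e' by auto
        finally show ?thesis .
      qed
      have 2: "norm (g (x + t *\<^sub>R w) - g x - G' (t *\<^sub>R w)) \<le> e' * (h * C)"
      proof -
        have s: "norm (t *\<^sub>R w) \<le> h * C" using small[of 0 t] t h by auto
        have "norm (g (x + t *\<^sub>R w) - g x - G' (t *\<^sub>R w)) \<le> e' * norm (t *\<^sub>R w)"
          using d1(2)[of "x + t *\<^sub>R w"] s hC by auto
        also have "\<dots> \<le> e' * (h * C)" using s e' by auto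
        finally show ?thesis .
      qed
      have "g (x + h *\<^sub>R v + t *\<^sub>R w) - g (x + t *\<^sub>R w) - h *\<^sub>R G' v =
        (g (x + h *\<^sub>R v + t *\<^sub>R w) - g x - G' (h *\<^sub>R v + t *\<^sub>R w)) - (g (x + t *\<^sub>R w) - g x - G' (t *\<^sub>R w))"
        using linear_add[OF lin] linear_scale[OF lin] by simp
      then have "norm (g (x + h *\<^sub>R v + t *\<^sub>R w) - g (x + t *\<^sub>R w) - h *\<^sub>R G' v) \<le> e' * (h * C) + e' * (h * C)"
        using norm_triangle_le_diff[OF add_mono[OF 1 2]] by metis
      also have "\<dots> = e * h" using C by (simp add: e'_def)
      finally show ?thesis .
    qed
    then have "norm (\<phi>' t (h - 0)) \<le> e * h\<^sup>2"
      using h by (simp add: \<phi>'_def power2_eq_square mult.commute mult.left_commute)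
    moreover have "\<phi> h - \<phi> 0 = f (x + h *\<^sub>R v + h *\<^sub>R w) - f (x + h *\<^sub>R v) - f (x + h *\<^sub>R w) + f x - h\<^sup>2 *\<^sub>R G' v"
      by (simp add: \<phi>_def power2_eq_square algebra_simps)
    ultimately show ?thesis using t(2) by simp
  qed
  then show ?thesis using dpos unfolding G'_def g_def by blast
qed

text \<open>The second difference is symmetric in \<open>v\<close> and \<open>w\<close>, and by
  \<open>second_difference_bound\<close> it approximates both mixed derivatives, multiplied by h^2,
  up to o(h^2).\<close>

lemma fder_fder_commute:
  fixes f :: "'a::real_normed_vector \<Rightarrow> 'b::real_inner"
  assumes "open S" "x \<in> S" "\<And>y. y \<in> S \<Longrightarrow> f differentiable (at y)"
    and "\<And>u. (\<lambda>y. fder f y u) differentiable (at x)"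
  shows "fder (\<lambda>y. fder f y w) x v = fder (\<lambda>y. fder f y v) x w"
proof (rule ccontr)
  define a where "a = fder (\<lambda>y. fder f y w) x v"
  define b where "b = fder (\<lambda>y. fder f y v) x w"
  assume "\<not> ?thesis"
  then have ab: "norm (a - b) > 0" by (simp add: a_def b_def)
  \<comment> \<open>A quarter, because the two error bounds then add up to only half of the distance
    between \<open>a\<close> and \<open>b\<close>.\<close>
  define e where "e = norm (a - b) / 4"
  have e: "e > 0" using ab by (simp add: e_def)
  obtain d where d: "d > 0" "\<And>h. 0 < h \<Longrightarrow> h < d \<Longrightarrow>
      norm (f (x + h *\<^sub>R v + h *\<^sub>R w) - f (x + h *\<^sub>R v) - f (x + h *\<^sub>R w) + f x - h\<^sup>2 *\<^sub>R a) \<le> e * h\<^sup>2"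
    using second_difference_bound[OF assms(1-3) assms(4) e] unfolding a_def by blast
  obtain d' where d': "d' > 0" "\<And>h. 0 < h \<Longrightarrow> h < d' \<Longrightarrow>
      norm (f (x + h *\<^sub>R w + h *\<^sub>R v) - f (x + h *\<^sub>R w) - f (x + h *\<^sub>R v) + f x - h\<^sup>2 *\<^sub>R b) \<le> e * h\<^sup>2"
    using second_difference_bound[OF assms(1-3) assms(4) e] unfolding b_def by blast
  define h where "h = min d d' / 2"
  have h: "0 < h" "h < d" "h < d'" using d(1) d'(1) by (auto simp: h_def)
  define X where "X = f (x + h *\<^sub>R v + h *\<^sub>R w) - f (x + h *\<^sub>R v) - f (x + h *\<^sub>R w) + f x"
  have eqX: "f (x + h *\<^sub>R w + h *\<^sub>R v) - f (x + h *\<^sub>R w) - f (x + h *\<^sub>R v) + f x = X"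
    by (simp add: X_def add_ac)
  have 1: "norm (X - h\<^sup>2 *\<^sub>R a) \<le> e * h\<^sup>2" using d(2)[of h] h by (simp add: X_def)
  have 2: "norm (X - h\<^sup>2 *\<^sub>R b) \<le> e * h\<^sup>2" using d'(2)[of h] h unfolding eqX by simp
  have eq: "(X - h\<^sup>2 *\<^sub>R b) - (X - h\<^sup>2 *\<^sub>R a) = h\<^sup>2 *\<^sub>R (a - b)" by (simp add: algebra_simps)
  have "h\<^sup>2 * norm (a - b) = norm (h\<^sup>2 *\<^sub>R (a - b))" by simp
  also have "\<dots> \<le> e * h\<^sup>2 + e * h\<^sup>2"
    using norm_triangle_le_diff[OF add_mono[OF 2 1]] unfolding eq .
  also have "\<dots> = h\<^sup>2 * (norm (a - b) / 2)" by (simp add: e_def)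
  finally show False using ab h by simp
qed

lemma smooth_on_fder_commute:
  fixes f :: "'a::euclidean_space \<Rightarrow> 'b::real_inner"
  assumes "open S" "x \<in> S" "smooth_on S f"
  shows "fder (\<lambda>y. fder f y w) x v = fder (\<lambda>y. fder f y v) x w"
  by (rule fder_fder_commute[OF assms(1,2)])
    (use assms smooth_on_fder smooth_on_differentiable in blast)+

lemma scaleR_matvec: "(a *\<^sub>R A) *v x = a *\<^sub>R (A *v x)"
  for A :: "'a::real_algebra_1^'n^'m" and x :: "'a^'n"
  by (simp add: vec_eq_iff matrix_vector_mult_def scaleR_sum_right)

lemma matvec_scaleR: "A *v (a *\<^sub>R x) = a *\<^sub>R (A *v x)"
  for A :: "'a::real_algebra_1^'n^'m" and x :: "'a^'n"
  by (simp add: vec_eq_iff matrix_vector_mult_def scaleR_sum_right)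

lemma scaleR_matmul: "(a *\<^sub>R A) ** B = a *\<^sub>R (A ** B)"
  for A :: "'a::real_algebra_1^'n^'m" and B :: "'a^'k^'n"
  by (simp add: vec_eq_iff matrix_matrix_mult_def scaleR_sum_right)

lemma matmul_scaleR: "A ** (a *\<^sub>R B) = a *\<^sub>R (A ** B)"
  for A :: "'a::real_algebra_1^'n^'m" and B :: "'a^'k^'n"
  by (simp add: vec_eq_iff matrix_matrix_mult_def scaleR_sum_right)

lemma linear_matvec: "linear ((*v) A)" for A :: "'a::real_algebra_1^'n^'m"
  by (simp add: linear_iff matrix_vector_right_distrib matvec_scaleR)

lemma matvec_sum: "A *v (\<Sum>i\<in>I. f i) = (\<Sum>i\<in>I. A *v f i)" for A :: "'a::real_algebra_1^'n^'m"
  by (rule linear_sum[OF linear_matvec])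

lemma matvec_minus: "A *v (- x) = - (A *v x)" for A :: "'a::real_algebra_1^'n^'m"
  by (rule linear_neg[OF linear_matvec])

lemma matvec_diff: "A *v (x - y) = A *v x - A *v y" for A :: "'a::real_algebra_1^'n^'m"
  by (rule linear_diff[OF linear_matvec])

lemma minus_matvec: "(- A) *v x = - (A *v x)" for A :: "'a::real_algebra_1^'n^'m"
  by (simp add: vec_eq_iff matrix_vector_mult_def sum_negf)

lemma sum_matvec: "(\<Sum>i\<in>I. f i) *v x = (\<Sum>i\<in>I. f i *v x)" for x :: "'a::real_algebra_1^'n"
  by (induction I rule: infinite_finite_induct) (auto simp: matrix_vector_mult_add_rdistrib)

lemmas matvec_simps = scaleR_matvec matvec_scaleR matvec_sum matvec_minus matvec_diff minus_matvec
  sum_matvec matrix_vector_right_distrib matrix_vector_mult_add_rdistrib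

section \<open>Spinor-valued tensors\<close>

abbreviation (input) slice :: "('n, 's) stensor \<Rightarrow> 'n \<Rightarrow> ('n, 's) stensor" where
  "slice \<psi> k \<equiv> (\<lambda>is. \<psi> (k # is))"

definition sym_ten :: "('n, 's) stensor \<Rightarrow> bool" where
  "sym_ten \<psi> \<longleftrightarrow> (\<forall>is ks. mset is = mset ks \<longrightarrow> \<psi> is = \<psi> ks)"

lemma sym_tenD: "sym_ten \<psi> \<Longrightarrow> mset is = mset ks \<Longrightarrow> \<psi> is = \<psi> ks"
  unfolding sym_ten_def by blast

lemma sym_ten_swap: "sym_ten \<psi> \<Longrightarrow> \<psi> (i # k # is) = \<psi> (k # i # is)"
  by (erule sym_tenD) simp

lemma sym_ten_slice: "sym_ten \<psi> \<Longrightarrow> sym_ten (slice \<psi> k)"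
  unfolding sym_ten_def[of "slice \<psi> k"] by (intro allI impI, erule sym_tenD) simp

lemma slice_slice_swap: "sym_ten \<psi> \<Longrightarrow> slice (slice \<psi> i) k = slice (slice \<psi> k) i"
  by (rule ext) (erule sym_ten_swap)

text \<open>Permutations are generated by exchanging the first two entries and by acting behind a
  common head. The operators on tensors are recursive in the index list, so these are the cases that
  a symmetry proof has to check.\<close>

lemma mset_eq_induct [consumes 1, case_names refl cons swap trans]:
  assumes "mset xs = mset ys"
    and refl: "\<And>xs. R xs xs"
    and cons: "\<And>x xs ys. mset xs = mset ys \<Longrightarrow> R xs ys \<Longrightarrow> R (x # xs) (x # ys)"
    and swap: "\<And>x y xs. R (x # y # xs) (y # x # xs)"
    and trans: "\<And>xs ys zs. R xs ys \<Longrightarrow> R ys zs \<Longrightarrow> R xs zs"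
  shows "R xs ys"
  using assms(1)
proof (induction xs arbitrary: ys)
  case Nil
  then show ?case using refl by simp
next
  case (Cons x xs)
  \<comment> \<open>The head travels to its place by repeated exchanges with its right
    neighbour.\<close>
  have move: "R (x # as @ bs) (as @ x # bs)" for as bs
  proof (induction as)
    case Nil
    show ?case using refl by simp
  next
    case (Cons a as)
    have "R (a # x # as @ bs) (a # as @ x # bs)"
      by (rule cons[OF _ Cons]) simp
    then show ?case using trans[OF swap] by simp
  qed
  have "x \<in> set ys" using Cons.prems by (metis list.set_intros(1) mset_eq_setD)
  then obtain as bs where ys: "ys = as @ x # bs" by (meson split_list)
  then have m: "mset xs = mset (as @ bs)" using Cons.prems by simp
  have "R (x # xs) (x # as @ bs)" by (rule cons[OF m Cons.IH[OF m]])
  then show ?case using trans move ys by blast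
qed

text \<open>The derivation extending \<open>A\<close> to tensors, which is the tensor part of
  \<open>so_act\<close> (see \<open>dten_eq\<close>). The recursion peels off the first index, so
  that proofs go by induction on the index list with \<open>slice \<psi> i\<close> as the smaller
  tensor.\<close>

fun dten :: "real^'n^'n \<Rightarrow> ('n::finite, 's::finite) stensor \<Rightarrow> ('n, 's) stensor" where
  "dten A \<psi> [] = 0"
| "dten A \<psi> (i # is) = (\<Sum>b\<in>UNIV. (A $ i $ b) *\<^sub>R \<psi> (b # is)) + dten A (slice \<psi> i) is"

lemma dten_eq: "(\<Sum>i<length is. \<Sum>b\<in>UNIV. (A $ (is ! i) $ b) *\<^sub>R \<psi> (is[i := b])) = dten A \<psi> is"
proof (induction "is" arbitrary: \<psi>)
  case (Cons a "is")
  show ?case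
    unfolding list.size(4) Groups.add_0_right add_Suc_right sum.lessThan_Suc_shift
    using Cons[of "slice \<psi> a"] by simp
qed simp

lemma dten_add: "dten A (\<lambda>is. \<psi> is + \<phi> is) is = dten A \<psi> is + dten A \<phi> is"
  by (induction "is" arbitrary: \<psi> \<phi>) (simp_all add: scaleR_add_right sum.distrib)

lemma dten_matvec: "dten A (\<lambda>is. B *v \<psi> is) is = B *v dten A \<psi> is"
  by (induction "is" arbitrary: \<psi>) (simp_all add: matvec_simps)

lemma dten_scaleR: "dten A (\<lambda>is. a *\<^sub>R \<psi> is) is = a *\<^sub>R dten A \<psi> is"
  by (induction "is" arbitrary: \<psi>) (simp_all add: scaleR_add_right scaleR_sum_right mult.commute)

lemma dten_minus: "dten A (\<lambda>is. - \<psi> is) is = - dten A \<psi> is"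
  using dten_scaleR[of A "-1" \<psi> "is"] by simp

lemma dten_zero [simp]: "dten A (\<lambda>is. 0) is = 0"
  by (induction "is") simp_all

lemma dten_sum: "dten A (\<lambda>is. \<Sum>i\<in>I. f i is) is = (\<Sum>i\<in>I. dten A (f i) is)"
  by (induction I rule: infinite_finite_induct) (simp_all add: dten_add)

lemma dten_add_matrix: "dten (A + B) \<psi> is = dten A \<psi> is + dten B \<psi> is"
  by (induction "is" arbitrary: \<psi>) (simp_all add: scaleR_add_left sum.distrib)

lemma dten_scaleR_matrix: "dten (a *\<^sub>R A) \<psi> is = a *\<^sub>R dten A \<psi> is"
  by (induction "is" arbitrary: \<psi>) (simp_all add: scaleR_add_right scaleR_sum_right)

lemma dten_lincomb: "dten A (\<lambda>is. \<Sum>b\<in>UNIV. a b *\<^sub>R f b is) is = (\<Sum>b\<in>UNIV. a b *\<^sub>R dten A (f b) is)"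
  by (simp add: dten_sum dten_scaleR)

text \<open>Terms in which \<open>A\<close> and \<open>B\<close> act in different slots occur in
  both orders and cancel; two actions in the same slot leave the matrix commutator.\<close>

lemma dten_commutator:
  "dten A (dten B \<psi>) is - dten B (dten A \<psi>) is = dten (A ** B - B ** A) \<psi> is"
proof (induction "is" arbitrary: \<psi>)
  case Nil
  show ?case by simp
next
  case (Cons i "is")
  have *: "dten A (dten B \<psi>) (i # is) =
      (\<Sum>e\<in>UNIV. ((A ** B) $ i $ e) *\<^sub>R \<psi> (e # is)) + (\<Sum>b\<in>UNIV. (A $ i $ b) *\<^sub>R dten B (slice \<psi> b) is)
      + (\<Sum>b\<in>UNIV. (B $ i $ b) *\<^sub>R dten A (slice \<psi> b) is) + dten A (dten B (slice \<psi> i)) is" for A B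
  proof -
    have "(\<Sum>b\<in>UNIV. (A $ i $ b) *\<^sub>R (\<Sum>e\<in>UNIV. (B $ b $ e) *\<^sub>R \<psi> (e # is)))
        = (\<Sum>e\<in>UNIV. ((A ** B) $ i $ e) *\<^sub>R \<psi> (e # is))"
      unfolding matrix_matrix_mult_def scaleR_sum_right
      by (subst sum.swap) (simp add: scaleR_sum_left)
    then show ?thesis
      by (simp add: dten_add dten_lincomb scaleR_add_right sum.distrib)
  qed
  show ?case
    unfolding * using Cons[of "slice \<psi> i"]
    by (simp add: algebra_simps sum_subtractf scaleR_diff_left)
qed

lemma sym_ten_dten:
  assumes "sym_ten \<psi>"
  shows "sym_ten (dten A \<psi>)"
  unfolding sym_ten_def
proof (intro allI impI)
  fix xs ys :: "'a list" assume "mset xs = mset ys"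
  then have "\<forall>\<psi> :: ('a, 'b) stensor. sym_ten \<psi> \<longrightarrow> dten A \<psi> xs = dten A \<psi> ys"
  proof (induction rule: mset_eq_induct)
    case (cons x xs ys)
    then show ?case by (auto intro!: arg_cong2[where f = "(+)"] sum.cong sym_ten_slice arg_cong2[where f = scaleR] elim!: sym_tenD)
  next
    case (swap x y xs)
    show ?case
    proof (intro allI impI)
      fix \<psi> :: "('a, 'b) stensor" assume s: "sym_ten \<psi>"
      show "dten A \<psi> (x # y # xs) = dten A \<psi> (y # x # xs)"
        using slice_slice_swap[OF s, of x y] by (simp add: add_ac sym_ten_swap[OF s])
    qed
  qed auto
  then show "dten A \<psi> xs = dten A \<psi> ys" using assms by blast
qed

lemma dten_support: "(\<And>ks. length ks = length is \<Longrightarrow> \<psi> ks = 0) \<Longrightarrow> dten A \<psi> is = 0"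
  by (induction "is" arbitrary: \<psi>) simp_all

lemma finite_lists_length [simp]: "finite {is::'n::finite list. length is = j}"
  using finite_lists_length_eq[of "UNIV :: 'n set" j] by simp

lemma sum_lists_Suc:
  fixes F :: "'n::finite list \<Rightarrow> 'b::comm_monoid_add"
  shows "(\<Sum>is | length is = Suc j. F is) = (\<Sum>k\<in>UNIV. \<Sum>is | length is = j. F (k # is))"
proof -
  have "(\<Sum>is | length is = Suc j. F is) = (\<Sum>(k, is)\<in>UNIV \<times> {is. length is = j}. F (k # is))"
    by (rule sum.reindex_bij_witness[where i = "\<lambda>(k, is). k # is" and j = "\<lambda>is. (hd is, tl is)"])
      (auto simp: length_Suc_conv)
  then show ?thesis by (simp add: sum.cartesian_product)
qed

lemma dten_minus_matrix: "dten (- A) \<psi> is = - dten A \<psi> is"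
  using dten_scaleR_matrix[of "-1" A \<psi> "is"] by simp

lemma skewD:
  fixes A :: "real^'n^'n"
  assumes "transpose A = - A"
  shows "A $ i $ k = - A $ k $ i"
proof -
  have "A $ i $ k = transpose A $ k $ i" by (simp add: transpose_def)
  also have "\<dots> = (- A) $ k $ i" unfolding assms ..
  finally show ?thesis unfolding vector_uminus_component .
qed

definition trace_free :: "('n::finite, 's::finite) stensor \<Rightarrow> bool" where
  "trace_free \<psi> \<longleftrightarrow> (\<forall>is. (\<Sum>k\<in>UNIV. \<psi> (k # k # is)) = 0)"

lemma sum_wedge_scaleR:
  fixes f :: "'n::finite \<Rightarrow> 'b::real_vector"
  shows
  "(\<Sum>b\<in>UNIV. (wedge k l $ a $ b) *\<^sub>R f b) = (if a = l then f k else 0) - (if a = k then f l else 0)"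
proof -
  have "(wedge k l $ a $ b) *\<^sub>R f b = (if b = k then (if a = l then f b else 0) else 0)
      - (if b = l then (if a = k then f b else 0) else 0)" for b
    by (auto simp: wedge_def)
  then show ?thesis by (simp add: sum_subtractf)
qed

text \<open>Every slot of \<open>is\<close> contributes a trace, which vanishes, and minus the
  tensor with \<open>a\<close> and the entry of that slot exchanged, which by symmetry is
  \<open>\<psi> (a # is)\<close>. These are the cross terms in \<open>dten_casimir\<close>.\<close>

lemma sum_dten_wedge_slice:
  assumes "sym_ten \<psi>" "trace_free \<psi>"
  shows "(\<Sum>i\<in>UNIV. dten (wedge i a) (slice \<psi> i) is) = - real (length is) *\<^sub>R \<psi> (a # is)"
  using assms
proof (induction "is" arbitrary: \<psi>)
  case (Cons s "is")
  have tf: "trace_free (slice \<psi> s)"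
    unfolding trace_free_def
  proof
    fix ks
    have "(\<Sum>k\<in>UNIV. slice \<psi> s (k # k # ks)) = (\<Sum>k\<in>UNIV. \<psi> (k # k # s # ks))"
      by (rule sum.cong) (auto intro: sym_tenD[OF Cons.prems(1)])
    then show "(\<Sum>k\<in>UNIV. slice \<psi> s (k # k # ks)) = 0"
      using Cons.prems(2) by (simp add: trace_free_def)
  qed
  have "(\<Sum>i\<in>UNIV. dten (wedge i a) (slice \<psi> i) (s # is)) =
     (\<Sum>i\<in>UNIV. (if s = a then \<psi> (i # i # is) else 0) - (if s = i then \<psi> (i # a # is) else 0))
     + (\<Sum>i\<in>UNIV. dten (wedge i a) (slice (slice \<psi> i) s) is)"
    by (simp add: sum_wedge_scaleR sum.distrib)
  also have "(\<Sum>i\<in>UNIV. (if s = a then \<psi> (i # i # is) else 0) - (if s = i then \<psi> (i # a # is) else 0))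
      = - \<psi> (a # s # is)"
    using Cons.prems sym_ten_swap[OF Cons.prems(1), of s a "is"]
    by (cases "s = a") (simp_all add: sum_subtractf sum_negf trace_free_def)
  also have "(\<Sum>i\<in>UNIV. dten (wedge i a) (slice (slice \<psi> i) s) is) = - real (length is) *\<^sub>R \<psi> (a # s # is)"
    using Cons.IH[OF sym_ten_slice[OF Cons.prems(1)] tf] slice_slice_swap[OF Cons.prems(1)]
      sym_ten_swap[OF Cons.prems(1), of s a "is"] by simp
  finally show ?case by (simp add: algebra_simps)
qed simp

text \<open>Up to sign this is twice the Casimir eigenvalue k (n + k - 2) of so(n) on harmonic
  polynomials of degree k, since every plane is counted for both orders of \<open>i\<close> and
  \<open>j\<close>. Splitting off the first slot gives 2 (n - 1) from two actions in it and 4 (k -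
  1) from one action in it and one behind it.\<close>

lemma dten_casimir:
  fixes \<psi> :: "('n::finite, 's::finite) stensor"
  assumes "sym_ten \<psi>" "trace_free \<psi>"
  shows "(\<Sum>i\<in>UNIV. \<Sum>j\<in>UNIV. dten (wedge i j) (dten (wedge i j) \<psi>) is)
    = - (2 * real (length is) * (real CARD('n) + real (length is) - 2)) *\<^sub>R \<psi> is"
  using assms
proof (induction "is" arbitrary: \<psi>)
  case (Cons a "is")
  have tf: "trace_free (slice \<psi> a)"
    unfolding trace_free_def
  proof
    fix ks
    have "(\<Sum>k\<in>UNIV. slice \<psi> a (k # k # ks)) = (\<Sum>k\<in>UNIV. \<psi> (k # k # a # ks))"
      by (rule sum.cong) (auto intro: sym_tenD[OF Cons.prems(1)])
    then show "(\<Sum>k\<in>UNIV. slice \<psi> a (k # k # ks)) = 0"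
      using Cons.prems(2) by (simp add: trace_free_def)
  qed
  \<comment> \<open>\<open>p\<close> and \<open>q\<close> are the values at first index
    \<open>b\<close> of one action in the first slot and of one action behind it.\<close>
  define p where "p i j b = (if b = j then \<psi> (i # is) else 0) - (if b = i then \<psi> (j # is) else 0)" for i j b
  define q where "q i j b = dten (wedge i j) (slice \<psi> b) is" for i j b
  have "dten (wedge i j) (dten (wedge i j) \<psi>) (a # is) =
      ((if a = j then p i j i else 0) - (if a = i then p i j j else 0))
      + 2 *\<^sub>R ((if a = j then q i j i else 0) - (if a = i then q i j j else 0))
      + dten (wedge i j) (dten (wedge i j) (slice \<psi> a)) is" for i j
  proof -
    have eq: "dten (wedge i j) (dten (wedge i j) \<psi>) (a # is) =
      (\<Sum>b\<in>UNIV. (wedge i j $ a $ b) *\<^sub>R (p i j b + q i j b))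
      + (\<Sum>b\<in>UNIV. (wedge i j $ a $ b) *\<^sub>R q i j b)
      + dten (wedge i j) (dten (wedge i j) (slice \<psi> a)) is"
      by (simp add: dten_add dten_lincomb p_def q_def sum_wedge_scaleR)
         (simp add: sum_wedge_scaleR dten_minus)
    show ?thesis unfolding eq sum_wedge_scaleR by (auto simp: scaleR_conv_of_real algebra_simps)
  qed
  then have "(\<Sum>i\<in>UNIV. \<Sum>j\<in>UNIV. dten (wedge i j) (dten (wedge i j) \<psi>) (a # is)) =
      ((\<Sum>i\<in>UNIV. p i a i) - (\<Sum>j\<in>UNIV. p a j j))
      + 2 *\<^sub>R ((\<Sum>i\<in>UNIV. q i a i) - (\<Sum>j\<in>UNIV. q a j j))
      + (\<Sum>i\<in>UNIV. \<Sum>j\<in>UNIV. dten (wedge i j) (dten (wedge i j) (slice \<psi> a)) is)"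
  proof -
    have 1: "(\<Sum>i\<in>UNIV. \<Sum>j\<in>UNIV. if a = i then f i j else 0) = (\<Sum>j\<in>UNIV. f a j)"
      for f :: "'n \<Rightarrow> 'n \<Rightarrow> complex^'s"
      by (subst sum.swap) simp
    show ?thesis
      using \<open>\<And>j i. dten (wedge i j) (dten (wedge i j) \<psi>) (a # is) = _\<close>
      by (simp add: sum.distrib sum_subtractf 1 flip: scaleR_sum_right)
  qed
  also have "(\<Sum>i\<in>UNIV. p i a i) - (\<Sum>j\<in>UNIV. p a j j) = - (2 * (real CARD('n) - 1)) *\<^sub>R \<psi> (a # is)"
  proof -
    have 1: "(\<Sum>i\<in>UNIV. p i a i) = \<psi> (a # is) - real CARD('n) *\<^sub>R \<psi> (a # is)"
      by (simp add: p_def sum_subtractf sum_constant_scaleR del: sum_constant)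
    have 2: "(\<Sum>j\<in>UNIV. p a j j) = real CARD('n) *\<^sub>R \<psi> (a # is) - \<psi> (a # is)"
      by (simp add: p_def sum_subtractf sum_constant_scaleR del: sum_constant)
    show ?thesis unfolding 1 2 by (simp add: scaleR_conv_of_real algebra_simps)
  qed
  also have "(\<Sum>i\<in>UNIV. q i a i) = - real (length is) *\<^sub>R \<psi> (a # is)"
    unfolding q_def by (rule sum_dten_wedge_slice[OF Cons.prems])
  also have "(\<Sum>j\<in>UNIV. q a j j) = real (length is) *\<^sub>R \<psi> (a # is)"
  proof -
    have "wedge a j = - wedge j a" for j by (simp add: vec_eq_iff wedge_def)
    then have "q a j j = - q j a j" for j unfolding q_def by (metis dten_minus_matrix)
    then show ?thesis
      using sum_dten_wedge_slice[OF Cons.prems, of a "is"] by (simp add: q_def sum_negf)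
  qed
  finally show ?case
    unfolding Cons.IH[OF sym_ten_slice[OF Cons.prems(1)] tf]
    by (simp add: scaleR_conv_of_real algebra_simps)
qed simp

lemma eq_minus_double:
  fixes y :: "'a::real_vector"
  assumes "y = - y - 2 *\<^sub>R x"
  shows "y = - x"
proof -
  have "y + y = - (2 *\<^sub>R x)" using assms by (metis diff_minus_eq_add uminus_add_conv_diff diff_add_cancel add.commute minus_diff_eq)
  then have "2 *\<^sub>R y = 2 *\<^sub>R (- x)" by (simp add: scaleR_2)
  then show ?thesis unfolding scaleR_cancel_left by simp
qed

lemma sum_rotate: "(\<Sum>k\<in>A. \<Sum>l\<in>B. \<Sum>b\<in>C. f k l b) = (\<Sum>b\<in>C. \<Sum>l\<in>B. \<Sum>k\<in>A. f k l b)"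
proof -
  have "(\<Sum>k\<in>A. \<Sum>l\<in>B. \<Sum>b\<in>C. f k l b) = (\<Sum>l\<in>B. \<Sum>k\<in>A. \<Sum>b\<in>C. f k l b)"
    by (rule sum.swap)
  also have "\<dots> = (\<Sum>l\<in>B. \<Sum>b\<in>C. \<Sum>k\<in>A. f k l b)"
    by (rule sum.cong[OF refl], rule sum.swap)
  also have "\<dots> = (\<Sum>b\<in>C. \<Sum>l\<in>B. \<Sum>k\<in>A. f k l b)"
    by (rule sum.swap)
  finally show ?thesis .
qed

locale spinor =
  fixes \<gamma> :: "('n::finite, 's::finite) gammas"
  assumes spinor_module: "spinor_module \<gamma>"
begin

lemma gamma_matmul: "\<gamma> k ** \<gamma> l + \<gamma> l ** \<gamma> k = (if k = l then mat (- 2) else 0)"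
  using spinor_module by (auto simp: spinor_module_def)

lemma gamma_swap: "\<gamma> k *v (\<gamma> l *v x) = - (\<gamma> l *v (\<gamma> k *v x)) - (if k = l then 2 *\<^sub>R x else 0)"
proof -
  have "\<gamma> k *v (\<gamma> l *v x) + \<gamma> l *v (\<gamma> k *v x) = (\<gamma> k ** \<gamma> l + \<gamma> l ** \<gamma> k) *v x"
    by (simp add: matrix_vector_mul_assoc matrix_vector_mult_add_rdistrib)
  also have "\<dots> = (if k = l then - 2 *\<^sub>R x else 0)"
  proof -
    have "(mat (- 2) :: complex^'s^'s) = (- 2 :: real) *\<^sub>R mat 1"
      by (simp add: vec_eq_iff mat_def scaleR_conv_of_real)
    then show ?thesis unfolding gamma_matmul by (auto simp: scaleR_matvec simp del: scaleR_minus_left)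
  qed
  finally show ?thesis by (auto simp: eq_neg_iff_add_eq_0 eq_diff_eq split: if_splits)
qed

lemma gamma_square: "\<gamma> k *v (\<gamma> k *v x) = - x"
  by (rule eq_minus_double) (use gamma_swap[of k k x] in simp)

text \<open>The adjoint of \<open>cliff_contract\<close> up to sign: Clifford multiplication by the vector in an
  additional symmetric index.\<close>

fun emb :: "('n, 's) stensor \<Rightarrow> ('n, 's) stensor" where
  "emb \<phi> [] = 0"
| "emb \<phi> (i # is) = \<gamma> i *v \<phi> is + emb (slice \<phi> i) is"

text \<open>The delta terms left over when \<open>\<gamma> k\<close> is moved past
  \<open>emb\<close>: the symmetric product with the basis vector of index \<open>k\<close>.\<close>

fun ins :: "'n \<Rightarrow> ('n, 's) stensor \<Rightarrow> ('n, 's) stensor" where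
  "ins k \<phi> [] = 0"
| "ins k \<phi> (i # is) = (if k = i then \<phi> is else 0) + ins k (slice \<phi> i) is"

abbreviation cc :: "('n, 's) stensor \<Rightarrow> ('n, 's) stensor" where
  "cc \<equiv> cliff_contract \<gamma>"

lemma cc_eq: "cc \<psi> is = (\<Sum>k\<in>UNIV. \<gamma> k *v \<psi> (k # is))"
  by (simp add: cliff_contract_def)

lemma emb_add: "emb (\<lambda>is. \<psi> is + \<phi> is) is = emb \<psi> is + emb \<phi> is"
  by (induction "is" arbitrary: \<psi> \<phi>) (simp_all add: matvec_simps)

lemma emb_zero [simp]: "emb (\<lambda>is. 0) is = 0"
  by (induction "is") simp_all

lemma emb_sum: "emb (\<lambda>is. \<Sum>i\<in>I. f i is) is = (\<Sum>i\<in>I. emb (f i) is)"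
  by (induction I rule: infinite_finite_induct) (simp_all add: emb_add)

lemma emb_scaleR: "emb (\<lambda>is. a *\<^sub>R \<psi> is) is = a *\<^sub>R emb \<psi> is"
  by (induction "is" arbitrary: \<psi>) (simp_all add: matvec_simps scaleR_add_right)

lemma ins_add: "ins k (\<lambda>is. \<psi> is + \<phi> is) is = ins k \<psi> is + ins k \<phi> is"
  by (induction "is" arbitrary: \<psi> \<phi>) simp_all

lemma ins_zero [simp]: "ins k (\<lambda>is. 0) is = 0"
  by (induction "is") simp_all

lemma ins_sum: "ins k (\<lambda>is. \<Sum>i\<in>I. f i is) is = (\<Sum>i\<in>I. ins k (f i) is)"
  by (induction I rule: infinite_finite_induct) (simp_all add: ins_add)

lemma ins_matvec: "ins k (\<lambda>is. A *v \<psi> is) is = A *v ins k \<psi> is"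
  by (induction "is" arbitrary: \<psi>) (simp_all add: matvec_simps)

lemma gamma_emb: "\<gamma> k *v emb \<phi> is = - emb (\<lambda>is. \<gamma> k *v \<phi> is) is - 2 *\<^sub>R ins k \<phi> is"
proof (induction "is" arbitrary: \<phi>)
  case (Cons i "is")
  have "\<gamma> k *v emb \<phi> (i # is) = \<gamma> k *v (\<gamma> i *v \<phi> is) + \<gamma> k *v emb (slice \<phi> i) is"
    by (simp add: matvec_simps)
  then show ?case unfolding Cons gamma_swap[of k i] by (simp add: scaleR_add_right)
qed simp

text \<open>Euler's identity in tensor form: contracting with a basis vector and multiplying it back
  in counts the slots.\<close>

lemma sum_ins_slice:
  "sym_ten \<psi> \<Longrightarrow> (\<Sum>k\<in>UNIV. ins k (slice \<psi> k) is) = real (length is) *\<^sub>R \<psi> is"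
proof (induction "is" arbitrary: \<psi>)
  case (Cons i "is")
  then show ?case
    using slice_slice_swap[OF Cons.prems, of _ i] Cons.IH[OF sym_ten_slice[OF Cons.prems, of i]]
    by (simp add: sum.distrib scaleR_add_left)
qed simp

text \<open>The tensor form of the relation x d + d x = -(n + 2 deg) between the vector variable and
  the Dirac operator of Clifford analysis. The n comes from the new slot via
  \<open>gamma_square\<close>, the 2 deg from the delta terms in the old slots.\<close>

lemma cc_emb:
  assumes "sym_ten \<phi>"
  shows "cc (emb \<phi>) is = - (real CARD('n) + 2 * real (length is)) *\<^sub>R \<phi> is - emb (cc \<phi>) is"
proof -
  have "cc (emb \<phi>) is = (\<Sum>k\<in>UNIV. - \<phi> is + (- emb (\<lambda>is. \<gamma> k *v \<phi> (k # is)) is - 2 *\<^sub>R ins k (slice \<phi> k) is))"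
    by (simp add: cc_eq matvec_simps gamma_square gamma_emb)
  also have "\<dots> = - real CARD('n) *\<^sub>R \<phi> is - emb (cc \<phi>) is - 2 *\<^sub>R real (length is) *\<^sub>R \<phi> is"
    using sum_ins_slice[OF assms, of "is"]
    by (simp add: sum.distrib sum_subtractf sum_negf sum_constant_scaleR emb_sum cc_eq[abs_def]
      flip: scaleR_sum_right del: sum_constant)
  finally show ?thesis by (simp add: algebra_simps scaleR_2)
qed

lemma sym_ten_emb:
  assumes "sym_ten \<phi>"
  shows "sym_ten (emb \<phi>)"
  unfolding sym_ten_def
proof (intro allI impI)
  fix xs ys :: "'n list" assume "mset xs = mset ys"
  then have "\<forall>\<phi>. sym_ten \<phi> \<longrightarrow> emb \<phi> xs = emb \<phi> ys"
  proof (induction rule: mset_eq_induct)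
    case (cons x xs ys)
    then show ?case by (auto intro!: arg_cong2[where f = "(+)"] arg_cong2[where f = "(*v)"] sym_ten_slice elim!: sym_tenD)
  next
    case (swap x y xs)
    show ?case
    proof (intro allI impI)
      fix \<phi> :: "('n, 's) stensor" assume s: "sym_ten \<phi>"
      show "emb \<phi> (x # y # xs) = emb \<phi> (y # x # xs)"
        using slice_slice_swap[OF s, of x y] by (simp add: add_ac)
    qed
  qed auto
  then show "emb \<phi> xs = emb \<phi> ys" using assms by blast
qed

lemma sym_ten_cc: "sym_ten \<psi> \<Longrightarrow> sym_ten (cc \<psi>)"
  unfolding sym_ten_def[of "cc \<psi>"] cc_eq
  by (intro allI impI sum.cong refl arg_cong2[where f = "(*v)"], erule sym_tenD) simp

lemma cc_slice: "sym_ten \<psi> \<Longrightarrow> cc (slice \<psi> i) = slice (cc \<psi>) i"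
  by (auto simp: fun_eq_iff cc_eq sym_ten_swap[of \<psi> i] intro!: sum.cong)

text \<open>The Clifford relation reduces the part symmetric in \<open>k\<close> and
  \<open>l\<close> to a trace. Applied to second covariant derivatives this separates the connection
  Laplacian from the curvature.\<close>

lemma sum_gamma_gamma:
  "(\<Sum>k\<in>UNIV. \<Sum>l\<in>UNIV. \<gamma> k *v (\<gamma> l *v t k l)) = - (\<Sum>k\<in>UNIV. t k k)
    + (1/2) *\<^sub>R (\<Sum>k\<in>UNIV. \<Sum>l\<in>UNIV. \<gamma> k *v (\<gamma> l *v (t k l - t l k)))"
proof -
  define A where "A = (\<Sum>k\<in>UNIV. \<Sum>l\<in>UNIV. \<gamma> k *v (\<gamma> l *v t k l))"
  define B where "B = (\<Sum>k\<in>UNIV. \<Sum>l\<in>UNIV. \<gamma> k *v (\<gamma> l *v t l k))"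
  have "A = (\<Sum>k\<in>UNIV. \<Sum>l\<in>UNIV. - (\<gamma> l *v (\<gamma> k *v t k l)) - (if k = l then 2 *\<^sub>R t k l else 0))"
    unfolding A_def by (intro sum.cong refl gamma_swap)
  also have "\<dots> = - (\<Sum>k\<in>UNIV. \<Sum>l\<in>UNIV. \<gamma> l *v (\<gamma> k *v t k l)) - 2 *\<^sub>R (\<Sum>k\<in>UNIV. t k k)"
    by (simp add: sum_subtractf sum_negf flip: scaleR_sum_right)
  also have "(\<Sum>k\<in>UNIV. \<Sum>l\<in>UNIV. \<gamma> l *v (\<gamma> k *v t k l)) = B"
    unfolding B_def by (rule sum.swap)
  finally have AB: "A = - B - 2 *\<^sub>R (\<Sum>k\<in>UNIV. t k k)" .
  have "(\<Sum>k\<in>UNIV. \<Sum>l\<in>UNIV. \<gamma> k *v (\<gamma> l *v (t k l - t l k))) = A - B"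
    unfolding A_def B_def by (simp add: matvec_simps sum_subtractf)
  also have "\<dots> = 2 *\<^sub>R A + 2 *\<^sub>R (\<Sum>k\<in>UNIV. t k k)" using AB by (simp add: scaleR_2)
  finally show ?thesis unfolding A_def by (simp add: scaleR_add_right)
qed

text \<open>For a symmetric tensor only the trace survives in \<open>sum_gamma_gamma\<close>. Hence
  a symmetric tensor with vanishing Clifford contraction is trace-free.\<close>

lemma cc_cc:
  assumes "sym_ten \<psi>"
  shows "cc (cc \<psi>) is = - (\<Sum>k\<in>UNIV. \<psi> (k # k # is))"
proof -
  have "cc (cc \<psi>) is = (\<Sum>k\<in>UNIV. \<Sum>l\<in>UNIV. \<gamma> k *v (\<gamma> l *v \<psi> (l # k # is)))"
    by (simp add: cc_eq matvec_sum)
  then show ?thesis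
    using sym_ten_swap[OF assms] by (subst (asm) sum_gamma_gamma) simp
qed

lemma gamma_gamma_gamma: "(\<Sum>k\<in>UNIV. \<gamma> k *v (\<gamma> l *v (\<gamma> k *v x))) = (real CARD('n) - 2) *\<^sub>R (\<gamma> l *v x)"
proof -
  have eq: "\<gamma> k *v (\<gamma> l *v (\<gamma> k *v x)) = \<gamma> l *v x - (if k = l then 2 *\<^sub>R (\<gamma> k *v x) else 0)" for k
    by (subst gamma_swap) (auto simp: gamma_square matvec_simps)
  show ?thesis
    unfolding eq by (simp add: sum_subtractf sum_constant_scaleR scaleR_diff_left del: sum_constant)
qed

text \<open>The twisted Dirac operator on embedded fields, in terms of the components \<open>t (k # is)\<close> of a
  covariant derivative.\<close>

lemma cc_dirac_emb:
  assumes "\<And>k. sym_ten (slice t k)" "\<And>k. cc (slice t k) = (\<lambda>_. 0)"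
  shows "(\<Sum>i\<in>UNIV. \<gamma> i *v (\<Sum>k\<in>UNIV. \<gamma> k *v emb (slice t k) (i # is)))
    = (real CARD('n) - 2 + 2 * real (length is)) *\<^sub>R cc t is + emb (cc (cc t)) is"
proof -
  have A: "(\<Sum>i\<in>UNIV. \<Sum>k\<in>UNIV. \<gamma> i *v (\<gamma> k *v (\<gamma> i *v t (k # is)))) = (real CARD('n) - 2) *\<^sub>R cc t is"
    by (subst sum.swap) (simp add: gamma_gamma_gamma cc_eq scaleR_sum_right)
  have *: "\<gamma> i *v (\<gamma> k *v emb \<phi> is) = emb (\<lambda>is. \<gamma> i *v (\<gamma> k *v \<phi> is)) is
      + 2 *\<^sub>R ins i (\<lambda>is. \<gamma> k *v \<phi> is) is - 2 *\<^sub>R (\<gamma> i *v ins k \<phi> is)" for i k \<phi>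
    by (simp add: gamma_emb matvec_simps)
  have s: "sym_ten (cc t)"
    unfolding sym_ten_def cc_eq
    by (intro allI impI sum.cong refl arg_cong2[where f = "(*v)"] sym_tenD[OF assms(1)])
  have B1: "(\<Sum>i\<in>UNIV. \<Sum>k\<in>UNIV. emb (\<lambda>is. \<gamma> i *v (\<gamma> k *v t (k # i # is))) is) = emb (cc (cc t)) is"
    by (simp add: cc_eq[abs_def] emb_sum matvec_sum)
  have B2: "(\<Sum>i\<in>UNIV. \<Sum>k\<in>UNIV. ins i (\<lambda>is. \<gamma> k *v t (k # i # is)) is) = real (length is) *\<^sub>R cc t is"
    using sum_ins_slice[OF s, of "is"] by (simp add: cc_eq ins_sum)
  \<comment> \<open>Summing over \<open>i\<close> first produces the Clifford contraction of
    \<open>slice t k\<close>, which vanishes.\<close>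
  have B3: "(\<Sum>i\<in>UNIV. \<Sum>k\<in>UNIV. \<gamma> i *v ins k (\<lambda>is. t (k # i # is)) is) = 0"
  proof -
    have "(\<Sum>i\<in>UNIV. \<gamma> i *v ins k (\<lambda>is. t (k # i # is)) is) = ins k (cc (slice t k)) is" for k
      by (simp add: cc_eq[abs_def] ins_sum ins_matvec)
    then show ?thesis by (subst sum.swap) (simp add: assms(2))
  qed
  have "(\<Sum>i\<in>UNIV. \<gamma> i *v (\<Sum>k\<in>UNIV. \<gamma> k *v emb (slice t k) (i # is))) =
     (\<Sum>i\<in>UNIV. \<Sum>k\<in>UNIV. \<gamma> i *v (\<gamma> k *v (\<gamma> i *v t (k # is))))
     + (\<Sum>i\<in>UNIV. \<Sum>k\<in>UNIV. \<gamma> i *v (\<gamma> k *v emb (\<lambda>is. t (k # i # is)) is))"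
    by (simp add: matvec_simps sum.distrib)
  also have "(\<Sum>i\<in>UNIV. \<Sum>k\<in>UNIV. \<gamma> i *v (\<gamma> k *v emb (\<lambda>is. t (k # i # is)) is))
     = emb (cc (cc t)) is + 2 *\<^sub>R real (length is) *\<^sub>R cc t is"
    unfolding * by (simp add: sum.distrib sum_subtractf B1 B2 B3 flip: scaleR_sum_right)
  finally show ?thesis unfolding A by (simp add: algebra_simps)
qed

section \<open>The action of so(n)\<close>

text \<open>Stated on vectors, because the Clifford relations are applied in the form of
  \<open>gamma_swap\<close>; the matrix itself, which is needed for the spin group, is
  \<open>spm\<close>.\<close>

definition spv :: "real^'n^'n \<Rightarrow> complex^'s \<Rightarrow> complex^'s" where
  "spv A x = (\<Sum>k\<in>UNIV. \<Sum>l\<in>UNIV. (A $ l $ k / 4) *\<^sub>R (\<gamma> k *v (\<gamma> l *v x)))"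

lemma so_act_eq: "so_act \<gamma> A \<psi> is = spv A (\<psi> is) + dten A \<psi> is"
  by (simp add: so_act_def spv_def matrix_vector_mul_assoc dten_eq)

lemma linear_spv: "linear (spv A)"
  unfolding linear_iff spv_def
  by (simp add: matvec_simps scaleR_add_right sum.distrib scaleR_sum_right mult.commute)

lemmas spv_linear_simps = linear_add[OF linear_spv] linear_scale[OF linear_spv] linear_sum[OF linear_spv]
  linear_0[OF linear_spv] linear_diff[OF linear_spv] linear_neg[OF linear_spv]

lemma so_act_add: "so_act \<gamma> A (\<lambda>is. \<psi> is + \<phi> is) is = so_act \<gamma> A \<psi> is + so_act \<gamma> A \<phi> is"
  by (simp add: so_act_eq spv_linear_simps dten_add)

lemma so_act_scaleR: "so_act \<gamma> A (\<lambda>is. a *\<^sub>R \<psi> is) is = a *\<^sub>R so_act \<gamma> A \<psi> is"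
  by (simp add: so_act_eq spv_linear_simps dten_scaleR scaleR_add_right)

lemma so_act_zero [simp]: "so_act \<gamma> A (\<lambda>is. 0) is = 0"
  by (simp add: so_act_eq spv_linear_simps)

lemma linear_so_act_matrix: "linear (\<lambda>A. so_act \<gamma> A \<psi> is)"
  unfolding linear_iff so_act_eq spv_def
  by (simp add: dten_add_matrix dten_scaleR_matrix scaleR_add_left scaleR_add_right sum.distrib
      add_divide_distrib scaleR_sum_right)

text \<open>Moving \<open>\<gamma> j\<close> through two Clifford factors leaves two delta terms,
  and skewness of \<open>A\<close> makes them add up. This equivariance of Clifford multiplication
  is behind \<open>so_act_cc\<close> and \<open>so_act_emb\<close>.\<close>

lemma spv_gamma:
  assumes "transpose A = - A"
  shows "spv A (\<gamma> j *v x) = \<gamma> j *v spv A x + (\<Sum>b\<in>UNIV. (A $ b $ j) *\<^sub>R (\<gamma> b *v x))"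
proof -
  have *: "\<gamma> k *v (\<gamma> l *v (\<gamma> j *v x)) = \<gamma> j *v (\<gamma> k *v (\<gamma> l *v x))
      + (if k = j then 2 *\<^sub>R (\<gamma> l *v x) else 0) - (if l = j then 2 *\<^sub>R (\<gamma> k *v x) else 0)" for k l
  proof -
    have "\<gamma> k *v (\<gamma> l *v (\<gamma> j *v x)) = - (\<gamma> k *v (\<gamma> j *v (\<gamma> l *v x))) - (if l = j then 2 *\<^sub>R (\<gamma> k *v x) else 0)"
      by (subst gamma_swap) (auto simp: matvec_simps)
    also have "\<gamma> k *v (\<gamma> j *v (\<gamma> l *v x)) = - (\<gamma> j *v (\<gamma> k *v (\<gamma> l *v x))) - (if k = j then 2 *\<^sub>R (\<gamma> l *v x) else 0)"
      by (rule gamma_swap)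
    finally show ?thesis by simp
  qed
  have "spv A (\<gamma> j *v x) = \<gamma> j *v spv A x
      + (\<Sum>k\<in>UNIV. \<Sum>l\<in>UNIV. (if k = j then (A $ l $ k / 2) *\<^sub>R (\<gamma> l *v x) else 0))
      - (\<Sum>k\<in>UNIV. \<Sum>l\<in>UNIV. (if l = j then (A $ l $ k / 2) *\<^sub>R (\<gamma> k *v x) else 0))"
    unfolding spv_def * matvec_sum matvec_scaleR sum.distrib[symmetric] sum_subtractf[symmetric]
    by (intro sum.cong refl) (simp add: scaleR_add_right scaleR_diff_right)
  also have "(\<Sum>k\<in>UNIV. \<Sum>l\<in>UNIV. (if k = j then (A $ l $ k / 2) *\<^sub>R (\<gamma> l *v x) else 0))
      = (\<Sum>b\<in>UNIV. (A $ b $ j / 2) *\<^sub>R (\<gamma> b *v x))"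
    by (subst sum.swap) simp
  also have "(\<Sum>k\<in>UNIV. \<Sum>l\<in>UNIV. (if l = j then (A $ l $ k / 2) *\<^sub>R (\<gamma> k *v x) else 0))
      = - (\<Sum>b\<in>UNIV. (A $ b $ j / 2) *\<^sub>R (\<gamma> b *v x))"
    by (simp add: skewD[OF assms, of j] sum_negf)
  finally show ?thesis
    unfolding diff_minus_eq_add add.assoc sum.distrib[symmetric] scaleR_add_left[symmetric] by simp
qed

lemma so_act_cc:
  assumes "transpose A = - A"
  shows "so_act \<gamma> A (cc \<psi>) is = cc (so_act \<gamma> A \<psi>) is"
proof -
  have "(\<Sum>k\<in>UNIV. \<Sum>b\<in>UNIV. (A $ b $ k) *\<^sub>R (\<gamma> b *v \<psi> (k # is)))
      = (\<Sum>k\<in>UNIV. \<gamma> k *v (\<Sum>b\<in>UNIV. (A $ k $ b) *\<^sub>R \<psi> (b # is)))"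
    by (subst sum.swap) (simp add: matvec_simps)
  then show ?thesis
    by (simp add: so_act_eq cc_eq[abs_def] spv_linear_simps spv_gamma[OF assms] dten_sum dten_matvec
        matvec_simps sum.distrib)
qed

lemma so_act_Cons: "so_act \<gamma> A \<psi> (i # is) = so_act \<gamma> A (slice \<psi> i) is + (\<Sum>b\<in>UNIV. (A $ i $ b) *\<^sub>R \<psi> (b # is))"
  by (simp add: so_act_eq)

text \<open>In the recursion, the term by which \<open>spv A\<close> fails to commute with
  \<open>\<gamma> i\<close> cancels, by skewness, against the action of \<open>A\<close> on the
  index that \<open>emb\<close> has added.\<close>

lemma so_act_emb:
  assumes "transpose A = - A"
  shows "so_act \<gamma> A (emb \<phi>) is = emb (so_act \<gamma> A \<phi>) is"
proof (induction "is" arbitrary: \<phi>)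
  case Nil
  show ?case by (simp add: so_act_eq spv_linear_simps)
next
  case (Cons i "is")
  have 1: "so_act \<gamma> A (\<lambda>is. \<gamma> i *v \<phi> is) is = \<gamma> i *v so_act \<gamma> A \<phi> is + (\<Sum>b\<in>UNIV. (A $ b $ i) *\<^sub>R (\<gamma> b *v \<phi> is))"
    by (simp add: so_act_eq spv_gamma[OF assms] dten_matvec matvec_simps)
  have 2: "(\<Sum>b\<in>UNIV. (A $ i $ b) *\<^sub>R (\<gamma> b *v \<phi> is)) = - (\<Sum>b\<in>UNIV. (A $ b $ i) *\<^sub>R (\<gamma> b *v \<phi> is))"
    by (simp add: skewD[OF assms, of i] sum_negf)
  have 3: "emb (\<lambda>is. so_act \<gamma> A \<phi> (i # is)) is
     = emb (so_act \<gamma> A (slice \<phi> i)) is + (\<Sum>b\<in>UNIV. (A $ i $ b) *\<^sub>R emb (slice \<phi> b) is)"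
    by (simp add: so_act_Cons emb_add emb_sum emb_scaleR)
  show ?case
    by (simp add: so_act_Cons[of A "emb \<phi>"] so_act_add 1 3 Cons[of "slice \<phi> i"] scaleR_add_right sum.distrib 2)
qed

lemma sym_ten_so_act: "sym_ten \<psi> \<Longrightarrow> sym_ten (so_act \<gamma> A \<psi>)"
  unfolding sym_ten_def[of "so_act \<gamma> A \<psi>"] so_act_eq
  by (intro allI impI arg_cong2[where f = "(+)"] arg_cong[where f = "spv A"])
    (auto dest: sym_tenD sym_tenD[OF sym_ten_dten])

text \<open>\<open>spv A\<close> acts as a derivation on the two Clifford factors of
  \<open>spv B\<close>; the two resulting terms have the coefficient matrices \<open>A ** B\<close>
  and, by skewness, \<open>- (B ** A)\<close>.\<close>

lemma spv_commutator:
  assumes "transpose A = - A" "transpose B = - B"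
  shows "spv A (spv B x) - spv B (spv A x) = spv (A ** B - B ** A) x"
proof -
  have "spv A (\<gamma> k *v (\<gamma> l *v x)) = \<gamma> k *v (\<gamma> l *v spv A x)
     + (\<Sum>b\<in>UNIV. (A $ b $ l) *\<^sub>R (\<gamma> k *v (\<gamma> b *v x))) + (\<Sum>b\<in>UNIV. (A $ b $ k) *\<^sub>R (\<gamma> b *v (\<gamma> l *v x)))" for k l
    by (simp add: spv_gamma[OF assms(1)] matvec_simps)
  then have "spv A (spv B x) = spv B (spv A x)
     + (\<Sum>k\<in>UNIV. \<Sum>l\<in>UNIV. \<Sum>b\<in>UNIV. (B $ l $ k / 4 * A $ b $ l) *\<^sub>R (\<gamma> k *v (\<gamma> b *v x)))
     + (\<Sum>k\<in>UNIV. \<Sum>l\<in>UNIV. \<Sum>b\<in>UNIV. (B $ l $ k / 4 * A $ b $ k) *\<^sub>R (\<gamma> b *v (\<gamma> l *v x)))"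
    by (simp add: spv_def[of B] spv_linear_simps scaleR_add_right scaleR_sum_right sum.distrib)
  also have "(\<Sum>k\<in>UNIV. \<Sum>l\<in>UNIV. \<Sum>b\<in>UNIV. (B $ l $ k / 4 * A $ b $ l) *\<^sub>R (\<gamma> k *v (\<gamma> b *v x)))
      = spv (A ** B) x"
    unfolding spv_def
    by (rule sum.cong[OF refl], subst sum.swap, rule sum.cong[OF refl])
      (simp add: matrix_matrix_mult_def sum_divide_distrib scaleR_sum_left mult.commute)
  also have "(\<Sum>k\<in>UNIV. \<Sum>l\<in>UNIV. \<Sum>b\<in>UNIV. (B $ l $ k / 4 * A $ b $ k) *\<^sub>R (\<gamma> b *v (\<gamma> l *v x)))
      = - spv (B ** A) x"
  proof -
    have "(\<Sum>k\<in>UNIV. \<Sum>l\<in>UNIV. \<Sum>b\<in>UNIV. (B $ l $ k / 4 * A $ b $ k) *\<^sub>R (\<gamma> b *v (\<gamma> l *v x)))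
       = (\<Sum>b\<in>UNIV. \<Sum>l\<in>UNIV. \<Sum>k\<in>UNIV. (B $ l $ k / 4 * A $ b $ k) *\<^sub>R (\<gamma> b *v (\<gamma> l *v x)))"
      by (rule sum_rotate)
    also have "\<dots> = - spv (B ** A) x"
    proof -
      have BA: "(B ** A) $ l $ b = - (\<Sum>k\<in>UNIV. B $ l $ k * A $ b $ k)" for l b
        unfolding matrix_matrix_mult_def vec_lambda_beta sum_negf[symmetric]
      proof (rule sum.cong[OF refl])
        fix k
        show "B $ l $ k * A $ k $ b = - (B $ l $ k * A $ b $ k)"
          by (subst skewD[OF assms(1)]) simp
      qed
      show ?thesis
        unfolding spv_def sum_negf[symmetric] BA
        by (intro sum.cong refl) (simp add: sum_divide_distrib scaleR_sum_left sum_negf)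
    qed
    finally show ?thesis .
  qed
  finally show ?thesis
    by (simp add: spv_def scaleR_diff_left sum_subtractf diff_divide_distrib)
qed

lemma so_act_commutator:
  assumes "transpose A = - A" "transpose B = - B"
  shows "so_act \<gamma> A (so_act \<gamma> B \<psi>) is - so_act \<gamma> B (so_act \<gamma> A \<psi>) is = so_act \<gamma> (A ** B - B ** A) \<psi> is"
proof -
  have spv_matrix: "\<exists>S. \<forall>x. spv A x = S *v x" for A
    by (rule exI[of _ "\<Sum>k\<in>UNIV. \<Sum>l\<in>UNIV. (A $ l $ k / 4) *\<^sub>R (\<gamma> k ** \<gamma> l)"])
      (simp add: spv_def matvec_simps matrix_vector_mul_assoc)
  have d: "dten A (\<lambda>is. spv B (\<psi> is)) is = spv B (dten A \<psi> is)" for A B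
    using spv_matrix[of B] by (auto simp: dten_matvec)
  have "so_act \<gamma> A (so_act \<gamma> B \<psi>) is = spv A (spv B (\<psi> is)) + spv A (dten B \<psi> is)
       + spv B (dten A \<psi> is) + dten A (dten B \<psi>) is" for A B
    unfolding so_act_eq[abs_def] dten_add d by (simp add: spv_linear_simps)
  then show ?thesis
    using spv_commutator[OF assms, of "\<psi> is"] dten_commutator[of A B \<psi> "is"]
    by (simp add: so_act_eq algebra_simps)
qed

lemma spv_wedge: "spv (wedge k l) x = (if k = l then 0 else (1/2) *\<^sub>R (\<gamma> k *v (\<gamma> l *v x)))"
proof -
  have "spv (wedge k l) x = (\<Sum>a\<in>UNIV. \<Sum>b\<in>UNIV. (wedge k l $ b $ a) *\<^sub>R ((1/4) *\<^sub>R (\<gamma> a *v (\<gamma> b *v x))))"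
    by (simp add: spv_def)
  also have "\<dots> = (\<Sum>b\<in>UNIV. \<Sum>a\<in>UNIV. (wedge k l $ b $ a) *\<^sub>R ((1/4) *\<^sub>R (\<gamma> a *v (\<gamma> b *v x))))"
    by (rule sum.swap)
  also have "\<dots> = (1/4) *\<^sub>R (\<gamma> k *v (\<gamma> l *v x)) - (1/4) *\<^sub>R (\<gamma> l *v (\<gamma> k *v x))"
    unfolding sum_wedge_scaleR sum_subtractf by simp
  finally have eq: "spv (wedge k l) x = (1/4) *\<^sub>R (\<gamma> k *v (\<gamma> l *v x)) - (1/4) *\<^sub>R (\<gamma> l *v (\<gamma> k *v x))" .
  show ?thesis
  proof (cases "k = l")
    case False
    then show ?thesis unfolding eq gamma_swap[of l k x] by (simp add: scaleR_add_left[symmetric])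
  next
    case True
    then show ?thesis using eq by simp
  qed
qed

text \<open>Each slot contributes -2 times the tensor and -2 times a Clifford factor applied to
  \<open>cc \<psi>\<close>; the latter collect to \<open>emb\<close>. This is the origin of the term
  in D^2 that distinguishes the summands S_j and S_(j-1).\<close>

lemma sum_gamma_dten_wedge:
  assumes "sym_ten \<psi>"
  shows "(\<Sum>k\<in>UNIV. \<Sum>l\<in>UNIV. \<gamma> k *v (\<gamma> l *v dten (wedge k l) \<psi> is))
    = - 2 *\<^sub>R (emb (cc \<psi>) is + real (length is) *\<^sub>R \<psi> is)"
  using assms
proof (induction "is" arbitrary: \<psi>)
  case (Cons i "is")
  have eq: "\<gamma> k *v (\<gamma> l *v dten (wedge k l) \<psi> (i # is)) =
     (if i = l then \<gamma> k *v (\<gamma> i *v \<psi> (k # is)) else 0) - (if i = k then \<gamma> i *v (\<gamma> l *v \<psi> (l # is)) else 0)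
     + \<gamma> k *v (\<gamma> l *v dten (wedge k l) (slice \<psi> i) is)" for k l
    by (simp add: sum_wedge_scaleR matvec_simps)
  have "(\<Sum>k\<in>UNIV. \<Sum>l\<in>UNIV. \<gamma> k *v (\<gamma> l *v dten (wedge k l) \<psi> (i # is))) =
     (\<Sum>k\<in>UNIV. \<gamma> k *v (\<gamma> i *v \<psi> (k # is))) - (\<Sum>l\<in>UNIV. \<gamma> i *v (\<gamma> l *v \<psi> (l # is)))
     + (\<Sum>k\<in>UNIV. \<Sum>l\<in>UNIV. \<gamma> k *v (\<gamma> l *v dten (wedge k l) (slice \<psi> i) is))"
  proof -
    have "(\<Sum>k\<in>UNIV. \<Sum>l\<in>UNIV. if i = k then f l else 0) = (\<Sum>l\<in>UNIV. f l)" for f :: "'n \<Rightarrow> complex^'s"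
      by (subst sum.swap) simp
    then show ?thesis unfolding eq by (simp add: sum.distrib sum_subtractf)
  qed
  also have "(\<Sum>k\<in>UNIV. \<gamma> k *v (\<gamma> i *v \<psi> (k # is))) = - (\<gamma> i *v cc \<psi> is) - 2 *\<^sub>R \<psi> (i # is)"
    unfolding gamma_swap[of _ i] by (simp add: cc_eq sum_subtractf sum_negf matvec_simps)
  also have "(\<Sum>l\<in>UNIV. \<gamma> i *v (\<gamma> l *v \<psi> (l # is))) = \<gamma> i *v cc \<psi> is"
    by (simp add: cc_eq matvec_sum)
  also have "(\<Sum>k\<in>UNIV. \<Sum>l\<in>UNIV. \<gamma> k *v (\<gamma> l *v dten (wedge k l) (slice \<psi> i) is)) =
     - 2 *\<^sub>R (emb (slice (cc \<psi>) i) is + real (length is) *\<^sub>R \<psi> (i # is))"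
    using Cons.IH[OF sym_ten_slice[OF Cons.prems]] cc_slice[OF Cons.prems] by simp
  finally show ?case by (simp add: algebra_simps scaleR_2)
qed simp

lemma sum_gamma_gamma_off_diagonal:
  "(\<Sum>k\<in>UNIV. \<Sum>l\<in>UNIV. if k = l then 0 else \<gamma> k *v (\<gamma> l *v (\<gamma> k *v (\<gamma> l *v x))))
    = - (real CARD('n) * (real CARD('n) - 1)) *\<^sub>R x"
proof -
  have eq: "(if k = l then 0 else \<gamma> k *v (\<gamma> l *v (\<gamma> k *v (\<gamma> l *v x)))) = - x + (if k = l then x else 0)" for k l
    using gamma_swap[of l k "\<gamma> l *v x"] by (auto simp: matvec_simps gamma_square)
  show ?thesis
    unfolding eq
    by (simp add: sum.distrib sum_subtractf sum_negf sum_constant_scaleR algebra_simps del: sum_constant)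
qed

text \<open>After multiplication by - K / 2 the spinor part n (n - 1) / 2 becomes a quarter of the
  scalar curvature K n (n - 1), as in the Lichnerowicz formula.\<close>

lemma weitzenboeck_term:
  assumes "sym_ten \<psi>"
  shows "(\<Sum>k\<in>UNIV. \<Sum>l\<in>UNIV. \<gamma> k *v (\<gamma> l *v so_act \<gamma> (wedge k l) \<psi> is))
    = - (real CARD('n) * (real CARD('n) - 1) / 2 + 2 * real (length is)) *\<^sub>R \<psi> is - 2 *\<^sub>R emb (cc \<psi>) is"
proof -
  have eq: "(\<Sum>k\<in>UNIV. \<Sum>l\<in>UNIV. \<gamma> k *v (\<gamma> l *v spv (wedge k l) (\<psi> is)))
     = (1/2) *\<^sub>R (\<Sum>k\<in>UNIV. \<Sum>l\<in>UNIV. if k = l then 0 else \<gamma> k *v (\<gamma> l *v (\<gamma> k *v (\<gamma> l *v \<psi> is))))"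
    unfolding spv_wedge scaleR_sum_right by (intro sum.cong refl) (simp add: matvec_simps)
  show ?thesis
    by (simp add: so_act_eq matvec_simps sum.distrib sum_gamma_dten_wedge[OF assms] eq
        sum_gamma_gamma_off_diagonal algebra_simps diff_divide_distrib)
qed

text \<open>The spinor and tensor parts of the action commute, so squaring gives both Casimirs and
  twice a mixed term. The mixed term is evaluated by \<open>sum_gamma_dten_wedge\<close>, where
  \<open>cc \<psi> = (\<lambda>_. 0)\<close> removes the \<open>emb\<close>.\<close>

lemma so_act_casimir:
  assumes "sym_ten \<psi>" "cc \<psi> = (\<lambda>_. 0)"
  shows "(\<Sum>i\<in>UNIV. \<Sum>j\<in>UNIV. so_act \<gamma> (wedge i j) (so_act \<gamma> (wedge i j) \<psi>) is)
    = - (real CARD('n) * (real CARD('n) - 1) / 4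
        + 2 * real (length is) * (real CARD('n) + real (length is) - 1)) *\<^sub>R \<psi> is"
proof -
  have tf: "trace_free \<psi>"
    using cc_cc[OF assms(1)] by (simp add: trace_free_def assms(2) cc_eq)
  have z: "dten (wedge i i) \<phi> is = 0" for i \<phi> "is"
  proof -
    have "wedge i i = 0 *\<^sub>R wedge i i" by (simp add: vec_eq_iff wedge_def)
    then show ?thesis by (metis dten_scaleR_matrix scaleR_zero_left)
  qed
  have "so_act \<gamma> (wedge i j) (so_act \<gamma> (wedge i j) \<psi>) is =
     (1/4) *\<^sub>R (if i = j then 0 else \<gamma> i *v (\<gamma> j *v (\<gamma> i *v (\<gamma> j *v \<psi> is))))
     + \<gamma> i *v (\<gamma> j *v dten (wedge i j) \<psi> is) + dten (wedge i j) (dten (wedge i j) \<psi>) is" for i j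
  proof (cases "i = j")
    case True
    then show ?thesis by (simp add: so_act_eq[abs_def] spv_wedge z matvec_simps)
  next
    case False
    have "so_act \<gamma> (wedge i j) (so_act \<gamma> (wedge i j) \<psi>) is =
      (1/2) *\<^sub>R (\<gamma> i *v (\<gamma> j *v ((1/2) *\<^sub>R (\<gamma> i *v (\<gamma> j *v \<psi> is)) + dten (wedge i j) \<psi> is)))
      + dten (wedge i j) (\<lambda>is. (1/2) *\<^sub>R (\<gamma> i *v (\<gamma> j *v \<psi> is)) + dten (wedge i j) \<psi> is) is"
      using False by (simp add: so_act_eq[abs_def] spv_wedge)
    also have "\<dots> = (1/4) *\<^sub>R (\<gamma> i *v (\<gamma> j *v (\<gamma> i *v (\<gamma> j *v \<psi> is))))
      + ((1/2) *\<^sub>R (\<gamma> i *v (\<gamma> j *v dten (wedge i j) \<psi> is)) + (1/2) *\<^sub>R (\<gamma> i *v (\<gamma> j *v dten (wedge i j) \<psi> is)))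
      + dten (wedge i j) (dten (wedge i j) \<psi>) is"
      by (simp add: dten_add dten_scaleR dten_matvec matvec_simps scaleR_add_right)
    also have "(1/2) *\<^sub>R (\<gamma> i *v (\<gamma> j *v dten (wedge i j) \<psi> is)) + (1/2) *\<^sub>R (\<gamma> i *v (\<gamma> j *v dten (wedge i j) \<psi> is))
      = \<gamma> i *v (\<gamma> j *v dten (wedge i j) \<psi> is)"
      by (simp flip: scaleR_add_left)
    finally show ?thesis using False by simp
  qed
  note eq = this
  show ?thesis unfolding eq
    by (simp add: sum.distrib dten_casimir[OF assms(1) tf] sum_gamma_dten_wedge[OF assms(1)] assms(2)
        sum_gamma_gamma_off_diagonal flip: scaleR_sum_right)
      (simp add: algebra_simps diff_divide_distrib flip: scaleR_add_left)
qed

end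

section \<open>The spin group\<close>

definition adjm :: "complex^'s^'s \<Rightarrow> complex^'s^'s" where
  "adjm A = (\<chi> a b. cnj (A $ b $ a))"

lemma has_derivative_vec_lambdaI:
  fixes f :: "'a::real_normed_vector \<Rightarrow> 'i::finite \<Rightarrow> 'b::euclidean_space"
  assumes "\<And>i. ((\<lambda>x. f x i) has_derivative (\<lambda>v. f' v i)) (at x)"
  shows "((\<lambda>x. \<chi> i. f x i) has_derivative (\<lambda>v. \<chi> i. f' v i)) (at x)"
proof -
  have "((\<lambda>x. \<Sum>i\<in>UNIV. axis i (f x i)) has_derivative (\<lambda>v. \<Sum>i\<in>UNIV. axis i (f' v i))) (at x)"
    by (intro has_derivative_sum bounded_linear.has_derivative[OF bounded_linear_axis] assms)
  moreover have "(\<Sum>i\<in>UNIV. axis i (g i)) = (\<chi> i. g i)" for g :: "'i \<Rightarrow> 'b"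
    using vec_eq_sum_axis[of "\<chi> i. g i"] by simp
  ultimately show ?thesis by simp
qed

lemma adjm_matmul: "adjm (A ** B) = adjm B ** adjm A"
  by (simp add: adjm_def matrix_matrix_mult_def vec_eq_iff mult.commute)

lemma adjm_mat1 [simp]: "adjm (mat 1) = mat 1"
  by (simp add: adjm_def mat_def vec_eq_iff)

lemma adjm_add: "adjm (A + B) = adjm A + adjm B"
  by (simp add: adjm_def vec_eq_iff)

lemma adjm_scaleR: "adjm (r *\<^sub>R A) = r *\<^sub>R adjm A"
  by (simp add: adjm_def vec_eq_iff)

lemma linear_adjm: "linear adjm"
  by (simp add: linear_iff adjm_add adjm_scaleR)

lemma bounded_linear_adjm: "bounded_linear adjm"
  using linear_adjm by (simp add: linear_conv_bounded_linear)

lemma adjm_sum: "adjm (\<Sum>i\<in>I. f i) = (\<Sum>i\<in>I. adjm (f i))"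
  by (rule linear_sum[OF linear_adjm])

lemma matrix_add_rdistrib: "(A + B) ** C = A ** C + B ** C" for C :: "'a::semiring_1^'k^'n"
  by (simp add: matrix_matrix_mult_def vec_eq_iff distrib_right sum.distrib)

lemma bounded_bilinear_matmul: "bounded_bilinear ((**) :: complex^'n^'m \<Rightarrow> complex^'k^'n \<Rightarrow> complex^'k^'m)"
  unfolding bilinear_conv_bounded_bilinear[symmetric] bilinear_def linear_iff
  by (intro allI conjI) (simp_all add: matrix_add_ldistrib matrix_add_rdistrib scaleR_matmul matmul_scaleR)

lemma bounded_bilinear_matmul_real: "bounded_bilinear ((**) :: real^'n^'m \<Rightarrow> real^'k^'n \<Rightarrow> real^'k^'m)"
  unfolding bilinear_conv_bounded_bilinear[symmetric] bilinear_def linear_iff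
  by (intro allI conjI) (simp_all add: matrix_add_ldistrib matrix_add_rdistrib scaleR_matmul matmul_scaleR)

lemma bounded_bilinear_matvec: "bounded_bilinear ((*v) :: complex^'n^'m \<Rightarrow> complex^'n \<Rightarrow> complex^'m)"
  unfolding bilinear_conv_bounded_bilinear[symmetric] bilinear_def
  by (auto simp: linear_iff scaleR_matvec matvec_scaleR matrix_vector_right_distrib matrix_vector_mult_add_rdistrib)

lemma bounded_linear_transpose: "bounded_linear (transpose :: real^'n^'m \<Rightarrow> real^'m^'n)"
  unfolding linear_conv_bounded_linear[symmetric] by (simp add: linear_iff transpose_def vec_eq_iff)

lemmas matmul_linear_simps = scaleR_matmul matmul_scaleR
  bounded_bilinear.add_left[OF bounded_bilinear_matmul] bounded_bilinear.add_right[OF bounded_bilinear_matmul]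
  bounded_bilinear.diff_left[OF bounded_bilinear_matmul] bounded_bilinear.diff_right[OF bounded_bilinear_matmul]
  bounded_bilinear.minus_left[OF bounded_bilinear_matmul] bounded_bilinear.minus_right[OF bounded_bilinear_matmul]
  bounded_bilinear.sum_left[OF bounded_bilinear_matmul] bounded_bilinear.sum_right[OF bounded_bilinear_matmul]
  bounded_bilinear.zero_left[OF bounded_bilinear_matmul] bounded_bilinear.zero_right[OF bounded_bilinear_matmul]

lemma matrix_eqI: "(\<And>x. A *v x = B *v x) \<Longrightarrow> A = B" for A B :: "'a::comm_ring_1^'n^'m"
  by (simp add: matrix_eq)

text \<open>Composing with a linear projection onto \<open>V\<close> does not change the map near
  \<open>x\<close>, hence not its derivative. It keeps derivatives of Spin-valued maps in the even
  Clifford algebra.\<close>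

lemma has_derivative_in_subspace:
  fixes h :: "'a::real_normed_vector \<Rightarrow> 'b::euclidean_space"
  assumes "(h has_derivative h') (at x)" "open S" "x \<in> S" "\<And>y. y \<in> S \<Longrightarrow> h y \<in> V" "subspace V"
  shows "h' v \<in> V"
proof -
  obtain p where p: "range p \<subseteq> V" "linear p" "\<forall>v\<in>V. p v = v"
    using linear_exists_left_inverse_on[OF linear_id assms(5)] inj_on_id[of V]
    by (auto simp: id_def)
  have "bounded_linear p" using p(2) by (simp add: linear_conv_bounded_linear)
  from bounded_linear.has_derivative[OF this assms(1)]
  have "((\<lambda>y. p (h y)) has_derivative (\<lambda>v. p (h' v))) (at x)" .
  moreover have "((\<lambda>y. p (h y)) has_derivative h') (at x)"
    by (rule has_derivative_transform_within_open[OF assms(1-3)]) (use p(3) assms(4) in auto)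
  ultimately have "(\<lambda>v. p (h' v)) = h'" by (rule has_derivative_unique)
  then have "p (h' v) = h' v" by (rule fun_cong)
  then show ?thesis using p(1) by (metis rangeI subsetD)
qed

context spinor
begin

lemma gamma_adjm: "adjm (\<gamma> k) = - \<gamma> k"
proof -
  have *: "\<gamma> k $ a $ b = - cnj (\<gamma> k $ b $ a)" for a b
    by (rule spinor_module[unfolded spinor_module_def, THEN conjunct2, THEN conjunct1, rule_format])
  have "cnj (\<gamma> k $ b $ a) = - \<gamma> k $ a $ b" for a b
    by (subst *[of a b]) simp
  then show ?thesis by (simp add: vec_eq_iff adjm_def)
qed

lemma linear_cliff: "linear (cliff \<gamma>)"
  by (simp add: linear_iff cliff_def scaleR_add_left sum.distrib scaleR_sum_right)

lemmas cliff_linear_simps = linear_add[OF linear_cliff] linear_scale[OF linear_cliff]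
  linear_diff[OF linear_cliff] linear_neg[OF linear_cliff] linear_sum[OF linear_cliff]

lemma cliff_axis: "cliff \<gamma> (axis k 1) = \<gamma> k"
  by (simp add: cliff_def axis_def if_distrib[of "\<lambda>a. a *\<^sub>R _"] cong: if_cong)

lemma cliff_adjm: "adjm (cliff \<gamma> v) = cliff \<gamma> (- v)"
  by (simp add: cliff_def adjm_sum adjm_scaleR gamma_adjm)

lemma cliff_anticommute: "cliff \<gamma> v ** cliff \<gamma> w + cliff \<gamma> w ** cliff \<gamma> v = (- 2 * (v \<bullet> w)) *\<^sub>R mat 1"
proof -
  have e: "cliff \<gamma> v ** cliff \<gamma> w = (\<Sum>k\<in>UNIV. \<Sum>l\<in>UNIV. (v $ k * w $ l) *\<^sub>R (\<gamma> k ** \<gamma> l))" for v w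
    by (subst sum.swap) (simp add: cliff_def matmul_linear_simps scaleR_sum_right mult.commute)
  have "cliff \<gamma> v ** cliff \<gamma> w + cliff \<gamma> w ** cliff \<gamma> v
      = (\<Sum>k\<in>UNIV. \<Sum>l\<in>UNIV. (v $ k * w $ l) *\<^sub>R (\<gamma> k ** \<gamma> l)) + (\<Sum>l\<in>UNIV. \<Sum>k\<in>UNIV. (v $ k * w $ l) *\<^sub>R (\<gamma> l ** \<gamma> k))"
    unfolding e by (simp add: mult.commute)
  also have "\<dots> = (\<Sum>k\<in>UNIV. \<Sum>l\<in>UNIV. (v $ k * w $ l) *\<^sub>R (\<gamma> k ** \<gamma> l + \<gamma> l ** \<gamma> k))"
    by (subst (2) sum.swap) (simp add: sum.distrib scaleR_add_right)
  also have "\<dots> = (\<Sum>k\<in>UNIV. \<Sum>l\<in>UNIV. if k = l then (v $ k * w $ l) *\<^sub>R mat (- 2) else 0)"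
    unfolding gamma_matmul by (intro sum.cong refl) simp
  also have "\<dots> = (v \<bullet> w) *\<^sub>R mat (- 2)"
    by (simp add: inner_vec_def scaleR_sum_left)
  also have "(mat (- 2) :: complex^'s^'s) = (- 2 :: real) *\<^sub>R mat 1"
    by (simp add: vec_eq_iff mat_def scaleR_conv_of_real)
  finally show ?thesis by (simp add: mult.commute)
qed

lemma cliff_square: "cliff \<gamma> v ** cliff \<gamma> v = - (v \<bullet> v) *\<^sub>R mat 1"
proof -
  have "2 *\<^sub>R (cliff \<gamma> v ** cliff \<gamma> v) = 2 *\<^sub>R (- (v \<bullet> v) *\<^sub>R mat 1)"
    using cliff_anticommute[of v v] by (simp only: scaleR_2[symmetric] scaleR_scaleR) simp
  then show ?thesis unfolding scaleR_cancel_left by simp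
qed

lemma mat1_nonzero: "(mat 1 :: complex^'s^'s) \<noteq> 0"
  by (simp add: vec_eq_iff mat_def)

lemma cliff_inj: "cliff \<gamma> v = cliff \<gamma> w \<Longrightarrow> v = w"
proof -
  assume "cliff \<gamma> v = cliff \<gamma> w"
  then have "cliff \<gamma> (v - w) = 0" by (simp add: cliff_linear_simps)
  then have "((v - w) \<bullet> (v - w)) *\<^sub>R (mat 1 :: complex^'s^'s) = 0"
    using cliff_square[of "v - w"] by (simp add: matmul_linear_simps)
  then show ?thesis using mat1_nonzero by simp
qed

text \<open>A linear left inverse on all matrices, so that \<open>cov\<close> becomes a formula
  quadratic in \<open>h\<close> that can be differentiated by the product rule.\<close>

definition uncliff :: "complex^'s^'s \<Rightarrow> real^'n" where
  "uncliff = (SOME L. linear L \<and> (\<forall>v. L (cliff \<gamma> v) = v))"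

lemma uncliff: "linear uncliff" "uncliff (cliff \<gamma> v) = v"
proof -
  have "inj (cliff \<gamma>)" using cliff_inj by (auto intro: injI)
  then have "\<exists>L. linear L \<and> (\<forall>v. L (cliff \<gamma> v) = v)"
    using linear_injective_left_inverse[OF linear_cliff] by (metis comp_apply id_apply)
  from someI_ex[OF this] show "linear uncliff" "uncliff (cliff \<gamma> v) = v"
    unfolding uncliff_def by auto
qed

abbreviation cprod :: "(real^'n) list \<Rightarrow> complex^'s^'s" where
  "cprod vs \<equiv> foldr (\<lambda>v h. cliff \<gamma> v ** h) vs (mat 1)"

lemma cprod_append: "cprod (vs @ ws) = cprod vs ** cprod ws"
  by (induction vs) (simp_all add: matrix_mul_assoc)

lemma cprod_adjm: "adjm (cprod vs) = cprod (rev (map uminus vs))"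
  by (induction vs) (simp_all add: adjm_matmul cliff_adjm cprod_append del: foldr_append)

lemma cprod_unitary:
  assumes "\<forall>v\<in>set vs. norm v = 1"
  shows "cprod vs ** adjm (cprod vs) = mat 1"
  using assms
proof (induction vs)
  case (Cons v vs)
  have "cprod (v # vs) ** adjm (cprod (v # vs)) = cliff \<gamma> v ** (cprod vs ** adjm (cprod vs)) ** cliff \<gamma> (- v)"
    by (simp add: adjm_matmul cliff_adjm matrix_mul_assoc)
  also have "\<dots> = cliff \<gamma> v ** cliff \<gamma> (- v)" using Cons by simp
  also have "\<dots> = mat 1"
    using Cons.prems by (simp add: cliff_linear_simps matmul_linear_simps cliff_square dot_square_norm)
  finally show ?case .
qed simp

lemma cprod_conj:
  assumes "\<forall>v\<in>set vs. norm v = 1"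
  shows "\<exists>A. \<forall>v. cprod vs ** cliff \<gamma> v = cliff \<gamma> (A *v v) ** cprod vs"
  using assms
proof (induction vs)
  case Nil
  show ?case by (rule exI[of _ "mat 1"]) simp
next
  case (Cons u vs)
  then obtain A where A: "cprod vs ** cliff \<gamma> v = cliff \<gamma> (A *v v) ** cprod vs" for v by auto
  have u: "u \<bullet> u = 1" using Cons.prems by (simp add: dot_square_norm)
  \<comment> \<open>Commuting \<open>cliff \<gamma> u\<close> past a vector applies minus the
    reflection in the hyperplane orthogonal to \<open>u\<close>.\<close>
  define B where "B = matrix (\<lambda>w. (2 * (u \<bullet> w)) *\<^sub>R u - w)"
  have "linear (\<lambda>w. (2 * (u \<bullet> w)) *\<^sub>R u - w)"
    by (simp add: linear_iff inner_add_right algebra_simps)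
  then have B: "B *v w = (2 * (u \<bullet> w)) *\<^sub>R u - w" for w
    unfolding B_def by (simp add: matrix_works linear_matrix_vector_mul_eq)
  have *: "cliff \<gamma> u ** cliff \<gamma> w = cliff \<gamma> (B *v w) ** cliff \<gamma> u" for w
    using cliff_anticommute[of u w]
    by (simp add: B cliff_linear_simps matmul_linear_simps u cliff_square algebra_simps eq_neg_iff_add_eq_0)
  have "cprod (u # vs) ** cliff \<gamma> v = cliff \<gamma> ((B ** A) *v v) ** cprod (u # vs)" for v
    by (simp add: A * matrix_mul_assoc[symmetric] flip: matrix_vector_mul_assoc)
       (simp add: * matrix_mul_assoc)
  then show ?case by blast
qed

lemma SpinE:
  assumes "h \<in> Spin \<gamma>"
  obtains vs where "h = cprod vs" "even (length vs)" "\<forall>v\<in>set vs. norm v = 1"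
  using assms unfolding Spin_def by blast

lemma Spin_one: "mat 1 \<in> Spin \<gamma>"
  unfolding Spin_def by (rule CollectI, rule exI[of _ "[]"]) simp

lemma Spin_mult: "h \<in> Spin \<gamma> \<Longrightarrow> k \<in> Spin \<gamma> \<Longrightarrow> h ** k \<in> Spin \<gamma>"
proof (elim SpinE)
  fix vs ws :: "(real^'n) list"
  assume "h = cprod vs" "even (length vs)" "\<forall>v\<in>set vs. norm v = 1"
    "k = cprod ws" "even (length ws)" "\<forall>v\<in>set ws. norm v = 1"
  then show ?thesis
    unfolding Spin_def by (intro CollectI exI[of _ "vs @ ws"]) (auto simp: cprod_append simp del: foldr_append)
qed

lemma Spin_adjm: "h \<in> Spin \<gamma> \<Longrightarrow> adjm h \<in> Spin \<gamma>"
proof (elim SpinE)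
  fix vs :: "(real^'n) list"
  assume "h = cprod vs" "even (length vs)" "\<forall>v\<in>set vs. norm v = 1"
  then show ?thesis
    unfolding Spin_def by (intro CollectI exI[of _ "rev (map uminus vs)"]) (auto simp: cprod_adjm)
qed

lemma Spin_unitary: "h \<in> Spin \<gamma> \<Longrightarrow> h ** adjm h = mat 1" "h \<in> Spin \<gamma> \<Longrightarrow> adjm h ** h = mat 1"
proof -
  show *: "h ** adjm h = mat 1" if "h \<in> Spin \<gamma>" for h
    using that by (elim SpinE) (simp add: cprod_unitary)
  show "h \<in> Spin \<gamma> \<Longrightarrow> adjm h ** h = mat 1"
    using * matrix_left_right_inverse by blast
qed

text \<open>The covering \<open>Spin_cover\<close> as an explicit formula: conjugation by
  \<open>h\<close>, with \<open>adjm h\<close> as the inverse on Spin. In this form it is visibly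
  smooth.\<close>

definition cov :: "complex^'s^'s \<Rightarrow> real^'n^'n" where
  "cov h = (\<chi> l k. uncliff (h ** \<gamma> k ** adjm h) $ l)"

lemma cov_unique:
  assumes "h \<in> Spin \<gamma>" "\<And>v. h ** cliff \<gamma> v = cliff \<gamma> (A *v v) ** h"
  shows "A = cov h"
proof -
  have "h ** cliff \<gamma> v ** adjm h = cliff \<gamma> (A *v v)" for v
    unfolding assms(2) by (simp add: Spin_unitary[OF assms(1)] flip: matrix_mul_assoc)
  then have "A *v axis k 1 = uncliff (h ** \<gamma> k ** adjm h)" for k
    using cliff_axis uncliff(2) by metis
  then have "A $ l $ k = uncliff (h ** \<gamma> k ** adjm h) $ l" for l k
    by (metis matrix_vector_mult_basis column_def vec_lambda_beta)
  then show ?thesis by (simp add: cov_def vec_eq_iff)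
qed

lemma cov_exists: "h \<in> Spin \<gamma> \<Longrightarrow> h ** cliff \<gamma> v = cliff \<gamma> (cov h *v v) ** h"
proof -
  assume h: "h \<in> Spin \<gamma>"
  then obtain A where A: "\<And>v. h ** cliff \<gamma> v = cliff \<gamma> (A *v v) ** h"
    using cprod_conj by (elim SpinE) metis
  show ?thesis using A cov_unique[OF h A] by simp
qed

lemma Spin_cover_eq: "h \<in> Spin \<gamma> \<Longrightarrow> Spin_cover \<gamma> h = cov h"
  unfolding Spin_cover_def
  by (rule the_equality) (auto simp: cov_exists intro: cov_unique)

lemma cov_mult: "h \<in> Spin \<gamma> \<Longrightarrow> k \<in> Spin \<gamma> \<Longrightarrow> cov (h ** k) = cov h ** cov k"
  by (rule cov_unique[symmetric, OF Spin_mult])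
    (simp_all add: matrix_mul_assoc[symmetric] cov_exists matrix_vector_mul_assoc[symmetric],
     simp add: matrix_mul_assoc cov_exists)

lemma cov_one: "cov (mat 1) = mat 1"
  by (rule cov_unique[symmetric, OF Spin_one]) simp

text \<open>Conjugation by \<open>h\<close> preserves the anticommutator of two vectors, which is
  their inner product up to the factor -2.\<close>

lemma cov_orthogonal:
  assumes "h \<in> Spin \<gamma>"
  shows "transpose (cov h) ** cov h = mat 1" "cov h ** transpose (cov h) = mat 1"
proof -
  have *: "(cov h *v v) \<bullet> (cov h *v w) = v \<bullet> w" for v w
  proof -
    have 2: "h ** (cliff \<gamma> v ** cliff \<gamma> w) = cliff \<gamma> (cov h *v v) ** cliff \<gamma> (cov h *v w) ** h" for v w
      by (metis matrix_mul_assoc cov_exists[OF assms])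
    have "(- 2 * (v \<bullet> w)) *\<^sub>R h = h ** (cliff \<gamma> v ** cliff \<gamma> w + cliff \<gamma> w ** cliff \<gamma> v)"
      unfolding cliff_anticommute matmul_linear_simps by simp
    also have "\<dots> = (cliff \<gamma> (cov h *v v) ** cliff \<gamma> (cov h *v w) + cliff \<gamma> (cov h *v w) ** cliff \<gamma> (cov h *v v)) ** h"
      unfolding matmul_linear_simps 2 ..
    also have "\<dots> = (- 2 * ((cov h *v v) \<bullet> (cov h *v w))) *\<^sub>R h"
      unfolding cliff_anticommute matmul_linear_simps by simp
    finally have "(- 2 * (v \<bullet> w)) *\<^sub>R h = (- 2 * ((cov h *v v) \<bullet> (cov h *v w))) *\<^sub>R h" .
    moreover have "h \<noteq> 0"
      using Spin_unitary(1)[OF assms] mat1_nonzero by (auto simp: matmul_linear_simps)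
    ultimately show ?thesis unfolding scaleR_cancel_right by simp
  qed
  then have "orthogonal_transformation ((*v) (cov h))"
    by (simp add: orthogonal_transformation_def matrix_vector_mul_linear)
  then have "orthogonal_matrix (cov h)"
    by (simp add: orthogonal_transformation_matrix)
  then show "transpose (cov h) ** cov h = mat 1" "cov h ** transpose (cov h) = mat 1"
    by (auto simp: orthogonal_matrix_def)
qed

lemma Spin_gamma: "h \<in> Spin \<gamma> \<Longrightarrow> h *v (\<gamma> k *v x) = (\<Sum>l\<in>UNIV. (cov h $ l $ k) *\<^sub>R (\<gamma> l *v (h *v x)))"
proof -
  assume h: "h \<in> Spin \<gamma>"
  have "h *v (\<gamma> k *v x) = (h ** cliff \<gamma> (axis k 1)) *v x"
    by (simp add: cliff_axis matrix_vector_mul_assoc)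
  also have "\<dots> = (cliff \<gamma> (cov h *v axis k 1) ** h) *v x"
    by (simp add: cov_exists[OF h])
  also have "cov h *v axis k 1 = column k (cov h)"
    by (simp add: matrix_vector_mult_basis)
  finally show ?thesis
    by (simp add: cliff_def column_def matrix_vector_mul_assoc[symmetric] matvec_simps)
qed

section \<open>The Lie algebra of the spin group\<close>

abbreviation gword :: "'n list \<Rightarrow> complex^'s^'s" where
  "gword ks \<equiv> foldr (\<lambda>k A. \<gamma> k ** A) ks (mat 1)"

text \<open>A real span on purpose: with complex coefficients the imaginary scalars would be central
  and skew-adjoint, and the argument that kills the remaining scalar in
  \<open>Spin_log_derivative\<close> would break down.\<close>

definition even_cliff :: "(complex^'s^'s) set" where
  "even_cliff = span {gword ks | ks. even (length ks)}"

lemma gword_append: "gword (ks @ ls) = gword ks ** gword ls"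
  by (induction ks) (simp_all add: matrix_mul_assoc)

lemma subspace_even_cliff: "subspace even_cliff"
  by (simp add: even_cliff_def)

lemma cprod_in_span: "cprod vs \<in> span {gword ks | ks. length ks = length vs}"
proof (induction vs)
  case Nil
  show ?case by (rule span_base) (rule CollectI, rule exI[of _ "[]"], simp)
next
  case (Cons v vs)
  have "cliff \<gamma> v ** B \<in> span {gword ks | ks. length ks = length (v # vs)}"
    if "B \<in> span {gword ks | ks. length ks = length vs}" for B
    using that
  proof (induction rule: span_induct_alt)
    case base
    show ?case by (simp add: matmul_linear_simps span_zero)
  next
    case (step r w B)
    then obtain ks where w: "w = gword ks" "length ks = length vs" by blast
    have "\<gamma> k ** w \<in> span {gword ks | ks. length ks = length (v # vs)}" for k
      by (rule span_base) (rule CollectI, rule exI[of _ "k # ks"], simp add: w)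
    then have "cliff \<gamma> v ** w \<in> span {gword ks | ks. length ks = length (v # vs)}"
      unfolding cliff_def matmul_linear_simps by (intro span_sum span_scale)
    then show ?case
      using step unfolding matmul_linear_simps by (intro span_add span_scale)
  qed
  then show ?case using Cons by simp
qed

lemma Spin_even_cliff: "h \<in> Spin \<gamma> \<Longrightarrow> h \<in> even_cliff"
proof (elim SpinE)
  fix vs :: "(real^'n) list" assume *: "h = cprod vs" "even (length vs)"
  have "{gword ks | ks. length ks = length vs} \<subseteq> {gword ks | ks. even (length ks)}"
    using *(2) by auto
  then show ?thesis
    using cprod_in_span[of vs] span_mono unfolding *(1) even_cliff_def by blast
qed

lemma even_cliff_mult: "A \<in> even_cliff \<Longrightarrow> B \<in> even_cliff \<Longrightarrow> A ** B \<in> even_cliff"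
proof -
  assume A: "A \<in> even_cliff" and B: "B \<in> even_cliff"
  have *: "w ** B \<in> even_cliff" if "w = gword ks" "even (length ks)" for w ks
    using B[unfolded even_cliff_def]
  proof (induction rule: span_induct_alt)
    case base
    show ?case by (simp add: matmul_linear_simps even_cliff_def span_zero)
  next
    case (step r w' B)
    then obtain ls where "w' = gword ls" "even (length ls)" by blast
    then have "w ** w' \<in> even_cliff"
      unfolding even_cliff_def using that
      by (intro span_base CollectI exI[of _ "ks @ ls"]) (simp add: gword_append del: foldr_append)
    then show ?case
      using step subspace_even_cliff unfolding matmul_linear_simps by (intro subspace_add subspace_scale)
  qed
  show ?thesis
    using A[unfolded even_cliff_def]
  proof (induction rule: span_induct_alt)
    case base
    show ?case by (simp add: matmul_linear_simps even_cliff_def span_zero)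
  next
    case (step r w A)
    then have "w ** B \<in> even_cliff" using * by blast
    then show ?case
      using step subspace_even_cliff unfolding matmul_linear_simps by (intro subspace_add subspace_scale)
  qed
qed

text \<open>Each letter different from \<open>k\<close> costs a sign, and their number has the
  parity of the length plus the number of letters \<open>k\<close>.\<close>

lemma gamma_gword: "\<gamma> k ** gword ks = (-1) ^ (length ks + count_list ks k) *\<^sub>R (gword ks ** \<gamma> k)"
proof (induction ks)
  case (Cons l ks)
  have "\<gamma> k ** \<gamma> l = (if k = l then 1 else -1) *\<^sub>R (\<gamma> l ** \<gamma> k)"
    using gamma_matmul[of k l] by (auto simp: eq_neg_iff_add_eq_0)
  then have "\<gamma> k ** gword (l # ks) = (if k = l then 1 else -1) *\<^sub>R (\<gamma> l ** (\<gamma> k ** gword ks))"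
    by (simp add: matrix_mul_assoc scaleR_matmul)
  also have "\<dots> = (-1) ^ (length (l # ks) + count_list (l # ks) k) *\<^sub>R (gword (l # ks) ** \<gamma> k)"
    unfolding Cons by (simp add: matmul_linear_simps matrix_mul_assoc)
  finally show ?case .
qed simp

lemma gamma_sq: "\<gamma> k ** \<gamma> k = - mat 1"
  by (rule matrix_eqI) (simp add: gamma_square minus_matvec flip: matrix_vector_mul_assoc)

text \<open>The first letter occurs a second time; moving it there and using \<open>gamma_sq\<close>
  gives, up to sign, a word that is shorter by two.\<close>

lemma gword_even_counts:
  "(\<And>k. even (count_list ks k)) \<Longrightarrow> gword ks \<in> range (\<lambda>r. r *\<^sub>R mat 1)"
proof (induction "length ks" arbitrary: ks rule: less_induct)
  case less
  show ?case
  proof (cases ks)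
    case Nil
    then show ?thesis by (auto intro: range_eqI[of _ _ 1])
  next
    case (Cons k ls)
    have "count_list ls k \<noteq> 0" using less.prems[of k] Cons by (auto intro: odd_pos)
    then have "k \<in> set ls" by (metis count_notin)
    then obtain as bs where ls: "ls = as @ k # bs" by (meson split_list)
    have "gword (as @ bs) \<in> range (\<lambda>r. r *\<^sub>R mat 1)"
    proof (rule less.hyps)
      show "length (as @ bs) < length ks" using Cons ls by simp
      show "even (count_list (as @ bs) l)" for l
        using less.prems[of l] Cons ls by (auto split: if_splits)
    qed
    then obtain r where r: "gword as ** gword bs = r *\<^sub>R mat 1"
      by (auto simp: gword_append simp del: foldr_append)
    have "gword ks = (\<gamma> k ** gword as) ** (\<gamma> k ** gword bs)"
      by (simp add: Cons ls gword_append matrix_mul_assoc del: foldr_append)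
    also have "\<dots> = (-1) ^ (length as + count_list as k) *\<^sub>R (gword as ** (\<gamma> k ** \<gamma> k) ** gword bs)"
      unfolding gamma_gword[of k as] by (simp add: matmul_linear_simps matrix_mul_assoc)
    also have "\<dots> = (- ((-1) ^ (length as + count_list as k)) * r) *\<^sub>R mat 1"
      unfolding gamma_sq by (simp add: matmul_linear_simps r)
    finally show ?thesis by blast
  qed
qed

text \<open>Averaging over conjugation with \<open>\<gamma> k\<close> kills every even monomial in which \<open>\<gamma> k\<close> occurs an
  odd number of times.\<close>

definition avg :: "'n \<Rightarrow> complex^'s^'s \<Rightarrow> complex^'s^'s" where
  "avg k A = (1/2) *\<^sub>R (A - \<gamma> k ** A ** \<gamma> k)"

lemma linear_avg: "linear (foldr avg ks)"
proof (induction ks)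
  case (Cons k ks)
  have "linear (avg k)"
    by (simp add: linear_iff avg_def matmul_linear_simps algebra_simps)
  from linear_compose[OF Cons this] show ?case by (simp add: o_def)
qed (simp add: linear_id[unfolded id_def])

lemma avg_gword: "even (length ws) \<Longrightarrow> avg k (gword ws) = (if even (count_list ws k) then gword ws else 0)"
proof -
  assume "even (length ws)"
  then have "\<gamma> k ** gword ws ** \<gamma> k = (-1) ^ count_list ws k *\<^sub>R - gword ws"
    unfolding gamma_gword
    by (simp add: matmul_linear_simps power_add gamma_sq flip: matrix_mul_assoc)
  then show ?thesis by (simp add: avg_def scaleR_2[symmetric] del: scaleR_2)
qed

lemma avg_commuting: "(\<And>k. \<gamma> k ** A = A ** \<gamma> k) \<Longrightarrow> foldr avg ks A = A"
proof (induction ks)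
  case (Cons k ks)
  have "\<gamma> k ** A ** \<gamma> k = - A"
    by (simp add: Cons.prems gamma_sq matmul_linear_simps flip: matrix_mul_assoc)
  then show ?case using Cons by (simp add: avg_def scaleR_2[symmetric] del: scaleR_2)
qed simp

text \<open>Averaging over all \<open>k\<close> fixes \<open>A\<close> but leaves only a scalar of
  every even monomial: a monomial that survives contains each generator an even number of
  times.\<close>

lemma even_cliff_central:
  assumes "A \<in> even_cliff" "\<And>k. \<gamma> k ** A = A ** \<gamma> k"
  shows "A \<in> range (\<lambda>r. r *\<^sub>R mat 1)"
proof -
  obtain ks :: "'n list" where ks: "set ks = UNIV" using finite_list[OF finite] by blast
  have sub: "subspace (range (\<lambda>r. r *\<^sub>R mat 1 :: complex^'s^'s))"
    by (rule linear_subspace_image) (simp_all add: linear_iff scaleR_add_left)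
  have w: "foldr avg ls (gword ws) = (if \<forall>k\<in>set ls. even (count_list ws k) then gword ws else 0)"
    if "even (length ws)" for ls ws
  proof (induction ls)
    case (Cons l ls)
    have "avg l 0 = 0" by (simp add: avg_def matmul_linear_simps)
    then show ?case using Cons avg_gword[OF that, of l] by simp
  qed simp
  have "foldr avg ks A \<in> range (\<lambda>r. r *\<^sub>R mat 1)"
    using assms(1)[unfolded even_cliff_def]
  proof (induction rule: span_induct_alt)
    case base
    show ?case using linear_0[OF linear_avg] subspace_0[OF sub] by simp
  next
    case (step r B C)
    then obtain ws where ws: "B = gword ws" "even (length ws)" by blast
    have "foldr avg ks B \<in> range (\<lambda>r. r *\<^sub>R mat 1)"
      using w[OF ws(2), of ks] ks gword_even_counts[of ws] subspace_0[OF sub] ws(1) by auto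
    then show ?case
      using step(2) sub
      by (simp add: linear_add[OF linear_avg] linear_scale[OF linear_avg] subspace_add subspace_scale del: image_iff)
  qed
  then show ?thesis using avg_commuting[OF assms(2)] by simp
qed

definition spm :: "real^'n^'n \<Rightarrow> complex^'s^'s" where
  "spm A = (\<Sum>k\<in>UNIV. \<Sum>l\<in>UNIV. (A $ l $ k / 4) *\<^sub>R (\<gamma> k ** \<gamma> l))"

lemma spm_matvec: "spm A *v x = spv A x"
  by (simp add: spm_def spv_def matvec_simps matrix_vector_mul_assoc)

lemma spm_even_cliff: "spm A \<in> even_cliff"
proof -
  have "\<gamma> k ** \<gamma> l \<in> even_cliff" for k l
    unfolding even_cliff_def by (intro span_base CollectI exI[of _ "[k, l]"]) simp
  then show ?thesis
    unfolding spm_def by (intro subspace_sum subspace_scale subspace_even_cliff)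
qed

lemma spm_adjm:
  assumes "transpose A = - A"
  shows "adjm (spm A) = - spm A"
proof -
  have "adjm (spm A) = (\<Sum>k\<in>UNIV. \<Sum>l\<in>UNIV. (A $ l $ k / 4) *\<^sub>R (\<gamma> l ** \<gamma> k))"
    by (simp add: spm_def adjm_sum adjm_scaleR adjm_matmul gamma_adjm matmul_linear_simps)
  also have "\<dots> = (\<Sum>l\<in>UNIV. \<Sum>k\<in>UNIV. (A $ l $ k / 4) *\<^sub>R (\<gamma> l ** \<gamma> k))"
    by (rule sum.swap)
  also have "\<dots> = (\<Sum>l\<in>UNIV. \<Sum>k\<in>UNIV. - ((A $ k $ l / 4) *\<^sub>R (\<gamma> l ** \<gamma> k)))"
    by (intro sum.cong refl, subst skewD[OF assms]) simp
  finally show ?thesis by (simp add: spm_def sum_negf)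
qed

lemma spm_cliff:
  assumes "transpose A = - A"
  shows "spm A ** cliff \<gamma> v - cliff \<gamma> v ** spm A = cliff \<gamma> (A *v v)"
proof -
  have *: "spm A ** \<gamma> k - \<gamma> k ** spm A = cliff \<gamma> (A *v axis k 1)" for k
    unfolding matrix_vector_mult_basis
    by (rule matrix_eqI) (simp add: matrix_vector_mult_diff_rdistrib spm_matvec spv_gamma[OF assms] cliff_def
        column_def matvec_simps flip: matrix_vector_mul_assoc)
  have "cliff \<gamma> (A *v v) = (\<Sum>k\<in>UNIV. (v $ k) *\<^sub>R cliff \<gamma> (A *v axis k 1))"
    by (subst euclid_expand[of v]) (simp add: cliff_linear_simps matvec_simps)
  also have "\<dots> = spm A ** cliff \<gamma> v - cliff \<gamma> v ** spm A"
    unfolding *[symmetric] by (simp add: cliff_def matmul_linear_simps scaleR_diff_right sum_subtractf)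
  finally show ?thesis ..
qed

lemma cov_has_derivative:
  assumes "(h has_derivative h') (at x)"
  shows "((\<lambda>y. cov (h y)) has_derivative
    (\<lambda>X. \<chi> l k. uncliff (h x ** \<gamma> k ** adjm (h' X) + h' X ** \<gamma> k ** adjm (h x)) $ l)) (at x)"
proof -
  have 1: "((\<lambda>y. h y ** \<gamma> k) has_derivative (\<lambda>X. h' X ** \<gamma> k)) (at x)" for k
    by (rule bounded_linear.has_derivative[OF bounded_bilinear.bounded_linear_left[OF bounded_bilinear_matmul] assms])
  have 2: "((\<lambda>y. adjm (h y)) has_derivative (\<lambda>X. adjm (h' X))) (at x)"
    by (rule bounded_linear.has_derivative[OF bounded_linear_adjm assms])
  have bl: "bounded_linear uncliff" using uncliff(1) by (simp add: linear_conv_bounded_linear)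
  have 3: "((\<lambda>y. uncliff (h y ** \<gamma> k ** adjm (h y)) $ l) has_derivative
      (\<lambda>X. uncliff (h x ** \<gamma> k ** adjm (h' X) + h' X ** \<gamma> k ** adjm (h x)) $ l)) (at x)" for k l
    by (intro bounded_linear.has_derivative[OF bounded_linear_vec_nth] bounded_linear.has_derivative[OF bl]
        bounded_bilinear.FDERIV[OF bounded_bilinear_matmul 1 2])
  show ?thesis
    unfolding cov_def by (intro has_derivative_vec_lambdaI 3)
qed

text \<open>The logarithmic derivative of a curve in the spin group is the spin lift of the logarithmic
  derivative of its image in the rotation group.\<close>

lemma Spin_log_derivative:
  assumes h: "(h has_derivative h') (at x)" and S: "open S" "x \<in> S" "\<And>y. y \<in> S \<Longrightarrow> h y \<in> Spin \<gamma>"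
  defines "B X \<equiv> fder (\<lambda>y. cov (h y)) x X ** transpose (cov (h x))"
  shows "transpose (B X) = - B X" and "h' X = spm (B X) ** h x"
proof -
  define A where "A y = cov (h y)" for y
  define A' where "A' = fder A x"
  have dA: "(A has_derivative A') (at x)"
    unfolding A'_def
  proof (rule has_fder)
    show "A differentiable (at x)"
      using cov_has_derivative[OF h] unfolding A_def differentiable_def by blast
  qed
  have BX: "B X = A' X ** transpose (A x)" by (simp add: B_def A'_def A_def[abs_def])
  have hx: "h x \<in> Spin \<gamma>" by (rule S(3)[OF S(2)])
  show skew: "transpose (B X) = - B X"
  proof -
    have "((\<lambda>y. A y ** transpose (A y)) has_derivative
        (\<lambda>X. A x ** transpose (A' X) + A' X ** transpose (A x))) (at x)"
      by (intro bounded_bilinear.FDERIV[OF bounded_bilinear_matmul_real] dA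
          bounded_linear.has_derivative[OF bounded_linear_transpose])
    moreover have "((\<lambda>y. A y ** transpose (A y)) has_derivative (\<lambda>X. 0)) (at x)"
      by (rule has_derivative_transform_within_open[OF has_derivative_const[of "mat 1"] S(1,2)])
        (simp add: A_def cov_orthogonal S(3))
    ultimately have "(\<lambda>X. A x ** transpose (A' X) + A' X ** transpose (A x)) = (\<lambda>X. 0)"
      by (rule has_derivative_unique)
    then have "A x ** transpose (A' X) + A' X ** transpose (A x) = 0" by (rule fun_cong)
    then show ?thesis
      by (simp add: BX matrix_transpose_mul eq_neg_iff_add_eq_0)
  qed
  define s where "s = h' X ** adjm (h x)"
  \<comment> \<open>Differentiate
    \<open>h y ** cliff \<gamma> v = cliff \<gamma> (A y *v v) ** h y\<close> at \<open>x\<close>,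
    with \<open>v\<close> chosen such that \<open>A x *v v = w\<close>.\<close>
  have s_comm: "s ** cliff \<gamma> w - cliff \<gamma> w ** s = cliff \<gamma> (B X *v w)" for w
  proof -
    define v where "v = transpose (A x) *v w"
    have Av: "A x *v v = w"
      unfolding v_def A_def matrix_vector_mul_assoc cov_orthogonal[OF hx] by simp
    have bl: "bounded_linear (cliff \<gamma>)" using linear_cliff by (simp add: linear_conv_bounded_linear)
    have blv: "bounded_linear (\<lambda>M. M *v v)" for v :: "real^'n"
      unfolding linear_conv_bounded_linear[symmetric] linear_iff
      by (simp add: matrix_vector_mult_add_rdistrib scaleR_matvec)
    have "((\<lambda>y. cliff \<gamma> (A y *v v) ** h y) has_derivative
        (\<lambda>X. cliff \<gamma> (A x *v v) ** h' X + cliff \<gamma> (A' X *v v) ** h x)) (at x)"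
      by (intro bounded_bilinear.FDERIV[OF bounded_bilinear_matmul] h bounded_linear.has_derivative[OF bl]
          bounded_linear.has_derivative[OF blv] dA)
    moreover have "((\<lambda>y. cliff \<gamma> (A y *v v) ** h y) has_derivative (\<lambda>X. h' X ** cliff \<gamma> v)) (at x)"
    proof (rule has_derivative_transform_within_open[OF _ S(1,2)])
      show "((\<lambda>y. h y ** cliff \<gamma> v) has_derivative (\<lambda>X. h' X ** cliff \<gamma> v)) (at x)"
        by (rule bounded_linear.has_derivative[OF bounded_bilinear.bounded_linear_left[OF bounded_bilinear_matmul] h])
    qed (simp add: A_def cov_exists S(3))
    ultimately have "(\<lambda>X. cliff \<gamma> (A x *v v) ** h' X + cliff \<gamma> (A' X *v v) ** h x) = (\<lambda>X. h' X ** cliff \<gamma> v)"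
      by (rule has_derivative_unique)
    then have eq: "cliff \<gamma> w ** h' X + cliff \<gamma> (A' X *v v) ** h x = h' X ** cliff \<gamma> v"
      unfolding Av by (rule fun_cong)
    have "cliff \<gamma> v ** adjm (h x) = adjm (h x) ** cliff \<gamma> w"
    proof -
      have "cliff \<gamma> v ** adjm (h x) = adjm (h x) ** (h x ** cliff \<gamma> v) ** adjm (h x)"
        by (simp add: matrix_mul_assoc Spin_unitary[OF hx])
      also have "h x ** cliff \<gamma> v = cliff \<gamma> w ** h x"
        by (simp add: cov_exists[OF hx] Av[unfolded A_def])
      finally show ?thesis by (simp add: Spin_unitary[OF hx] flip: matrix_mul_assoc)
    qed
    then have "s ** cliff \<gamma> w = (h' X ** cliff \<gamma> v) ** adjm (h x)"
      by (simp add: s_def flip: matrix_mul_assoc)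
    also have "\<dots> = cliff \<gamma> w ** s + cliff \<gamma> (A' X *v v)"
      unfolding eq[symmetric] by (simp add: matmul_linear_simps s_def Spin_unitary[OF hx] flip: matrix_mul_assoc)
    finally show ?thesis unfolding BX v_def matrix_vector_mul_assoc by simp
  qed
  have s_adj: "adjm s = - s"
  proof -
    have "((\<lambda>y. h y ** adjm (h y)) has_derivative (\<lambda>X. h x ** adjm (h' X) + h' X ** adjm (h x))) (at x)"
      by (intro bounded_bilinear.FDERIV[OF bounded_bilinear_matmul] h bounded_linear.has_derivative[OF bounded_linear_adjm])
    moreover have "((\<lambda>y. h y ** adjm (h y)) has_derivative (\<lambda>X. 0)) (at x)"
      by (rule has_derivative_transform_within_open[OF has_derivative_const[of "mat 1"] S(1,2)])
        (simp add: Spin_unitary S(3))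
    ultimately have "(\<lambda>X. h x ** adjm (h' X) + h' X ** adjm (h x)) = (\<lambda>X. 0)"
      by (rule has_derivative_unique)
    then have "h x ** adjm (h' X) + h' X ** adjm (h x) = 0" by (rule fun_cong)
    moreover have "adjm (adjm (h x)) = h x" by (simp add: adjm_def vec_eq_iff)
    ultimately show ?thesis
      by (simp add: s_def adjm_matmul eq_neg_iff_add_eq_0)
  qed
  \<comment> \<open>\<open>s\<close> and its expected value have the same commutator with every
    vector, so \<open>d\<close> commutes with all generators and is a real scalar; being
    skew-adjoint, it is 0.\<close>
  define d where "d = s - spm (B X)"
  have "h' X \<in> even_cliff"
    by (rule has_derivative_in_subspace[OF h S(1,2) _ subspace_even_cliff]) (rule Spin_even_cliff[OF S(3)])
  then have "s \<in> even_cliff"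
    unfolding s_def by (rule even_cliff_mult) (intro Spin_even_cliff Spin_adjm hx)
  then have "d \<in> even_cliff"
    unfolding d_def by (intro subspace_diff subspace_even_cliff spm_even_cliff)
  moreover have "\<gamma> k ** d = d ** \<gamma> k" for k
    using s_comm[of "axis k 1"] spm_cliff[OF skew, of "axis k 1"]
    by (simp add: d_def cliff_axis matmul_linear_simps algebra_simps)
  ultimately obtain r where r: "d = r *\<^sub>R mat 1" using even_cliff_central by blast
  have "adjm d = - d"
    using s_adj spm_adjm[OF skew] by (simp add: d_def linear_diff[OF linear_adjm])
  then have "(2 * r) *\<^sub>R (mat 1 :: complex^'s^'s) = 0"
    unfolding r by (simp add: adjm_scaleR eq_neg_iff_add_eq_0 flip: scaleR_add_left)
  then have "d = 0" using mat1_nonzero r by simp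
  then have "s = spm (B X)" by (simp add: d_def)
  then have "spm (B X) ** h x = h' X ** (adjm (h x) ** h x)"
    by (simp add: s_def matrix_mul_assoc)
  then show "h' X = spm (B X) ** h x" by (simp add: Spin_unitary[OF hx])
qed

section \<open>The action of the spin group on spinor-valued tensors\<close>

text \<open>The tensor power of \<open>A\<close>, by recursion on the index list for the same reason
  as \<open>dten\<close>; \<open>tact_eq\<close> matches it with the product formula in
  \<open>Spin_act\<close>.\<close>

fun tact :: "real^'n^'n \<Rightarrow> ('n, 's) stensor \<Rightarrow> ('n, 's) stensor" where
  "tact A \<psi> [] = \<psi> []"
| "tact A \<psi> (i # is) = (\<Sum>k\<in>UNIV. (A $ i $ k) *\<^sub>R tact A (slice \<psi> k) is)"

lemma tact_eq:
  "(\<Sum>ks | length ks = length is. (\<Prod>i<length is. A $ (is ! i) $ (ks ! i)) *\<^sub>R \<psi> ks) = tact A \<psi> is"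
proof (induction "is" arbitrary: \<psi>)
  case Nil
  have "{ks :: 'n list. length ks = 0} = {[]}" by auto
  then show ?case by simp
next
  case (Cons a "is")
  have "(\<Sum>ks | length ks = length (a # is). (\<Prod>i<length (a # is). A $ ((a # is) ! i) $ (ks ! i)) *\<^sub>R \<psi> ks) =
     (\<Sum>k\<in>UNIV. (A $ a $ k) *\<^sub>R (\<Sum>ks | length ks = length is. (\<Prod>i<length is. A $ (is ! i) $ (ks ! i)) *\<^sub>R \<psi> (k # ks)))"
    unfolding list.size(4) Groups.add_0_right add_Suc_right sum_lists_Suc prod.lessThan_Suc_shift
    by (simp add: scaleR_sum_right)
  then show ?case unfolding Cons by simp
qed

lemma Spin_act_eq: "h \<in> Spin \<gamma> \<Longrightarrow> Spin_act \<gamma> h \<psi> is = h *v tact (cov h) \<psi> is"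
  by (simp add: Spin_act_def Spin_cover_eq tact_eq)

lemma Spin_act_fun: "h \<in> Spin \<gamma> \<Longrightarrow> Spin_act \<gamma> h \<psi> = (\<lambda>is. h *v tact (cov h) \<psi> is)"
  by (rule ext) (rule Spin_act_eq)

lemma tact_add: "tact A (\<lambda>is. \<psi> is + \<phi> is) is = tact A \<psi> is + tact A \<phi> is"
  by (induction "is" arbitrary: \<psi> \<phi>) (simp_all add: scaleR_add_right sum.distrib)

lemma tact_scaleR: "tact A (\<lambda>is. r *\<^sub>R \<psi> is) is = r *\<^sub>R tact A \<psi> is"
  by (induction "is" arbitrary: \<psi>) (simp_all add: scaleR_sum_right mult.commute)

lemma tact_zero [simp]: "tact A (\<lambda>is. 0) is = 0"
  by (induction "is") simp_all

lemma tact_sum: "tact A (\<lambda>is. \<Sum>i\<in>I. f i is) is = (\<Sum>i\<in>I. tact A (f i) is)"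
  by (induction I rule: infinite_finite_induct) (simp_all add: tact_add)

lemma tact_matvec: "tact A (\<lambda>is. B *v \<psi> is) is = B *v tact A \<psi> is"
  by (induction "is" arbitrary: \<psi>) (simp_all add: matvec_simps)

lemma tact_mult: "tact A (tact B \<psi>) is = tact (A ** B) \<psi> is"
proof (induction "is" arbitrary: \<psi>)
  case (Cons i "is")
  have "tact A (tact B \<psi>) (i # is) = (\<Sum>k\<in>UNIV. \<Sum>l\<in>UNIV. (A $ i $ k * B $ k $ l) *\<^sub>R tact (A ** B) (slice \<psi> l) is)"
    by (simp add: tact_sum tact_scaleR Cons scaleR_sum_right)
  also have "\<dots> = tact (A ** B) \<psi> (i # is)"
    by (subst sum.swap) (simp add: matrix_matrix_mult_def scaleR_sum_left)
  finally show ?case .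
qed simp

lemma sum_mat1_scaleR: "(\<Sum>k\<in>UNIV. (mat 1 $ i $ k) *\<^sub>R f k) = f i" for f :: "'n \<Rightarrow> 'b::real_vector"
  by (simp add: mat_def if_distrib[of "\<lambda>a. a *\<^sub>R _"] cong: if_cong)

lemma tact_one: "tact (mat 1) \<psi> is = \<psi> is"
  by (induction "is" arbitrary: \<psi>) (simp_all add: sum_mat1_scaleR)

lemma Spin_act_mult:
  "h \<in> Spin \<gamma> \<Longrightarrow> k \<in> Spin \<gamma> \<Longrightarrow> Spin_act \<gamma> h (Spin_act \<gamma> k \<psi>) is = Spin_act \<gamma> (h ** k) \<psi> is"
  by (simp add: Spin_act_fun Spin_mult tact_matvec tact_mult cov_mult matrix_vector_mul_assoc)

lemma Spin_act_one: "Spin_act \<gamma> (mat 1) \<psi> is = \<psi> is"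
  by (simp add: Spin_act_eq Spin_one cov_one tact_one)

lemma Spin_act_inverse:
  "h \<in> Spin \<gamma> \<Longrightarrow> Spin_act \<gamma> (adjm h) (Spin_act \<gamma> h \<psi>) is = \<psi> is"
  by (simp add: Spin_act_mult Spin_adjm Spin_unitary Spin_act_one)

lemma Spin_act_Cons:
  "h \<in> Spin \<gamma> \<Longrightarrow> Spin_act \<gamma> h \<psi> (i # is) = (\<Sum>k\<in>UNIV. (cov h $ i $ k) *\<^sub>R Spin_act \<gamma> h (slice \<psi> k) is)"
  by (simp add: Spin_act_eq matvec_simps)

lemma Spin_act_lincomb:
  "h \<in> Spin \<gamma> \<Longrightarrow> Spin_act \<gamma> h (\<lambda>is. \<Sum>k\<in>I. a k *\<^sub>R f k is) is = (\<Sum>k\<in>I. a k *\<^sub>R Spin_act \<gamma> h (f k) is)"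
  by (simp add: Spin_act_eq tact_sum tact_scaleR matvec_simps)

lemma Spin_act_add:
  "h \<in> Spin \<gamma> \<Longrightarrow> Spin_act \<gamma> h (\<lambda>is. \<psi> is + \<phi> is) is = Spin_act \<gamma> h \<psi> is + Spin_act \<gamma> h \<phi> is"
  by (simp add: Spin_act_eq tact_add matvec_simps)

lemma Spin_act_scaleR:
  "h \<in> Spin \<gamma> \<Longrightarrow> Spin_act \<gamma> h (\<lambda>is. r *\<^sub>R \<psi> is) is = r *\<^sub>R Spin_act \<gamma> h \<psi> is"
  by (simp add: Spin_act_eq tact_scaleR matvec_simps)

lemma sum_orthogonal:
  fixes f :: "'n \<Rightarrow> 'b::real_vector"
  assumes "h \<in> Spin \<gamma>"
  shows "(\<Sum>k\<in>UNIV. \<Sum>l\<in>UNIV. (cov h $ i $ k * cov h $ l $ k) *\<^sub>R f l) = f i"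
proof -
  have "(\<Sum>k\<in>UNIV. \<Sum>l\<in>UNIV. (cov h $ i $ k * cov h $ l $ k) *\<^sub>R f l)
      = (\<Sum>l\<in>UNIV. ((cov h ** transpose (cov h)) $ i $ l) *\<^sub>R f l)"
    by (subst sum.swap) (simp add: matrix_matrix_mult_def transpose_def scaleR_sum_left)
  then show ?thesis by (simp add: cov_orthogonal[OF assms] sum_mat1_scaleR)
qed

lemma Spin_act_gamma:
  assumes "h \<in> Spin \<gamma>"
  shows "Spin_act \<gamma> h (\<lambda>is. \<gamma> k *v \<psi> is) is = (\<Sum>l\<in>UNIV. (cov h $ l $ k) *\<^sub>R (\<gamma> l *v Spin_act \<gamma> h \<psi> is))"
  by (simp add: Spin_act_eq assms tact_matvec Spin_gamma)

lemma Spin_act_cc: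
  assumes "h \<in> Spin \<gamma>"
  shows "Spin_act \<gamma> h (cc \<psi>) is = cc (Spin_act \<gamma> h \<psi>) is"
proof -
  have "Spin_act \<gamma> h (cc \<psi>) is = (\<Sum>k\<in>UNIV. Spin_act \<gamma> h (\<lambda>is. \<gamma> k *v \<psi> (k # is)) is)"
    using Spin_act_lincomb[OF assms, where I = UNIV and a = "\<lambda>_. 1"] by (simp add: cc_eq[abs_def])
  also have "\<dots> = (\<Sum>l\<in>UNIV. \<gamma> l *v Spin_act \<gamma> h \<psi> (l # is))"
    by (simp add: Spin_act_gamma[OF assms] Spin_act_Cons[OF assms] matvec_simps) (rule sum.swap)
  finally show ?thesis by (simp add: cc_eq)
qed

lemma Spin_act_emb:
  assumes "h \<in> Spin \<gamma>"
  shows "Spin_act \<gamma> h (emb \<phi>) is = emb (Spin_act \<gamma> h \<phi>) is"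
proof (induction "is" arbitrary: \<phi>)
  case Nil
  show ?case by (simp add: Spin_act_eq[OF assms])
next
  case (Cons i "is")
  have "Spin_act \<gamma> h (emb \<phi>) (i # is) =
     (\<Sum>k\<in>UNIV. (cov h $ i $ k) *\<^sub>R Spin_act \<gamma> h (\<lambda>is. \<gamma> k *v \<phi> is) is)
     + (\<Sum>k\<in>UNIV. (cov h $ i $ k) *\<^sub>R Spin_act \<gamma> h (emb (slice \<phi> k)) is)"
    by (simp add: Spin_act_Cons[OF assms] Spin_act_add[OF assms] scaleR_add_right sum.distrib)
  also have "(\<Sum>k\<in>UNIV. (cov h $ i $ k) *\<^sub>R Spin_act \<gamma> h (\<lambda>is. \<gamma> k *v \<phi> is) is) = \<gamma> i *v Spin_act \<gamma> h \<phi> is"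
    by (simp add: Spin_act_gamma[OF assms] scaleR_sum_right sum_orthogonal[OF assms])
  also have "(\<Sum>k\<in>UNIV. (cov h $ i $ k) *\<^sub>R Spin_act \<gamma> h (emb (slice \<phi> k)) is) = emb (slice (Spin_act \<gamma> h \<phi>) i) is"
    by (simp add: Cons Spin_act_Cons[OF assms] emb_sum emb_scaleR)
  finally show ?case by simp
qed

lemma Spin_spv:
  assumes "h \<in> Spin \<gamma>"
  shows "h *v spv N x = spv (cov h ** N ** transpose (cov h)) (h *v x)"
proof -
  let ?A = "cov h"
  have "h *v spv N x = (\<Sum>k\<in>UNIV. \<Sum>l\<in>UNIV. \<Sum>a\<in>UNIV. \<Sum>b\<in>UNIV.
      (N $ l $ k / 4 * ?A $ a $ k * ?A $ b $ l) *\<^sub>R (\<gamma> a *v (\<gamma> b *v (h *v x))))"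
    by (simp add: spv_def matvec_simps Spin_gamma[OF assms] scaleR_sum_right mult.assoc)
  also have "\<dots> = (\<Sum>a\<in>UNIV. \<Sum>b\<in>UNIV. \<Sum>k\<in>UNIV. \<Sum>l\<in>UNIV.
      (N $ l $ k / 4 * ?A $ a $ k * ?A $ b $ l) *\<^sub>R (\<gamma> a *v (\<gamma> b *v (h *v x))))"
    (is "(\<Sum>k\<in>_. \<Sum>l\<in>_. \<Sum>a\<in>_. \<Sum>b\<in>_. ?f k l a b) = _")
  proof -
    have "(\<Sum>k\<in>UNIV. \<Sum>l\<in>UNIV. \<Sum>a\<in>UNIV. \<Sum>b\<in>UNIV. ?f k l a b) = (\<Sum>k\<in>UNIV. \<Sum>a\<in>UNIV. \<Sum>l\<in>UNIV. \<Sum>b\<in>UNIV. ?f k l a b)"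
      by (rule sum.cong[OF refl], rule sum.swap)
    also have "\<dots> = (\<Sum>a\<in>UNIV. \<Sum>k\<in>UNIV. \<Sum>l\<in>UNIV. \<Sum>b\<in>UNIV. ?f k l a b)"
      by (rule sum.swap)
    also have "\<dots> = (\<Sum>a\<in>UNIV. \<Sum>b\<in>UNIV. \<Sum>l\<in>UNIV. \<Sum>k\<in>UNIV. ?f k l a b)"
      by (rule sum.cong[OF refl], rule sum_rotate)
    also have "\<dots> = (\<Sum>a\<in>UNIV. \<Sum>b\<in>UNIV. \<Sum>k\<in>UNIV. \<Sum>l\<in>UNIV. ?f k l a b)"
      by (rule sum.cong[OF refl], rule sum.cong[OF refl], rule sum.swap)
    finally show ?thesis .
  qed
  also have "\<dots> = spv (?A ** N ** transpose ?A) (h *v x)"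
    unfolding spv_def
    by (intro sum.cong refl)
      (simp add: matrix_matrix_mult_def transpose_def sum_distrib_right sum_distrib_left sum_divide_distrib scaleR_sum_left mult_ac)
  finally show ?thesis .
qed

lemma tact_dten:
  assumes A: "transpose A ** A = mat 1"
  shows "tact A (dten N \<psi>) is = dten (A ** N ** transpose A) (tact A \<psi>) is"
proof (induction "is" arbitrary: \<psi>)
  case (Cons i "is")
  let ?B = "A ** N ** transpose A"
  have BA: "?B ** A = A ** N" by (simp add: A flip: matrix_mul_assoc)
  have swap: "(\<Sum>k\<in>UNIV. \<Sum>l\<in>UNIV. (C $ i $ k * D $ k $ l) *\<^sub>R f l) = (\<Sum>l\<in>UNIV. ((C ** D) $ i $ l) *\<^sub>R f l)"
    for C D :: "real^'n^'n" and f :: "'n \<Rightarrow> complex^'s"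
    by (subst sum.swap) (simp add: matrix_matrix_mult_def scaleR_sum_left)
  have "tact A (dten N \<psi>) (i # is) = (\<Sum>l\<in>UNIV. ((A ** N) $ i $ l) *\<^sub>R tact A (slice \<psi> l) is)
     + (\<Sum>k\<in>UNIV. (A $ i $ k) *\<^sub>R dten ?B (tact A (slice \<psi> k)) is)"
    by (simp add: tact_add tact_sum tact_scaleR scaleR_add_right sum.distrib scaleR_sum_right swap Cons)
  also have "\<dots> = dten ?B (tact A \<psi>) (i # is)"
    by (simp add: scaleR_sum_right swap BA dten_lincomb)
  finally show ?case .
qed simp

lemma Spin_act_so_act:
  assumes "h \<in> Spin \<gamma>"
  shows "Spin_act \<gamma> h (so_act \<gamma> N \<psi>) is = so_act \<gamma> (cov h ** N ** transpose (cov h)) (Spin_act \<gamma> h \<psi>) is"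
proof -
  have "Spin_act \<gamma> h (\<lambda>is. spv N (\<psi> is)) is = h *v spv N (tact (cov h) \<psi> is)"
    unfolding spm_matvec[symmetric] by (simp add: Spin_act_eq[OF assms] tact_matvec)
  then show ?thesis
    unfolding so_act_eq[abs_def] Spin_act_add[OF assms]
    by (simp add: Spin_spv[OF assms] Spin_act_fun[OF assms]
        tact_dten[OF cov_orthogonal(1)[OF assms]] dten_matvec)
qed

text \<open>Orthogonality gives A' = (A' A^T) A, so differentiating one tensor factor of
  \<open>A\<close> amounts to applying the derivation of A' A^T in that slot after all of
  \<open>tact\<close>.\<close>

lemma tact_has_derivative:
  assumes A: "(A has_derivative A') (at x)" and F: "\<And>is. ((\<lambda>y. F y is) has_derivative F' is) (at x)"
    and o: "transpose (A x) ** A x = mat 1"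
  shows "((\<lambda>y. tact (A y) (F y) is) has_derivative
    (\<lambda>X. tact (A x) (\<lambda>is. F' is X) is + dten (A' X ** transpose (A x)) (tact (A x) (F x)) is)) (at x)"
  using F
proof (induction "is" arbitrary: F F')
  case (Cons i "is")
  have 1: "((\<lambda>y. A y $ i $ k) has_derivative (\<lambda>X. A' X $ i $ k)) (at x)" for k
    by (intro bounded_linear.has_derivative[OF bounded_linear_vec_nth] A)
  have 2: "((\<lambda>y. tact (A y) (slice (F y) k) is) has_derivative
    (\<lambda>X. tact (A x) (\<lambda>is. F' (k # is) X) is + dten (A' X ** transpose (A x)) (tact (A x) (slice (F x) k)) is)) (at x)" for k
    by (rule Cons.IH[of "\<lambda>y. slice (F y) k" "\<lambda>is. F' (k # is)"]) (rule Cons.prems)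
  have "((\<lambda>y. tact (A y) (F y) (i # is)) has_derivative
      (\<lambda>X. \<Sum>k\<in>UNIV. (A x $ i $ k) *\<^sub>R (tact (A x) (\<lambda>is. F' (k # is) X) is
          + dten (A' X ** transpose (A x)) (tact (A x) (slice (F x) k)) is)
        + (A' X $ i $ k) *\<^sub>R tact (A x) (slice (F x) k) is)) (at x)"
    unfolding tact.simps
    by (intro has_derivative_sum bounded_bilinear.FDERIV[OF bounded_bilinear_scaleR] 1 2)
  moreover have "(\<Sum>k\<in>UNIV. (A x $ i $ k) *\<^sub>R (tact (A x) (\<lambda>is. F' (k # is) X) is
          + dten (A' X ** transpose (A x)) (tact (A x) (slice (F x) k)) is)
        + (A' X $ i $ k) *\<^sub>R tact (A x) (slice (F x) k) is)
    = tact (A x) (\<lambda>is. F' is X) (i # is) + dten (A' X ** transpose (A x)) (tact (A x) (F x)) (i # is)" for X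
  proof -
    let ?B = "A' X ** transpose (A x)"
    have BA: "?B ** A x = A' X" by (simp add: o flip: matrix_mul_assoc)
    have "(\<Sum>k\<in>UNIV. \<Sum>l\<in>UNIV. (?B $ i $ k * A x $ k $ l) *\<^sub>R f l) = (\<Sum>l\<in>UNIV. ((?B ** A x) $ i $ l) *\<^sub>R f l)"
      for f :: "'n \<Rightarrow> complex^'s"
      by (subst sum.swap) (simp add: matrix_matrix_mult_def scaleR_sum_left)
    then show ?thesis
      unfolding BA by (simp add: scaleR_add_right sum.distrib scaleR_sum_right dten_lincomb)
  qed
  ultimately show ?case by simp
qed (simp add: assms)

text \<open>By \<open>Spin_log_derivative\<close> the spinor factor and the tensor factors are
  differentiated with the same matrix \<open>B X\<close>, so their contributions form one
  \<open>so_act\<close>. This inhomogeneous term is what the connection absorbs in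
  \<open>lnabla_gauge\<close>.\<close>

lemma Spin_act_has_derivative:
  assumes h: "(h has_derivative h') (at x)" and S: "open S" "x \<in> S" "\<And>y. y \<in> S \<Longrightarrow> h y \<in> Spin \<gamma>"
    and F: "\<And>is. ((\<lambda>y. F y is) has_derivative F' is) (at x)"
  defines "B X \<equiv> fder (\<lambda>y. cov (h y)) x X ** transpose (cov (h x))"
  shows "((\<lambda>y. Spin_act \<gamma> (h y) (F y) is) has_derivative
     (\<lambda>X. Spin_act \<gamma> (h x) (\<lambda>is. F' is X) is + so_act \<gamma> (B X) (Spin_act \<gamma> (h x) (F x)) is)) (at x)"
proof (rule has_derivative_transform_within_open[OF _ S(1,2)])
  have hx: "h x \<in> Spin \<gamma>" by (rule S(3)[OF S(2)])
  have dA: "((\<lambda>y. cov (h y)) has_derivative fder (\<lambda>y. cov (h y)) x) (at x)"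
    by (rule has_fder) (use cov_has_derivative[OF h] in \<open>auto simp: differentiable_def\<close>)
  have hX: "h' X = spm (B X) ** h x" for X
    unfolding B_def by (rule Spin_log_derivative(2)[OF h S])
  have eq: "h' X *v y = spv (B X) (h x *v y)" for X y
    unfolding hX spm_matvec[symmetric] matrix_vector_mul_assoc ..
  have d: "dten C (\<lambda>is. h x *v \<psi> is) is = h x *v dten C \<psi> is" for C \<psi> "is" by (rule dten_matvec)
  have "((\<lambda>y. h y *v tact (cov (h y)) (F y) is) has_derivative
     (\<lambda>X. h x *v (tact (cov (h x)) (\<lambda>is. F' is X) is + dten (B X) (tact (cov (h x)) (F x)) is)
       + h' X *v tact (cov (h x)) (F x) is)) (at x)"
    unfolding B_def
    by (intro bounded_bilinear.FDERIV[OF bounded_bilinear_matvec] h tact_has_derivative dA F cov_orthogonal(1)[OF hx])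
  then show "((\<lambda>y. h y *v tact (cov (h y)) (F y) is) has_derivative
     (\<lambda>X. Spin_act \<gamma> (h x) (\<lambda>is. F' is X) is + so_act \<gamma> (B X) (Spin_act \<gamma> (h x) (F x)) is)) (at x)"
    by (simp add: eq so_act_eq Spin_act_fun[OF hx] d matvec_simps add_ac)
qed (simp add: Spin_act_eq S(3))

end

section \<open>Constant sectional curvature\<close>

text \<open>The usual polarisation: pair symmetry follows from four Bianchi identities; polarising
  \<open>sec\<close> in \<open>x\<close> and then in \<open>y\<close> makes \<open>T\<close> skew in
  the two middle arguments; then the three terms of a Bianchi identity are equal.\<close>

lemma curvature_like_zero:
  fixes T :: "'a::real_vector \<Rightarrow> 'a \<Rightarrow> 'a \<Rightarrow> 'a \<Rightarrow> real"
  assumes add: "\<And>x x' y z w. T (x + x') y z w = T x y z w + T x' y z w"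
      "\<And>x y y' z w. T x (y + y') z w = T x y z w + T x y' z w"
      "\<And>x y z z' w. T x y (z + z') w = T x y z w + T x y z' w"
      "\<And>x y z w w'. T x y z (w + w') = T x y z w + T x y z w'"
    and a1: "\<And>x y z w. T x y z w = - T y x z w"
    and a2: "\<And>x y z w. T x y z w = - T x y w z"
    and bianchi: "\<And>x y z w. T x y z w + T y z x w + T z x y w = 0"
    and sec: "\<And>x y. T x y y x = 0"
  shows "T x y z w = 0"
proof -
  have pair: "T x y z w = T z w x y" for x y z w
    using bianchi[of x y z w] bianchi[of y z w x] bianchi[of z w x y] bianchi[of w x y z]
      a2[of y z w x] a2[of z w y x] a1[of w y z x] a1[of w x z y] a2[of x w z y] a1[of x z w y]
      a2[of z x w y] a1[of w x y z] a2[of x y w z] a2[of y w x z] by linarith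
  have 1: "T x y y w = 0" for x y w
    using sec[of "x + w" y] sec[of x y] sec[of w y] pair[of w y y x] a1[of y x w y] a2[of x y w y]
    by (simp add: add)
  have 2: "T x y z w = - T x z y w" for x y z w
    using 1[of x "y + z" w] 1[of x y w] 1[of x z w] by (simp add: add)
  then show ?thesis
    using bianchi[of x y z w] a1[of y z x w] a1[of z x y w] 2[of y z x w] 2[of x y z w] a1[of x y z w]
      a1[of y x z w] by linarith
qed

context spinor
begin

lemma bounded_bilinear_spv: "bounded_bilinear spv"
  unfolding bilinear_conv_bounded_bilinear[symmetric] bilinear_def
proof (intro conjI allI linear_spv)
  fix x show "linear (\<lambda>A. spv A x)"
    by (simp add: linear_iff spv_def scaleR_add_left add_divide_distrib sum.distrib scaleR_sum_right)
qed

lemma so_act_has_derivative: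
  assumes A: "(A has_derivative A') (at x)" and F: "\<And>is. ((\<lambda>y. F y is) has_derivative F' is) (at x)"
  shows "((\<lambda>y. so_act \<gamma> (A y) (F y) is) has_derivative
    (\<lambda>X. so_act \<gamma> (A x) (\<lambda>is. F' is X) is + so_act \<gamma> (A' X) (F x) is)) (at x)"
proof -
  have d: "((\<lambda>y. dten (A y) (F y) is) has_derivative
    (\<lambda>X. dten (A x) (\<lambda>is. F' is X) is + dten (A' X) (F x) is)) (at x)"
    using F
  proof (induction "is" arbitrary: F F')
    case (Cons i "is")
    have 1: "((\<lambda>y. A y $ i $ k) has_derivative (\<lambda>X. A' X $ i $ k)) (at x)" for k
      by (intro bounded_linear.has_derivative[OF bounded_linear_vec_nth] A)
    have 2: "((\<lambda>y. dten (A y) (slice (F y) i) is) has_derivative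
        (\<lambda>X. dten (A x) (\<lambda>is. F' (i # is) X) is + dten (A' X) (slice (F x) i) is)) (at x)"
      by (rule Cons.IH[of "\<lambda>y. slice (F y) i" "\<lambda>is. F' (i # is)"]) (rule Cons.prems)
    have "((\<lambda>y. dten (A y) (F y) (i # is)) has_derivative
       (\<lambda>X. (\<Sum>b\<in>UNIV. (A x $ i $ b) *\<^sub>R F' (b # is) X + (A' X $ i $ b) *\<^sub>R F x (b # is))
         + (dten (A x) (\<lambda>is. F' (i # is) X) is + dten (A' X) (slice (F x) i) is))) (at x)"
      unfolding dten.simps
      by (intro has_derivative_add has_derivative_sum bounded_bilinear.FDERIV[OF bounded_bilinear_scaleR] 1 2 Cons.prems)
    then show ?case by (simp add: sum.distrib add_ac)
  qed simp
  have "((\<lambda>y. so_act \<gamma> (A y) (F y) is) has_derivative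
     (\<lambda>X. (spv (A x) (F' is X) + spv (A' X) (F x is)) + (dten (A x) (\<lambda>is. F' is X) is + dten (A' X) (F x) is))) (at x)"
    unfolding so_act_eq by (intro has_derivative_add bounded_bilinear.FDERIV[OF bounded_bilinear_spv] A F d)
  then show ?thesis by (simp add: so_act_eq add_ac)
qed

lemma fder_so_act:
  assumes "A differentiable (at x)" "\<And>is. (\<lambda>y. F y is) differentiable (at x)"
  shows "fder (\<lambda>y. so_act \<gamma> (A y) (F y) is) x X =
    so_act \<gamma> (A x) (\<lambda>is. fder (\<lambda>y. F y is) x X) is + so_act \<gamma> (fder A x X) (F x) is"
  using fder_eq[OF so_act_has_derivative[OF has_fder[OF assms(1)] has_fder[OF assms(2)]]] by simp

lemma smooth_on_so_act:
  assumes "open S" "smooth_on S A" "\<And>is. smooth_on S (\<lambda>y. F y is)"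
  shows "smooth_on S (\<lambda>y. so_act \<gamma> (A y) (F y) is)"
proof -
  have "smooth_on S (\<lambda>y. dten (A y) (F y) is)"
    using assms(3)
  proof (induction "is" arbitrary: F)
    case (Cons i "is")
    have "smooth_on S (\<lambda>y. dten (A y) (slice (F y) i) is)"
      by (rule Cons.IH[of "\<lambda>y. slice (F y) i"]) (rule Cons.prems)
    then show ?case
      unfolding dten.simps
      by (intro smooth_on_add smooth_on_sum smooth_on_scaleR smooth_on_component assms(1,2) Cons.prems)
  qed (simp add: smooth_on_const)
  then show ?thesis
    unfolding so_act_eq
    by (intro smooth_on_add smooth_on_bilinear[OF _ bounded_bilinear_spv] assms)
qed

end

section \<open>Levi-Civita connection in coordinates and orthonormal frames\<close>

text \<open>The picture of the manifold and of a section of the spin bundle in one chart: a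
  coordinate domain, the metric and an orthonormal frame. Nondegeneracy of \<open>g\<close> comes
  from the frame, see \<open>frame_expand\<close>.\<close>

locale local_frame = spinor \<gamma> for \<gamma> :: "('n::finite, 's::finite) gammas" +
  fixes \<Omega> :: "(real^'n) set" and g :: "real^'n \<Rightarrow> real^'n \<Rightarrow> real^'n \<Rightarrow> real"
    and e :: "'n \<Rightarrow> real^'n \<Rightarrow> real^'n"
  assumes open_domain: "open \<Omega>"
    and g_sym: "p \<in> \<Omega> \<Longrightarrow> g p v w = g p w v"
    and g_linear: "p \<in> \<Omega> \<Longrightarrow> linear (g p v)"
    and g_smooth: "smooth_on \<Omega> (\<lambda>p. g p v w)"
    and e_smooth: "smooth_on \<Omega> (e a)"
    and e_orthonormal: "p \<in> \<Omega> \<Longrightarrow> g p (e a p) (e b p) = (if a = b then 1 else 0)"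
begin

lemma g_linear_left: "p \<in> \<Omega> \<Longrightarrow> linear (\<lambda>v. g p v w)"
  using g_linear[of p w] g_sym[of p _ w] by (simp add: linear_iff)

lemmas g_simps = linear_add[OF g_linear] linear_scale[OF g_linear] linear_diff[OF g_linear]
  linear_sum[OF g_linear] linear_0[OF g_linear] linear_neg[OF g_linear]
  linear_add[OF g_linear_left] linear_scale[OF g_linear_left] linear_diff[OF g_linear_left]
  linear_sum[OF g_linear_left] linear_0[OF g_linear_left] linear_neg[OF g_linear_left]

text \<open>There are as many orthonormal vectors as dimensions: forming linear combinations is
  injective, since the coefficients are inner products, and hence onto.\<close>

lemma frame_expand:
  assumes "p \<in> \<Omega>"
  shows "v = (\<Sum>a\<in>UNIV. g p v (e a p) *\<^sub>R e a p)"
proof -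
  define S where "S x = (\<Sum>a\<in>UNIV. (x $ a) *\<^sub>R e a p)" for x :: "real^'n"
  have lin: "linear S" by (simp add: linear_iff S_def scaleR_add_left sum.distrib scaleR_sum_right)
  have coeff: "g p (S x) (e b p) = x $ b" for x b
    using assms by (simp add: S_def g_simps e_orthonormal if_distrib cong: if_cong)
  have "inj S"
    by (rule injI) (metis coeff vec_eq_iff)
  then have "surj S" using lin linear_injective_imp_surjective by blast
  then obtain x where x: "v = S x" by (metis surjD)
  show ?thesis unfolding x coeff by (simp add: S_def)
qed

lemma g_eqI: "p \<in> \<Omega> \<Longrightarrow> (\<And>a. g p v (e a p) = g p w (e a p)) \<Longrightarrow> v = w"
  using frame_expand[of p v] frame_expand[of p w] by simp

lemma g_differentiable: "p \<in> \<Omega> \<Longrightarrow> (\<lambda>q. g q v w) differentiable (at p)"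
  using smooth_on_differentiable[OF g_smooth] .

lemma e_differentiable: "p \<in> \<Omega> \<Longrightarrow> e a differentiable (at p)"
  using smooth_on_differentiable[OF e_smooth] .

definition koszul :: "real^'n \<Rightarrow> real^'n \<Rightarrow> real^'n \<Rightarrow> real^'n \<Rightarrow> real" where
  "koszul p v w z = fder (\<lambda>q. g q w z) p v + fder (\<lambda>q. g q v z) p w - fder (\<lambda>q. g q v w) p z"

lemma fder_g_linear:
  assumes "p \<in> \<Omega>"
  shows "linear (\<lambda>w. fder (\<lambda>q. g q v w) p h)" "linear (\<lambda>w. fder (\<lambda>q. g q w v) p h)" "linear (fder (\<lambda>q. g q v w) p)"
proof -
  have 1: "fder (\<lambda>q. g q v (w + w')) p h = fder (\<lambda>q. g q v w + g q v w') p h" for w w'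
    by (subst fder_cong_open[OF open_domain assms, of _ "\<lambda>q. g q v w + g q v w'"]) (simp_all add: g_simps)
  have 2: "fder (\<lambda>q. g q v (r *\<^sub>R w)) p h = fder (\<lambda>q. r *\<^sub>R g q v w) p h" for r w
    by (subst fder_cong_open[OF open_domain assms, of _ "\<lambda>q. r *\<^sub>R g q v w"]) (simp_all add: g_simps)
  show *: "linear (\<lambda>w. fder (\<lambda>q. g q v w) p h)"
    unfolding linear_iff 1 2
    by (simp add: fder_add g_differentiable[OF assms] fder_linear_image[OF bounded_linear_mult_right])
  have "fder (\<lambda>q. g q w v) p h = fder (\<lambda>q. g q v w) p h" for w
    by (subst fder_cong_open[OF open_domain assms, of _ "\<lambda>q. g q v w"]) (simp_all add: g_sym)
  then show "linear (\<lambda>w. fder (\<lambda>q. g q w v) p h)" using * by simp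
  show "linear (fder (\<lambda>q. g q v w) p)"
    by (rule linear_fder[OF g_differentiable[OF assms]])
qed

lemma fder_g_sym: "p \<in> \<Omega> \<Longrightarrow> fder (\<lambda>q. g q w v) p h = fder (\<lambda>q. g q v w) p h"
  by (subst fder_cong_open[OF open_domain, of p _ "\<lambda>q. g q v w"]) (simp_all add: g_sym)

lemma koszul_linear:
  assumes "p \<in> \<Omega>"
  shows "linear (koszul p v w)" "linear (\<lambda>v. koszul p v w z)" "linear (\<lambda>w. koszul p v w z)"
  unfolding koszul_def
  by (intro linear_compose_sub linear_compose_add fder_g_linear[OF assms])+

lemma koszul_smooth: "smooth_on \<Omega> (\<lambda>p. koszul p v w z)"
  unfolding koszul_def by (intro smooth_on_add smooth_on_diff smooth_on_fder g_smooth open_domain)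

text \<open>Literally the description used in \<open>christoffel\<close>, so that the two agree once
  \<open>g\<close> is the metric of a chart.\<close>

definition \<Gamma> :: "real^'n \<Rightarrow> real^'n \<Rightarrow> real^'n \<Rightarrow> real^'n" where
  "\<Gamma> p v w = (THE y. \<forall>z. 2 * g p y z = koszul p v w z)"

text \<open>The frame turns the implicit description into an explicit sum, from which linearity and
  smoothness can be read off.\<close>

lemma \<Gamma>_eq:
  assumes "p \<in> \<Omega>"
  shows "\<Gamma> p v w = (\<Sum>a\<in>UNIV. (koszul p v w (e a p) / 2) *\<^sub>R e a p)" "2 * g p (\<Gamma> p v w) z = koszul p v w z"
proof -
  define y where "y = (\<Sum>a\<in>UNIV. (koszul p v w (e a p) / 2) *\<^sub>R e a p)"
  have y: "2 * g p y z = koszul p v w z" for z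
  proof -
    have "koszul p v w z = koszul p v w (\<Sum>a\<in>UNIV. g p z (e a p) *\<^sub>R e a p)"
      using frame_expand[OF assms] by simp
    also have "\<dots> = (\<Sum>a\<in>UNIV. g p z (e a p) * koszul p v w (e a p))"
      by (simp add: linear_sum[OF koszul_linear(1)[OF assms]] linear_scale[OF koszul_linear(1)[OF assms]])
    also have "\<dots> = 2 * g p y z"
      using assms by (simp add: y_def g_simps sum_distrib_left g_sym[OF assms, of z] mult.commute)
    finally show ?thesis ..
  qed
  have "\<Gamma> p v w = y"
    unfolding \<Gamma>_def
  proof (rule the_equality)
    fix y' assume "\<forall>z. 2 * g p y' z = koszul p v w z"
    then have "g p y' z = g p y z" for z using y by (smt (verit))
    then show "y' = y" by (intro g_eqI[OF assms])
  qed (simp add: y)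
  then show "\<Gamma> p v w = (\<Sum>a\<in>UNIV. (koszul p v w (e a p) / 2) *\<^sub>R e a p)" "2 * g p (\<Gamma> p v w) z = koszul p v w z"
    using y by (auto simp: y_def)
qed

lemma \<Gamma>_sym: "p \<in> \<Omega> \<Longrightarrow> \<Gamma> p v w = \<Gamma> p w v"
  by (simp add: \<Gamma>_eq(1) koszul_def fder_g_sym[of p w v] add.commute)

lemma \<Gamma>_linear: "p \<in> \<Omega> \<Longrightarrow> linear (\<Gamma> p v)" "p \<in> \<Omega> \<Longrightarrow> linear (\<lambda>v. \<Gamma> p v w)"
proof -
  show *: "linear (\<Gamma> p v)" if "p \<in> \<Omega>" for v
    using koszul_linear(3)[OF that]
    by (simp add: linear_iff \<Gamma>_eq(1)[OF that] add_divide_distrib scaleR_add_left sum.distrib scaleR_sum_right)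
  show "p \<in> \<Omega> \<Longrightarrow> linear (\<lambda>v. \<Gamma> p v w)"
    using *[of w] \<Gamma>_sym by (simp add: linear_iff)
qed

lemmas \<Gamma>_simps = linear_add[OF \<Gamma>_linear(1)] linear_scale[OF \<Gamma>_linear(1)] linear_sum[OF \<Gamma>_linear(1)]
  linear_diff[OF \<Gamma>_linear(1)] linear_add[OF \<Gamma>_linear(2)] linear_scale[OF \<Gamma>_linear(2)]
  linear_sum[OF \<Gamma>_linear(2)] linear_diff[OF \<Gamma>_linear(2)]

lemma \<Gamma>_smooth: "smooth_on \<Omega> (\<lambda>p. \<Gamma> p v w)"
proof -
  have "smooth_on \<Omega> (\<lambda>p. koszul p v w (e a p))" for a
    by (rule smooth_on_linear_family[OF open_domain koszul_linear(1) koszul_smooth e_smooth])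
  from smooth_on_linear_image[OF open_domain bounded_linear_divide this]
  have "smooth_on \<Omega> (\<lambda>p. \<Sum>a\<in>UNIV. (koszul p v w (e a p) / 2) *\<^sub>R e a p)"
    by (intro smooth_on_sum smooth_on_scaleR open_domain e_smooth)
  then show ?thesis
    by (rule smooth_on_cong[OF open_domain]) (simp add: \<Gamma>_eq)
qed

text \<open>Add the Koszul formulas with \<open>w\<close> and \<open>z\<close> exchanged; the other
  derivatives of the metric cancel.\<close>

lemma metric_compatible: "p \<in> \<Omega> \<Longrightarrow> fder (\<lambda>q. g q w z) p v = g p (\<Gamma> p v w) z + g p w (\<Gamma> p v z)"
  using \<Gamma>_eq(2)[of p v w z] \<Gamma>_eq(2)[of p v z w] g_sym[of p w "\<Gamma> p v z"] fder_g_sym[of p z w v]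
  by (simp add: koszul_def)

lemma g_along:
  assumes p: "p \<in> \<Omega>" and x: "x differentiable (at p)" and y: "y differentiable (at p)"
  shows "fder (\<lambda>q. g q (x q) (y q)) p v = g p (fder x p v + \<Gamma> p v (x p)) (y p) + g p (x p) (fder y p v + \<Gamma> p v (y p))"
    and "(\<lambda>q. g q (x q) (y q)) differentiable (at p)"
proof -
  have 1: "(\<lambda>q. g q w (y q)) differentiable (at p)" for w
    by (rule fder_linear_family(2)[OF open_domain p g_linear g_differentiable[OF p] y])
  show "(\<lambda>q. g q (x q) (y q)) differentiable (at p)"
    by (rule fder_linear_family(2)[OF open_domain p g_linear_left 1 x])
  have "fder (\<lambda>q. g q (x q) (y q)) p v = fder (\<lambda>q. g q (x p) (y q)) p v + g p (fder x p v) (y p)"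
    by (rule fder_linear_family(1)[OF open_domain p g_linear_left 1 x])
  also have "fder (\<lambda>q. g q (x p) (y q)) p v = fder (\<lambda>q. g q (x p) (y p)) p v + g p (x p) (fder y p v)"
    by (rule fder_linear_family(1)[OF open_domain p g_linear g_differentiable[OF p] y])
  finally show "fder (\<lambda>q. g q (x q) (y q)) p v = g p (fder x p v + \<Gamma> p v (x p)) (y p) + g p (x p) (fder y p v + \<Gamma> p v (y p))"
    by (simp add: metric_compatible[OF p] g_simps p)
qed

definition \<omega> :: "real^'n \<Rightarrow> real^'n \<Rightarrow> real^'n^'n" where
  "\<omega> p v = (\<chi> a b. g p (fder (e b) p v + \<Gamma> p v (e b p)) (e a p))"

lemma \<omega>_linear: "p \<in> \<Omega> \<Longrightarrow> linear (\<omega> p)"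
  by (simp add: linear_iff[of "\<omega> p"] \<omega>_def vec_eq_iff g_simps \<Gamma>_simps linear_add[OF linear_fder[OF e_differentiable]]
      linear_scale[OF linear_fder[OF e_differentiable]] algebra_simps)

lemma covariant_frame:
  assumes "p \<in> \<Omega>"
  shows "fder (e b) p v + \<Gamma> p v (e b p) = (\<Sum>a\<in>UNIV. (\<omega> p v $ a $ b) *\<^sub>R e a p)"
  by (subst frame_expand[OF assms]) (simp add: \<omega>_def)

lemma \<omega>_skew:
  assumes "p \<in> \<Omega>"
  shows "transpose (\<omega> p v) = - \<omega> p v"
proof -
  have "\<omega> p v $ b $ a + \<omega> p v $ a $ b = 0" for a b
  proof -
    have "0 = fder (\<lambda>q. if a = b then 1 else 0 :: real) p v" by simp
    also have "\<dots> = fder (\<lambda>q. g q (e a q) (e b q)) p v"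
      by (subst fder_cong_open[OF open_domain assms, of _ "\<lambda>q. g q (e a q) (e b q)"]) (auto simp: e_orthonormal)
    also have "\<dots> = g p (fder (e a) p v + \<Gamma> p v (e a p)) (e b p) + g p (e a p) (fder (e b) p v + \<Gamma> p v (e b p))"
      by (rule g_along(1)[OF assms e_differentiable[OF assms] e_differentiable[OF assms]])
    finally show ?thesis
      using g_sym[OF assms, of "e a p" "fder (e b) p v + \<Gamma> p v (e b p)"] by (simp add: \<omega>_def)
  qed
  then show ?thesis by (auto simp: vec_eq_iff transpose_def eq_neg_iff_add_eq_0)
qed

lemma \<omega>_smooth: "smooth_on \<Omega> (\<lambda>p. \<omega> p v)"
proof (intro smooth_on_vecI open_domain)
  fix a b
  have "smooth_on \<Omega> (\<lambda>p. \<Gamma> p v (e b p))"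
    by (rule smooth_on_linear_family[OF open_domain \<Gamma>_linear(1) \<Gamma>_smooth e_smooth])
  then have x: "smooth_on \<Omega> (\<lambda>p. fder (e b) p v + \<Gamma> p v (e b p))"
    by (intro smooth_on_add open_domain smooth_on_fder e_smooth)
  have "smooth_on \<Omega> (\<lambda>p. g p w (e a p))" for w
    by (rule smooth_on_linear_family[OF open_domain g_linear g_smooth e_smooth])
  then have "smooth_on \<Omega> (\<lambda>p. g p (fder (e b) p v + \<Gamma> p v (e b p)) (e a p))"
    by (intro smooth_on_linear_family[OF open_domain g_linear_left _ x])
  then show "smooth_on \<Omega> (\<lambda>p. \<omega> p v $ a $ b)" by (simp add: \<omega>_def)
qed

lemma \<omega>_frame_smooth: "smooth_on \<Omega> (\<lambda>p. \<omega> p (e k p))"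
  by (rule smooth_on_linear_family[OF open_domain \<omega>_linear \<omega>_smooth e_smooth])

text \<open>The Koszul formula in terms of the brackets of the frame, which does not depend on the
  coordinates.\<close>

definition bracket :: "'n \<Rightarrow> 'n \<Rightarrow> real^'n \<Rightarrow> real^'n" where
  "bracket k b p = fder (e b) p (e k p) - fder (e k) p (e b p)"

lemma \<omega>_bracket:
  assumes p: "p \<in> \<Omega>"
  shows "2 * \<omega> p (e k p) $ a $ b =
    g p (bracket k b p) (e a p) + g p (bracket a k p) (e b p) - g p (bracket b a p) (e k p)"
proof -
  define n where "n k b = fder (e b) p (e k p) + \<Gamma> p (e k p) (e b p)" for k b
  have br: "bracket k b p = n k b - n b k" for k b
    using \<Gamma>_sym[OF p, of "e k p" "e b p"] by (simp add: bracket_def n_def)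
  have sk: "g p (n k b) (e a p) = - g p (n k a) (e b p)" for k a b
    using skewD[OF \<omega>_skew[OF p], of "e k p" a b] by (simp add: \<omega>_def n_def)
  show ?thesis
    unfolding br using sk[of k b a] sk[of a k b] sk[of b k a]
    by (simp add: g_simps p \<omega>_def flip: n_def)
qed

definition Rm :: "real^'n \<Rightarrow> real^'n \<Rightarrow> real^'n \<Rightarrow> real^'n \<Rightarrow> real^'n" where
  "Rm p v w z = fder (\<lambda>q. \<Gamma> q w z) p v + \<Gamma> p v (\<Gamma> p w z) - (fder (\<lambda>q. \<Gamma> q v z) p w + \<Gamma> p w (\<Gamma> p v z))"

text \<open>The curvature form d \<omega> + \<omega> \<and> \<omega> on constant coordinate fields,
  whose bracket vanishes.\<close>

definition curv_form :: "real^'n \<Rightarrow> real^'n \<Rightarrow> real^'n \<Rightarrow> real^'n^'n" where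
  "curv_form p v w = fder (\<lambda>q. \<omega> q w) p v - fder (\<lambda>q. \<omega> q v) p w + (\<omega> p v ** \<omega> p w - \<omega> p w ** \<omega> p v)"

lemma \<Gamma>_differentiable: "p \<in> \<Omega> \<Longrightarrow> (\<lambda>q. \<Gamma> q v w) differentiable (at p)"
  using smooth_on_differentiable[OF \<Gamma>_smooth] .

lemma \<omega>_differentiable: "p \<in> \<Omega> \<Longrightarrow> (\<lambda>q. \<omega> q v) differentiable (at p)"
  using smooth_on_differentiable[OF \<omega>_smooth] .

text \<open>Cartan's second structure equation: differentiate \<open>covariant_frame\<close> once
  more and antisymmetrise in \<open>v\<close> and \<open>w\<close>. The second derivatives of the
  frame cancel by \<open>smooth_on_fder_commute\<close>, the products of one connection matrix and
  one Christoffel term by their symmetry.\<close>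

lemma structure_equation:
  assumes p: "p \<in> \<Omega>"
  shows "Rm p v w (e b p) = (\<Sum>a\<in>UNIV. (curv_form p v w $ a $ b) *\<^sub>R e a p)"
proof -
  have e_expand: "fder (e b) p v = (\<Sum>a\<in>UNIV. (\<omega> p v $ a $ b) *\<^sub>R e a p) - \<Gamma> p v (e b p)" for b v
    using covariant_frame[OF p] by (simp add: algebra_simps)
  have d\<omega>: "(\<lambda>q. \<omega> q v $ a $ b) differentiable (at p)" for v a b
    by (intro differentiable_linear_image[OF bounded_linear_vec_nth] \<omega>_differentiable p)
  have f\<omega>: "fder (\<lambda>q. \<omega> q v $ a $ b) p w = fder (\<lambda>q. \<omega> q v) p w $ a $ b" for v w a b
    by (simp add: fder_component \<omega>_differentiable[OF p] differentiable_linear_image[OF bounded_linear_vec_nth])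
  have deriv: "fder (\<lambda>q. fder (e b) q v) p w + (fder (\<lambda>q. \<Gamma> q v (e b p)) p w + \<Gamma> p v (fder (e b) p w))
      = (\<Sum>a\<in>UNIV. (\<omega> p v $ a $ b) *\<^sub>R fder (e a) p w + (fder (\<lambda>q. \<omega> q v) p w $ a $ b) *\<^sub>R e a p)" for v w
  proof -
    have "fder (\<lambda>q. fder (e b) q v + \<Gamma> q v (e b q)) p = fder (\<lambda>q. \<Sum>a\<in>UNIV. (\<omega> q v $ a $ b) *\<^sub>R e a q) p"
      by (rule fder_cong_open[OF open_domain p covariant_frame])
    moreover have "fder (\<lambda>q. fder (e b) q v + \<Gamma> q v (e b q)) p w
       = fder (\<lambda>q. fder (e b) q v) p w + fder (\<lambda>q. \<Gamma> q v (e b q)) p w"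
      by (intro fder_add smooth_on_differentiable[OF smooth_on_fder[OF e_smooth] p]
          fder_linear_family(2)[OF open_domain p \<Gamma>_linear(1) \<Gamma>_differentiable[OF p] e_differentiable[OF p]])
    moreover have "fder (\<lambda>q. \<Gamma> q v (e b q)) p w = fder (\<lambda>q. \<Gamma> q v (e b p)) p w + \<Gamma> p v (fder (e b) p w)"
      by (rule fder_linear_family(1)[OF open_domain p \<Gamma>_linear(1) \<Gamma>_differentiable[OF p] e_differentiable[OF p]])
    moreover have "fder (\<lambda>q. \<Sum>a\<in>UNIV. (\<omega> q v $ a $ b) *\<^sub>R e a q) p w
       = (\<Sum>a\<in>UNIV. (\<omega> p v $ a $ b) *\<^sub>R fder (e a) p w + (fder (\<lambda>q. \<omega> q v) p w $ a $ b) *\<^sub>R e a p)"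
      by (subst fder_sum) (auto simp: fder_bilinear[OF bounded_bilinear_scaleR] d\<omega> f\<omega> e_differentiable[OF p]
          intro!: differentiable_bilinear[OF bounded_bilinear_scaleR])
    ultimately show ?thesis by simp
  qed
  have mm: "(\<Sum>a\<in>UNIV. (\<omega> p v $ a $ b) *\<^sub>R (\<Sum>c\<in>UNIV. (\<omega> p w $ c $ a) *\<^sub>R e c p))
      = (\<Sum>c\<in>UNIV. ((\<omega> p w ** \<omega> p v) $ c $ b) *\<^sub>R e c p)" for v w
    unfolding scaleR_sum_right
    by (subst sum.swap) (simp add: matrix_matrix_mult_def scaleR_sum_left mult.commute)
  have expand: "fder (\<lambda>q. \<Gamma> q v (e b p)) p w = (\<Sum>a\<in>UNIV. (fder (\<lambda>q. \<omega> q v) p w $ a $ b) *\<^sub>R e a p)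
      + (\<Sum>c\<in>UNIV. ((\<omega> p w ** \<omega> p v) $ c $ b) *\<^sub>R e c p) - (\<Sum>a\<in>UNIV. (\<omega> p v $ a $ b) *\<^sub>R \<Gamma> p w (e a p))
      - fder (\<lambda>q. fder (e b) q v) p w - (\<Sum>a\<in>UNIV. (\<omega> p w $ a $ b) *\<^sub>R \<Gamma> p v (e a p)) + \<Gamma> p v (\<Gamma> p w (e b p))" for v w
    using deriv[of v w] unfolding e_expand[of _ w]
    by (simp add: \<Gamma>_simps p scaleR_diff_right sum.distrib sum_subtractf mm algebra_simps)
  have schwarz: "fder (\<lambda>q. fder (e b) q w) p v = fder (\<lambda>q. fder (e b) q v) p w"
    by (rule smooth_on_fder_commute[OF open_domain p e_smooth])
  show ?thesis
    unfolding Rm_def expand curv_form_def schwarz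
    by (simp add: scaleR_add_left scaleR_diff_left sum.distrib sum_subtractf)
qed

lemma curv_form_skew:
  assumes p: "p \<in> \<Omega>"
  shows "transpose (curv_form p v w) = - curv_form p v w"
proof -
  have s: "fder (\<lambda>q. \<omega> q v) p w $ a $ b = - fder (\<lambda>q. \<omega> q v) p w $ b $ a" for v w a b
  proof -
    have 1: "fder (\<lambda>q. \<omega> q v $ a $ b) p w = fder (\<lambda>q. \<omega> q v) p w $ a $ b" for a b
      by (simp add: fder_component \<omega>_differentiable[OF p] differentiable_linear_image[OF bounded_linear_vec_nth])
    have "fder (\<lambda>q. \<omega> q v $ a $ b) p w = fder (\<lambda>q. - (\<omega> q v $ b $ a)) p w"
      by (subst fder_cong_open[OF open_domain p, of _ "\<lambda>q. - (\<omega> q v $ b $ a)"]) (auto intro: skewD \<omega>_skew)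
    also have "\<dots> = - fder (\<lambda>q. \<omega> q v $ b $ a) p w"
      by (rule fder_linear_image[OF bounded_linear_minus[OF bounded_linear_ident]])
        (intro differentiable_linear_image[OF bounded_linear_vec_nth] \<omega>_differentiable p)
    finally show ?thesis unfolding 1 .
  qed
  have m: "(\<omega> p v ** \<omega> p w) $ b $ a = (\<omega> p w ** \<omega> p v) $ a $ b" for v w a b
    unfolding matrix_matrix_mult_def vec_lambda_beta
  proof (rule sum.cong[OF refl])
    fix k
    show "\<omega> p v $ b $ k * \<omega> p w $ k $ a = \<omega> p w $ a $ k * \<omega> p v $ k $ b"
      using skewD[OF \<omega>_skew[OF p], of v b k] skewD[OF \<omega>_skew[OF p], of w k a] by simp
  qed
  show ?thesis
    unfolding vec_eq_iff
  proof (intro allI)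
    fix a b
    show "transpose (curv_form p v w) $ a $ b = (- curv_form p v w) $ a $ b"
      using s[of w v a b] s[of v w a b] m[of v w b a] m[of w v b a] by (simp add: transpose_def curv_form_def)
  qed
qed

lemma Rm_frame: "p \<in> \<Omega> \<Longrightarrow> g p (Rm p v w (e b p)) (e a p) = curv_form p v w $ a $ b"
  by (simp add: structure_equation g_simps e_orthonormal if_distrib cong: if_cong)

lemma Rm_linear:
  assumes p: "p \<in> \<Omega>"
  shows "linear (Rm p v w)" "linear (\<lambda>v. Rm p v w z)" "linear (\<lambda>w. Rm p v w z)"
proof -
  have 1: "linear (\<lambda>z. fder (\<lambda>q. \<Gamma> q w z) p v)" for v w
  proof -
    have a: "fder (\<lambda>q. \<Gamma> q w (z + z')) p v = fder (\<lambda>q. \<Gamma> q w z + \<Gamma> q w z') p v" for z z'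
      by (subst fder_cong_open[OF open_domain p, of _ "\<lambda>q. \<Gamma> q w z + \<Gamma> q w z'"]) (simp_all add: \<Gamma>_simps)
    have b: "fder (\<lambda>q. \<Gamma> q w (r *\<^sub>R z)) p v = fder (\<lambda>q. r *\<^sub>R \<Gamma> q w z) p v" for r z
      by (subst fder_cong_open[OF open_domain p, of _ "\<lambda>q. r *\<^sub>R \<Gamma> q w z"]) (simp_all add: \<Gamma>_simps)
    show ?thesis unfolding linear_iff a b
      by (simp add: fder_add \<Gamma>_differentiable[OF p] fder_linear_image[OF bounded_linear_scaleR_right])
  qed
  have sw: "fder (\<lambda>q. \<Gamma> q w z) p v = fder (\<lambda>q. \<Gamma> q z w) p v" for v w z
    by (subst fder_cong_open[OF open_domain p, of _ "\<lambda>q. \<Gamma> q z w"]) (auto intro: \<Gamma>_sym)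
  have 2: "linear (\<lambda>w. fder (\<lambda>q. \<Gamma> q w z) p v)" for v z
    unfolding sw[of _ z] by (rule 1)
  have 3: "linear (fder (\<lambda>q. \<Gamma> q w z) p)" for w z by (rule linear_fder[OF \<Gamma>_differentiable[OF p]])
  have 4: "linear (\<lambda>z. \<Gamma> p v (\<Gamma> p w z))" "linear (\<lambda>w. \<Gamma> p v (\<Gamma> p w z))" "linear (\<lambda>v. \<Gamma> p v (\<Gamma> p w z))" for v w z
    using linear_compose[OF \<Gamma>_linear(1)[OF p, of w] \<Gamma>_linear(1)[OF p, of v]]
      linear_compose[OF \<Gamma>_linear(2)[OF p, of z] \<Gamma>_linear(1)[OF p, of v]] \<Gamma>_linear(2)[OF p]
    by (auto simp: o_def)
  show "linear (Rm p v w)" "linear (\<lambda>v. Rm p v w z)" "linear (\<lambda>w. Rm p v w z)"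
    unfolding Rm_def by (intro linear_compose_sub linear_compose_add 1 2 3 4)+
qed

lemma Rm_bianchi: "p \<in> \<Omega> \<Longrightarrow> Rm p v w z + Rm p w z v + Rm p z v w = 0"
proof -
  assume p: "p \<in> \<Omega>"
  have s: "fder (\<lambda>q. \<Gamma> q w z) p v = fder (\<lambda>q. \<Gamma> q z w) p v" for v w z
    by (subst fder_cong_open[OF open_domain p, of _ "\<lambda>q. \<Gamma> q z w"]) (auto intro: \<Gamma>_sym p)
  show ?thesis
    unfolding Rm_def s[of z v w] s[of w v z] s[of w z v] \<Gamma>_sym[OF p, of z v] \<Gamma>_sym[OF p, of w v] \<Gamma>_sym[OF p, of w z]
    by simp
qed

text \<open>In frame components this is the skewness of \<open>curv_form\<close>, which comes from
  that of the connection matrix.\<close>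

lemma Rm_skew: "p \<in> \<Omega> \<Longrightarrow> g p (Rm p v w x) y = - g p (Rm p v w y) x"
proof -
  assume p: "p \<in> \<Omega>"
  have *: "g p (Rm p v w x) y = (\<Sum>a\<in>UNIV. \<Sum>b\<in>UNIV. g p x (e b p) * g p y (e a p) * curv_form p v w $ a $ b)" for x y
  proof -
    have "g p (Rm p v w x) y = g p (Rm p v w (\<Sum>b\<in>UNIV. g p x (e b p) *\<^sub>R e b p)) (\<Sum>a\<in>UNIV. g p y (e a p) *\<^sub>R e a p)"
      using frame_expand[OF p] by simp
    also have "\<dots> = (\<Sum>a\<in>UNIV. \<Sum>b\<in>UNIV. g p x (e b p) * g p y (e a p) * curv_form p v w $ a $ b)"
      by (simp add: linear_sum[OF Rm_linear(1)[OF p]] linear_scale[OF Rm_linear(1)[OF p]] g_simps p Rm_frame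
          sum_distrib_left mult_ac)
    finally show ?thesis .
  qed
  have "g p (Rm p v w x) y = (\<Sum>a\<in>UNIV. \<Sum>b\<in>UNIV. - (g p y (e a p) * g p x (e b p) * curv_form p v w $ b $ a))"
    unfolding * by (intro sum.cong refl, subst skewD[OF curv_form_skew[OF p]]) simp
  also have "\<dots> = - g p (Rm p v w y) x"
    unfolding *[of y x] by (subst sum.swap) (simp add: sum_negf)
  finally show ?thesis .
qed

text \<open>Apply \<open>curvature_like_zero\<close> to the difference from the model tensor. The
  assumption \<open>sec\<close> speaks of linearly independent pairs, so dependent pairs are treated
  separately.\<close>

lemma constant_curvature_Rm:
  assumes p: "p \<in> \<Omega>"
    and sec: "\<And>x y. (\<And>a b. a *\<^sub>R x + b *\<^sub>R y = 0 \<Longrightarrow> a = 0 \<and> b = 0) \<Longrightarrow>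
       g p (Rm p x y y) x = c * (g p x x * g p y y - (g p x y)\<^sup>2)"
  shows "g p (Rm p x y z) w = c * (g p y z * g p x w - g p x z * g p y w)"
proof -
  define T where "T x y z w = g p (Rm p x y z) w - c * (g p y z * g p x w - g p x z * g p y w)" for x y z w
  have anti: "Rm p x y z = - Rm p y x z" for x y z by (simp add: Rm_def)
  have "T x y z w = 0"
  proof (rule curvature_like_zero[of T])
    show "T x y z w = - T y x z w" for x y z w
      unfolding T_def anti[of x y] by (simp add: g_simps p algebra_simps)
    show "T x y z w = - T x y w z" for x y z w
      unfolding T_def Rm_skew[OF p, of x y z w] by (simp add: algebra_simps)
    show "T x y z w + T y z x w + T z x y w = 0" for x y z w
    proof -
      have "g p (Rm p x y z) w + g p (Rm p y z x) w + g p (Rm p z x y) w = 0"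
        using arg_cong[OF Rm_bianchi[OF p, of x y z], of "\<lambda>v. g p v w"] by (simp add: g_simps p)
      then show ?thesis
        using g_sym[OF p, of x y] g_sym[OF p, of x z] g_sym[OF p, of y z] by (simp add: T_def algebra_simps)
    qed
    show "T x y y x = 0" for x y
    proof (cases "\<forall>a b. a *\<^sub>R x + b *\<^sub>R y = 0 \<longrightarrow> a = 0 \<and> b = 0")
      case True
      have "g p (Rm p x y y) x = c * (g p x x * g p y y - (g p x y)\<^sup>2)"
        by (rule sec) (use True in blast)
      then show ?thesis
        using g_sym[OF p, of x y] by (simp add: T_def power2_eq_square algebra_simps)
    next
      case False
      have z: "T x x u w = 0" "T 0 x u w = 0" "T x 0 u w = 0" for x u w
        using linear_0[OF Rm_linear(2)[OF p], of x u] linear_0[OF Rm_linear(3)[OF p], of x u]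
        by (auto simp: T_def g_simps p Rm_def[of p x x])
      have s: "T (r *\<^sub>R x) y z w = r * T x y z w" "T x (r *\<^sub>R y) z w = r * T x y z w" for r x y z w
        by (simp_all add: T_def linear_scale[OF Rm_linear(2)[OF p]] linear_scale[OF Rm_linear(3)[OF p]] g_simps p algebra_simps)
      from False obtain a b where ab: "a *\<^sub>R x + b *\<^sub>R y = 0" "a \<noteq> 0 \<or> b \<noteq> 0" by blast
      \<comment> \<open>The dependence replaces \<open>a *\<^sub>R x\<close> by a multiple of
        \<open>y\<close> and \<open>b *\<^sub>R y\<close> by a multiple of \<open>x\<close>;
        \<open>T\<close> vanishes when its first two arguments coincide.\<close>
      have "a * T x y y x = 0" "b * T x y y x = 0"
      proof -
        have "a *\<^sub>R x = (- b) *\<^sub>R y" "b *\<^sub>R y = (- a) *\<^sub>R x"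
          using ab(1) by (simp_all add: eq_neg_iff_add_eq_0 add.commute)
        then have "T (a *\<^sub>R x) y y x = T ((- b) *\<^sub>R y) y y x" "T x (b *\<^sub>R y) y x = T x ((- a) *\<^sub>R x) y x" by simp_all
        then show "a * T x y y x = 0" "b * T x y y x = 0" by (simp_all only: s z mult_zero_right)
      qed
      then show ?thesis using ab(2) by auto
    qed
  qed (simp_all add: T_def linear_add[OF Rm_linear(1)[OF p]] linear_add[OF Rm_linear(2)[OF p]]
      linear_add[OF Rm_linear(3)[OF p]] g_simps p algebra_simps)
  then show ?thesis by (simp add: T_def)
qed

text \<open>The sign arises because R(e_k, e_l) maps e_l to c e_k, whereas \<open>wedge k l\<close>
  maps e_l to - e_k.\<close>

lemma constant_curvature_form:
  assumes p: "p \<in> \<Omega>"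
    and "\<And>x y z w. g p (Rm p x y z) w = c * (g p y z * g p x w - g p x z * g p y w)"
  shows "curv_form p (e k p) (e l p) = - c *\<^sub>R wedge k l"
  unfolding vec_eq_iff Rm_frame[OF p, symmetric] assms(2)
  by (auto simp: e_orthonormal[OF p] wedge_def)

section \<open>The covariant derivative in coordinates and the Ricci identity\<close>

text \<open>The empty index list has no direction of differentiation and gets the value 0, as in
  \<open>nabla\<close>, so that the two agree on all lists.\<close>

definition cov_deriv :: "(real^'n \<Rightarrow> ('n, 's) stensor) \<Rightarrow> real^'n \<Rightarrow> ('n, 's) stensor" where
  "cov_deriv F p is = (case is of [] \<Rightarrow> 0
     | k # ks \<Rightarrow> fder (\<lambda>q. F q ks) p (e k p) + so_act \<gamma> (\<omega> p (e k p)) (F p) ks)"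

lemma cov_deriv_simps [simp]:
  "cov_deriv F p [] = 0"
  "cov_deriv F p (k # ks) = fder (\<lambda>q. F q ks) p (e k p) + so_act \<gamma> (\<omega> p (e k p)) (F p) ks"
  by (simp_all add: cov_deriv_def)

lemma cov_deriv_smooth:
  assumes "\<And>is. smooth_on \<Omega> (\<lambda>p. F p is)"
  shows "smooth_on \<Omega> (\<lambda>p. cov_deriv F p is)"
proof (cases "is")
  case Nil
  then show ?thesis by (simp add: smooth_on_const)
next
  case (Cons k ks)
  show ?thesis
    unfolding Cons cov_deriv_simps
    by (intro smooth_on_add open_domain smooth_on_fder_along smooth_on_so_act \<omega>_frame_smooth assms e_smooth)
qed

text \<open>Second derivatives of \<open>F\<close> cancel by symmetry, and so do the terms with one
  derivative of \<open>F\<close> and one connection matrix. The derivatives of the frame combine to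
  a derivative along \<Gamma>(e_k, e_l), which is symmetric because the torsion vanishes. What
  remains is d \<omega> plus the commutator.\<close>

lemma ricci_identity:
  assumes p: "p \<in> \<Omega>" and F: "\<And>is. smooth_on \<Omega> (\<lambda>p. F p is)"
  shows "cov_deriv (cov_deriv F) p (k # l # is) - cov_deriv (cov_deriv F) p (l # k # is)
    = so_act \<gamma> (curv_form p (e k p) (e l p)) (F p) is"
proof -
  have dF: "(\<lambda>q. F q is) differentiable (at p)" for "is"
    by (rule smooth_on_differentiable[OF F p])
  \<comment> \<open>The covariant derivative in an arbitrary direction: differentiating the frame
    fields produces the directions \<open>d k l\<close>, which are not frame vectors.\<close>
  define Q where "Q v = fder (\<lambda>q. F q is) p v + so_act \<gamma> (\<omega> p v) (F p) is" for v
  have linQ: "linear Q"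
  proof -
    have "linear (\<lambda>v. so_act \<gamma> (\<omega> p v) (F p) is)"
      using linear_compose[OF \<omega>_linear[OF p] linear_so_act_matrix] by (simp add: o_def)
    then show ?thesis unfolding Q_def by (intro linear_compose_add linear_fder[OF dF])
  qed
  define d where "d k l = fder (e l) p (e k p)" for k l
  have main: "cov_deriv (cov_deriv F) p (k # l # is) =
      fder (\<lambda>q. fder (\<lambda>q. F q is) q (e l p)) p (e k p) + Q (d k l)
      + so_act \<gamma> (fder (\<lambda>q. \<omega> q (e l p)) p (e k p)) (F p) is
      + (so_act \<gamma> (\<omega> p (e l p)) (\<lambda>ks. fder (\<lambda>q. F q ks) p (e k p)) is
         + so_act \<gamma> (\<omega> p (e k p)) (\<lambda>ks. fder (\<lambda>q. F q ks) p (e l p)) is)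
      + so_act \<gamma> (\<omega> p (e k p)) (so_act \<gamma> (\<omega> p (e l p)) (F p)) is
      + (\<Sum>b\<in>UNIV. (\<omega> p (e k p) $ l $ b) *\<^sub>R Q (e b p))" for k l
  proof -
    have d1: "(\<lambda>q. fder (\<lambda>q. F q is) q w) differentiable (at p)" for w
      by (rule smooth_on_differentiable[OF smooth_on_fder[OF F] p])
    have lin: "linear (fder (\<lambda>q. F q is) q)" if "q \<in> \<Omega>" for q
      by (rule linear_fder[OF smooth_on_differentiable[OF F that]])
    have A: "(\<lambda>q. \<omega> q (e l q)) differentiable (at p)"
      "fder (\<lambda>q. \<omega> q (e l q)) p (e k p) = fder (\<lambda>q. \<omega> q (e l p)) p (e k p) + \<omega> p (d k l)"
      unfolding d_def
      using fder_linear_family(1)[OF open_domain p \<omega>_linear \<omega>_differentiable[OF p] e_differentiable[OF p, of l], of "e k p"]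
        fder_linear_family(2)[OF open_domain p \<omega>_linear \<omega>_differentiable[OF p] e_differentiable[OF p, of l]]
      by simp_all
    have B: "(\<lambda>q. fder (\<lambda>q. F q is) q (e l q)) differentiable (at p)"
      "fder (\<lambda>q. fder (\<lambda>q. F q is) q (e l q)) p (e k p) =
        fder (\<lambda>q. fder (\<lambda>q. F q is) q (e l p)) p (e k p) + fder (\<lambda>q. F q is) p (d k l)"
      using fder_linear_family(1)[OF open_domain p lin d1 e_differentiable[OF p, of l], of "e k p"]
        fder_linear_family(2)[OF open_domain p lin d1 e_differentiable[OF p, of l]]
      unfolding d_def by simp_all
    have C: "fder (\<lambda>q. so_act \<gamma> (\<omega> q (e l q)) (F q) is) p (e k p) =
        so_act \<gamma> (\<omega> p (e l p)) (\<lambda>is. fder (\<lambda>q. F q is) p (e k p)) is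
        + (so_act \<gamma> (fder (\<lambda>q. \<omega> q (e l p)) p (e k p)) (F p) is + so_act \<gamma> (\<omega> p (d k l)) (F p) is)"
      unfolding fder_so_act[OF A(1) dF] A(2) linear_add[OF linear_so_act_matrix] ..
    have D: "(\<lambda>q. so_act \<gamma> (\<omega> q (e l q)) (F q) is) differentiable (at p)"
      unfolding differentiable_def
      by (rule exI, rule so_act_has_derivative[where F = F, OF has_fder[OF A(1)]], rule has_fder[OF dF])
    have 1: "fder (\<lambda>q. cov_deriv F q (l # is)) p (e k p) =
        fder (\<lambda>q. fder (\<lambda>q. F q is) q (e l p)) p (e k p) + fder (\<lambda>q. F q is) p (d k l)
        + (so_act \<gamma> (\<omega> p (e l p)) (\<lambda>is. fder (\<lambda>q. F q is) p (e k p)) is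
        + (so_act \<gamma> (fder (\<lambda>q. \<omega> q (e l p)) p (e k p)) (F p) is + so_act \<gamma> (\<omega> p (d k l)) (F p) is))"
      unfolding cov_deriv_simps fder_add[OF B(1) D] B(2) C ..
    have 2: "so_act \<gamma> (\<omega> p (e k p)) (cov_deriv F p) (l # is) =
        so_act \<gamma> (\<omega> p (e k p)) (\<lambda>ks. fder (\<lambda>q. F q ks) p (e l p)) is
        + so_act \<gamma> (\<omega> p (e k p)) (so_act \<gamma> (\<omega> p (e l p)) (F p)) is
        + (\<Sum>b\<in>UNIV. (\<omega> p (e k p) $ l $ b) *\<^sub>R Q (e b p))"
      by (simp add: so_act_Cons so_act_add Q_def)
    show ?thesis
      unfolding cov_deriv_simps(2)[of "cov_deriv F"] 1 2 by (simp add: Q_def algebra_simps)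
  qed
  have schwarz: "fder (\<lambda>q. fder (\<lambda>q. F q is) q (e l p)) p (e k p) = fder (\<lambda>q. fder (\<lambda>q. F q is) q (e k p)) p (e l p)"
    by (rule smooth_on_fder_commute[OF open_domain p F])
  \<comment> \<open>The connection acting on the new first index compensates the derivative of the
    frame up to a Christoffel term.\<close>
  have fr: "(\<Sum>b\<in>UNIV. (\<omega> p (e k p) $ l $ b) *\<^sub>R e b p) = - (d k l + \<Gamma> p (e k p) (e l p))" for k l
    unfolding d_def covariant_frame[OF p] sum_negf[symmetric]
    by (intro sum.cong refl, subst skewD[OF \<omega>_skew[OF p]]) simp
  have Qf: "(\<Sum>b\<in>UNIV. (\<omega> p (e k p) $ l $ b) *\<^sub>R Q (e b p)) = - Q (d k l) - Q (\<Gamma> p (e k p) (e l p))" for k l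
    using arg_cong[OF fr[of k l], of Q]
    by (simp add: linear_sum[OF linQ] linear_scale[OF linQ] linear_neg[OF linQ] linear_diff[OF linQ] linear_add[OF linQ])
  have comm: "so_act \<gamma> (\<omega> p (e k p)) (so_act \<gamma> (\<omega> p (e l p)) (F p)) is
      - so_act \<gamma> (\<omega> p (e l p)) (so_act \<gamma> (\<omega> p (e k p)) (F p)) is
      = so_act \<gamma> (\<omega> p (e k p) ** \<omega> p (e l p) - \<omega> p (e l p) ** \<omega> p (e k p)) (F p) is"
    by (rule so_act_commutator[OF \<omega>_skew[OF p] \<omega>_skew[OF p]])
  show ?thesis
    unfolding main Qf curv_form_def schwarz \<Gamma>_sym[OF p, of "e l p" "e k p"]
      linear_add[OF linear_so_act_matrix] linear_diff[OF linear_so_act_matrix, of "fder _ _ _"] comm[symmetric]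
    by simp
qed

end

context local_frame
begin

text \<open>In frame coordinates \<open>g\<close> is the standard inner product, so this is the
  equality case of the Cauchy-Schwarz inequality. It lets the quotient in
  \<open>sectional_curvature\<close> be cleared.\<close>

lemma gram_nonzero:
  assumes p: "p \<in> \<Omega>" and ind: "\<And>a b. a *\<^sub>R x + b *\<^sub>R y = 0 \<Longrightarrow> a = 0 \<and> b = 0"
  shows "g p x x * g p y y - (g p x y)\<^sup>2 \<noteq> 0"
proof
  define q where "q v = (\<chi> a. g p v (e a p))" for v
  have lin: "linear q" by (simp add: linear_iff q_def vec_eq_iff g_simps p)
  have q0: "v = 0" if "q v = 0" for v
    using frame_expand[OF p, of v] that by (simp add: q_def vec_eq_iff)
  have inner: "g p v w = q v \<bullet> q w" for v w
  proof -
    have "g p v w = g p v (\<Sum>a\<in>UNIV. g p w (e a p) *\<^sub>R e a p)" using frame_expand[OF p] by simp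
    also have "\<dots> = q v \<bullet> q w" by (simp add: g_simps p q_def inner_vec_def mult.commute)
    finally show ?thesis .
  qed
  assume "g p x x * g p y y - (g p x y)\<^sup>2 = 0"
  then have "(q x \<bullet> q y)\<^sup>2 = (norm (q x) * norm (q y))\<^sup>2"
    by (simp add: inner dot_square_norm power_mult_distrib)
  then have "\<bar>q x \<bullet> q y\<bar> = norm (q x) * norm (q y)"
    by (metis abs_mult abs_norm_cancel power2_eq_iff_nonneg abs_ge_zero norm_ge_zero zero_le_mult_iff power2_abs)
  then consider "norm (q x) *\<^sub>R q y = norm (q y) *\<^sub>R q x" | "norm (q x) *\<^sub>R q y = - norm (q y) *\<^sub>R q x"
    unfolding norm_cauchy_schwarz_abs_eq by blast
  then have "norm (q x) = 0"
  proof cases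
    case 1
    then have "q ((- norm (q y)) *\<^sub>R x + norm (q x) *\<^sub>R y) = 0"
      by (simp add: linear_add[OF lin] linear_scale[OF lin] linear_neg[OF lin] linear_diff[OF lin])
    then show ?thesis using q0 ind by blast
  next
    case 2
    then have "q (norm (q y) *\<^sub>R x + norm (q x) *\<^sub>R y) = 0"
      by (simp add: linear_add[OF lin] linear_scale[OF lin])
    then show ?thesis using q0 ind by blast
  qed
  then have "x = 0" using q0 by simp
  then show False using ind[of 1 0] by simp
qed

lemma cov_deriv_cong:
  assumes "p \<in> \<Omega>" "\<And>q. q \<in> \<Omega> \<Longrightarrow> F q = G q"
  shows "cov_deriv F p is = cov_deriv G p is"
proof (cases "is")
  case (Cons k ks)
  have "fder (\<lambda>q. F q ks) p = fder (\<lambda>q. G q ks) p"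
    by (rule fder_cong_open[OF open_domain assms(1)]) (simp add: assms(2))
  then show ?thesis by (simp add: Cons assms)
qed simp

end

section \<open>Charts\<close>

locale riemannian =
  fixes M :: "('m, 'n::finite) rmfd"
  assumes riem: "riemannian_manifold M"
begin

lemma atlas_props:
  assumes "c \<in> Atlas M"
  shows "openin (Mtop M) (fst c)" "open (snd c ` fst c)"
    "homeomorphic_map (subtopology (Mtop M) (fst c)) (top_of_set (snd c ` fst c)) (snd c)"
  using riem assms unfolding riemannian_manifold_def smooth_manifold_def by blast+

lemma chart_inj: "c \<in> Atlas M \<Longrightarrow> inj_on (snd c) (fst c)"
  using homeomorphic_imp_injective_map[OF atlas_props(3)] openin_subset[OF atlas_props(1)]
  by (metis topspace_subtopology_subset)

lemma cinv_left [simp]: "c \<in> Atlas M \<Longrightarrow> y \<in> fst c \<Longrightarrow> cinv c (snd c y) = y"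
  by (simp add: cinv_def chart_inj)

lemma cinv_right: "p \<in> snd c ` fst c \<Longrightarrow> cinv c p \<in> fst c" "p \<in> snd c ` fst c \<Longrightarrow> snd c (cinv c p) = p"
  by (simp_all add: cinv_def inv_into_into f_inv_into_f)

lemma chart_image_open: "c \<in> Atlas M \<Longrightarrow> openin (Mtop M) U \<Longrightarrow> open (snd c ` (fst c \<inter> U))"
  using homeomorphic_imp_open_map[OF atlas_props(3)] openin_subtopology_Int2[of "Mtop M" U "fst c"]
    openin_open_trans[OF _ atlas_props(2)] by (metis open_map_def)

lemma chart_imageD:
  assumes "c \<in> Atlas M" "p \<in> snd c ` (fst c \<inter> U)"
  shows "cinv c p \<in> fst c" "cinv c p \<in> U" "snd c (cinv c p) = p" "c \<in> charts_at M (cinv c p)"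
  using assms by (auto simp: charts_at_def)

lemma charts_at_nonempty: "x \<in> topspace (Mtop M) \<Longrightarrow> chart_at M x \<in> charts_at M x"
proof -
  assume "x \<in> topspace (Mtop M)"
  then obtain c where "c \<in> Atlas M" "x \<in> fst c"
    using riem unfolding riemannian_manifold_def smooth_manifold_def by blast
  then have "c \<in> charts_at M x" by (simp add: charts_at_def)
  then show ?thesis unfolding chart_at_def by (rule someI)
qed

lemma charts_atD: "c \<in> charts_at M x \<Longrightarrow> c \<in> Atlas M" "c \<in> charts_at M x \<Longrightarrow> x \<in> fst c"
  by (auto simp: charts_at_def)

lemma transition_smooth:
  "c \<in> Atlas M \<Longrightarrow> d \<in> Atlas M \<Longrightarrow> smooth_on (snd c ` (fst c \<inter> fst d)) (snd d \<circ> cinv c)"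
  using riem unfolding riemannian_manifold_def smooth_manifold_def by blast

lemma overlap_open: "c \<in> Atlas M \<Longrightarrow> d \<in> Atlas M \<Longrightarrow> open (snd c ` (fst c \<inter> fst d))"
  by (rule chart_image_open[OF _ atlas_props(1)])

lemma overlap_mem: "c \<in> charts_at M x \<Longrightarrow> d \<in> charts_at M x \<Longrightarrow> snd c x \<in> snd c ` (fst c \<inter> fst d)"
  by (auto simp: charts_at_def)

lemma transition_differentiable:
  "c \<in> charts_at M x \<Longrightarrow> d \<in> charts_at M x \<Longrightarrow> (snd d \<circ> cinv c) differentiable (at (snd c x))"
  by (rule smooth_on_differentiable[OF transition_smooth overlap_mem]) (auto dest: charts_atD)

lemma fder_chart_change:
  assumes c: "c \<in> charts_at M x" and d: "d \<in> charts_at M x"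
    and f: "(f \<circ> cinv d) differentiable (at (snd d x))"
  shows "fder (f \<circ> cinv c) (snd c x) v = fder (f \<circ> cinv d) (snd d x) (fder (snd d \<circ> cinv c) (snd c x) v)"
proof -
  note A = charts_atD[OF c] charts_atD[OF d]
  have "fder (f \<circ> cinv c) (snd c x) = fder ((f \<circ> cinv d) \<circ> (snd d \<circ> cinv c)) (snd c x)"
  proof (rule fder_cong_open[OF overlap_open[OF A(1,3)] overlap_mem[OF c d]])
    fix p assume "p \<in> snd c ` (fst c \<inter> fst d)"
    then show "(f \<circ> cinv c) p = ((f \<circ> cinv d) \<circ> (snd d \<circ> cinv c)) p"
      using chart_imageD[OF A(1), of p "fst d"] A(3) by simp
  qed
  also have "\<dots> = fder (f \<circ> cinv d) ((snd d \<circ> cinv c) (snd c x)) \<circ> fder (snd d \<circ> cinv c) (snd c x)"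
    by (rule frechet_derivative_compose[OF transition_differentiable[OF c d]]) (use f A in simp)
  finally show ?thesis using A by simp
qed

lemma transition_self:
  assumes "c \<in> charts_at M x"
  shows "fder (snd c \<circ> cinv c) (snd c x) v = v"
proof -
  note A = charts_atD[OF assms]
  have "fder (snd c \<circ> cinv c) (snd c x) = fder (\<lambda>p. p) (snd c x)"
    by (rule fder_cong_open[OF atlas_props(2)[OF A(1)]]) (use A in \<open>auto simp: cinv_right\<close>)
  then show ?thesis by simp
qed

lemma transition_compose:
  assumes "c \<in> charts_at M x" "d \<in> charts_at M x" "d' \<in> charts_at M x"
  shows "fder (snd d' \<circ> cinv d) (snd d x) (fder (snd d \<circ> cinv c) (snd c x) v) = fder (snd d' \<circ> cinv c) (snd c x) v"
  using fder_chart_change[OF assms(1,2) transition_differentiable[OF assms(2,3)]] by simp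

lemma tangent_spaceD:
  "X \<in> tangent_space M x \<Longrightarrow> c \<in> charts_at M x \<Longrightarrow> d \<in> charts_at M x \<Longrightarrow>
    X d = fder (snd d \<circ> cinv c) (snd c x) (X c)"
  unfolding tangent_space_def by blast

lemma coord_vec_self: "c \<in> charts_at M x \<Longrightarrow> coord_vec M c x v c = v"
  by (simp add: coord_vec_def transition_self)

lemma coord_vec_tangent: "c \<in> charts_at M x \<Longrightarrow> coord_vec M c x v \<in> tangent_space M x"
  unfolding tangent_space_def by (auto simp: coord_vec_def transition_compose)

lemma coord_vec_component: "X \<in> tangent_space M x \<Longrightarrow> c \<in> charts_at M x \<Longrightarrow> coord_vec M c x (X c) = X"
proof (rule ext)
  fix d assume X: "X \<in> tangent_space M x" and c: "c \<in> charts_at M x"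
  show "coord_vec M c x (X c) d = X d"
  proof (cases "d \<in> charts_at M x")
    case True
    then show ?thesis by (simp add: coord_vec_def tangent_spaceD[OF X c True])
  next
    case False
    then have "X d = 0" using X unfolding tangent_space_def by blast
    then show ?thesis using False by (simp add: coord_vec_def)
  qed
qed

lemma coord_vec_lincomb:
  assumes "c \<in> charts_at M x"
  shows "coord_vec M c x (a *\<^sub>R v + w) = (\<lambda>d. a *\<^sub>R coord_vec M c x v d + coord_vec M c x w d)"
  unfolding coord_vec_def
  by (rule ext) (simp add: linear_add[OF linear_fder[OF transition_differentiable[OF assms]]]
      linear_scale[OF linear_fder[OF transition_differentiable[OF assms]]])

lemma coord_vec_change:
  assumes "c \<in> charts_at M x" "d \<in> charts_at M x"
  shows "coord_vec M d x (fder (snd d \<circ> cinv c) (snd c x) v) = coord_vec M c x v"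
  unfolding coord_vec_def by (rule ext) (simp add: transition_compose assms)

lemma metric_props:
  assumes "x \<in> topspace (Mtop M)" "X \<in> tangent_space M x" "Y \<in> tangent_space M x" "Z \<in> tangent_space M x"
  shows "Metric M x X Y = Metric M x Y X"
    "Metric M x (\<lambda>c. a *\<^sub>R X c + Y c) Z = a * Metric M x X Z + Metric M x Y Z"
  using riem assms unfolding riemannian_manifold_def by blast+

lemma metric_coord_eq:
  assumes "X \<in> tangent_space M x" "Y \<in> tangent_space M x" "c \<in> charts_at M x"
  shows "metric_coord M c (snd c x) (X c) (Y c) = Metric M x X Y"
  using assms charts_atD[OF assms(3)] by (simp add: metric_coord_def coord_vec_component)

lemma charts_at_topspace: "c \<in> charts_at M x \<Longrightarrow> x \<in> topspace (Mtop M)"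
  using atlas_props(1) charts_atD by (meson openin_subset subsetD)

lemma metric_coord_sym_linear:
  assumes c: "c \<in> Atlas M" and p: "p \<in> snd c ` fst c"
  shows "metric_coord M c p v w = metric_coord M c p w v" "linear (metric_coord M c p v)"
proof -
  define x where "x = cinv c p"
  have x: "c \<in> charts_at M x" using cinv_right[OF p] c by (simp add: x_def charts_at_def)
  note T = coord_vec_tangent[OF x] and top = charts_at_topspace[OF x]
  show *: "metric_coord M c p v w = metric_coord M c p w v" for v w
    unfolding metric_coord_def x_def[symmetric] by (rule metric_props(1)[OF top T T T])
  have l: "metric_coord M c p (a *\<^sub>R v + w) z = a * metric_coord M c p v z + metric_coord M c p w z" for a v w z
    unfolding metric_coord_def x_def[symmetric] coord_vec_lincomb[OF x] by (rule metric_props(2)[OF top T T T])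
  have "metric_coord M c p (a *\<^sub>R w) v = a * metric_coord M c p w v" for a w
    using l[of a w 0 v] l[of 1 0 0 v] by simp
  then show "linear (metric_coord M c p v)"
    unfolding linear_iff *[of v] using l[of 1] by auto
qed

lemma metric_coord_smooth: "c \<in> Atlas M \<Longrightarrow> smooth_on (snd c ` fst c) (\<lambda>p. metric_coord M c p v w)"
  using riem unfolding riemannian_manifold_def by blast

text \<open>\<open>dir_deriv\<close> uses a chart chosen separately at each point; to see how the
  value varies with the point, one chart must serve for a whole neighbourhood.\<close>

lemma dir_deriv_chart:
  assumes "X \<in> tangent_space M x" "c \<in> charts_at M x" "(f \<circ> cinv c) differentiable (at (snd c x))"
  shows "dir_deriv M x X f = fder (f \<circ> cinv c) (snd c x) (X c)"
proof -
  have d: "chart_at M x \<in> charts_at M x"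
    by (rule charts_at_nonempty[OF charts_at_topspace[OF assms(2)]])
  show ?thesis
    unfolding dir_deriv_def Let_def fder_chart_change[OF d assms(2,3)] tangent_spaceD[OF assms(1) d assms(2), symmetric] ..
qed

lemma smooth_map_onD: "smooth_map_on M U f \<Longrightarrow> c \<in> Atlas M \<Longrightarrow> smooth_on (snd c ` (fst c \<inter> U)) (\<lambda>p. f (cinv c p))"
  by (simp add: smooth_map_on_def o_def)

lemma smooth_map_onI: "(\<And>c. c \<in> Atlas M \<Longrightarrow> smooth_on (snd c ` (fst c \<inter> U)) (\<lambda>p. f (cinv c p))) \<Longrightarrow> smooth_map_on M U f"
  by (simp add: smooth_map_on_def o_def)

lemma smooth_map_on_subset: "smooth_map_on M U f \<Longrightarrow> V \<subseteq> U \<Longrightarrow> smooth_map_on M V f"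
  unfolding smooth_map_on_def by (meson smooth_on_subset image_mono Int_mono subset_refl)

end

section \<open>Local sections of the spin structure\<close>

locale spin_geometry = riemannian M + spinor \<gamma>
  for M :: "('m, 'n::finite) rmfd" and \<gamma> :: "('n, 's::finite) gammas" +
  fixes P :: "('m, 'n, 'p, 's) spinstr"
  assumes spin: "spin_structure M \<gamma> P"
begin

abbreviation lsec :: "'m set \<Rightarrow> ('m \<Rightarrow> 'p) \<Rightarrow> bool" where
  "lsec \<equiv> smooth_local_section M \<gamma> P"

lemma principal: "principal_Spin_bundle M \<gamma> P"
  using spin by (simp add: spin_structure_def)

lemma PTot_base: "u \<in> PTot P \<Longrightarrow> PBase P u \<in> topspace (Mtop M)"
  using principal by (simp add: principal_Spin_bundle_def)

lemma PAct_one: "u \<in> PTot P \<Longrightarrow> PAct P u (mat 1) = u"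
  using principal by (simp add: principal_Spin_bundle_def)

lemma PAct_props:
  assumes "u \<in> PTot P" "h \<in> Spin \<gamma>"
  shows "PAct P u h \<in> PTot P" "PBase P (PAct P u h) = PBase P u"
    "k \<in> Spin \<gamma> \<Longrightarrow> PAct P (PAct P u h) k = PAct P u (h ** k)"
  using principal[unfolded principal_Spin_bundle_def, THEN conjunct2, THEN conjunct2, THEN conjunct1, rule_format, OF assms]
  by simp_all

lemma PAct_transitive:
  "u \<in> PTot P \<Longrightarrow> v \<in> PTot P \<Longrightarrow> PBase P u = PBase P v \<Longrightarrow> \<exists>!h. h \<in> Spin \<gamma> \<and> v = PAct P u h"
  by (rule principal[unfolded principal_Spin_bundle_def, THEN conjunct2, THEN conjunct2, THEN conjunct2,
        THEN conjunct1, rule_format])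

lemma PSecs_cover:
  assumes "x \<in> topspace (Mtop M)"
  obtains V \<tau> where "(V, \<tau>) \<in> PSecs P" "x \<in> V"
proof -
  have "x \<in> (\<Union>(U, \<sigma>)\<in>PSecs P. U)"
    unfolding principal[unfolded principal_Spin_bundle_def, THEN conjunct2, THEN conjunct2, THEN conjunct2,
        THEN conjunct2, THEN conjunct1] by (rule assms)
  then show thesis using that by auto
qed

lemma PSecs_lsec: "(V, \<tau>) \<in> PSecs P \<Longrightarrow> lsec V \<tau>"
  using principal[unfolded principal_Spin_bundle_def, THEN conjunct2, THEN conjunct2, THEN conjunct2,
        THEN conjunct2, THEN conjunct2] by auto

lemma frame_tangent: "u \<in> PTot P \<Longrightarrow> PFrame P u k \<in> tangent_space M (PBase P u)"
  using spin by (simp add: spin_structure_def)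

lemma frame_orthonormal:
  "u \<in> PTot P \<Longrightarrow> Metric M (PBase P u) (PFrame P u k) (PFrame P u l) = (if k = l then 1 else 0)"
  using spin by (simp add: spin_structure_def)

lemma frame_PAct:
  "u \<in> PTot P \<Longrightarrow> h \<in> Spin \<gamma> \<Longrightarrow> PFrame P (PAct P u h) k c = (\<Sum>l\<in>UNIV. (cov h $ l $ k) *\<^sub>R PFrame P u l c)"
  using spin by (simp add: spin_structure_def Spin_cover_eq)

lemma PSecs_frame_smooth:
  "(V, \<tau>) \<in> PSecs P \<Longrightarrow> c \<in> Atlas M \<Longrightarrow>
    smooth_on (snd c ` (fst c \<inter> V)) (\<lambda>p. PFrame P (\<tau> (cinv c p)) k c)"
  using spin unfolding spin_structure_def by blast

lemma lsecD:
  assumes "lsec U \<sigma>"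
  shows "openin (Mtop M) U" "x \<in> U \<Longrightarrow> \<sigma> x \<in> PTot P" "x \<in> U \<Longrightarrow> PBase P (\<sigma> x) = x"
  using assms unfolding smooth_local_section_def by blast+

lemma lsec_transition:
  assumes "lsec U \<sigma>" "(V, \<tau>) \<in> PSecs P"
  obtains h where "smooth_map_on M (U \<inter> V) h" "\<And>y. y \<in> U \<inter> V \<Longrightarrow> h y \<in> Spin \<gamma>"
    "\<And>y. y \<in> U \<inter> V \<Longrightarrow> \<sigma> y = PAct P (\<tau> y) (h y)"
  using assms unfolding smooth_local_section_def by blast

text \<open>\<open>smooth_local_section\<close> compares a section with the bundle atlas only, so
  both sections are compared with a third one near \<open>x\<close>. The inverse in Spin is
  \<open>adjm\<close>, which is smooth.\<close>

lemma lsec_transition2: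
  assumes "lsec U \<sigma>" "lsec U' \<sigma>'" "x \<in> U" "x \<in> U'"
  obtains V h where "openin (Mtop M) V" "x \<in> V" "V \<subseteq> U" "V \<subseteq> U'" "smooth_map_on M V h"
    "\<And>y. y \<in> V \<Longrightarrow> h y \<in> Spin \<gamma>" "\<And>y. y \<in> V \<Longrightarrow> \<sigma>' y = PAct P (\<sigma> y) (h y)"
proof -
  have "x \<in> topspace (Mtop M)" using assms(1,3) lsecD(1) openin_subset by blast
  then obtain W \<tau> where W: "(W, \<tau>) \<in> PSecs P" "x \<in> W" by (rule PSecs_cover)
  obtain h1 where h1: "smooth_map_on M (U \<inter> W) h1" "\<And>y. y \<in> U \<inter> W \<Longrightarrow> h1 y \<in> Spin \<gamma>"
    "\<And>y. y \<in> U \<inter> W \<Longrightarrow> \<sigma> y = PAct P (\<tau> y) (h1 y)" by (rule lsec_transition[OF assms(1) W(1)]) blast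
  obtain h2 where h2: "smooth_map_on M (U' \<inter> W) h2" "\<And>y. y \<in> U' \<inter> W \<Longrightarrow> h2 y \<in> Spin \<gamma>"
    "\<And>y. y \<in> U' \<inter> W \<Longrightarrow> \<sigma>' y = PAct P (\<tau> y) (h2 y)" by (rule lsec_transition[OF assms(2) W(1)]) blast
  define V where "V = U \<inter> U' \<inter> W"
  define h where "h y = adjm (h1 y) ** h2 y" for y
  have V: "openin (Mtop M) V"
    unfolding V_def by (intro openin_Int lsecD(1)[OF assms(1)] lsecD(1)[OF assms(2)] lsecD(1)[OF PSecs_lsec[OF W(1)]])
  have sm: "smooth_map_on M V h"
  proof (rule smooth_map_onI)
    fix c assume c: "c \<in> Atlas M"
    have "smooth_on (snd c ` (fst c \<inter> V)) (\<lambda>p. h1 (cinv c p))"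
      by (rule smooth_map_onD[OF smooth_map_on_subset[OF h1(1)] c]) (auto simp: V_def)
    moreover have "smooth_on (snd c ` (fst c \<inter> V)) (\<lambda>p. h2 (cinv c p))"
      by (rule smooth_map_onD[OF smooth_map_on_subset[OF h2(1)] c]) (auto simp: V_def)
    ultimately show "smooth_on (snd c ` (fst c \<inter> V)) (\<lambda>p. h (cinv c p))"
      unfolding h_def
      by (intro smooth_on_bilinear[OF _ bounded_bilinear_matmul] smooth_on_linear_image[OF _ bounded_linear_adjm]
          chart_image_open c V)
  qed
  have tr: "\<sigma>' y = PAct P (\<sigma> y) (h y)" if "y \<in> V" for y
  proof -
    have y: "y \<in> U \<inter> W" "y \<in> U' \<inter> W" using that by (auto simp: V_def)
    have t: "\<tau> y \<in> PTot P" using lsecD(2)[OF PSecs_lsec[OF W(1)]] y by blast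
    have hh: "h y \<in> Spin \<gamma>" unfolding h_def by (intro Spin_mult Spin_adjm h1 h2 y)
    show ?thesis
      unfolding h1(3)[OF y(1)] h2(3)[OF y(2)] PAct_props(3)[OF t h1(2)[OF y(1)] hh]
      by (simp add: h_def matrix_mul_assoc Spin_unitary[OF h1(2)[OF y(1)]])
  qed
  show thesis
    by (rule that[OF V _ _ _ sm _ tr]) (use assms W in \<open>auto simp: V_def h_def intro!: Spin_mult Spin_adjm h1 h2\<close>)
qed

lemma smooth_cov:
  assumes "open S" "smooth_on S h"
  shows "smooth_on S (\<lambda>p. cov (h p))"
proof (intro smooth_on_vecI assms)
  fix l k
  have "bounded_linear uncliff" using uncliff(1) by (simp add: linear_conv_bounded_linear)
  then have "smooth_on S (\<lambda>p. uncliff (h p ** \<gamma> k ** adjm (h p)) $ l)"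
    using assms
    by (intro smooth_on_component smooth_on_linear_image[of S uncliff] smooth_on_bilinear[OF _ bounded_bilinear_matmul]
        smooth_on_linear_image[OF _ bounded_linear_adjm] smooth_on_const)
  then show "smooth_on S (\<lambda>p. cov (h p) $ l $ k)" by (simp add: cov_def)
qed

lemma smooth_tact:
  assumes "open S" "smooth_on S A" "\<And>is. smooth_on S (\<lambda>p. F p is)"
  shows "smooth_on S (\<lambda>p. tact (A p) (F p) is)"
  using assms(3)
proof (induction "is" arbitrary: F)
  case (Cons i "is")
  have "smooth_on S (\<lambda>p. tact (A p) (slice (F p) k) is)" for k
    by (rule Cons.IH[of "\<lambda>p. slice (F p) k"]) (rule Cons.prems)
  then show ?case
    unfolding tact.simps by (intro smooth_on_sum smooth_on_scaleR smooth_on_component assms(1,2))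
qed simp

lemma smooth_Spin_act:
  assumes "open S" "smooth_on S h" "\<And>is. smooth_on S (\<lambda>p. F p is)" "\<And>p. p \<in> S \<Longrightarrow> h p \<in> Spin \<gamma>"
  shows "smooth_on S (\<lambda>p. Spin_act \<gamma> (h p) (F p) is)"
proof (rule smooth_on_cong[OF assms(1)])
  show "smooth_on S (\<lambda>p. h p *v tact (cov (h p)) (F p) is)"
    by (intro smooth_on_bilinear[OF _ bounded_bilinear_matvec] smooth_tact smooth_cov assms(1-3))
qed (simp add: Spin_act_eq assms(4))

text \<open>Smooth frames are given for the sections in \<open>PSecs\<close>. Near each point any
  other section is a translate of one of these by a smooth \<open>h\<close>, which rotates the frame
  by \<open>cov\<close>.\<close>

lemma lsec_frame_smooth:
  assumes \<sigma>: "lsec U \<sigma>" and c: "c \<in> Atlas M"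
  shows "smooth_on (snd c ` (fst c \<inter> U)) (\<lambda>p. PFrame P (\<sigma> (cinv c p)) k c)"
proof (rule smooth_on_local)
  fix p assume "p \<in> snd c ` (fst c \<inter> U)"
  note p = chart_imageD[OF c this]
  have "cinv c p \<in> topspace (Mtop M)" by (rule charts_at_topspace[OF p(4)])
  then obtain W \<tau> where W: "(W, \<tau>) \<in> PSecs P" "cinv c p \<in> W" by (rule PSecs_cover)
  obtain h where h: "smooth_map_on M (U \<inter> W) h" "\<And>y. y \<in> U \<inter> W \<Longrightarrow> h y \<in> Spin \<gamma>"
    "\<And>y. y \<in> U \<inter> W \<Longrightarrow> \<sigma> y = PAct P (\<tau> y) (h y)" by (rule lsec_transition[OF \<sigma> W(1)]) blast
  let ?T = "snd c ` (fst c \<inter> (U \<inter> W))"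
  have T: "open ?T"
    by (intro chart_image_open c openin_Int lsecD(1)[OF \<sigma>] lsecD(1)[OF PSecs_lsec[OF W(1)]])
  have "smooth_on ?T (\<lambda>p. \<Sum>l\<in>UNIV. (cov (h (cinv c p)) $ l $ k) *\<^sub>R PFrame P (\<tau> (cinv c p)) l c)"
    by (intro smooth_on_sum smooth_on_scaleR smooth_on_component smooth_cov smooth_map_onD h c T
        smooth_on_subset[OF PSecs_frame_smooth[OF W(1) c]]) auto
  then have "smooth_on ?T (\<lambda>p. PFrame P (\<sigma> (cinv c p)) k c)"
  proof (rule smooth_on_cong[OF T])
    fix q assume "q \<in> ?T"
    note q = chart_imageD[OF c this]
    have "\<tau> (cinv c q) \<in> PTot P" using lsecD(2)[OF PSecs_lsec[OF W(1)]] q(2) by blast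
    then show "(\<Sum>l\<in>UNIV. (cov (h (cinv c q)) $ l $ k) *\<^sub>R PFrame P (\<tau> (cinv c q)) l c) = PFrame P (\<sigma> (cinv c q)) k c"
      using h(2,3)[OF q(2)] by (simp add: frame_PAct)
  qed
  then show "\<exists>T. open T \<and> p \<in> T \<and> smooth_on T (\<lambda>p. PFrame P (\<sigma> (cinv c p)) k c)"
    using T p W(2) by (intro exI[of _ ?T]) (auto intro!: image_eqI[of p _ "cinv c p"])
qed

section \<open>Equivariant fields and sections through a given point of the bundle\<close>

definition fields :: "('p, 'n, 's) field set" where
  "fields = {f. (\<forall>u\<in>PTot P. \<forall>h\<in>Spin \<gamma>. \<forall>is. Spin_act \<gamma> h (f (PAct P u h)) is = f u is) \<and>
     (\<forall>(U, \<sigma>)\<in>PSecs P. \<forall>is. smooth_map_on M U (\<lambda>x. f (\<sigma> x) is))}"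

lemma fields_equivariant:
  "f \<in> fields \<Longrightarrow> u \<in> PTot P \<Longrightarrow> h \<in> Spin \<gamma> \<Longrightarrow> Spin_act \<gamma> h (f (PAct P u h)) is = f u is"
  by (simp add: fields_def)

lemma fields_inverse:
  assumes "f \<in> fields" "u \<in> PTot P" "h \<in> Spin \<gamma>"
  shows "f (PAct P u h) is = Spin_act \<gamma> (adjm h) (f u) is"
proof -
  have "f u = Spin_act \<gamma> h (f (PAct P u h))" using fields_equivariant[OF assms] by auto
  then show ?thesis by (simp add: Spin_act_inverse[OF assms(3)])
qed

lemma PSecs_field_smooth: "f \<in> fields \<Longrightarrow> (V, \<tau>) \<in> PSecs P \<Longrightarrow> smooth_map_on M V (\<lambda>x. f (\<tau> x) is)"
  unfolding fields_def by blast

lemma lsec_field_smooth: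
  assumes f: "f \<in> fields" and \<sigma>: "lsec U \<sigma>" and c: "c \<in> Atlas M"
  shows "smooth_on (snd c ` (fst c \<inter> U)) (\<lambda>p. f (\<sigma> (cinv c p)) is)"
proof (rule smooth_on_local)
  fix p assume "p \<in> snd c ` (fst c \<inter> U)"
  note p = chart_imageD[OF c this]
  have "cinv c p \<in> topspace (Mtop M)" by (rule charts_at_topspace[OF p(4)])
  then obtain W \<tau> where W: "(W, \<tau>) \<in> PSecs P" "cinv c p \<in> W" by (rule PSecs_cover)
  obtain h where h: "smooth_map_on M (U \<inter> W) h" "\<And>y. y \<in> U \<inter> W \<Longrightarrow> h y \<in> Spin \<gamma>"
    "\<And>y. y \<in> U \<inter> W \<Longrightarrow> \<sigma> y = PAct P (\<tau> y) (h y)" by (rule lsec_transition[OF \<sigma> W(1)]) blast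
  let ?T = "snd c ` (fst c \<inter> (U \<inter> W))"
  have T: "open ?T"
    by (intro chart_image_open c openin_Int lsecD(1)[OF \<sigma>] lsecD(1)[OF PSecs_lsec[OF W(1)]])
  have "smooth_on ?T (\<lambda>p. Spin_act \<gamma> (adjm (h (cinv c p))) (f (\<tau> (cinv c p))) is)"
  proof (rule smooth_Spin_act[OF T])
    show "smooth_on ?T (\<lambda>p. adjm (h (cinv c p)))"
      by (intro smooth_on_linear_image[OF T bounded_linear_adjm] smooth_map_onD h c)
    show "smooth_on ?T (\<lambda>p. f (\<tau> (cinv c p)) is)" for "is"
      by (rule smooth_on_subset[OF smooth_map_onD[OF PSecs_field_smooth[OF f W(1)] c]]) auto
    show "adjm (h (cinv c p)) \<in> Spin \<gamma>" if "p \<in> ?T" for p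
      by (intro Spin_adjm h chart_imageD[OF c that])
  qed
  then have "smooth_on ?T (\<lambda>p. f (\<sigma> (cinv c p)) is)"
  proof (rule smooth_on_cong[OF T])
    fix q assume "q \<in> ?T"
    note q = chart_imageD[OF c this]
    have "\<tau> (cinv c q) \<in> PTot P" using lsecD(2)[OF PSecs_lsec[OF W(1)]] q(2) by blast
    then show "Spin_act \<gamma> (adjm (h (cinv c q))) (f (\<tau> (cinv c q))) is = f (\<sigma> (cinv c q)) is"
      using h(2,3)[OF q(2)] by (simp add: fields_inverse[OF f])
  qed
  then show "\<exists>T. open T \<and> p \<in> T \<and> smooth_on T (\<lambda>p. f (\<sigma> (cinv c p)) is)"
    using T p W(2) by (intro exI[of _ ?T]) (auto intro!: image_eqI[of p _ "cinv c p"])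
qed

text \<open>Translate a section of the bundle atlas by the constant group element that carries its
  value to \<open>u\<close>.\<close>

lemma lsec_exists:
  assumes "u \<in> PTot P"
  shows "\<exists>\<sigma> U. PBase P u \<in> U \<and> lsec U \<sigma> \<and> \<sigma> (PBase P u) = u"
proof -
  let ?x = "PBase P u"
  obtain W \<tau> where W: "(W, \<tau>) \<in> PSecs P" "?x \<in> W" by (rule PSecs_cover[OF PTot_base[OF assms]])
  note \<tau> = PSecs_lsec[OF W(1)]
  obtain h where h: "h \<in> Spin \<gamma>" "u = PAct P (\<tau> ?x) h"
    using PAct_transitive[OF lsecD(2)[OF \<tau> W(2)] assms] lsecD(3)[OF \<tau> W(2)] by auto
  have "lsec W (\<lambda>y. PAct P (\<tau> y) h)"
    unfolding smooth_local_section_def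
  proof (intro conjI ballI, goal_cases)
    case 1
    show ?case by (rule lsecD(1)[OF \<tau>])
  next
    case (2 y)
    show ?case by (rule PAct_props(1)[OF lsecD(2)[OF \<tau> 2] h(1)])
  next
    case (3 y)
    show ?case using PAct_props(2)[OF lsecD(2)[OF \<tau> 3] h(1)] lsecD(3)[OF \<tau> 3] by simp
  next
    case (4 s)
    obtain V \<rho> where s: "s = (V, \<rho>)" by (cases s)
    have \<rho>: "(V, \<rho>) \<in> PSecs P" using 4 s by simp
    obtain k where k: "smooth_map_on M (W \<inter> V) k" "\<And>y. y \<in> W \<inter> V \<Longrightarrow> k y \<in> Spin \<gamma>"
      "\<And>y. y \<in> W \<inter> V \<Longrightarrow> \<tau> y = PAct P (\<rho> y) (k y)" by (rule lsec_transition[OF \<tau> \<rho>]) blast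
    have "smooth_map_on M (W \<inter> V) (\<lambda>y. k y ** h)"
    proof (rule smooth_map_onI)
      fix c assume c: "c \<in> Atlas M"
      show "smooth_on (snd c ` (fst c \<inter> (W \<inter> V))) (\<lambda>p. k (cinv c p) ** h)"
        by (intro smooth_on_bilinear[OF _ bounded_bilinear_matmul] chart_image_open c openin_Int lsecD(1)[OF \<tau>]
            lsecD(1)[OF PSecs_lsec[OF \<rho>]] smooth_map_onD[OF k(1) c] smooth_on_const)
    qed
    moreover have "k y ** h \<in> Spin \<gamma> \<and> PAct P (\<tau> y) h = PAct P (\<rho> y) (k y ** h)" if "y \<in> W \<inter> V" for y
      using k(2,3)[OF that] h(1) lsecD(2)[OF PSecs_lsec[OF \<rho>], of y] that by (simp add: Spin_mult PAct_props(3))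
    ultimately show ?case unfolding s by blast
  qed
  then show ?thesis using W(2) h(2) by (intro exI[of _ "\<lambda>y. PAct P (\<tau> y) h"] exI[of _ W]) simp
qed

lemma section_through:
  assumes "u \<in> PTot P"
  obtains U where "PBase P u \<in> U" "lsec U (section_through M \<gamma> P u)" "section_through M \<gamma> P u (PBase P u) = u"
  using someI_ex[OF lsec_exists[OF assms]] unfolding section_through_def by blast

end

context spin_geometry
begin

section \<open>Independence of the covariant derivative from charts and sections\<close>

abbreviation dom :: "('m, 'n) chart \<Rightarrow> 'm set \<Rightarrow> (real^'n) set" where
  "dom c U \<equiv> snd c ` (fst c \<inter> U)"

abbreviation fr :: "('m \<Rightarrow> 'p) \<Rightarrow> ('m, 'n) chart \<Rightarrow> 'n \<Rightarrow> real^'n \<Rightarrow> real^'n" where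
  "fr \<sigma> c \<equiv> (\<lambda>k p. PFrame P (\<sigma> (cinv c p)) k c)"

lemma lsec_local_frame:
  assumes \<sigma>: "lsec U \<sigma>" and c: "c \<in> Atlas M"
  shows "local_frame \<gamma> (dom c U) (metric_coord M c) (fr \<sigma> c)"
proof (intro local_frame.intro local_frame_axioms.intro spinor_axioms)
  have sub: "p \<in> snd c ` fst c" if "p \<in> dom c U" for p using that by auto
  show "open (dom c U)" by (rule chart_image_open[OF c lsecD(1)[OF \<sigma>]])
  show "smooth_on (dom c U) (\<lambda>p. metric_coord M c p v w)" for v w
    by (rule smooth_on_subset[OF metric_coord_smooth[OF c]]) auto
  show "smooth_on (dom c U) (fr \<sigma> c a)" for a
    by (rule lsec_frame_smooth[OF \<sigma> c])
  show "metric_coord M c p v w = metric_coord M c p w v" if "p \<in> dom c U" for p v w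
    by (rule metric_coord_sym_linear(1)[OF c sub[OF that]])
  show "linear (metric_coord M c p v)" if "p \<in> dom c U" for p v
    by (rule metric_coord_sym_linear(2)[OF c sub[OF that]])
  show "metric_coord M c p (fr \<sigma> c a p) (fr \<sigma> c b p) = (if a = b then 1 else 0)" if "p \<in> dom c U" for p a b
  proof -
    note q = chart_imageD[OF c that]
    show ?thesis
      using metric_coord_eq[OF frame_tangent[OF lsecD(2)[OF \<sigma> q(2)]] frame_tangent[OF lsecD(2)[OF \<sigma> q(2)]], of c a b]
        frame_orthonormal[OF lsecD(2)[OF \<sigma> q(2)], of a b] q
      by (simp add: lsecD(3)[OF \<sigma> q(2)])
  qed
qed

lemma dom_mem: "c \<in> charts_at M x \<Longrightarrow> x \<in> U \<Longrightarrow> snd c x \<in> dom c U"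
  by (auto simp: charts_at_def)

lemma fr_at: "c \<in> charts_at M x \<Longrightarrow> fr \<sigma> c k (snd c x) = PFrame P (\<sigma> x) k c"
  using charts_atD[of c x] by simp

lemma lsec_frame_tangent: "lsec U \<sigma> \<Longrightarrow> x \<in> U \<Longrightarrow> PFrame P (\<sigma> x) k \<in> tangent_space M x"
  using frame_tangent[of "\<sigma> x" k] lsecD(2,3)[of U \<sigma> x] by simp

lemma lsec_topspace: "lsec U \<sigma> \<Longrightarrow> x \<in> U \<Longrightarrow> x \<in> topspace (Mtop M)"
  using lsecD(1) openin_subset by blast

lemma christoffel_eq: "local_frame.\<Gamma> (metric_coord M c) p v w = christoffel M c p v w"
  if "local_frame \<gamma> \<Omega> (metric_coord M c) e"
proof -
  interpret L: local_frame \<gamma> \<Omega> "metric_coord M c" e by (rule that)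
  show ?thesis by (simp add: L.\<Gamma>_def L.koszul_def christoffel_def)
qed

lemma metric_frame_component:
  assumes "lsec U \<sigma>" "x \<in> U" "c \<in> charts_at M x"
  shows "Metric M x (coord_vec M c x v) (PFrame P (\<sigma> x) a) = metric_coord M c (snd c x) v (PFrame P (\<sigma> x) a c)"
  using metric_coord_eq[OF coord_vec_tangent[OF assms(3)] lsec_frame_tangent[OF assms(1,2)] assms(3), of v a]
  by (simp add: coord_vec_self[OF assms(3)])

lemma conn_form_chart_at:
  assumes \<sigma>: "lsec U \<sigma>" and x: "x \<in> U"
  defines "c \<equiv> chart_at M x"
  shows "conn_form M P \<sigma> x X = local_frame.\<omega> (metric_coord M c) (fr \<sigma> c) (snd c x) (X c)"
proof -
  have c: "c \<in> charts_at M x" unfolding c_def by (rule charts_at_nonempty[OF lsec_topspace[OF \<sigma> x]])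
  note L = lsec_local_frame[OF \<sigma> charts_atD(1)[OF c]]
  interpret L: local_frame \<gamma> "dom c U" "metric_coord M c" "fr \<sigma> c" by (rule L)
  show ?thesis
    unfolding conn_form_def L.\<omega>_def levi_civita_def Let_def c_def[symmetric] metric_frame_component[OF \<sigma> x c]
      christoffel_eq[OF L] fr_at[OF c] ..
qed

text \<open>Differentiating the relation \<open>rel\<close> between the two coordinate frames adds a
  second derivative of the chart change, which is symmetric and drops out of the bracket.\<close>

lemma bracket_chart_change:
  assumes \<sigma>: "lsec U \<sigma>" and x: "x \<in> U" and c: "c \<in> charts_at M x" and d: "d \<in> charts_at M x"
  shows "local_frame.bracket (fr \<sigma> d) k b (snd d x) =
    fder (snd d \<circ> cinv c) (snd c x) (local_frame.bracket (fr \<sigma> c) k b (snd c x))"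
proof -
  note cA = charts_atD[OF c] and dA = charts_atD[OF d]
  interpret Lc: local_frame \<gamma> "dom c U" "metric_coord M c" "fr \<sigma> c" by (rule lsec_local_frame[OF \<sigma> cA(1)])
  interpret Ld: local_frame \<gamma> "dom d U" "metric_coord M d" "fr \<sigma> d" by (rule lsec_local_frame[OF \<sigma> dA(1)])
  define \<phi> where "\<phi> = snd d \<circ> cinv c"
  define p where "p = snd c x"
  define N where "N = dom c (fst d \<inter> U)"
  have N: "open N" unfolding N_def
    by (intro chart_image_open cA openin_Int atlas_props(1) dA lsecD(1)[OF \<sigma>])
  have pN: "p \<in> N" using cA dA x by (auto simp: N_def p_def)
  have \<phi>p: "\<phi> p = snd d x" using cA by (simp add: \<phi>_def p_def)
  have sm: "smooth_on N \<phi>"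
    unfolding \<phi>_def N_def by (rule smooth_on_subset[OF transition_smooth[OF cA(1) dA(1)]]) auto
  have pd: "\<phi> p \<in> dom d U" unfolding \<phi>p using dom_mem[OF d x] .
  have pc: "p \<in> dom c U" unfolding p_def using dom_mem[OF c x] .
  have rel: "fr \<sigma> d k (\<phi> q) = fder \<phi> q (fr \<sigma> c k q)" if "q \<in> N" for q k
  proof -
    note q = chart_imageD[OF cA(1) that[unfolded N_def]]
    have "d \<in> charts_at M (cinv c q)" using q dA by (simp add: charts_at_def)
    from tangent_spaceD[OF lsec_frame_tangent[OF \<sigma>, of "cinv c q"] q(4) this, of k]
    show ?thesis using q dA(1) by (simp add: \<phi>_def)
  qed
  have der: "fder (fr \<sigma> d k) (\<phi> p) (fr \<sigma> d b (\<phi> p)) =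
     fder (\<lambda>q. fder \<phi> q (fr \<sigma> c k p)) p (fr \<sigma> c b p) + fder \<phi> p (fder (fr \<sigma> c k) p (fr \<sigma> c b p))" for k b
  proof -
    have 1: "fder (\<lambda>q. fr \<sigma> d k (\<phi> q)) p = fder (\<lambda>q. fder \<phi> q (fr \<sigma> c k q)) p"
      by (rule fder_cong_open[OF N pN rel])
    have 2: "fder (\<lambda>q. fr \<sigma> d k (\<phi> q)) p h = fder (fr \<sigma> d k) (\<phi> p) (fder \<phi> p h)" for h
      using frechet_derivative_compose[OF smooth_on_differentiable[OF sm pN] Ld.e_differentiable[OF pd, of k]]
      by (simp add: o_def)
    have 3: "fder (\<lambda>q. fder \<phi> q (fr \<sigma> c k q)) p h =
        fder (\<lambda>q. fder \<phi> q (fr \<sigma> c k p)) p h + fder \<phi> p (fder (fr \<sigma> c k) p h)" for h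
      by (rule fder_linear_family(1)[OF N pN linear_fder[OF smooth_on_differentiable[OF sm]]
            smooth_on_differentiable[OF smooth_on_fder[OF sm] pN] Lc.e_differentiable[OF pc]])
    show ?thesis
      unfolding rel[OF pN, of b] 2[symmetric] 1 3 ..
  qed
  have lin: "linear (fder \<phi> p)" by (rule linear_fder[OF smooth_on_differentiable[OF sm pN]])
  have "local_frame.bracket (fr \<sigma> d) k b (\<phi> p) = fder \<phi> p (local_frame.bracket (fr \<sigma> c) k b p)"
    unfolding Lc.bracket_def Ld.bracket_def der linear_diff[OF lin]
    using smooth_on_fder_commute[OF N pN sm, of "fr \<sigma> c b p" "fr \<sigma> c k p"] by simp
  then show ?thesis by (simp add: \<phi>p) (simp add: \<phi>_def p_def)
qed

text \<open>\<open>\<omega>_bracket\<close> expresses the connection matrix by inner products of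
  brackets with frame vectors, and both are tensorial. This takes the place of the transformation
  law of Christoffel symbols.\<close>

lemma conn_form_chart:
  assumes \<sigma>: "lsec U \<sigma>" and x: "x \<in> U" and d: "d \<in> charts_at M x"
  shows "conn_form M P \<sigma> x (PFrame P (\<sigma> x) k) = local_frame.\<omega> (metric_coord M d) (fr \<sigma> d) (snd d x) (fr \<sigma> d k (snd d x))"
proof -
  define c where "c = chart_at M x"
  have c: "c \<in> charts_at M x" unfolding c_def by (rule charts_at_nonempty[OF lsec_topspace[OF \<sigma> x]])
  note cA = charts_atD[OF c] and dA = charts_atD[OF d]
  interpret Lc: local_frame \<gamma> "dom c U" "metric_coord M c" "fr \<sigma> c" by (rule lsec_local_frame[OF \<sigma> cA(1)])
  interpret Ld: local_frame \<gamma> "dom d U" "metric_coord M d" "fr \<sigma> d" by (rule lsec_local_frame[OF \<sigma> dA(1)])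
  have g: "metric_coord M d (snd d x) (Ld.bracket a b (snd d x)) (fr \<sigma> d k (snd d x))
     = metric_coord M c (snd c x) (Lc.bracket a b (snd c x)) (fr \<sigma> c k (snd c x))" for a b k
    unfolding fr_at[OF c] fr_at[OF d] metric_frame_component[OF \<sigma> x c, symmetric] metric_frame_component[OF \<sigma> x d, symmetric]
      bracket_chart_change[OF \<sigma> x c d] coord_vec_change[OF c d] ..
  have "2 * Lc.\<omega> (snd c x) (fr \<sigma> c k (snd c x)) $ a $ b = 2 * Ld.\<omega> (snd d x) (fr \<sigma> d k (snd d x)) $ a $ b" for a b
    unfolding Lc.\<omega>_bracket[OF dom_mem[OF c x]] Ld.\<omega>_bracket[OF dom_mem[OF d x]] g ..
  then have "Lc.\<omega> (snd c x) (fr \<sigma> c k (snd c x)) = Ld.\<omega> (snd d x) (fr \<sigma> d k (snd d x))"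
    by (simp add: vec_eq_iff)
  then show ?thesis
    unfolding conn_form_chart_at[OF \<sigma> x, folded c_def] fr_at[OF c, symmetric] .
qed

text \<open>\<open>nabla\<close> with the local section as a parameter in place of the arbitrary
  choice \<open>section_through\<close>.\<close>

definition lnabla :: "('m \<Rightarrow> 'p) \<Rightarrow> ('p, 'n, 's) field \<Rightarrow> 'm \<Rightarrow> ('n, 's) stensor" where
  "lnabla \<sigma> f x is = (case is of [] \<Rightarrow> 0
     | k # ks \<Rightarrow> dir_deriv M x (PFrame P (\<sigma> x) k) (\<lambda>y. f (\<sigma> y) ks)
         + so_act \<gamma> (conn_form M P \<sigma> x (PFrame P (\<sigma> x) k)) (f (\<sigma> x)) ks)"

lemma nabla_lnabla:
  assumes "\<sigma> = section_through M \<gamma> P u" "\<sigma> (PBase P u) = u"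
  shows "nabla M \<gamma> P f u = lnabla \<sigma> f (PBase P u)"
  using assms(2) by (auto simp: fun_eq_iff nabla_def lnabla_def Let_def assms(1) split: list.split)

lemma field_differentiable:
  assumes f: "f \<in> fields" and \<sigma>: "lsec U \<sigma>" and x: "x \<in> U" and c: "c \<in> charts_at M x"
  shows "((\<lambda>y. f (\<sigma> y) is) \<circ> cinv c) differentiable (at (snd c x))"
  using smooth_on_differentiable[OF lsec_field_smooth[OF f \<sigma> charts_atD(1)[OF c]] dom_mem[OF c x]]
  by (simp add: o_def)

lemma lnabla_chart:
  assumes f: "f \<in> fields" and \<sigma>: "lsec U \<sigma>" and x: "x \<in> U" and c: "c \<in> charts_at M x"
  shows "lnabla \<sigma> f x is = local_frame.cov_deriv \<gamma> (metric_coord M c) (fr \<sigma> c) (\<lambda>p. f (\<sigma> (cinv c p))) (snd c x) is"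
proof -
  interpret L: local_frame \<gamma> "dom c U" "metric_coord M c" "fr \<sigma> c" by (rule lsec_local_frame[OF \<sigma> charts_atD(1)[OF c]])
  show ?thesis
  proof (cases "is")
    case (Cons k ks)
    have "dir_deriv M x (PFrame P (\<sigma> x) k) (\<lambda>y. f (\<sigma> y) ks)
       = fder ((\<lambda>y. f (\<sigma> y) ks) \<circ> cinv c) (snd c x) (PFrame P (\<sigma> x) k c)"
      by (rule dir_deriv_chart[OF lsec_frame_tangent[OF \<sigma> x] c field_differentiable[OF f \<sigma> x c]])
    then show ?thesis
      using conn_form_chart[OF \<sigma> x c, of k] charts_atD[OF c] by (simp add: Cons lnabla_def o_def)
  qed (simp add: lnabla_def)
qed

text \<open>The transformation law of a connection matrix under a change of frame; the inhomogeneous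
  term comes from differentiating the coefficients of the new frame.\<close>

lemma gauge_connection:
  assumes L: "local_frame \<gamma> T g e" and L': "local_frame \<gamma> T g e'"
    and p: "p \<in> T" and H: "smooth_on T H" "\<And>q. q \<in> T \<Longrightarrow> H q \<in> Spin \<gamma>"
    and rel: "\<And>q k. q \<in> T \<Longrightarrow> e' k q = (\<Sum>l\<in>UNIV. (cov (H q) $ l $ k) *\<^sub>R e l q)"
  shows "cov (H p) ** local_frame.\<omega> g e' p v ** transpose (cov (H p)) =
    local_frame.\<omega> g e p v + fder (\<lambda>q. cov (H q)) p v ** transpose (cov (H p))"
proof -
  interpret L: local_frame \<gamma> T g e by (rule L)
  interpret L': local_frame \<gamma> T g e' by (rule L')
  define A where "A = cov (H p)"
  define A' where "A' = fder (\<lambda>q. cov (H q)) p v"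
  note O = cov_orthogonal[OF H(2)[OF p], folded A_def]
  have dA: "(\<lambda>q. cov (H q)) differentiable (at p)"
    by (rule smooth_on_differentiable[OF smooth_cov[OF L.open_domain H(1)] p])
  have dAlk: "(\<lambda>q. cov (H q) $ l $ k) differentiable (at p)" for l k
    by (intro differentiable_linear_image[OF bounded_linear_vec_nth] dA)
  have fA: "fder (\<lambda>q. cov (H q) $ l $ k) p v = A' $ l $ k" for l k
    unfolding A'_def by (simp add: fder_component dA differentiable_linear_image[OF bounded_linear_vec_nth])
  have de': "fder (e' b) p v = (\<Sum>l\<in>UNIV. (A $ l $ b) *\<^sub>R fder (e l) p v + (A' $ l $ b) *\<^sub>R e l p)" for b
  proof -
    have "fder (e' b) p v = fder (\<lambda>q. \<Sum>l\<in>UNIV. (cov (H q) $ l $ b) *\<^sub>R e l q) p v"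
      by (subst fder_cong_open[OF L.open_domain p rel]) auto
    also have "\<dots> = (\<Sum>l\<in>UNIV. (A $ l $ b) *\<^sub>R fder (e l) p v + (A' $ l $ b) *\<^sub>R e l p)"
      by (subst fder_sum) (auto simp: fder_bilinear[OF bounded_bilinear_scaleR dAlk L.e_differentiable[OF p]] fA A_def
          intro!: differentiable_bilinear[OF bounded_bilinear_scaleR] dAlk L.e_differentiable[OF p])
    finally show ?thesis .
  qed
  have tm: "(transpose A ** C) $ a $ b = (\<Sum>m\<in>UNIV. A $ m $ a * C $ m $ b)" for C a b
    by (simp add: matrix_matrix_mult_def transpose_def)
  have "L'.\<omega> p v $ a $ b = (transpose A ** (L.\<omega> p v ** A + A')) $ a $ b" for a b
  proof -
    have "fder (e' b) p v + L.\<Gamma> p v (e' b p) =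
      (\<Sum>l\<in>UNIV. (A $ l $ b) *\<^sub>R (fder (e l) p v + L.\<Gamma> p v (e l p))) + (\<Sum>m\<in>UNIV. (A' $ m $ b) *\<^sub>R e m p)"
      unfolding de' rel[OF p]
      by (simp add: A_def linear_sum[OF L.\<Gamma>_linear(1)[OF p]] linear_scale[OF L.\<Gamma>_linear(1)[OF p]]
          scaleR_add_right sum.distrib)
    also have "(\<Sum>l\<in>UNIV. (A $ l $ b) *\<^sub>R (fder (e l) p v + L.\<Gamma> p v (e l p))) = (\<Sum>m\<in>UNIV. ((L.\<omega> p v ** A) $ m $ b) *\<^sub>R e m p)"
      unfolding L.covariant_frame[OF p] scaleR_sum_right
      by (subst sum.swap) (simp add: matrix_matrix_mult_def scaleR_sum_left mult.commute)
    finally have "fder (e' b) p v + L.\<Gamma> p v (e' b p) = (\<Sum>m\<in>UNIV. ((L.\<omega> p v ** A + A') $ m $ b) *\<^sub>R e m p)"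
      by (simp add: scaleR_add_left sum.distrib)
    then have "L'.\<omega> p v $ a $ b = g p (\<Sum>m\<in>UNIV. ((L.\<omega> p v ** A + A') $ m $ b) *\<^sub>R e m p) (\<Sum>l\<in>UNIV. (A $ l $ a) *\<^sub>R e l p)"
      unfolding L'.\<omega>_def by (simp add: rel[OF p] A_def)
    also have "\<dots> = (\<Sum>m\<in>UNIV. A $ m $ a * (L.\<omega> p v ** A + A') $ m $ b)"
      by (simp add: L.g_simps p L.e_orthonormal if_distrib cong: if_cong)
    finally show ?thesis unfolding tm .
  qed
  then have eq: "L'.\<omega> p v = transpose A ** (L.\<omega> p v ** A + A')" by (simp add: vec_eq_iff)
  have "A ** L'.\<omega> p v ** transpose A = (A ** transpose A) ** (L.\<omega> p v ** A + A') ** transpose A"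
    unfolding eq by (simp add: matrix_mul_assoc)
  also have "\<dots> = L.\<omega> p v ** (A ** transpose A) + A' ** transpose A"
    unfolding O by (simp add: matrix_add_rdistrib O flip: matrix_mul_assoc)
  finally show ?thesis by (simp add: O) (simp add: A_def A'_def)
qed

text \<open>Differentiating the group element that relates the two sections produces
  \<open>so_act\<close> of \<open>B X\<close>, and the connection matrix changes by the same
  \<open>B X\<close>. For \<open>h = mat 1\<close> this shows that only the value of the section at
  \<open>x\<close> matters, for general \<open>h\<close> that \<open>nabla\<close> is
  equivariant.\<close>

lemma lnabla_gauge:
  assumes f: "f \<in> fields" and \<sigma>: "lsec U \<sigma>" and \<sigma>': "lsec U' \<sigma>'" and x: "x \<in> U" "x \<in> U'"
    and h: "h \<in> Spin \<gamma>" "\<sigma>' x = PAct P (\<sigma> x) h"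
  shows "Spin_act \<gamma> h (lnabla \<sigma>' f x) is = lnabla \<sigma> f x is"
proof -
  obtain V k where V: "openin (Mtop M) V" "x \<in> V" "V \<subseteq> U" "V \<subseteq> U'" "smooth_map_on M V k"
    "\<And>y. y \<in> V \<Longrightarrow> k y \<in> Spin \<gamma>" "\<And>y. y \<in> V \<Longrightarrow> \<sigma>' y = PAct P (\<sigma> y) (k y)"
    by (rule lsec_transition2[OF \<sigma> \<sigma>' x]) blast
  have "k x = h"
    using PAct_transitive[OF lsecD(2)[OF \<sigma> x(1)] lsecD(2)[OF \<sigma>' x(2)]] lsecD(3)[OF \<sigma> x(1)] lsecD(3)[OF \<sigma>' x(2)]
      V(2,6,7) h by auto
  define c where "c = chart_at M x"
  have c: "c \<in> charts_at M x" unfolding c_def by (rule charts_at_nonempty[OF lsec_topspace[OF \<sigma> x(1)]])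
  note cA = charts_atD[OF c]
  \<comment> \<open>Both sections are restricted to \<open>V\<close>, because
    \<open>gauge_connection\<close> compares two frames over the same domain.\<close>
  have restr: "lsec V \<tau>" if W: "lsec W \<tau>" "V \<subseteq> W" for W \<tau>
    unfolding smooth_local_section_def
  proof (intro conjI ballI, goal_cases)
    case (4 s)
    obtain Y \<rho> where s: "s = (Y, \<rho>)" by (cases s)
    have \<rho>: "(Y, \<rho>) \<in> PSecs P" using 4 s by simp
    obtain h where h: "smooth_map_on M (W \<inter> Y) h" "\<And>y. y \<in> W \<inter> Y \<Longrightarrow> h y \<in> Spin \<gamma>"
      "\<And>y. y \<in> W \<inter> Y \<Longrightarrow> \<tau> y = PAct P (\<rho> y) (h y)"
      by (rule lsec_transition[OF W(1) \<rho>]) blast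
    have "smooth_map_on M (V \<inter> Y) h" by (rule smooth_map_on_subset[OF h(1)]) (use W(2) in auto)
    then show ?case unfolding s using h(2,3) W(2) by blast
  qed (use V(1) lsecD[OF W(1)] W(2) in auto)
  let ?T = "dom c V" and ?p = "snd c x"
  define H where "H p = k (cinv c p)" for p
  define F where "F p = f (\<sigma> (cinv c p))" for p
  define F' where "F' p = f (\<sigma>' (cinv c p))" for p
  have L: "local_frame \<gamma> ?T (metric_coord M c) (fr \<sigma> c)"
    by (rule lsec_local_frame[OF restr[OF \<sigma> V(3)] cA(1)])
  have L': "local_frame \<gamma> ?T (metric_coord M c) (fr \<sigma>' c)"
    by (rule lsec_local_frame[OF restr[OF \<sigma>' V(4)] cA(1)])
  interpret L: local_frame \<gamma> ?T "metric_coord M c" "fr \<sigma> c" by (rule L)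
  interpret L': local_frame \<gamma> ?T "metric_coord M c" "fr \<sigma>' c" by (rule L')
  have p: "?p \<in> ?T" by (rule dom_mem[OF c V(2)])
  have Hs: "smooth_on ?T H" unfolding H_def by (rule smooth_map_onD[OF V(5) cA(1)])
  have HS: "H q \<in> Spin \<gamma>" if "q \<in> ?T" for q
    unfolding H_def by (rule V(6)[OF chart_imageD(2)[OF cA(1) that]])
  have Hp: "H ?p = h" using cA \<open>k x = h\<close> by (simp add: H_def)
  have e': "fr \<sigma>' c l q = (\<Sum>m\<in>UNIV. (cov (H q) $ m $ l) *\<^sub>R fr \<sigma> c m q)" if "q \<in> ?T" for l q
  proof -
    note q = chart_imageD(2)[OF cA(1) that]
    show ?thesis
      unfolding V(7)[OF q] H_def by (rule frame_PAct[OF lsecD(2)[OF \<sigma>] V(6)[OF q]]) (use q V(3) in auto)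
  qed
  have FF: "Spin_act \<gamma> (H q) (F' q) is = F q is" if "q \<in> ?T" for q "is"
  proof -
    note q = chart_imageD(2)[OF cA(1) that]
    show ?thesis
      unfolding F_def F'_def H_def V(7)[OF q]
      by (rule fields_equivariant[OF f lsecD(2)[OF \<sigma>] V(6)[OF q]]) (use q V(3) in auto)
  qed
  have FFp: "Spin_act \<gamma> h (F' ?p) = F ?p" using FF[OF p] by (auto simp: Hp)
  have dF': "(\<lambda>q. F' q is) differentiable (at ?p)" for "is"
    using field_differentiable[OF f \<sigma>' x(2) c, of "is"] by (simp add: F'_def o_def)
  define B where "B X = fder (\<lambda>y. cov (H y)) ?p X ** transpose (cov h)" for X
  have dF: "fder (\<lambda>q. F q is) ?p X = Spin_act \<gamma> h (\<lambda>is. fder (\<lambda>q. F' q is) ?p X) is + so_act \<gamma> (B X) (F ?p) is" for X "is"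
  proof -
    have "fder (\<lambda>q. F q is) ?p = fder (\<lambda>q. Spin_act \<gamma> (H q) (F' q) is) ?p"
      by (rule fder_cong_open[OF L.open_domain p]) (simp add: FF)
    also have "\<dots> = (\<lambda>X. Spin_act \<gamma> (H ?p) (\<lambda>is. fder (\<lambda>q. F' q is) ?p X) is
        + so_act \<gamma> (fder (\<lambda>y. cov (H y)) ?p X ** transpose (cov (H ?p))) (Spin_act \<gamma> (H ?p) (F' ?p)) is)"
      by (rule fder_eq, rule Spin_act_has_derivative[OF has_fder[OF smooth_on_differentiable[OF Hs p]] L.open_domain p HS])
        (auto intro: has_fder[OF dF'])
    finally show ?thesis by (simp add: Hp FFp B_def)
  qed
  define D where "D X is = fder (\<lambda>q. F q is) ?p X + so_act \<gamma> (L.\<omega> ?p X) (F ?p) is" for X "is"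
  define D' where "D' X is = fder (\<lambda>q. F' q is) ?p X + so_act \<gamma> (L'.\<omega> ?p X) (F' ?p) is" for X "is"
  have DD: "Spin_act \<gamma> h (D' X) is = D X is" for X "is"
  proof -
    have "Spin_act \<gamma> h (D' X) is = Spin_act \<gamma> h (\<lambda>is. fder (\<lambda>q. F' q is) ?p X) is
       + so_act \<gamma> (cov h ** L'.\<omega> ?p X ** transpose (cov h)) (F ?p) is"
      unfolding D'_def[abs_def] Spin_act_add[OF h(1)] Spin_act_so_act[OF h(1)] FFp ..
    also have "cov h ** L'.\<omega> ?p X ** transpose (cov h) = L.\<omega> ?p X + B X"
      using gauge_connection[OF L L' p Hs HS e', of X] by (simp add: Hp B_def)
    finally show ?thesis
      by (simp add: D_def dF linear_add[OF linear_so_act_matrix])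
  qed
  have linD: "linear (\<lambda>X. D X is)" for "is"
  proof -
    have "(\<lambda>q. F q is) differentiable (at ?p)"
      using field_differentiable[OF f \<sigma> x(1) c, of "is"] by (simp add: F_def o_def)
    moreover have "linear (\<lambda>X. so_act \<gamma> (L.\<omega> ?p X) (F ?p) is)"
      using linear_compose[OF L.\<omega>_linear[OF p] linear_so_act_matrix] by (simp add: o_def)
    ultimately show ?thesis unfolding D_def by (intro linear_compose_add linear_fder)
  qed
  show ?thesis
  proof (cases "is")
    case Nil
    then show ?thesis by (simp add: Spin_act_eq[OF h(1)] lnabla_def)
  next
    case (Cons i ks)
    have n': "slice (lnabla \<sigma>' f x) l = D' (fr \<sigma>' c l ?p)" for l
      unfolding lnabla_chart[OF f \<sigma>' x(2) c] L'.cov_deriv_simps D'_def F'_def by (rule ext) (rule refl)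
    have n: "lnabla \<sigma> f x (i # ks) = D (fr \<sigma> c i ?p) ks"
      unfolding lnabla_chart[OF f \<sigma> x(1) c] L.cov_deriv_simps D_def F_def ..
    have "Spin_act \<gamma> h (lnabla \<sigma>' f x) (i # ks) = (\<Sum>l\<in>UNIV. (cov h $ i $ l) *\<^sub>R D (fr \<sigma>' c l ?p) ks)"
      unfolding Spin_act_Cons[OF h(1)] n' DD ..
    also have "\<dots> = (\<Sum>l\<in>UNIV. \<Sum>m\<in>UNIV. (cov h $ i $ l * cov h $ m $ l) *\<^sub>R D (fr \<sigma> c m ?p) ks)"
      unfolding e'[OF p] Hp linear_sum[OF linD] linear_scale[OF linD] scaleR_sum_right scaleR_scaleR ..
    also have "\<dots> = D (fr \<sigma> c i ?p) ks" by (rule sum_orthogonal[OF h(1)])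
    finally show ?thesis unfolding Cons n .
  qed
qed

text \<open>The section chosen inside \<open>nabla\<close> has the same value at \<open>x\<close> as
  \<sigma>, so the two differ there by the identity of the group and \<open>lnabla_gauge\<close>
  applies.\<close>

lemma nabla_lsec:
  assumes f: "f \<in> fields" and \<sigma>: "lsec U \<sigma>" and x: "x \<in> U"
  shows "nabla M \<gamma> P f (\<sigma> x) is = lnabla \<sigma> f x is"
proof -
  note u = lsecD(2)[OF \<sigma> x] and b = lsecD(3)[OF \<sigma> x]
  define \<tau> where "\<tau> = section_through M \<gamma> P (\<sigma> x)"
  obtain V where V: "x \<in> V" "lsec V \<tau>" "\<tau> x = \<sigma> x"
    unfolding \<tau>_def by (rule section_through[OF u]) (simp add: b)
  have "nabla M \<gamma> P f (\<sigma> x) is = lnabla \<tau> f x is"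
    using nabla_lnabla[OF \<tau>_def, of f] V(3) by (simp add: b)
  also have "\<dots> = lnabla \<sigma> f x is"
    using lnabla_gauge[OF f \<sigma> V(2) x V(1) Spin_one, of "is"] V(3) by (simp add: PAct_one[OF u] Spin_act_one)
  finally show ?thesis .
qed

lemma nabla_lsec_chart:
  assumes f: "f \<in> fields" and \<sigma>: "lsec U \<sigma>" and c: "c \<in> Atlas M" and p: "p \<in> dom c U"
  shows "nabla M \<gamma> P f (\<sigma> (cinv c p)) is
    = local_frame.cov_deriv \<gamma> (metric_coord M c) (fr \<sigma> c) (\<lambda>p. f (\<sigma> (cinv c p))) p is"
  using nabla_lsec[OF f \<sigma> chart_imageD(2)[OF c p]] lnabla_chart[OF f \<sigma> chart_imageD(2)[OF c p] chart_imageD(4)[OF c p]]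
  by (simp add: chart_imageD(3)[OF c p])

text \<open>Equivariance is \<open>lnabla_gauge\<close>. Smoothness is seen in one chart and
  section, where \<open>nabla_lsec_chart\<close> replaces the pointwise choices by
  \<open>cov_deriv\<close>. This makes it possible to iterate \<open>nabla\<close>.\<close>

lemma nabla_fields:
  assumes f: "f \<in> fields"
  shows "nabla M \<gamma> P f \<in> fields"
  unfolding fields_def
proof (rule CollectI, intro conjI ballI allI)
  fix u h "is" assume u: "u \<in> PTot P" and h: "h \<in> Spin \<gamma>"
  define \<sigma> where "\<sigma> = section_through M \<gamma> P u"
  define \<sigma>' where "\<sigma>' = section_through M \<gamma> P (PAct P u h)"
  note uh = PAct_props[OF u h]
  obtain U where U: "PBase P u \<in> U" "lsec U \<sigma>" "\<sigma> (PBase P u) = u"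
    unfolding \<sigma>_def by (rule section_through[OF u])
  obtain U' where U': "PBase P u \<in> U'" "lsec U' \<sigma>'" "\<sigma>' (PBase P u) = PAct P u h"
    unfolding \<sigma>'_def by (rule section_through[OF uh(1)]) (simp add: uh(2))
  have "nabla M \<gamma> P f (PAct P u h) = lnabla \<sigma>' f (PBase P u)"
    using nabla_lnabla[OF \<sigma>'_def, of f] U'(3) uh(2) by simp
  moreover have "nabla M \<gamma> P f u = lnabla \<sigma> f (PBase P u)"
    using nabla_lnabla[OF \<sigma>_def, of f] U(3) by simp
  ultimately show "Spin_act \<gamma> h (nabla M \<gamma> P f (PAct P u h)) is = nabla M \<gamma> P f u is"
    using lnabla_gauge[OF f U(2) U'(2) U(1) U'(1) h, of "is"] U(3) U'(3) by simp
next
  fix s assume s: "s \<in> PSecs P"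
  obtain V \<tau> where V: "s = (V, \<tau>)" by (cases s)
  have \<tau>: "lsec V \<tau>" using PSecs_lsec s V by blast
  have "smooth_map_on M V (\<lambda>x. nabla M \<gamma> P f (\<tau> x) is)" for "is"
  proof (rule smooth_map_onI)
    fix c assume c: "c \<in> Atlas M"
    interpret L: local_frame \<gamma> "dom c V" "metric_coord M c" "fr \<tau> c" by (rule lsec_local_frame[OF \<tau> c])
    show "smooth_on (dom c V) (\<lambda>p. nabla M \<gamma> P f (\<tau> (cinv c p)) is)"
      by (rule smooth_on_cong[OF L.open_domain L.cov_deriv_smooth])
        (rule lsec_field_smooth[OF f \<tau> c], rule nabla_lsec_chart[OF f \<tau> c, symmetric])
  qed
  then show "case s of (U, \<sigma>) \<Rightarrow> \<forall>is. smooth_map_on M U (\<lambda>x. nabla M \<gamma> P f (\<sigma> x) is)"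
    by (simp add: V)
qed

text \<open>Every point of the bundle lies on a local section, so pointwise statements about \<open>nabla\<close>
  reduce to the coordinate expression \<open>cov_deriv\<close>.\<close>

lemma local_expression:
  assumes "u \<in> PTot P"
  obtains \<sigma> U c where "lsec U \<sigma>" "PBase P u \<in> U" "\<sigma> (PBase P u) = u" "c = chart_at M (PBase P u)"
    "c \<in> charts_at M (PBase P u)" "c \<in> Atlas M" "snd c (PBase P u) \<in> dom c U"
    "local_frame \<gamma> (dom c U) (metric_coord M c) (fr \<sigma> c)" "cinv c (snd c (PBase P u)) = PBase P u"
proof -
  obtain U where U: "PBase P u \<in> U" "lsec U (section_through M \<gamma> P u)" "section_through M \<gamma> P u (PBase P u) = u"
    by (rule section_through[OF assms])
  have c: "chart_at M (PBase P u) \<in> charts_at M (PBase P u)"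
    by (rule charts_at_nonempty[OF PTot_base[OF assms]])
  show thesis
    by (rule that[OF U(2,1,3) refl c charts_atD(1)[OF c] dom_mem[OF c U(1)] lsec_local_frame[OF U(2) charts_atD(1)[OF c]]])
      (use charts_atD[OF c] in simp)
qed

section \<open>Constant curvature: Ricci identity and curvature endomorphism of fields\<close>

lemma sectional_curvature_coord:
  assumes u: "u \<in> PTot P" and K: "constant_curvature M K"
  defines "x \<equiv> PBase P u" and "c \<equiv> chart_at M (PBase P u)"
  shows "local_frame \<gamma> \<Omega> (metric_coord M c) e \<Longrightarrow> snd c x \<in> \<Omega> \<Longrightarrow>
      metric_coord M c (snd c x) (local_frame.Rm (metric_coord M c) (snd c x) a b d) w =
      K * (metric_coord M c (snd c x) b d * metric_coord M c (snd c x) a w - metric_coord M c (snd c x) a d * metric_coord M c (snd c x) b w)"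
    and "local_frame \<gamma> \<Omega> (metric_coord M c) e \<Longrightarrow> snd c x \<in> \<Omega> \<Longrightarrow>
      X \<in> tangent_space M x \<Longrightarrow> Y \<in> tangent_space M x \<Longrightarrow> Z \<in> tangent_space M x \<Longrightarrow> V \<in> tangent_space M x \<Longrightarrow>
      Metric M x (curvature M x X Y Z) V = K * (Metric M x Y Z * Metric M x X V - Metric M x X Z * Metric M x Y V)"
proof -
  have xt: "x \<in> topspace (Mtop M)" unfolding x_def by (rule PTot_base[OF u])
  have c: "c \<in> charts_at M x" unfolding c_def x_def by (rule charts_at_nonempty[OF PTot_base[OF u]])
  assume L: "local_frame \<gamma> \<Omega> (metric_coord M c) e" and p: "snd c x \<in> \<Omega>"
  interpret L: local_frame \<gamma> \<Omega> "metric_coord M c" e by (rule L)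
  have curv: "curvature M x X Y Z = coord_vec M c x (L.Rm (snd c x) (X c) (Y c) (Z c))" for X Y Z
    unfolding curvature_def Let_def c_def[folded x_def, symmetric] L.Rm_def christoffel_eq[OF L] ..
  have mc: "Metric M x (coord_vec M c x v) Y = metric_coord M c (snd c x) v (Y c)" if "Y \<in> tangent_space M x" for v Y
    using metric_coord_eq[OF coord_vec_tangent[OF c] that c, of v] by (simp add: coord_vec_self[OF c])
  have sec: "metric_coord M c (snd c x) (L.Rm (snd c x) v w w) v = K * (metric_coord M c (snd c x) v v * metric_coord M c (snd c x) w w
      - (metric_coord M c (snd c x) v w)\<^sup>2)"
    if ind: "\<And>a b. a *\<^sub>R v + b *\<^sub>R w = 0 \<Longrightarrow> a = 0 \<and> b = 0" for v w
  proof -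
    let ?X = "coord_vec M c x v" and ?Y = "coord_vec M c x w"
    note T = coord_vec_tangent[OF c]
    have "a = 0 \<and> b = 0" if "(\<lambda>d. a *\<^sub>R ?X d + b *\<^sub>R ?Y d) = (\<lambda>_. 0)" for a b
      using fun_cong[OF that, of c] ind by (simp add: coord_vec_self[OF c])
    then have "sectional_curvature M x ?X ?Y = K"
      using K xt T unfolding constant_curvature_def by blast
    then have "metric_coord M c (snd c x) (L.Rm (snd c x) v w w) v
       / (metric_coord M c (snd c x) v v * metric_coord M c (snd c x) w w - (metric_coord M c (snd c x) v w)\<^sup>2) = K"
      unfolding sectional_curvature_def curv by (simp add: mc[OF T] coord_vec_self[OF c])
    then show ?thesis
      using L.gram_nonzero[OF p ind] by (simp add: field_simps)
  qed
  show R: "metric_coord M c (snd c x) (L.Rm (snd c x) a b d) w =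
      K * (metric_coord M c (snd c x) b d * metric_coord M c (snd c x) a w - metric_coord M c (snd c x) a d * metric_coord M c (snd c x) b w)"
    for a b d w
    by (rule L.constant_curvature_Rm[OF p sec])
  show "Metric M x (curvature M x X Y Z) V = K * (Metric M x Y Z * Metric M x X V - Metric M x X Z * Metric M x Y V)"
    if "X \<in> tangent_space M x" "Y \<in> tangent_space M x" "Z \<in> tangent_space M x" "V \<in> tangent_space M x"
    using that by (simp add: curv mc R metric_coord_eq[OF _ _ c])
qed

lemma nabla_ricci:
  assumes f: "f \<in> fields" and u: "u \<in> PTot P" and K: "constant_curvature M K"
  shows "nabla M \<gamma> P (nabla M \<gamma> P f) u (k # l # is) - nabla M \<gamma> P (nabla M \<gamma> P f) u (l # k # is)
    = - K *\<^sub>R so_act \<gamma> (wedge k l) (f u) is"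
proof -
  define x where "x = PBase P u"
  obtain \<sigma> U c where \<sigma>: "lsec U \<sigma>" and x: "x \<in> U" "\<sigma> x = u" and c: "c = chart_at M x" "c \<in> charts_at M x" "c \<in> Atlas M"
    and p: "snd c x \<in> dom c U" and L: "local_frame \<gamma> (dom c U) (metric_coord M c) (fr \<sigma> c)" and ci: "cinv c (snd c x) = x"
    unfolding x_def by (rule local_expression[OF u]) blast
  interpret L: local_frame \<gamma> "dom c U" "metric_coord M c" "fr \<sigma> c" by (rule L)
  define F where "F p = f (\<sigma> (cinv c p))" for p
  have F: "F = (\<lambda>p. f (\<sigma> (cinv c p)))" by (simp add: F_def fun_eq_iff)
  have NN: "nabla M \<gamma> P (nabla M \<gamma> P f) u is = L.cov_deriv (L.cov_deriv F) (snd c x) is" for "is"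
  proof -
    have "nabla M \<gamma> P (nabla M \<gamma> P f) u is = L.cov_deriv (\<lambda>p. nabla M \<gamma> P f (\<sigma> (cinv c p))) (snd c x) is"
      using nabla_lsec_chart[OF nabla_fields[OF f] \<sigma> c(3) p, of "is"] by (simp add: ci x)
    also have "\<dots> = L.cov_deriv (L.cov_deriv F) (snd c x) is"
      by (rule L.cov_deriv_cong[OF p], rule ext) (simp add: F nabla_lsec_chart[OF f \<sigma> c(3)])
    finally show ?thesis .
  qed
  have sm: "smooth_on (dom c U) (\<lambda>p. F p is)" for "is"
    unfolding F_def by (rule lsec_field_smooth[OF f \<sigma> c(3)])
  have "L.curv_form (snd c x) (fr \<sigma> c k (snd c x)) (fr \<sigma> c l (snd c x)) = - K *\<^sub>R wedge k l"
    using sectional_curvature_coord(1)[OF u K, folded x_def, folded c(1), OF L p]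
    by (rule L.constant_curvature_form[OF p])
  then show ?thesis
    unfolding NN L.ricci_identity[OF p sm]
    by (simp add: F_def ci x linear_scale[OF linear_so_act_matrix] linear_neg[OF linear_so_act_matrix])
qed

text \<open>Only R_ijji and R_ijij survive. Reversing a wedge changes the sign, so both contribute
  the same square, and the factor 1/2 turns - 2 K into - K.\<close>

lemma curvature_endo_constant:
  assumes u: "u \<in> PTot P" and K: "constant_curvature M K"
  shows "curvature_endo M \<gamma> P f u is = - K *\<^sub>R (\<Sum>i\<in>UNIV. \<Sum>j\<in>UNIV. so_act \<gamma> (wedge i j) (so_act \<gamma> (wedge i j) (f u)) is)"
proof -
  define x where "x = PBase P u"
  obtain \<sigma> U c where c: "c = chart_at M x" and p: "snd c x \<in> dom c U"
    and L: "local_frame \<gamma> (dom c U) (metric_coord M c) (fr \<sigma> c)"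
    unfolding x_def by (rule local_expression[OF u]) blast
  define S where "S i j k l = so_act \<gamma> (wedge i j) (so_act \<gamma> (wedge k l) (f u)) is" for i j k l
  have R: "Metric M x (curvature M x (PFrame P u i) (PFrame P u j) (PFrame P u k)) (PFrame P u l)
      = (if j = k then if i = l then K else 0 else 0) - (if i = k then if j = l then K else 0 else 0)" for i j k l
    using sectional_curvature_coord(2)[OF u K, folded x_def, folded c, OF L p]
    by (simp add: frame_tangent[OF u] frame_orthonormal[OF u] x_def)
  have w: "wedge j i = - wedge i j" for i j :: 'n by (simp add: vec_eq_iff wedge_def)
  have neg: "so_act \<gamma> (- A) \<psi> is = - so_act \<gamma> A \<psi> is" for A \<psi> "is"
    by (rule linear_neg[OF linear_so_act_matrix])
  have S: "S i j j i = - S i j i j" for i j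
  proof -
    have "so_act \<gamma> (wedge j i) (f u) = (\<lambda>is. - so_act \<gamma> (wedge i j) (f u) is)"
      by (rule ext) (simp only: w[of j i] neg)
    then show ?thesis
      unfolding S_def using so_act_scaleR[of "wedge i j" "-1" "so_act \<gamma> (wedge i j) (f u)" "is"] by simp
  qed
  have "curvature_endo M \<gamma> P f u is = (1/2) *\<^sub>R (\<Sum>i\<in>UNIV. \<Sum>j\<in>UNIV. \<Sum>k\<in>UNIV. \<Sum>l\<in>UNIV.
      (if j = k then if i = l then K *\<^sub>R S i j k l else 0 else 0) - (if i = k then if j = l then K *\<^sub>R S i j k l else 0 else 0))"
    unfolding curvature_endo_def Let_def x_def[symmetric] R S_def[symmetric]
    by (intro arg_cong2[where f = scaleR] sum.cong refl) (auto simp: scaleR_diff_left)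
  also have "\<dots> = (1/2) *\<^sub>R (\<Sum>i\<in>UNIV. \<Sum>j\<in>UNIV. K *\<^sub>R S i j j i - K *\<^sub>R S i j i j)"
  proof -
    have "(\<Sum>k\<in>UNIV. \<Sum>l\<in>UNIV. (if j = k then if i = l then K *\<^sub>R S i j k l else 0 else 0)
        - (if i = k then if j = l then K *\<^sub>R S i j k l else 0 else 0)) = K *\<^sub>R S i j j i - K *\<^sub>R S i j i j" for i j
    proof -
      have "(\<Sum>l\<in>UNIV. (if a = k then if b = l then G l else 0 else 0)) = (if a = k then G b else 0)"
        for a b k :: 'n and G :: "'n \<Rightarrow> complex^'s" by simp
      then show ?thesis by (simp add: sum_subtractf)
    qed
    then show ?thesis by simp
  qed
  also have "\<dots> = - K *\<^sub>R (\<Sum>i\<in>UNIV. \<Sum>j\<in>UNIV. S i j i j)"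
  proof -
    have "K *\<^sub>R S i j j i - K *\<^sub>R S i j i j = (- 2 * K) *\<^sub>R S i j i j" for i j
      unfolding S by (simp add: scaleR_conv_of_real)
    then show ?thesis by (simp add: sum_negf flip: scaleR_sum_right)
  qed
  finally show ?thesis by (simp add: S_def)
qed

end

section \<open>The modules \<open>W\<^sub>j\<close>\<close>

text \<open>Minus the factor by which \<open>cc\<close> after \<open>emb\<close> multiplies tensors
  in the kernel of \<open>cc\<close>, see \<open>cc_emb_rank\<close>.\<close>

abbreviation mm :: "nat \<Rightarrow> nat \<Rightarrow> real" where
  "mm n j \<equiv> real n + 2 * real j - 2"

definition rank_ten :: "nat \<Rightarrow> ('n, 's::finite) stensor \<Rightarrow> bool" where
  "rank_ten j \<psi> \<longleftrightarrow> (\<forall>is. length is \<noteq> j \<longrightarrow> \<psi> is = 0)"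

lemma rank_tenD: "rank_ten j \<psi> \<Longrightarrow> length is \<noteq> j \<Longrightarrow> \<psi> is = 0"
  by (simp add: rank_ten_def)

context spinor
begin

lemma cc_lincomb: "cc (\<lambda>is. a *\<^sub>R \<psi> is + b *\<^sub>R \<phi> is) is = a *\<^sub>R cc \<psi> is + b *\<^sub>R cc \<phi> is"
  by (simp add: cc_eq matvec_simps sum.distrib scaleR_sum_right)

lemma emb_lincomb: "emb (\<lambda>is. a *\<^sub>R \<psi> is + b *\<^sub>R \<phi> is) is = a *\<^sub>R emb \<psi> is + b *\<^sub>R emb \<phi> is"
  by (simp add: emb_add emb_scaleR)

lemma emb_support: "(\<And>ks. Suc (length ks) = length is \<Longrightarrow> \<phi> ks = 0) \<Longrightarrow> emb \<phi> is = 0"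
proof (induction "is" arbitrary: \<phi>)
  case (Cons i "is")
  have "emb (slice \<phi> i) is = 0" by (rule Cons.IH) (simp add: Cons.prems)
  then show ?case using Cons.prems[of "is"] by simp
qed simp

lemma rank_emb: "rank_ten i \<phi> \<Longrightarrow> rank_ten (Suc i) (emb \<phi>)"
  unfolding rank_ten_def[of "Suc i"] by (auto intro!: emb_support rank_tenD)

lemma rank_cc: "rank_ten (Suc i) \<psi> \<Longrightarrow> rank_ten i (cc \<psi>)"
  unfolding rank_ten_def[of i] by (auto simp: cc_eq rank_tenD)

lemma rank_0_cc: "rank_ten 0 \<psi> \<Longrightarrow> cc \<psi> = (\<lambda>_. 0)"
  by (auto simp: cc_eq rank_tenD)

lemma rank_so_act: "rank_ten j \<psi> \<Longrightarrow> rank_ten j (so_act \<gamma> A \<psi>)"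
  unfolding rank_ten_def[of j "so_act \<gamma> A \<psi>"] so_act_eq
  by (auto simp: rank_tenD spv_linear_simps intro!: dten_support rank_tenD)

text \<open>The trace condition in \<open>spinor_Sym0\<close> is recovered from the vanishing
  Clifford contraction by \<open>cc_cc\<close>.\<close>

lemma W_iff: "\<psi> \<in> W \<gamma> j \<longleftrightarrow> rank_ten j \<psi> \<and> sym_ten \<psi> \<and> cc \<psi> = (\<lambda>_. 0)"
proof -
  have "(\<Sum>k\<in>UNIV. \<psi> (k # k # is)) = 0" if "sym_ten \<psi>" "cc \<psi> = (\<lambda>_. 0)" for "is"
    using cc_cc[OF that(1), of "is"] that(2) by (simp add: cc_eq)
  then show ?thesis
    unfolding W_def spinor_Sym0_def rank_ten_def sym_ten_def by blast
qed

lemma herm_Suc: "herm (Suc j) \<psi> \<phi> = (\<Sum>k\<in>UNIV. herm j (slice \<psi> k) (slice \<phi> k))"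
  by (simp add: herm_def sum_lists_Suc)

lemma herm_add: "herm j (\<lambda>is. \<psi> is + \<phi> is) \<eta> = herm j \<psi> \<eta> + herm j \<phi> \<eta>"
  by (simp add: herm_def distrib_right sum.distrib)

lemma herm_diff: "herm j (\<lambda>is. \<psi> is - \<phi> is) \<eta> = herm j \<psi> \<eta> - herm j \<phi> \<eta>"
  by (simp add: herm_def left_diff_distrib sum_subtractf)

lemma herm_scaleR: "herm j (\<lambda>is. r *\<^sub>R \<psi> is) \<eta> = r *\<^sub>R herm j \<psi> \<eta>"
  by (simp add: herm_def scaleR_sum_right)

lemma herm_sum_right: "herm j \<psi> (\<lambda>is. \<Sum>k\<in>I. \<phi> k is) = (\<Sum>k\<in>I. herm j \<psi> (\<phi> k))"
  unfolding herm_def by (simp add: sum_distrib_left) (subst sum.swap, subst (2) sum.swap, rule refl)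

lemma herm_gamma: "herm j (\<lambda>is. \<gamma> k *v \<psi> is) \<phi> = - herm j \<psi> (\<lambda>is. \<gamma> k *v \<phi> is)"
proof -
  have "(\<Sum>a\<in>UNIV. (\<gamma> k *v x) $ a * cnj (y $ a)) = - (\<Sum>a\<in>UNIV. x $ a * cnj ((\<gamma> k *v y) $ a))" for x y
  proof -
    have *: "cnj (\<gamma> k $ b $ a) = - \<gamma> k $ a $ b" for a b
      using arg_cong[OF gamma_adjm[of k], of "\<lambda>A. A $ a $ b"] by (simp add: adjm_def)
    have "(\<Sum>a\<in>UNIV. (\<gamma> k *v x) $ a * cnj (y $ a)) = (\<Sum>a\<in>UNIV. \<Sum>b\<in>UNIV. \<gamma> k $ a $ b * x $ b * cnj (y $ a))"
      by (simp add: matrix_vector_mult_def sum_distrib_right)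
    also have "\<dots> = (\<Sum>b\<in>UNIV. \<Sum>a\<in>UNIV. \<gamma> k $ a $ b * x $ b * cnj (y $ a))" by (rule sum.swap)
    also have "\<dots> = - (\<Sum>b\<in>UNIV. x $ b * cnj ((\<gamma> k *v y) $ b))"
      by (simp add: matrix_vector_mult_def sum_distrib_left * sum_negf mult_ac)
    finally show ?thesis .
  qed
  then show ?thesis by (simp add: herm_def sum_negf)
qed

text \<open>Against symmetric tensors \<open>emb\<close> is, up to a factor, the adjoint of
  \<open>cc\<close>, so its image is orthogonal to the kernel of \<open>cc\<close>. The recursion
  moves one skew-Hermitian \<open>\<gamma> k\<close> at a time.\<close>

lemma herm_emb:
  assumes "sym_ten \<eta>" "cc \<eta> = (\<lambda>_. 0)"
  shows "herm j (emb \<phi>) \<eta> = 0"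
  using assms
proof (induction j arbitrary: \<phi> \<eta>)
  case 0
  have "{is :: 'n list. length is = 0} = {[]}" by auto
  then show ?case by (simp add: herm_def)
next
  case (Suc j)
  have "herm (Suc j) (emb \<phi>) \<eta> = (\<Sum>k\<in>UNIV. herm j (\<lambda>is. \<gamma> k *v \<phi> is) (slice \<eta> k))
      + (\<Sum>k\<in>UNIV. herm j (emb (slice \<phi> k)) (slice \<eta> k))"
    by (simp add: herm_Suc herm_add sum.distrib)
  also have "(\<Sum>k\<in>UNIV. herm j (\<lambda>is. \<gamma> k *v \<phi> is) (slice \<eta> k)) = - herm j \<phi> (cc \<eta>)"
    by (simp add: herm_gamma sum_negf cc_eq[abs_def] herm_sum_right)
  also have "herm j \<phi> (cc \<eta>) = 0" by (simp add: Suc.prems herm_def)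
  finally have "herm (Suc j) (emb \<phi>) \<eta> = (\<Sum>k\<in>UNIV. herm j (emb (slice \<phi> k)) (slice \<eta> k))" by simp
  also have "\<dots> = 0"
    by (intro sum.neutral ballI Suc.IH sym_ten_slice Suc.prems) (simp add: cc_slice Suc.prems)
  finally show ?case .
qed

lemma herm_definite:
  assumes "herm j \<psi> \<psi> = 0" "length is = j"
  shows "\<psi> is = 0"
proof -
  have "herm j \<psi> \<psi> = complex_of_real (\<Sum>is | length is = j. \<Sum>a\<in>UNIV. (norm (\<psi> is $ a))\<^sup>2)"
    by (simp add: herm_def complex_norm_square flip: of_real_power)
  then have "(\<Sum>is | length is = j. \<Sum>a\<in>UNIV. (norm (\<psi> is $ a))\<^sup>2) = 0" using assms(1) by (metis of_real_eq_0_iff)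
  then have "(\<Sum>a\<in>UNIV. (norm (\<psi> is $ a))\<^sup>2) = 0"
    using assms(2) by (subst (asm) sum_nonneg_eq_0_iff) (auto intro: sum_nonneg)
  then show ?thesis by (simp add: sum_nonneg_eq_0_iff vec_eq_iff)
qed

text \<open>The argument \<open>Suc i\<close> is the rank of \<open>emb \<phi>\<close>, not that of
  \<phi>: \<open>mm\<close> at \<open>Suc i\<close> is n + 2 i. Index lists of the wrong length give
  0 on both sides of the \<open>\<phi>\<close> term.\<close>

lemma cc_emb_rank:
  assumes "rank_ten i \<phi>" "sym_ten \<phi>"
  shows "cc (emb \<phi>) is = - mm CARD('n) (Suc i) *\<^sub>R \<phi> is - emb (cc \<phi>) is"
  unfolding cc_emb[OF assms(2)] by (cases "length is = i") (simp_all add: rank_tenD[OF assms(1)])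

text \<open>Since \<open>cc \<psi>\<close> is itself in the kernel of \<open>cc\<close>, contracting
  \<open>emb (cc \<psi>)\<close> gives \<open>- m\<close> times \<open>cc \<psi>\<close>. Adding 1/m
  of it therefore removes the contraction of \<psi>, and by \<open>herm_emb\<close> the correction
  is orthogonal to \<open>W\<close>.\<close>

lemma W_proj_eq:
  assumes n: "CARD('n) \<ge> 3" and r: "rank_ten j \<psi>" and s: "sym_ten \<psi>" and z: "cc (cc \<psi>) = (\<lambda>_. 0)"
  shows "W_proj \<gamma> j \<psi> = (\<lambda>is. \<psi> is + (1 / mm CARD('n) j) *\<^sub>R emb (cc \<psi>) is)"
    and "W_proj \<gamma> j \<psi> \<in> W \<gamma> j"
proof -
  define m where "m = mm CARD('n) j"
  define \<phi> where "\<phi> = (\<lambda>is. \<psi> is + (1 / m) *\<^sub>R emb (cc \<psi>) is)"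
  have m: "m > 0" using n by (simp add: m_def)
  have rank: "rank_ten j (emb (cc \<psi>))"
  proof (cases j)
    case 0
    then show ?thesis using rank_0_cc r by (simp add: rank_ten_def)
  qed (use r rank_cc rank_emb in blast)
  have "cc \<phi> is = 0" for "is"
  proof -
    have e: "cc (emb (cc \<psi>)) is = - m *\<^sub>R cc \<psi> is"
    proof (cases j)
      case 0
      then have "cc \<psi> = (\<lambda>_. 0)" using rank_0_cc r by simp
      then show ?thesis by (simp add: cc_eq)
    next
      case (Suc i)
      then show ?thesis
        using cc_emb_rank[OF rank_cc sym_ten_cc[OF s], of i "is"] r by (simp add: z m_def)
    qed
    show ?thesis
      using cc_lincomb[of 1 \<psi> "1 / m" "emb (cc \<psi>)" "is"] m by (simp add: \<phi>_def e)
  qed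
  moreover have "sym_ten \<phi>"
    using sym_tenD[OF s] sym_tenD[OF sym_ten_emb[OF sym_ten_cc[OF s]]] unfolding sym_ten_def \<phi>_def by metis
  moreover have "rank_ten j \<phi>"
    using r rank by (simp add: rank_ten_def \<phi>_def)
  ultimately have W: "\<phi> \<in> W \<gamma> j" by (simp add: W_iff fun_eq_iff)
  have orth: "herm j (\<lambda>is. \<psi> is - \<phi> is) \<eta> = 0" if "\<eta> \<in> W \<gamma> j" for \<eta>
  proof -
    have "(\<lambda>is. \<psi> is - \<phi> is) = (\<lambda>is. (- (1 / m)) *\<^sub>R emb (cc \<psi>) is)" by (simp add: \<phi>_def fun_eq_iff)
    then show ?thesis using that by (simp only: herm_scaleR) (simp add: herm_emb W_iff)
  qed
  have "W_proj \<gamma> j \<psi> = \<phi>"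
    unfolding W_proj_def
  proof (rule the_equality)
    fix \<phi>' assume \<phi>': "\<phi>' \<in> W \<gamma> j \<and> (\<forall>\<eta>\<in>W \<gamma> j. herm j (\<lambda>is. \<psi> is - \<phi>' is) \<eta> = 0)"
    define \<delta> where "\<delta> = (\<lambda>is. 1 *\<^sub>R \<phi>' is + (-1) *\<^sub>R \<phi> is)"
    have "\<delta> \<in> W \<gamma> j"
      unfolding W_iff
    proof (intro conjI)
      show "rank_ten j \<delta>" using W \<phi>' by (simp add: W_iff rank_ten_def \<delta>_def)
      show "sym_ten \<delta>" using W \<phi>' unfolding W_iff sym_ten_def \<delta>_def by metis
      show "cc \<delta> = (\<lambda>_. 0)"
        unfolding \<delta>_def by (rule ext, subst cc_lincomb) (use W \<phi>' in \<open>simp add: W_iff\<close>)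
    qed
    then have "herm j (\<lambda>is. \<psi> is - \<phi> is) \<delta> - herm j (\<lambda>is. \<psi> is - \<phi>' is) \<delta> = 0"
      using orth \<phi>' by simp
    then have "herm j \<delta> \<delta> = 0" unfolding herm_diff[symmetric] by (simp add: \<delta>_def)
    then have "\<delta> is = 0" if "length is = j" for "is" using herm_definite that by blast
    moreover have "\<phi>' is = 0 \<and> \<phi> is = 0" if "length is \<noteq> j" for "is"
      using that W \<phi>' by (auto simp: W_iff rank_ten_def)
    ultimately have "\<phi>' is = \<phi> is" for "is"
      by (cases "length is = j") (auto simp: \<delta>_def)
    then show "\<phi>' = \<phi>" by blast
  qed (use W orth in blast)
  then show "W_proj \<gamma> j \<psi> = (\<lambda>is. \<psi> is + (1 / mm CARD('n) j) *\<^sub>R emb (cc \<psi>) is)" "W_proj \<gamma> j \<psi> \<in> W \<gamma> j"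
    using W by (simp_all add: \<phi>_def m_def)
qed

text \<open>\<open>cc\<close> kills both elements of \<open>W\<close> and multiplies \<xi> by a
  nonzero constant after \<open>emb\<close>, so \<xi> is 0. This is the tool for comparing S_j
  components of powers of D.\<close>

lemma W_split:
  assumes n: "CARD('n) \<ge> 3" and "w \<in> W \<gamma> (Suc i)" "w' \<in> W \<gamma> (Suc i)" "\<xi> \<in> W \<gamma> i"
    and eq: "\<And>is. w is = w' is + emb \<xi> is"
  shows "w = w'"
proof -
  define m where "m = mm CARD('n) (Suc i)"
  have m: "m > 0" using n by (simp add: m_def)
  have "cc w is = cc w' is + cc (emb \<xi>) is" for "is"
    using cc_lincomb[of 1 w' 1 "emb \<xi>" "is"] eq by (simp add: cc_eq)
  then have "cc (emb \<xi>) is = 0" for "is" using assms(2,3) by (simp add: W_iff)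
  moreover have "cc (emb \<xi>) is = - m *\<^sub>R \<xi> is" for "is"
    using cc_emb_rank[of i \<xi> "is"] assms(4) by (simp add: W_iff m_def)
  ultimately have "m *\<^sub>R \<xi> is = 0" for "is" by simp
  then have \<xi>: "\<xi> = (\<lambda>_. 0)" using m by (simp add: fun_eq_iff)
  show ?thesis by (rule ext) (simp add: eq \<xi>)
qed

end

section \<open>Natural operators\<close>

context spin_geometry
begin

abbreviation N :: "('p, 'n, 's) field \<Rightarrow> ('p, 'n, 's) field" where
  "N \<equiv> nabla M \<gamma> P"

text \<open>Chart and section are hidden behind a parametrisation \<open>s\<close> of a piece of the
  bundle; the rules for \<open>nabla\<close> in this section are derived in this form.\<close>

lemma nabla_local:
  assumes u: "u \<in> PTot P"
  obtains \<Omega> g e s p where "local_frame \<gamma> \<Omega> g e" "p \<in> \<Omega>" "s p = u" "\<And>q. q \<in> \<Omega> \<Longrightarrow> s q \<in> PTot P"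
    "\<And>f is. f \<in> fields \<Longrightarrow> smooth_on \<Omega> (\<lambda>q. f (s q) is)"
    "\<And>f is. f \<in> fields \<Longrightarrow> N f u is = local_frame.cov_deriv \<gamma> g e (\<lambda>q. f (s q)) p is"
proof -
  obtain \<sigma> U c where \<sigma>: "lsec U \<sigma>" "PBase P u \<in> U" "\<sigma> (PBase P u) = u" and c: "c \<in> Atlas M"
    and p: "snd c (PBase P u) \<in> dom c U" and L: "local_frame \<gamma> (dom c U) (metric_coord M c) (fr \<sigma> c)"
    and ci: "cinv c (snd c (PBase P u)) = PBase P u"
    by (rule local_expression[OF u]) blast
  show thesis
  proof (rule that[OF L p, of "\<lambda>q. \<sigma> (cinv c q)"])
    show "\<sigma> (cinv c (snd c (PBase P u))) = u" by (simp add: ci \<sigma>)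
    show "\<sigma> (cinv c q) \<in> PTot P" if "q \<in> dom c U" for q
      by (rule lsecD(2)[OF \<sigma>(1) chart_imageD(2)[OF c that]])
    show "smooth_on (dom c U) (\<lambda>q. f (\<sigma> (cinv c q)) is)" if "f \<in> fields" for f "is"
      by (rule lsec_field_smooth[OF that \<sigma>(1) c])
    show "N f u is = local_frame.cov_deriv \<gamma> (metric_coord M c) (fr \<sigma> c) (\<lambda>q. f (\<sigma> (cinv c q))) (snd c (PBase P u)) is"
      if "f \<in> fields" for f "is"
      using nabla_lsec_chart[OF that \<sigma>(1) c p, of "is"] by (simp add: ci \<sigma>)
  qed
qed

lemma fields_cong:
  assumes f: "f \<in> fields" and eq: "\<And>u. u \<in> PTot P \<Longrightarrow> f u = g u"
  shows "g \<in> fields"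
  unfolding fields_def
proof (rule CollectI, intro conjI ballI allI)
  show "Spin_act \<gamma> h (g (PAct P u h)) is = g u is" if "u \<in> PTot P" "h \<in> Spin \<gamma>" for u h "is"
    using fields_equivariant[OF f that] PAct_props(1)[OF that] that by (simp add: eq)
  fix s assume s: "s \<in> PSecs P"
  obtain V \<tau> where V: "s = (V, \<tau>)" by (cases s)
  have \<tau>: "lsec V \<tau>" using PSecs_lsec s V by blast
  have "smooth_map_on M V (\<lambda>x. g (\<tau> x) is)" for "is"
  proof (rule smooth_map_onI)
    fix c assume c: "c \<in> Atlas M"
    show "smooth_on (dom c V) (\<lambda>p. g (\<tau> (cinv c p)) is)"
      by (rule smooth_on_cong[OF chart_image_open[OF c lsecD(1)[OF \<tau>]] lsec_field_smooth[OF f \<tau> c]])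
        (simp add: eq lsecD(2)[OF \<tau> chart_imageD(2)[OF c]])
  qed
  then show "case s of (U, \<sigma>) \<Rightarrow> \<forall>is. smooth_map_on M U (\<lambda>x. g (\<sigma> x) is)" by (simp add: V)
qed

lemma nabla_cong:
  assumes f: "f \<in> fields" and eq: "\<And>u. u \<in> PTot P \<Longrightarrow> f u = g u" and u: "u \<in> PTot P"
  shows "N f u = N g u"
proof (rule ext)
  fix "is"
  have g: "g \<in> fields" by (rule fields_cong[OF f eq])
  obtain \<Omega> m e s p where L: "local_frame \<gamma> \<Omega> m e" "p \<in> \<Omega>" "s p = u" "\<And>q. q \<in> \<Omega> \<Longrightarrow> s q \<in> PTot P"
    "\<And>f is. f \<in> fields \<Longrightarrow> N f u is = local_frame.cov_deriv \<gamma> m e (\<lambda>q. f (s q)) p is"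
    by (rule nabla_local[OF u]) blast
  interpret L: local_frame \<gamma> \<Omega> m e by (rule L(1))
  show "N f u is = N g u is"
    unfolding L(5)[OF f] L(5)[OF g] by (rule L.cov_deriv_cong[OF L(2)]) (simp add: eq L(4))
qed

text \<open>A Spin-equivariant linear map of the fibres, on all ranks at once. Tensors are functions
  on lists and derivatives are taken component by component, so compatibility with derivatives and
  with smoothness is made part of the definition.\<close>

definition natural_op :: "(('n, 's) stensor \<Rightarrow> ('n, 's) stensor) \<Rightarrow> bool" where
  "natural_op L \<longleftrightarrow>
     (\<forall>a b \<psi> \<phi> is. L (\<lambda>is. a *\<^sub>R \<psi> is + b *\<^sub>R \<phi> is) is = a *\<^sub>R L \<psi> is + b *\<^sub>R L \<phi> is) \<and>
     (\<forall>F F' x is. (\<forall>is. ((\<lambda>y :: real^'n. F y is) has_derivative F' is) (at x)) \<longrightarrow>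
        ((\<lambda>y. L (F y) is) has_derivative (\<lambda>X. L (\<lambda>is. F' is X) is)) (at x)) \<and>
     (\<forall>S F is. open S \<longrightarrow> (\<forall>is. smooth_on S (\<lambda>p :: real^'n. F p is)) \<longrightarrow> smooth_on S (\<lambda>p. L (F p) is)) \<and>
     (\<forall>A \<psi> is. transpose A = - A \<longrightarrow> so_act \<gamma> A (L \<psi>) is = L (so_act \<gamma> A \<psi>) is) \<and>
     (\<forall>h \<psi> is. h \<in> Spin \<gamma> \<longrightarrow> Spin_act \<gamma> h (L \<psi>) is = L (Spin_act \<gamma> h \<psi>) is)"

lemma natural_opD:
  assumes "natural_op L"
  shows "L (\<lambda>is. a *\<^sub>R \<psi> is + b *\<^sub>R \<phi> is) is = a *\<^sub>R L \<psi> is + b *\<^sub>R L \<phi> is"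
    "(\<And>is. ((\<lambda>y :: real^'n. F y is) has_derivative F' is) (at x)) \<Longrightarrow>
        ((\<lambda>y. L (F y) is) has_derivative (\<lambda>X. L (\<lambda>is. F' is X) is)) (at x)"
    "open S \<Longrightarrow> (\<And>is. smooth_on S (\<lambda>p :: real^'n. F p is)) \<Longrightarrow> smooth_on S (\<lambda>p. L (F p) is)"
    "transpose A = - A \<Longrightarrow> so_act \<gamma> A (L \<psi>) is = L (so_act \<gamma> A \<psi>) is"
    "h \<in> Spin \<gamma> \<Longrightarrow> Spin_act \<gamma> h (L \<psi>) is = L (Spin_act \<gamma> h \<psi>) is"
proof -
  note D = assms[unfolded natural_op_def]
  show "L (\<lambda>is. a *\<^sub>R \<psi> is + b *\<^sub>R \<phi> is) is = a *\<^sub>R L \<psi> is + b *\<^sub>R L \<phi> is"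
    by (rule D[THEN conjunct1, rule_format])
  show "(\<And>is. ((\<lambda>y :: real^'n. F y is) has_derivative F' is) (at x)) \<Longrightarrow>
        ((\<lambda>y. L (F y) is) has_derivative (\<lambda>X. L (\<lambda>is. F' is X) is)) (at x)"
    by (rule D[THEN conjunct2, THEN conjunct1, rule_format])
  show "open S \<Longrightarrow> (\<And>is. smooth_on S (\<lambda>p :: real^'n. F p is)) \<Longrightarrow> smooth_on S (\<lambda>p. L (F p) is)"
    by (rule D[THEN conjunct2, THEN conjunct2, THEN conjunct1, rule_format])
  show "transpose A = - A \<Longrightarrow> so_act \<gamma> A (L \<psi>) is = L (so_act \<gamma> A \<psi>) is"
    by (rule D[THEN conjunct2, THEN conjunct2, THEN conjunct2, THEN conjunct1, rule_format])
  show "h \<in> Spin \<gamma> \<Longrightarrow> Spin_act \<gamma> h (L \<psi>) is = L (Spin_act \<gamma> h \<psi>) is"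
    by (rule D[THEN conjunct2, THEN conjunct2, THEN conjunct2, THEN conjunct2, rule_format])
qed

lemma natural_op_add: "natural_op L \<Longrightarrow> L (\<lambda>is. \<psi> is + \<phi> is) is = L \<psi> is + L \<phi> is"
  using natural_opD(1)[of L 1 \<psi> 1 \<phi> "is"] by simp

lemma natural_op_scaleR: "natural_op L \<Longrightarrow> L (\<lambda>is. r *\<^sub>R \<psi> is) is = r *\<^sub>R L \<psi> is"
  using natural_opD(1)[of L r \<psi> 0 \<psi> "is"] by simp

lemma natural_op_zero: "natural_op L \<Longrightarrow> L (\<lambda>is. 0) is = 0"
  using natural_op_scaleR[of L 0 "\<lambda>_. 0" "is"] by simp

lemma natural_op_sum:
  assumes "natural_op L"
  shows "L (\<lambda>is. \<Sum>i\<in>I. f i is) is = (\<Sum>i\<in>I. L (f i) is)"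
  by (induction I rule: infinite_finite_induct) (simp_all add: natural_op_zero[OF assms] natural_op_add[OF assms])

lemma natural_cc: "natural_op cc"
  unfolding natural_op_def
proof (intro conjI allI impI)
  fix F :: "real^'n \<Rightarrow> ('n, 's) stensor" and F' x "is"
  assume *: "\<forall>is. ((\<lambda>y :: real^'n. F y is) has_derivative F' is) (at x)"
  show "((\<lambda>y. cc (F y) is) has_derivative (\<lambda>X. cc (\<lambda>is. F' is X) is)) (at x)"
    unfolding cc_eq
    by (intro has_derivative_sum bounded_linear.has_derivative[OF bounded_bilinear.bounded_linear_right[OF bounded_bilinear_matvec]])
      (use * in blast)
next
  fix S and F :: "real^'n \<Rightarrow> ('n, 's) stensor" and "is"
  assume *: "open S" "\<forall>is. smooth_on S (\<lambda>p :: real^'n. F p is)"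
  show "smooth_on S (\<lambda>p. cc (F p) is)"
    unfolding cc_eq
    by (intro smooth_on_sum smooth_on_linear_image[OF _ bounded_bilinear.bounded_linear_right[OF bounded_bilinear_matvec]])
      (use * in auto)
qed (simp_all add: cc_lincomb so_act_cc Spin_act_cc)

lemma natural_emb: "natural_op emb"
  unfolding natural_op_def
proof (intro conjI allI impI)
  fix F :: "real^'n \<Rightarrow> ('n, 's) stensor" and F' x "is"
  assume "\<forall>is. ((\<lambda>y :: real^'n. F y is) has_derivative F' is) (at x)"
  then show "((\<lambda>y. emb (F y) is) has_derivative (\<lambda>X. emb (\<lambda>is. F' is X) is)) (at x)"
  proof (induction "is" arbitrary: F F')
    case (Cons i "is")
    have "((\<lambda>y. emb (slice (F y) i) is) has_derivative (\<lambda>X. emb (\<lambda>is. F' (i # is) X) is)) (at x)"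
      by (rule Cons.IH[of "\<lambda>y. slice (F y) i" "\<lambda>is. F' (i # is)"]) (use Cons.prems in blast)
    then show ?case
      unfolding emb.simps
      by (intro has_derivative_add bounded_linear.has_derivative[OF bounded_bilinear.bounded_linear_right[OF bounded_bilinear_matvec]])
        (use Cons.prems in blast)+
  qed simp
next
  fix S and F :: "real^'n \<Rightarrow> ('n, 's) stensor" and "is"
  assume S: "open S" and "\<forall>is. smooth_on S (\<lambda>p :: real^'n. F p is)"
  then show "smooth_on S (\<lambda>p. emb (F p) is)"
  proof (induction "is" arbitrary: F)
    case (Cons i "is")
    have "smooth_on S (\<lambda>p. emb (slice (F p) i) is)"
      by (rule Cons.IH[OF S, of "\<lambda>y. slice (F y) i"]) (use Cons.prems in blast)
    then show ?case
      unfolding emb.simps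
      by (intro smooth_on_add S smooth_on_linear_image[OF _ bounded_bilinear.bounded_linear_right[OF bounded_bilinear_matvec]])
        (use Cons.prems in blast)+
  qed (simp add: smooth_on_const)
qed (simp_all add: emb_lincomb so_act_emb Spin_act_emb)

text \<open>Acts behind the first index, which is the direction of differentiation added by
  \<open>nabla\<close>; applying it twice handles \<open>nabla (nabla f)\<close>.\<close>

definition lift_op :: "(('n, 's) stensor \<Rightarrow> ('n, 's) stensor) \<Rightarrow> ('n, 's) stensor \<Rightarrow> ('n, 's) stensor" where
  "lift_op L \<psi> is = (case is of [] \<Rightarrow> 0 | k # ks \<Rightarrow> L (slice \<psi> k) ks)"

lemma lift_op_simps [simp]: "lift_op L \<psi> [] = 0" "lift_op L \<psi> (k # ks) = L (slice \<psi> k) ks"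
  by (simp_all add: lift_op_def)

lemma natural_lift:
  assumes L: "natural_op L"
  shows "natural_op (lift_op L)"
  unfolding natural_op_def
proof (intro conjI allI impI)
  note D = natural_opD[OF L]
  show "lift_op L (\<lambda>is. a *\<^sub>R \<psi> is + b *\<^sub>R \<phi> is) is = a *\<^sub>R lift_op L \<psi> is + b *\<^sub>R lift_op L \<phi> is" for a b \<psi> \<phi> "is"
    by (cases "is") (simp_all add: D(1))
  show "((\<lambda>y. lift_op L (F y) is) has_derivative (\<lambda>X. lift_op L (\<lambda>is. F' is X) is)) (at x)"
    if "\<forall>is. ((\<lambda>y :: real^'n. F y is) has_derivative F' is) (at x)" for F F' x "is"
  proof (cases "is")
    case (Cons k ks)
    show ?thesis
      unfolding Cons lift_op_simps
      by (rule D(2)[of "\<lambda>y. slice (F y) k" "\<lambda>is. F' (k # is)"]) (use that in blast)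
  qed simp
  show "smooth_on S (\<lambda>p. lift_op L (F p) is)" if "open S" "\<forall>is. smooth_on S (\<lambda>p :: real^'n. F p is)" for S F "is"
  proof (cases "is")
    case (Cons k ks)
    show ?thesis
      unfolding Cons lift_op_simps by (rule D(3)[OF that(1), of "\<lambda>y. slice (F y) k"]) (use that in blast)
  qed (simp add: smooth_on_const)
  show "so_act \<gamma> A (lift_op L \<psi>) is = lift_op L (so_act \<gamma> A \<psi>) is" if "transpose A = - A" for A \<psi> "is"
  proof (cases "is")
    case Nil
    then show ?thesis by (simp add: so_act_eq spv_linear_simps)
  next
    case (Cons k ks)
    show ?thesis
      unfolding Cons lift_op_simps so_act_Cons
      by (simp add: natural_op_add[OF L] natural_op_sum[OF L] natural_op_scaleR[OF L] D(4)[OF that])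
  qed
  show "Spin_act \<gamma> h (lift_op L \<psi>) is = lift_op L (Spin_act \<gamma> h \<psi>) is" if "h \<in> Spin \<gamma>" for h \<psi> "is"
  proof (cases "is")
    case Nil
    then show ?thesis by (simp add: Spin_act_eq[OF that])
  next
    case (Cons k ks)
    show ?thesis
      unfolding Cons lift_op_simps Spin_act_Cons[OF that]
      by (simp add: natural_op_sum[OF L] natural_op_scaleR[OF L] D(5)[OF that])
  qed
qed

lemma fields_natural:
  assumes L: "natural_op L" and f: "f \<in> fields"
  shows "(\<lambda>u. L (f u)) \<in> fields"
  unfolding fields_def
proof (rule CollectI, intro conjI ballI allI)
  show "Spin_act \<gamma> h (L (f (PAct P u h))) is = L (f u) is" if "u \<in> PTot P" "h \<in> Spin \<gamma>" for u h "is"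
  proof -
    have "Spin_act \<gamma> h (f (PAct P u h)) = f u" using fields_equivariant[OF f that] by auto
    then show ?thesis by (simp add: natural_opD(5)[OF L that(2)])
  qed
  fix s assume s: "s \<in> PSecs P"
  obtain V \<tau> where V: "s = (V, \<tau>)" by (cases s)
  have \<tau>: "lsec V \<tau>" using PSecs_lsec s V by blast
  have "smooth_map_on M V (\<lambda>x. L (f (\<tau> x)) is)" for "is"
    by (rule smooth_map_onI, rule natural_opD(3)[OF L])
      (auto intro: chart_image_open lsecD(1)[OF \<tau>] lsec_field_smooth[OF f \<tau>])
  then show "case s of (U, \<sigma>) \<Rightarrow> \<forall>is. smooth_map_on M U (\<lambda>x. L (f (\<sigma> x)) is)" by (simp add: V)
qed

text \<open>In a local frame \<open>L\<close> has constant coefficients and commutes with the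
  derivative; it commutes with the connection term because the connection matrix is skew and
  \<open>L\<close> is equivariant under skew matrices.\<close>

lemma nabla_natural:
  assumes L: "natural_op L" and f: "f \<in> fields" and u: "u \<in> PTot P"
  shows "N (\<lambda>u. L (f u)) u = lift_op L (N f u)"
proof (rule ext)
  fix "is"
  obtain \<Omega> m e s p where F: "local_frame \<gamma> \<Omega> m e" "p \<in> \<Omega>" "s p = u"
    "\<And>f is. f \<in> fields \<Longrightarrow> smooth_on \<Omega> (\<lambda>q. f (s q) is)"
    "\<And>f is. f \<in> fields \<Longrightarrow> N f u is = local_frame.cov_deriv \<gamma> m e (\<lambda>q. f (s q)) p is"
    by (rule nabla_local[OF u]) blast
  interpret F: local_frame \<gamma> \<Omega> m e by (rule F(1))
  show "N (\<lambda>u. L (f u)) u is = lift_op L (N f u) is"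
  proof (cases "is")
    case Nil
    then show ?thesis by (simp add: nabla_def)
  next
    case (Cons k ks)
    have "((\<lambda>q. f (s q) is) has_derivative fder (\<lambda>q. f (s q) is) p) (at p)" for "is"
      by (rule has_fder[OF smooth_on_differentiable[OF F(4)[OF f] F(2)]])
    from fder_eq[OF natural_opD(2)[OF L this]]
    have d: "fder (\<lambda>q. L (f (s q)) ks) p X = L (\<lambda>is. fder (\<lambda>q. f (s q) is) p X) ks" for X
      by simp
    show ?thesis
      unfolding Cons lift_op_simps F(5)[OF fields_natural[OF L f]] F(5)[OF f] F.cov_deriv_simps d
        natural_opD(4)[OF L F.\<omega>_skew[OF F(2)]] natural_op_add[OF L] ..
  qed
qed

text \<open>Scalar multiples are written as \<open>lc a f 0 f\<close> and the zero field as
  \<open>lc 0 f 0 f\<close>, so one linearity lemma per operator covers all cases.\<close>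

definition lc :: "real \<Rightarrow> ('p, 'n, 's) field \<Rightarrow> real \<Rightarrow> ('p, 'n, 's) field \<Rightarrow> ('p, 'n, 's) field" where
  "lc a f b g = (\<lambda>u is. a *\<^sub>R f u is + b *\<^sub>R g u is)"

lemma lc_apply: "lc a f b g u is = a *\<^sub>R f u is + b *\<^sub>R g u is"
  by (simp add: lc_def)

lemma fields_lc:
  assumes f: "f \<in> fields" and g: "g \<in> fields"
  shows "lc a f b g \<in> fields"
  unfolding fields_def
proof (rule CollectI, intro conjI ballI allI)
  show "Spin_act \<gamma> h (lc a f b g (PAct P u h)) is = lc a f b g u is" if "u \<in> PTot P" "h \<in> Spin \<gamma>" for u h "is"
    by (simp add: lc_def Spin_act_add[OF that(2)] Spin_act_scaleR[OF that(2)] fields_equivariant[OF f that] fields_equivariant[OF g that])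
  fix s assume s: "s \<in> PSecs P"
  obtain V \<tau> where V: "s = (V, \<tau>)" by (cases s)
  have \<tau>: "lsec V \<tau>" using PSecs_lsec s V by blast
  have "smooth_map_on M V (\<lambda>x. lc a f b g (\<tau> x) is)" for "is"
    unfolding lc_def
  proof (rule smooth_map_onI)
    fix c assume c: "c \<in> Atlas M"
    have o: "open (dom c V)" by (rule chart_image_open[OF c lsecD(1)[OF \<tau>]])
    show "smooth_on (dom c V) (\<lambda>p. a *\<^sub>R f (\<tau> (cinv c p)) is + b *\<^sub>R g (\<tau> (cinv c p)) is)"
      using smooth_on_linear_image[OF o bounded_linear_scaleR_right[of a] lsec_field_smooth[OF f \<tau> c, of "is"]]
        smooth_on_linear_image[OF o bounded_linear_scaleR_right[of b] lsec_field_smooth[OF g \<tau> c, of "is"]]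
      by (rule smooth_on_add[OF o])
  qed
  then show "case s of (U, \<sigma>) \<Rightarrow> \<forall>is. smooth_map_on M U (\<lambda>x. lc a f b g (\<sigma> x) is)" by (simp add: V)
qed

lemma nabla_lc:
  assumes f: "f \<in> fields" and g: "g \<in> fields" and u: "u \<in> PTot P"
  shows "N (lc a f b g) u is = a *\<^sub>R N f u is + b *\<^sub>R N g u is"
proof -
  obtain \<Omega> m e s p where F: "local_frame \<gamma> \<Omega> m e" "p \<in> \<Omega>" "s p = u"
    "\<And>f is. f \<in> fields \<Longrightarrow> smooth_on \<Omega> (\<lambda>q. f (s q) is)"
    "\<And>f is. f \<in> fields \<Longrightarrow> N f u is = local_frame.cov_deriv \<gamma> m e (\<lambda>q. f (s q)) p is"
    by (rule nabla_local[OF u]) blast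
  interpret F: local_frame \<gamma> \<Omega> m e by (rule F(1))
  have d: "(\<lambda>q. f (s q) is) differentiable (at p)" if "f \<in> fields" for f "is"
    by (rule smooth_on_differentiable[OF F(4)[OF that] F(2)])
  show ?thesis
  proof (cases "is")
    case (Cons k ks)
    have "fder (\<lambda>q. a *\<^sub>R f (s q) ks + b *\<^sub>R g (s q) ks) p X = a *\<^sub>R fder (\<lambda>q. f (s q) ks) p X + b *\<^sub>R fder (\<lambda>q. g (s q) ks) p X" for X
      using fder_add[OF differentiable_linear_image[OF bounded_linear_scaleR_right[of a] d[OF f, of ks]]
          differentiable_linear_image[OF bounded_linear_scaleR_right[of b] d[OF g, of ks]], of X]
      by (simp add: fder_linear_image[OF bounded_linear_scaleR_right d[OF f]]
          fder_linear_image[OF bounded_linear_scaleR_right d[OF g]])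
    then show ?thesis
      unfolding Cons F(5)[OF fields_lc[OF f g]] F(5)[OF f] F(5)[OF g] F.cov_deriv_simps
      by (simp add: lc_def so_act_add so_act_scaleR scaleR_add_right)
  qed (simp add: nabla_def)
qed

lemma nabla_sym_rank:
  assumes f: "f \<in> fields" and u: "u \<in> PTot P"
  shows "(\<And>v. v \<in> PTot P \<Longrightarrow> sym_ten (f v)) \<Longrightarrow> sym_ten (slice (N f u) k)"
    "(\<And>v. v \<in> PTot P \<Longrightarrow> rank_ten j (f v)) \<Longrightarrow> rank_ten j (slice (N f u) k)"
proof -
  obtain \<Omega> m e s p where F: "local_frame \<gamma> \<Omega> m e" "p \<in> \<Omega>" "s p = u" "\<And>q. q \<in> \<Omega> \<Longrightarrow> s q \<in> PTot P"
    "\<And>f is. f \<in> fields \<Longrightarrow> N f u is = local_frame.cov_deriv \<gamma> m e (\<lambda>q. f (s q)) p is"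
    by (rule nabla_local[OF u]) blast
  interpret F: local_frame \<gamma> \<Omega> m e by (rule F(1))
  show "sym_ten (slice (N f u) k)" if s: "\<And>v. v \<in> PTot P \<Longrightarrow> sym_ten (f v)"
    unfolding sym_ten_def F(5)[OF f] F.cov_deriv_simps
  proof (intro allI impI)
    fix xs ys :: "'n list" assume eq: "mset xs = mset ys"
    have "fder (\<lambda>q. f (s q) xs) p = fder (\<lambda>q. f (s q) ys) p"
      by (rule fder_cong_open[OF F.open_domain F(2)]) (rule sym_tenD[OF s[OF F(4)] eq])
    moreover have "so_act \<gamma> (F.\<omega> p (e k p)) (f (s p)) xs = so_act \<gamma> (F.\<omega> p (e k p)) (f (s p)) ys"
      by (rule sym_tenD[OF sym_ten_so_act[OF s[OF F(4)[OF F(2)]]] eq])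
    ultimately show "fder (\<lambda>q. f (s q) xs) p (e k p) + so_act \<gamma> (F.\<omega> p (e k p)) (f (s p)) xs =
      fder (\<lambda>q. f (s q) ys) p (e k p) + so_act \<gamma> (F.\<omega> p (e k p)) (f (s p)) ys" by simp
  qed
  show "rank_ten j (slice (N f u) k)" if r: "\<And>v. v \<in> PTot P \<Longrightarrow> rank_ten j (f v)"
    unfolding rank_ten_def F(5)[OF f] F.cov_deriv_simps
  proof (intro allI impI)
    fix ks :: "'n list" assume ks: "length ks \<noteq> j"
    have "fder (\<lambda>q. f (s q) ks) p = fder (\<lambda>q. 0) p"
      by (rule fder_cong_open[OF F.open_domain F(2)]) (rule rank_tenD[OF r[OF F(4)] ks])
    moreover have "so_act \<gamma> (F.\<omega> p (e k p)) (f (s p)) ks = 0"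
      by (rule rank_tenD[OF rank_so_act[OF r[OF F(4)[OF F(2)]]] ks])
    ultimately show "fder (\<lambda>q. f (s q) ks) p (e k p) + so_act \<gamma> (F.\<omega> p (e k p)) (f (s p)) ks = 0" by simp
  qed
qed

end

section \<open>Higher spin Dirac operators in constant curvature\<close>

locale space_form = spin_geometry M \<gamma> P
  for M :: "('m, 'n::finite) rmfd" and \<gamma> :: "('n, 's::finite) gammas" and P :: "('m, 'n, 'p, 's) spinstr" +
  fixes K n :: real
  assumes K: "constant_curvature M K" and n3: "CARD('n) \<ge> 3" and n_def: "n = real CARD('n)"
begin

abbreviation m :: "nat \<Rightarrow> real" where
  "m j \<equiv> n + 2 * real j - 2"

lemma m_pos: "m j > 0"
  using n3 by (simp add: n_def)

definition D :: "('p, 'n, 's) field \<Rightarrow> ('p, 'n, 's) field" where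
  "D f = (\<lambda>u. cc (N f u))"

definition E :: "('p, 'n, 's) field \<Rightarrow> ('p, 'n, 's) field" where
  "E f = (\<lambda>u. emb (f u))"

definition C :: "('p, 'n, 's) field \<Rightarrow> ('p, 'n, 's) field" where
  "C f = (\<lambda>u. cc (f u))"

abbreviation L :: "('p, 'n, 's) field \<Rightarrow> ('p, 'n, 's) field" where
  "L \<equiv> bochner_laplacian M \<gamma> P"

text \<open>Traces are allowed here, so the set contains the sections of S_0 \<otimes> Sym_0^j, and
  \<open>E\<close>, \<open>C\<close> and \<open>D\<close> preserve it up to the shift of rank by
  symmetry alone.\<close>

definition tens :: "nat \<Rightarrow> ('p, 'n, 's) field set" where
  "tens j = {f \<in> fields. \<forall>u\<in>PTot P. sym_ten (f u) \<and> rank_ten j (f u)}"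

definition secs :: "nat \<Rightarrow> ('p, 'n, 's) field set" where
  "secs j = {f \<in> fields. \<forall>u\<in>PTot P. f u \<in> W \<gamma> j}"

lemma tensD: "f \<in> tens j \<Longrightarrow> f \<in> fields" "f \<in> tens j \<Longrightarrow> u \<in> PTot P \<Longrightarrow> sym_ten (f u)"
  "f \<in> tens j \<Longrightarrow> u \<in> PTot P \<Longrightarrow> rank_ten j (f u)"
  by (auto simp: tens_def)

lemma secsD: "f \<in> secs j \<Longrightarrow> f \<in> fields" "f \<in> secs j \<Longrightarrow> f \<in> tens j"
  "f \<in> secs j \<Longrightarrow> u \<in> PTot P \<Longrightarrow> cc (f u) = (\<lambda>_. 0)" "f \<in> secs j \<Longrightarrow> u \<in> PTot P \<Longrightarrow> f u \<in> W \<gamma> j"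
  by (auto simp: secs_def tens_def W_iff)

lemma secsI: "f \<in> tens j \<Longrightarrow> (\<And>u is. u \<in> PTot P \<Longrightarrow> cc (f u) is = 0) \<Longrightarrow> f \<in> secs j"
  by (auto simp: secs_def tens_def W_iff fun_eq_iff)

lemma secs_cong: "f \<in> secs j \<Longrightarrow> (\<And>u. u \<in> PTot P \<Longrightarrow> f u = g u) \<Longrightarrow> g \<in> secs j"
  using fields_cong[of f g] by (auto simp: secs_def)

lemma E_fields: "f \<in> fields \<Longrightarrow> E f \<in> fields"
  unfolding E_def by (rule fields_natural[OF natural_emb])

lemma C_fields: "f \<in> fields \<Longrightarrow> C f \<in> fields"
  unfolding C_def by (rule fields_natural[OF natural_cc])

lemma D_fields: "f \<in> fields \<Longrightarrow> D f \<in> fields"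
  unfolding D_def by (rule fields_natural[OF natural_cc nabla_fields])

lemma tens_lc:
  assumes f: "f \<in> tens j" and g: "g \<in> tens j"
  shows "lc a f b g \<in> tens j"
  unfolding tens_def
proof (rule CollectI, intro conjI ballI)
  show "lc a f b g \<in> fields" using f g by (intro fields_lc tensD)
  fix u assume u: "u \<in> PTot P"
  show "sym_ten (lc a f b g u)"
    using sym_tenD[OF tensD(2)[OF f u]] sym_tenD[OF tensD(2)[OF g u]] unfolding sym_ten_def lc_def by metis
  show "rank_ten j (lc a f b g u)"
    using tensD(3)[OF f u] tensD(3)[OF g u] by (simp add: rank_ten_def lc_def)
qed

lemma cc_lc: "cc (lc a f b g u) is = a *\<^sub>R cc (f u) is + b *\<^sub>R cc (g u) is"
  unfolding lc_def by (rule cc_lincomb)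

lemma emb_lc: "emb (lc a f b g u) is = a *\<^sub>R emb (f u) is + b *\<^sub>R emb (g u) is"
  unfolding lc_def by (rule emb_lincomb)

lemma secs_lc: "f \<in> secs j \<Longrightarrow> g \<in> secs j \<Longrightarrow> lc a f b g \<in> secs j"
  by (rule secsI[OF tens_lc]) (simp_all add: secsD cc_lc)

lemma E_tens: "f \<in> tens i \<Longrightarrow> E f \<in> tens (Suc i)"
  by (auto simp: tens_def E_def intro: sym_ten_emb rank_emb fields_natural[OF natural_emb])

lemma C_tens: "f \<in> tens (Suc i) \<Longrightarrow> C f \<in> tens i"
  by (auto simp: tens_def C_def intro: sym_ten_cc rank_cc fields_natural[OF natural_cc])

lemma sym_ten_cc_slices: "(\<And>k. sym_ten (slice t k)) \<Longrightarrow> sym_ten (cc t)"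
  unfolding sym_ten_def[of "cc t"] cc_eq
  by (intro allI impI sum.cong refl arg_cong2[where f = "(*v)"]) (rule sym_tenD)

lemma D_tens:
  assumes f: "f \<in> tens j"
  shows "D f \<in> tens j"
  unfolding tens_def
proof (rule CollectI, intro conjI ballI)
  show "D f \<in> fields" by (rule D_fields[OF tensD(1)[OF f]])
  fix u assume u: "u \<in> PTot P"
  show "sym_ten (D f u)"
    unfolding D_def by (rule sym_ten_cc_slices, rule nabla_sym_rank(1)[OF tensD(1)[OF f] u]) (rule tensD(2)[OF f])
  have "rank_ten j (slice (N f u) k)" for k
    by (rule nabla_sym_rank(2)[OF tensD(1)[OF f] u]) (rule tensD(3)[OF f])
  then show "rank_ten j (D f u)" by (simp add: D_def rank_ten_def cc_eq)
qed

lemma D_cong: "f \<in> fields \<Longrightarrow> (\<And>u. u \<in> PTot P \<Longrightarrow> f u = g u) \<Longrightarrow> u \<in> PTot P \<Longrightarrow> D f u = D g u"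
  unfolding D_def by (rule arg_cong[of _ _ cc]) (rule nabla_cong)

lemma D_lc:
  assumes "f \<in> fields" "g \<in> fields" "u \<in> PTot P"
  shows "D (lc a f b g) u is = a *\<^sub>R D f u is + b *\<^sub>R D g u is"
proof -
  have "N (lc a f b g) u = (\<lambda>is. a *\<^sub>R N f u is + b *\<^sub>R N g u is)"
    by (rule ext) (rule nabla_lc[OF assms])
  then show ?thesis by (simp add: D_def cc_lincomb)
qed

lemma nabla_zero:
  assumes f: "f \<in> fields" and z: "\<And>u. u \<in> PTot P \<Longrightarrow> f u = (\<lambda>_. 0)" and u: "u \<in> PTot P"
  shows "N f u is = 0"
proof -
  have "N f u = N (lc 0 f 0 f) u" by (rule nabla_cong[OF f _ u]) (simp add: z lc_def)
  from fun_cong[OF this, of "is"] show ?thesis unfolding nabla_lc[OF f f u] by simp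
qed

text \<open>The natural map \<open>cc\<close> commutes with \<open>nabla\<close>, and
  \<open>C f\<close> vanishes. So the connection preserves the subbundle S_j.\<close>

lemma cc_slice_nabla:
  assumes f: "f \<in> secs j" and u: "u \<in> PTot P"
  shows "cc (slice (N f u) k) = (\<lambda>_. 0)"
proof (rule ext)
  fix "is"
  have "N (C f) u (k # is) = 0"
    by (rule nabla_zero[OF C_fields[OF secsD(1)[OF f]] _ u]) (simp add: C_def secsD(3)[OF f])
  then show "cc (slice (N f u) k) is = 0"
    using nabla_natural[OF natural_cc secsD(1)[OF f] u] by (simp add: C_def)
qed

lemma sym_slice_nabla: "f \<in> tens j \<Longrightarrow> u \<in> PTot P \<Longrightarrow> sym_ten (slice (N f u) k)"
  by (rule nabla_sym_rank(1)[OF tensD(1)]) (auto intro: tensD(2))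

text \<open>Each slice of \<open>N f u\<close> is trace-free because its Clifford contraction
  vanishes, and \<open>D f\<close> is a Clifford combination of these slices. Hence
  \<open>D f\<close> has components in S_j and S_(j-1) only.\<close>

lemma cc_cc_D:
  assumes f: "f \<in> secs j" and u: "u \<in> PTot P"
  shows "cc (cc (D f u)) = (\<lambda>_. 0)"
proof (rule ext)
  fix "is"
  note s = sym_slice_nabla[OF secsD(2)[OF f] u]
  have tr: "(\<Sum>k\<in>UNIV. N f u (l # k # k # is)) = 0" for l
    using cc_cc[OF s, of l "is"] cc_slice_nabla[OF f u, of l] by (simp add: cc_eq)
  have "cc (cc (D f u)) is = - (\<Sum>k\<in>UNIV. D f u (k # k # is))"
    by (rule cc_cc[OF tensD(2)[OF D_tens[OF secsD(2)[OF f]] u]])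
  also have "(\<Sum>k\<in>UNIV. D f u (k # k # is)) = (\<Sum>l\<in>UNIV. \<gamma> l *v (\<Sum>k\<in>UNIV. N f u (l # k # k # is)))"
    by (simp add: D_def cc_eq matvec_sum) (rule sum.swap)
  finally show "cc (cc (D f u)) is = 0" by (simp add: tr)
qed

lemma CD_secs: "f \<in> secs (Suc i) \<Longrightarrow> C (D f) \<in> secs i"
  by (rule secsI[OF C_tens[OF D_tens[OF secsD(2)]]]) (simp_all add: C_def cc_cc_D)

text \<open>The Weitzenboeck formula: \<open>sum_gamma_gamma\<close> separates trace and curvature,
  and the Ricci identity in constant curvature turns the latter into
  \<open>weitzenboeck_term\<close>.\<close>

lemma D_square:
  assumes f: "f \<in> tens j" and u: "u \<in> PTot P"
  shows "D (D f) u is = L f u is + (K * (n * (n - 1) / 4 + real (length is))) *\<^sub>R f u is + K *\<^sub>R emb (cc (f u)) is"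
proof -
  note ff = tensD(1)[OF f]
  define t where "t k l = N (N f) u (k # l # is)" for k l
  have "D (D f) u is = (\<Sum>k\<in>UNIV. \<Sum>l\<in>UNIV. \<gamma> k *v (\<gamma> l *v t k l))"
    unfolding D_def nabla_natural[OF natural_cc nabla_fields[OF ff] u] by (simp add: cc_eq matvec_sum t_def)
  also have "\<dots> = - (\<Sum>k\<in>UNIV. t k k) + (1/2) *\<^sub>R (\<Sum>k\<in>UNIV. \<Sum>l\<in>UNIV. \<gamma> k *v (\<gamma> l *v (t k l - t l k)))"
    by (rule sum_gamma_gamma)
  also have "- (\<Sum>k\<in>UNIV. t k k) = L f u is"
    by (simp add: t_def bochner_laplacian_def)
  also have "(\<Sum>k\<in>UNIV. \<Sum>l\<in>UNIV. \<gamma> k *v (\<gamma> l *v (t k l - t l k)))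
     = - K *\<^sub>R (\<Sum>k\<in>UNIV. \<Sum>l\<in>UNIV. \<gamma> k *v (\<gamma> l *v so_act \<gamma> (wedge k l) (f u) is))"
    unfolding t_def nabla_ricci[OF ff u K] matvec_scaleR scaleR_sum_right ..
  also have "\<dots> = - K *\<^sub>R (- (n * (n - 1) / 2 + 2 * real (length is)) *\<^sub>R f u is - 2 *\<^sub>R emb (cc (f u)) is)"
    unfolding weitzenboeck_term[OF tensD(2)[OF f u], folded n_def] ..
  finally show ?thesis
    by (simp add: scaleR_diff_right scaleR_add_right scaleR_add_left algebra_simps diff_divide_distrib)
qed

lemma D_square_secs:
  assumes f: "f \<in> secs j" and u: "u \<in> PTot P"
  shows "D (D f) u is = L f u is + (K * (n * (n - 1) / 4 + real j)) *\<^sub>R f u is"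
  using D_square[OF secsD(2)[OF f] u, of "is"] rank_tenD[OF tensD(3)[OF secsD(2)[OF f] u], of "is"]
  by (cases "length is = j") (simp_all add: secsD(3)[OF f u])

lemma L_cong:
  assumes f: "f \<in> fields" and eq: "\<And>u. u \<in> PTot P \<Longrightarrow> f u = g u" and u: "u \<in> PTot P"
  shows "L f u = L g u"
proof (rule ext)
  fix "is"
  have "N f v = N g v" if "v \<in> PTot P" for v by (rule nabla_cong[OF f eq that])
  from nabla_cong[OF nabla_fields[OF f] this u]
  show "L f u is = L g u is" by (simp add: bochner_laplacian_def)
qed

lemma L_lc:
  assumes f: "f \<in> fields" and g: "g \<in> fields" and u: "u \<in> PTot P"
  shows "L (lc a f b g) u is = a *\<^sub>R L f u is + b *\<^sub>R L g u is"
proof -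
  have "N (N (lc a f b g)) u = N (lc a (N f) b (N g)) u"
    by (rule nabla_cong[OF nabla_fields[OF fields_lc[OF f g]] _ u]) (simp add: fun_eq_iff nabla_lc[OF f g] lc_apply)
  then show ?thesis
    by (simp add: bochner_laplacian_def nabla_lc[OF nabla_fields[OF f] nabla_fields[OF g] u] sum.distrib
        scaleR_sum_right)
qed

lemma L_natural:
  assumes A: "natural_op A" and f: "f \<in> fields" and u: "u \<in> PTot P"
  shows "L (\<lambda>u. A (f u)) u is = A (L f u) is"
proof -
  have "N (N (\<lambda>u. A (f u))) u = N (\<lambda>u. lift_op A (N f u)) u"
    by (rule nabla_cong[OF nabla_fields[OF fields_natural[OF A f]] _ u]) (rule nabla_natural[OF A f])
  also have "\<dots> = lift_op (lift_op A) (N (N f) u)"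
    by (rule nabla_natural[OF natural_lift[OF A] nabla_fields[OF f] u])
  finally have "L (\<lambda>u. A (f u)) u is = - (\<Sum>k\<in>UNIV. A (\<lambda>is. N (N f) u (k # k # is)) is)"
    by (simp add: bochner_laplacian_def)
  also have "\<dots> = A (\<lambda>is. - 1 *\<^sub>R (\<Sum>k\<in>UNIV. N (N f) u (k # k # is))) is"
    unfolding natural_op_scaleR[OF A] natural_op_sum[OF A] by simp
  finally show ?thesis by (simp add: bochner_laplacian_def[abs_def])
qed

text \<open>The Weitzenboeck formula exhibits \<open>L f\<close> as a symmetric field of rank
  \<open>j\<close>, and \<open>L\<close> commutes with the natural map \<open>cc\<close>, which
  kills \<open>f\<close>.\<close>

lemma L_secs:
  assumes f: "f \<in> secs j"
  shows "L f \<in> secs j"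
proof -
  let ?g = "lc 1 (D (D f)) (- (K * (n * (n - 1) / 4 + real j))) f"
  have eq: "L f u = ?g u" if "u \<in> PTot P" for u
    by (rule ext) (simp add: lc_apply D_square_secs[OF f that])
  have "?g \<in> tens j" by (intro tens_lc D_tens secsD f)
  moreover have "cc (?g u) is = 0" if u: "u \<in> PTot P" for u "is"
  proof -
    have "N (C f) v = (\<lambda>_. 0)" if "v \<in> PTot P" for v
      by (rule ext, rule nabla_zero[OF C_fields[OF secsD(1)[OF f]] _ that]) (simp add: C_def secsD(3)[OF f])
    then have "N (N (C f)) u is = 0" for "is"
      by (rule nabla_zero[OF nabla_fields[OF C_fields[OF secsD(1)[OF f]]] _ u])
    then have "L (C f) u is = 0" by (simp add: bochner_laplacian_def)
    then show ?thesis
      using L_natural[OF natural_cc secsD(1)[OF f] u, of "is"] eq[OF u] by (simp add: C_def)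
  qed
  ultimately have "?g \<in> secs j" by (rule secsI)
  then show ?thesis by (rule secs_cong) (simp add: eq)
qed

section \<open>The components of the twisted Dirac operator and their relations\<close>

text \<open>The higher spin Dirac operator with the projection written out by
  \<open>W_proj_eq\<close>; in this form it is linear on all fields.\<close>

definition H :: "nat \<Rightarrow> ('p, 'n, 's) field \<Rightarrow> ('p, 'n, 's) field" where
  "H j f = lc 1 (D f) (1 / m j) (E (C (D f)))"

lemma H_W_proj:
  assumes f: "f \<in> secs j" and u: "u \<in> PTot P"
  shows "H j f u = W_proj \<gamma> j (D f u)" "W_proj \<gamma> j (D f u) \<in> W \<gamma> j"
proof -
  note Df = D_tens[OF secsD(2)[OF f]]
  note w = W_proj_eq[OF n3 tensD(3)[OF Df u] tensD(2)[OF Df u] cc_cc_D[OF f u], folded n_def]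
  show "H j f u = W_proj \<gamma> j (D f u)"
    unfolding w(1) by (simp add: H_def lc_def E_def C_def)
  show "W_proj \<gamma> j (D f u) \<in> W \<gamma> j" by (rule w(2))
qed

lemma H_secs:
  assumes f: "f \<in> secs j"
  shows "H j f \<in> secs j"
proof -
  have "H j f \<in> fields"
    unfolding H_def by (intro fields_lc D_fields E_fields C_fields secsD(1)[OF f])
  moreover have "H j f u \<in> W \<gamma> j" if "u \<in> PTot P" for u
    using H_W_proj[OF f that] by simp
  ultimately show ?thesis unfolding secs_def by blast
qed

lemma H_cong:
  assumes "f \<in> fields" "\<And>u. u \<in> PTot P \<Longrightarrow> f u = g u" "u \<in> PTot P"
  shows "H j f u = H j g u"
  using D_cong[OF assms] by (simp add: H_def lc_def E_def C_def)

lemma H_lc: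
  assumes "f \<in> fields" "g \<in> fields" "u \<in> PTot P"
  shows "H j (lc a f b g) u is = a *\<^sub>R H j f u is + b *\<^sub>R H j g u is"
proof -
  have "D (lc a f b g) u = lc a (D f) b (D g) u" by (rule ext) (simp add: D_lc[OF assms] lc_apply)
  moreover have "cc (lc a (D f) b (D g) u) = lc a (C (D f)) b (C (D g)) u"
    by (rule ext) (simp add: cc_lc lc_apply C_def)
  ultimately show ?thesis
    by (simp add: H_def lc_apply E_def C_def emb_lc algebra_simps)
qed

definition T :: "nat \<Rightarrow> ('p, 'n, 's) field \<Rightarrow> ('p, 'n, 's) field" where
  "T i \<phi> = lc 1 (D (E \<phi>)) (m i / m (Suc i)) (E (H i \<phi>))"

lemma T_cong:
  assumes "f \<in> fields" "\<And>u. u \<in> PTot P \<Longrightarrow> f u = g u" "u \<in> PTot P"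
  shows "T i f u = T i g u"
proof -
  have "D (E f) u = D (E g) u"
    by (rule D_cong[OF E_fields[OF assms(1)] _ assms(3)]) (simp add: E_def assms(2))
  then show ?thesis using H_cong[OF assms] by (simp add: T_def lc_def E_def)
qed

lemma T_lc:
  assumes "f \<in> fields" "g \<in> fields" "u \<in> PTot P"
  shows "T i (lc a f b g) u is = a *\<^sub>R T i f u is + b *\<^sub>R T i g u is"
proof -
  have "E (lc a f b g) v = lc a (E f) b (E g) v" for v by (rule ext) (simp add: E_def emb_lc lc_apply)
  then have "D (E (lc a f b g)) u = D (lc a (E f) b (E g)) u"
    by (intro D_cong E_fields fields_lc assms)
  moreover have "H i (lc a f b g) u = lc a (H i f) b (H i g) u"
    by (rule ext) (simp add: H_lc[OF assms] lc_apply)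
  ultimately show ?thesis
    by (simp add: T_def lc_apply D_lc[OF E_fields[OF assms(1)] E_fields[OF assms(2)] assms(3)])
      (simp add: E_def emb_lc algebra_simps)
qed

text \<open>\<open>cc_dirac_emb\<close> shows that \<open>cc\<close> maps
  \<open>D (E \<phi>)\<close> to \<open>m i\<close> times \<open>H i \<phi>\<close>, while
  \<open>cc\<close> after \<open>E\<close> is \<open>- m (Suc i)\<close>; the quotient is the
  coefficient in \<open>T\<close>.\<close>

lemma T_secs:
  assumes \<phi>: "\<phi> \<in> secs i"
  shows "T i \<phi> \<in> secs (Suc i)"
proof (rule secsI)
  note H = H_secs[OF \<phi>]
  show "T i \<phi> \<in> tens (Suc i)"
    unfolding T_def by (intro tens_lc D_tens E_tens secsD \<phi> H)
  fix u "is" assume u: "u \<in> PTot P"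
  have D: "D (E \<phi>) u ks = (\<Sum>k\<in>UNIV. \<gamma> k *v emb (slice (N \<phi> u) k) ks)" for ks
    unfolding D_def E_def nabla_natural[OF natural_emb secsD(1)[OF \<phi>] u] by (simp add: cc_eq)
  have D': "D \<phi> u = cc (N \<phi> u)" by (simp add: D_def)
  have "cc (D (E \<phi>) u) is = (n - 2 + 2 * real (length is)) *\<^sub>R D \<phi> u is + emb (cc (D \<phi> u)) is"
    unfolding D' cc_eq[of "D (E \<phi>) u"] D
    by (rule cc_dirac_emb[OF sym_slice_nabla[OF secsD(2)[OF \<phi>] u] cc_slice_nabla[OF \<phi> u], folded n_def])
  \<comment> \<open>\<open>m i\<close> times the correction term in \<open>H\<close> is exactly the
    \<open>emb (cc (D \<phi> u))\<close> produced by \<open>cc_dirac_emb\<close>.\<close>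
  also have "\<dots> = m i *\<^sub>R H i \<phi> u is"
  proof -
    have "(n - 2 + 2 * real (length is)) *\<^sub>R D \<phi> u is = m i *\<^sub>R D \<phi> u is"
      using rank_tenD[OF tensD(3)[OF D_tens[OF secsD(2)[OF \<phi>]] u], of "is"]
      by (cases "length is = i") (simp_all add: algebra_simps)
    moreover have "m i *\<^sub>R ((1 / m i) *\<^sub>R x) = x" for x :: "complex^'s" using m_pos[of i] by simp
    ultimately show ?thesis
      by (simp only: H_def lc_apply E_def C_def scaleR_add_right scaleR_one)
  qed
  finally have 1: "cc (D (E \<phi>) u) is = m i *\<^sub>R H i \<phi> u is" .
  have 2: "cc (E (H i \<phi>) u) is = - m (Suc i) *\<^sub>R H i \<phi> u is"
    unfolding E_def using cc_emb_rank[OF tensD(3)[OF secsD(2)[OF H] u] tensD(2)[OF secsD(2)[OF H] u], of "is", folded n_def]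
    by (simp only: secsD(3)[OF H u] emb_zero diff_zero)
  have "m (Suc i) \<noteq> 0" using m_pos[of "Suc i"] by linarith
  moreover have "(a / b) *\<^sub>R (- b *\<^sub>R x) = - a *\<^sub>R x" if "b \<noteq> 0" for a b :: real and x :: "complex^'s"
    using that by simp
  ultimately have "(m i / m (Suc i)) *\<^sub>R (- m (Suc i) *\<^sub>R x) = - m i *\<^sub>R x" for x :: "complex^'s"
    by blast
  then show "cc (T i \<phi> u) is = 0"
    unfolding T_def cc_lc 1 2 by (simp only: scaleR_one scaleR_minus_left add.right_inverse)
qed

lemma D_split: "D f u is = H j f u is - (1 / m j) *\<^sub>R emb (cc (D f u)) is"
  by (simp add: H_def lc_apply E_def C_def)

lemma DE_split: "D (E \<phi>) u is = T i \<phi> u is - (m i / m (Suc i)) *\<^sub>R emb (H i \<phi> u) is"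
  by (simp add: T_def lc_apply E_def)

lemma lc_secs_W: "f \<in> secs j \<Longrightarrow> g \<in> secs j \<Longrightarrow> u \<in> PTot P \<Longrightarrow> lc a f b g u \<in> W \<gamma> j"
  by (intro secsD(4) secs_lc)

text \<open>\<open>E g\<close> is the S_i part of \<open>D f\<close>, that is, D f = H f + E g.
  Hence the S_(i+1) part of D (D f) is H (H f) + T g, and by \<open>D_square_secs\<close> nothing
  else is left of D (D f).\<close>

lemma H_square:
  assumes f: "f \<in> secs (Suc i)" and u: "u \<in> PTot P"
  defines "g \<equiv> lc (- 1 / m (Suc i)) (C (D f)) 0 (C (D f))"
  shows "H (Suc i) (H (Suc i) f) u is = L f u is + (K * (n * (n - 1) / 4 + real (Suc i))) *\<^sub>R f u is - T i g u is"
proof -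
  let ?j = "Suc i"
  define \<alpha> where "\<alpha> = m i / m ?j"
  define k where "k = K * (n * (n - 1) / 4 + real ?j)"
  have g: "g \<in> secs i" unfolding g_def by (intro secs_lc CD_secs f)
  note Hf = H_secs[OF f] and HHf = H_secs[OF H_secs[OF f]] and Tg = T_secs[OF g] and Hg = H_secs[OF g]
  have "D f v = lc 1 (H ?j f) 1 (E g) v" for v
  proof (rule ext)
    fix "is"
    have "E g v is = (- 1 / m ?j) *\<^sub>R emb (cc (D f v)) is"
      unfolding E_def g_def by (simp add: emb_lc C_def)
    then show "D f v is = lc 1 (H ?j f) 1 (E g) v is"
      unfolding lc_apply by (subst D_split[of f v "is" ?j]) simp
  qed
  then have "D f = lc 1 (H ?j f) 1 (E g)" by (rule ext)
  then have DD: "D (D f) u is = D (H ?j f) u is + D (E g) u is" for "is"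
    by (simp add: D_lc[OF secsD(1)[OF Hf] E_fields[OF secsD(1)[OF g]] u])
  \<comment> \<open>All that the two summands contribute to S_i; for \<open>W_split\<close> it is
    enough that this lies in \<open>W \<gamma> i\<close>.\<close>
  define \<xi> where "\<xi> = lc (- 1 / m ?j) (C (D (H ?j f))) (- \<alpha>) (H i g) u"
  have "lc 1 (L f) k f u = lc 1 (H ?j (H ?j f)) 1 (T i g) u"
  proof (rule W_split[OF n3])
    show "lc 1 (L f) k f u \<in> W \<gamma> ?j" "lc 1 (H ?j (H ?j f)) 1 (T i g) u \<in> W \<gamma> ?j" "\<xi> \<in> W \<gamma> i"
      unfolding \<xi>_def by (intro lc_secs_W L_secs f HHf Tg Hg CD_secs Hf u)+
    fix "is"
    have "lc 1 (L f) k f u is = D (D f) u is"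
      by (simp add: lc_apply D_square_secs[OF f u] k_def)
    also have "\<dots> = lc 1 (H ?j (H ?j f)) 1 (T i g) u is + emb \<xi> is"
      unfolding DD D_split[of "H ?j f" u "is" ?j] DE_split[of g u "is" i] \<xi>_def emb_lc lc_apply C_def
      by (simp add: \<alpha>_def)
    finally show "lc 1 (L f) k f u is = lc 1 (H ?j (H ?j f)) 1 (T i g) u is + emb \<xi> is" .
  qed
  from fun_cong[OF this, of "is"] show ?thesis by (simp add: lc_apply k_def algebra_simps)
qed

text \<open>\<open>L\<close> commutes with the natural map \<open>emb\<close>, and the curvature
  term in \<open>D_square\<close> contributes \<open>emb (cc (E \<phi> u))\<close>, which is
  \<open>- m (Suc i)\<close> times \<open>E \<phi> u\<close>.\<close>

lemma DDE:
  assumes \<phi>: "\<phi> \<in> secs i" and u: "u \<in> PTot P"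
  shows "D (D (E \<phi>)) u = E (lc 1 (L \<phi>) (K * (n * (n - 1) / 4 + real (Suc i) - m (Suc i))) \<phi>) u"
proof (rule ext)
  fix "is"
  have 1: "emb (cc (E \<phi> u)) is = - m (Suc i) *\<^sub>R emb (\<phi> u) is"
  proof -
    have "cc (E \<phi> u) ks = - m (Suc i) *\<^sub>R \<phi> u ks" for ks
      unfolding E_def using cc_emb_rank[OF tensD(3)[OF secsD(2)[OF \<phi>] u] tensD(2)[OF secsD(2)[OF \<phi>] u], folded n_def]
      by (simp only: secsD(3)[OF \<phi> u] emb_zero diff_zero)
    then have "cc (E \<phi> u) = (\<lambda>is. - m (Suc i) *\<^sub>R \<phi> u is)" by (rule ext)
    then show ?thesis by (simp only: emb_scaleR)
  qed
  have 2: "(K * (n * (n - 1) / 4 + real (length is))) *\<^sub>R E \<phi> u is = (K * (n * (n - 1) / 4 + real (Suc i))) *\<^sub>R E \<phi> u is"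
    using rank_tenD[OF tensD(3)[OF E_tens[OF secsD(2)[OF \<phi>]] u], of "is"] by (cases "length is = Suc i") simp_all
  have 3: "L (E \<phi>) u is = emb (L \<phi> u) is"
    unfolding E_def by (rule L_natural[OF natural_emb secsD(1)[OF \<phi>] u])
  show "D (D (E \<phi>)) u is = E (lc 1 (L \<phi>) (K * (n * (n - 1) / 4 + real (Suc i) - m (Suc i))) \<phi>) u is"
    unfolding D_square[OF E_tens[OF secsD(2)[OF \<phi>]] u] 1 2 3
    by (simp only: E_def emb_lc scaleR_one scaleR_scaleR add.assoc scaleR_add_left[symmetric])
      (simp add: algebra_simps)
qed

lemma DE_lc: "\<phi> \<in> secs i \<Longrightarrow> D (E \<phi>) = lc 1 (T i \<phi>) (- (m i / m (Suc i))) (E (H i \<phi>))"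
  by (simp add: fun_eq_iff lc_apply T_def)

text \<open>By \<open>DDE\<close> the field D (D (E \<phi>)) lies in the image of \<open>E\<close>.
  Expanding D (E \<phi>) first, its S_(i+1) component is H (T \<phi>) - \<alpha> T (H \<phi>), which
  therefore vanishes.\<close>

lemma H_T:
  assumes \<phi>: "\<phi> \<in> secs i" and u: "u \<in> PTot P"
  shows "H (Suc i) (T i \<phi>) u is = (m i / m (Suc i)) *\<^sub>R T i (H i \<phi>) u is"
proof -
  let ?j = "Suc i"
  define \<alpha> where "\<alpha> = m i / m ?j"
  define k where "k = K * (n * (n - 1) / 4 + real (Suc i) - m (Suc i))"
  note T\<phi> = T_secs[OF \<phi>] and H\<phi> = H_secs[OF \<phi>]
  note TH = T_secs[OF H\<phi>] and HT = H_secs[OF T\<phi>] and HH = H_secs[OF H\<phi>]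
  have DD: "D (D (E \<phi>)) u is = D (T i \<phi>) u is - \<alpha> *\<^sub>R D (E (H i \<phi>)) u is" for "is"
    unfolding DE_lc[OF \<phi>] \<alpha>_def[symmetric] by (simp add: D_lc[OF secsD(1)[OF T\<phi>] E_fields[OF secsD(1)[OF H\<phi>]] u])
  define \<xi> where "\<xi> = lc 1 (lc 1 (L \<phi>) k \<phi>) 1 (lc (1 / m ?j) (C (D (T i \<phi>))) (- \<alpha> * \<alpha>) (H i (H i \<phi>))) u"
  have "H ?j (T i \<phi>) u = lc \<alpha> (T i (H i \<phi>)) 0 (T i (H i \<phi>)) u"
  proof (rule W_split[OF n3])
    show "H ?j (T i \<phi>) u \<in> W \<gamma> ?j" "lc \<alpha> (T i (H i \<phi>)) 0 (T i (H i \<phi>)) u \<in> W \<gamma> ?j" "\<xi> \<in> W \<gamma> i"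
      unfolding \<xi>_def by (intro lc_secs_W secs_lc secsD(4)[OF HT u] TH L_secs \<phi> CD_secs T\<phi> HH u)+
    fix "is"
    have "emb (lc 1 (L \<phi>) k \<phi> u) is = D (T i \<phi>) u is - \<alpha> *\<^sub>R D (E (H i \<phi>)) u is"
      using fun_cong[OF DDE[OF \<phi> u], of "is"] DD[of "is"] unfolding k_def[symmetric] by (simp add: E_def)
    also have "\<dots> = H ?j (T i \<phi>) u is - (1 / m ?j) *\<^sub>R emb (cc (D (T i \<phi>) u)) is
        - \<alpha> *\<^sub>R (T i (H i \<phi>) u is - \<alpha> *\<^sub>R emb (H i (H i \<phi>) u) is)"
      unfolding D_split[of "T i \<phi>" u "is" ?j] DE_split[of "H i \<phi>" u "is" i] \<alpha>_def ..
    finally show "H ?j (T i \<phi>) u is = lc \<alpha> (T i (H i \<phi>)) 0 (T i (H i \<phi>)) u is + emb \<xi> is"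
      unfolding \<xi>_def emb_lc[of _ "lc _ _ _ _"] emb_lc[of "1 / m ?j"] C_def by (simp add: lc_apply scaleR_diff_right)
  qed
  from fun_cong[OF this, of "is"] show ?thesis by (simp add: lc_apply \<alpha>_def)
qed

text \<open>Compute D^3 (E \<phi>) twice. As D applied to \<open>DDE\<close> its S_(i+1) component
  is T \<psi>; as D^2 applied to D (E \<phi>) it is L (T \<phi>) + z T \<phi>. The two zeroth-order
  constants differ by K m (Suc i).\<close>

lemma L_T:
  assumes \<phi>: "\<phi> \<in> secs i" and u: "u \<in> PTot P"
  shows "L (T i \<phi>) u is = T i (L \<phi>) u is - (K * m (Suc i)) *\<^sub>R T i \<phi> u is"
proof -
  let ?j = "Suc i"
  define \<alpha> where "\<alpha> = m i / m ?j"
  \<comment> \<open>\<open>z\<close> and \<open>k\<close> are the zeroth-order terms of D^2 on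
    S_(i+1) and on the image of S_i under \<open>E\<close>.\<close>
  define z where "z = K * (n * (n - 1) / 4 + real (Suc i))"
  define k where "k = K * (n * (n - 1) / 4 + real (Suc i) - m (Suc i))"
  define \<psi> where "\<psi> = lc 1 (L \<phi>) k \<phi>"
  note T\<phi> = T_secs[OF \<phi>] and H\<phi> = H_secs[OF \<phi>]
  have \<psi>: "\<psi> \<in> secs i" unfolding \<psi>_def by (intro secs_lc L_secs \<phi>)
  note DEt = D_tens[OF E_tens[OF secsD(2)[OF \<phi>]]]
  have DEs: "D (E \<phi>) = lc 1 (T i \<phi>) (- \<alpha>) (E (H i \<phi>))" using DE_lc[OF \<phi>] by (simp add: \<alpha>_def)
  have 1: "D (D (D (E \<phi>))) u is = T i \<psi> u is - \<alpha> *\<^sub>R emb (H i \<psi> u) is" for "is"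
  proof -
    have "D (D (D (E \<phi>))) u = D (E \<psi>) u"
      by (rule D_cong[OF D_fields[OF tensD(1)[OF DEt]] _ u]) (simp add: DDE[OF \<phi>] \<psi>_def k_def)
    then show ?thesis by (simp only: DE_split[of \<psi> u "is" i] \<alpha>_def)
  qed
  have 2: "D (D (D (E \<phi>))) u is = L (T i \<phi>) u is - \<alpha> *\<^sub>R emb (L (H i \<phi>) u) is + z *\<^sub>R (T i \<phi> u is - \<alpha> *\<^sub>R emb (H i \<phi> u) is)
      + K *\<^sub>R emb (cc (D (E \<phi>) u)) is" for "is"
  proof -
    have a: "L (D (E \<phi>)) u is = L (T i \<phi>) u is - \<alpha> *\<^sub>R emb (L (H i \<phi>) u) is"
      unfolding DEs by (simp add: L_lc[OF secsD(1)[OF T\<phi>] E_fields[OF secsD(1)[OF H\<phi>]] u])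
        (simp add: E_def L_natural[OF natural_emb secsD(1)[OF H\<phi>] u])
    have b: "(K * (n * (n - 1) / 4 + real (length is))) *\<^sub>R D (E \<phi>) u is = z *\<^sub>R D (E \<phi>) u is"
      using rank_tenD[OF tensD(3)[OF DEt u], of "is"] by (cases "length is = Suc i") (simp_all add: z_def)
    show ?thesis
      unfolding D_square[OF DEt u] a b unfolding DE_split[of \<phi> u _ i] \<alpha>_def ..
  qed
  define \<xi> where "\<xi> = lc (- \<alpha>) (H i \<psi>) 1 (lc \<alpha> (L (H i \<phi>)) 1 (lc (z * \<alpha>) (H i \<phi>) (- K * m i) (H i \<phi>))) u"
  have cD: "cc (D (E \<phi>) u) = (\<lambda>is. m i *\<^sub>R H i \<phi> u is)"
  proof (rule ext)
    fix "is"
    have "cc (E (H i \<phi>) u) is = - m (Suc i) *\<^sub>R H i \<phi> u is"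
      unfolding E_def using cc_emb_rank[OF tensD(3)[OF secsD(2)[OF H\<phi>] u] tensD(2)[OF secsD(2)[OF H\<phi>] u], of "is", folded n_def]
      by (simp only: secsD(3)[OF H\<phi> u] emb_zero diff_zero)
    moreover have "(- \<alpha>) * (- m ?j) = m i"
      unfolding minus_mult_minus \<alpha>_def using m_pos[of ?j] by (simp del: of_nat_Suc)
    ultimately show "cc (D (E \<phi>) u) is = m i *\<^sub>R H i \<phi> u is"
      unfolding DEs cc_lc by (simp only: secsD(3)[OF T\<phi> u] scaleR_scaleR scaleR_zero_right add_0_left)
  qed
  have "lc 1 (L (T i \<phi>)) z (T i \<phi>) u = T i \<psi> u"
  proof (rule W_split[OF n3])
    show "lc 1 (L (T i \<phi>)) z (T i \<phi>) u \<in> W \<gamma> ?j" "T i \<psi> u \<in> W \<gamma> ?j" "\<xi> \<in> W \<gamma> i"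
      unfolding \<xi>_def by (intro lc_secs_W secs_lc secsD(4)[OF T_secs[OF \<psi>] u] L_secs T\<phi> H\<phi> H_secs[OF \<psi>] u)+
    fix "is"
    show "lc 1 (L (T i \<phi>)) z (T i \<phi>) u is = T i \<psi> u is + emb \<xi> is"
      using 1[of "is"] 2[of "is"] unfolding \<xi>_def emb_lc cD emb_scaleR lc_apply by (simp add: algebra_simps)
  qed
  from fun_cong[OF this, of "is"]
  have "L (T i \<phi>) u is + z *\<^sub>R T i \<phi> u is = T i (L \<phi>) u is + k *\<^sub>R T i \<phi> u is"
    by (simp add: lc_apply \<psi>_def T_lc[OF secsD(1)[OF L_secs[OF \<phi>]] secsD(1)[OF \<phi>] u])
  moreover have "k = z - K * m ?j" by (simp add: k_def z_def algebra_simps)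
  ultimately show ?thesis by (simp only: scaleR_diff_left) (simp add: algebra_simps)
qed

section \<open>The second order operators and their product\<close>

text \<open>The zeroth-order part of the bracket in \<open>B_op\<close> relative to the connection
  Laplacian: K times the term j (n + j - 1) + n (n - 1) / 8 of the standard Laplacian minus s (n + s
  - 2) - n (n - 1) / 8.\<close>

definition eig :: "nat \<Rightarrow> nat \<Rightarrow> real" where
  "eig s j = K * (real j * (n + real j - 1) + n * (n - 1) / 4 - real s * (n + real s - 2))"

definition B :: "nat \<Rightarrow> nat \<Rightarrow> ('p, 'n, 's) field \<Rightarrow> ('p, 'n, 's) field" where
  "B s j f = lc 1 (H j (H j f)) (- ((m s)\<^sup>2 / (m j)\<^sup>2)) (lc 1 (L f) (eig s j) f)"

lemma B_secs: "f \<in> secs j \<Longrightarrow> B s j f \<in> secs j"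
  unfolding B_def by (intro secs_lc H_secs L_secs)

text \<open>- K / 2 times the Casimir value of \<open>so_act_casimir\<close> is the stated constant;
  index lists whose length is not \<open>j\<close> give 0 on both sides.\<close>

lemma standard_laplacian_secs:
  assumes f: "f \<in> secs j" and u: "u \<in> PTot P"
  shows "standard_laplacian M \<gamma> P f u is = L f u is + (K * (real j * (n + real j - 1) + n * (n - 1) / 8)) *\<^sub>R f u is"
proof -
  have "(1/2) *\<^sub>R curvature_endo M \<gamma> P f u is = (K * (real j * (n + real j - 1) + n * (n - 1) / 8)) *\<^sub>R f u is"
  proof -
    have "(1/2) *\<^sub>R curvature_endo M \<gamma> P f u is
        = (K * (real (length is) * (n + real (length is) - 1) + n * (n - 1) / 8)) *\<^sub>R f u is"
      unfolding curvature_endo_constant[OF u K] so_act_casimir[OF tensD(2)[OF secsD(2)[OF f] u] secsD(3)[OF f u], folded n_def]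
        scaleR_scaleR
      by (rule arg_cong[where f = "\<lambda>a. a *\<^sub>R f u is"]) (simp add: field_simps)
    then show ?thesis
      using rank_tenD[OF tensD(3)[OF secsD(2)[OF f] u], of "is"] by (cases "length is = j") auto
  qed
  then show ?thesis by (simp add: standard_laplacian_def)
qed

text \<open>When the operator is applied twice, its inner value is known only on the total space;
  \<open>g\<close> stands for such a function.\<close>

lemma higher_spin_dirac_secs:
  assumes f: "f \<in> secs j" and eq: "\<And>u. u \<in> PTot P \<Longrightarrow> f u = g u" and u: "u \<in> PTot P"
  shows "higher_spin_dirac M \<gamma> P j g u = H j f u"
proof -
  have "twisted_dirac M \<gamma> P g u = D g u"
    by (rule ext) (simp add: twisted_dirac_def D_def cc_eq)
  also have "\<dots> = D f u" by (rule D_cong[OF secsD(1)[OF f] eq u, symmetric])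
  finally show ?thesis by (simp add: higher_spin_dirac_def H_W_proj[OF f u])
qed

lemma B_op_secs:
  assumes f: "f \<in> secs j" and u: "u \<in> PTot P"
  shows "B_op M \<gamma> P K s j f u = B s j f u"
proof (rule ext)
  fix "is"
  have HH: "higher_spin_dirac M \<gamma> P j (higher_spin_dirac M \<gamma> P j f) u = H j (H j f) u"
    by (rule higher_spin_dirac_secs[OF H_secs[OF f] _ u]) (rule higher_spin_dirac_secs[OF f refl, symmetric])
  have LL: "standard_laplacian M \<gamma> P f u is - ((real s * (n + real s - 2) - n * (n - 1) / 8) * K) *\<^sub>R f u is
     = lc 1 (L f) (eig s j) f u is"
    unfolding standard_laplacian_secs[OF f u] lc_apply eig_def
    by (simp add: add_diff_eq[symmetric] scaleR_diff_left[symmetric]) (simp add: field_simps)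
  show "B_op M \<gamma> P K s j f u is = B s j f u is"
    unfolding B_op_def Let_def n_def[symmetric] HH LL B_def lc_apply[of 1 "H j (H j f)"] by simp
qed

lemma B_op_secs_closed: "f \<in> secs j \<Longrightarrow> B_op M \<gamma> P K s j f \<in> secs j"
  by (rule secs_cong[OF B_secs]) (simp_all add: B_op_secs)

lemma B_lc:
  assumes f: "f \<in> secs j" and g: "g \<in> secs j" and u: "u \<in> PTot P"
  shows "B s j (lc a f b g) u is = a *\<^sub>R B s j f u is + b *\<^sub>R B s j g u is"
proof -
  have "H j (lc a f b g) v = lc a (H j f) b (H j g) v" if "v \<in> PTot P" for v
    by (rule ext) (simp add: H_lc[OF secsD(1)[OF f] secsD(1)[OF g] that] lc_apply)
  then have "H j (H j (lc a f b g)) u = H j (lc a (H j f) b (H j g)) u"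
    by (intro H_cong secsD(1)[OF H_secs[OF secs_lc[OF f g]]] u)
  then show ?thesis
    by (simp add: B_def lc_apply H_lc[OF secsD(1)[OF H_secs[OF f]] secsD(1)[OF H_secs[OF g]] u]
        L_lc[OF secsD(1)[OF f] secsD(1)[OF g] u] algebra_simps)
qed

lemma B_cong:
  assumes f: "f \<in> secs j" and eq: "\<And>u. u \<in> PTot P \<Longrightarrow> f u = g u" and u: "u \<in> PTot P"
  shows "B s j f u = B s j g u"
proof -
  have "H j f v = H j g v" if "v \<in> PTot P" for v by (rule H_cong[OF secsD(1)[OF f] eq that])
  from H_cong[OF secsD(1)[OF H_secs[OF f]] this u]
  show ?thesis using L_cong[OF secsD(1)[OF f] eq u] eq[OF u] by (simp add: B_def lc_def)
qed

text \<open>The two factors \<alpha> from \<open>H_T\<close> match the change of coefficient from (m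
  s / m i)^2 to (m s / m (Suc i))^2, and the shift in \<open>L_T\<close> is the increment of
  \<open>eig s\<close>.\<close>

lemma B_T:
  assumes \<phi>: "\<phi> \<in> secs i" and u: "u \<in> PTot P"
  shows "B s (Suc i) (T i \<phi>) u is = (m i / m (Suc i))\<^sup>2 *\<^sub>R T i (B s i \<phi>) u is"
proof -
  let ?j = "Suc i"
  define \<alpha> where "\<alpha> = m i / m ?j"
  note T\<phi> = T_secs[OF \<phi>] and H\<phi> = H_secs[OF \<phi>]
  note TH = T_secs[OF H\<phi>]
  have "H ?j (T i \<phi>) v = lc \<alpha> (T i (H i \<phi>)) 0 (T i (H i \<phi>)) v" if "v \<in> PTot P" for v
    by (rule ext) (simp add: lc_apply H_T[OF \<phi> that] \<alpha>_def)
  from H_cong[OF secsD(1)[OF H_secs[OF T\<phi>]] this u]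
  have HH: "H ?j (H ?j (T i \<phi>)) u is = \<alpha>\<^sup>2 *\<^sub>R T i (H i (H i \<phi>)) u is"
    by (simp add: H_lc[OF secsD(1)[OF TH] secsD(1)[OF TH] u] H_T[OF H\<phi> u] power2_eq_square) (simp add: \<alpha>_def)
  have e: "eig s ?j - K * m ?j = eig s i"
    by (simp add: eig_def algebra_simps)
  have LL: "lc 1 (L (T i \<phi>)) (eig s ?j) (T i \<phi>) u is = T i (lc 1 (L \<phi>) (eig s i) \<phi>) u is"
    unfolding lc_apply T_lc[OF secsD(1)[OF L_secs[OF \<phi>]] secsD(1)[OF \<phi>] u] L_T[OF \<phi> u] e[symmetric]
    by (simp add: algebra_simps)
  have r: "(m s)\<^sup>2 / (m ?j)\<^sup>2 = \<alpha>\<^sup>2 * ((m s)\<^sup>2 / (m i)\<^sup>2)"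
  proof -
    have "m i \<noteq> 0" using m_pos[of i] by linarith
    then show ?thesis unfolding \<alpha>_def power_divide by (simp del: of_nat_Suc)
  qed
  have "B s ?j (T i \<phi>) u is = \<alpha>\<^sup>2 *\<^sub>R T i (H i (H i \<phi>)) u is - (\<alpha>\<^sup>2 * ((m s)\<^sup>2 / (m i)\<^sup>2)) *\<^sub>R T i (lc 1 (L \<phi>) (eig s i) \<phi>) u is"
    unfolding B_def lc_apply[of 1 "H ?j (H ?j (T i \<phi>))"] HH LL r by simp
  also have "\<dots> = \<alpha>\<^sup>2 *\<^sub>R T i (B s i \<phi>) u is"
    unfolding B_def T_lc[OF secsD(1)[OF H_secs[OF H\<phi>]] secsD(1)[OF secs_lc[OF L_secs[OF \<phi>] \<phi>]] u]
    by (simp add: scaleR_diff_right)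
  finally show ?thesis by (simp add: \<alpha>_def)
qed

text \<open>For equal indices the coefficient is 1 and \<open>eig\<close> is the constant of
  \<open>H_square\<close>, so only \<open>- T i g\<close> survives.\<close>

lemma B_diag:
  assumes f: "f \<in> secs (Suc i)"
  shows "\<exists>\<phi>\<in>secs i. \<forall>u\<in>PTot P. \<forall>is. B (Suc i) (Suc i) f u is = T i \<phi> u is"
proof -
  let ?j = "Suc i"
  define g where "g = lc (- 1 / m ?j) (C (D f)) 0 (C (D f))"
  have g: "g \<in> secs i" unfolding g_def by (intro secs_lc CD_secs f)
  have "B ?j ?j f u is = T i (lc (-1) g 0 g) u is" if u: "u \<in> PTot P" for u "is"
  proof -
    have "(m ?j)\<^sup>2 / (m ?j)\<^sup>2 = 1" using m_pos[of ?j] by (simp del: of_nat_Suc)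
    moreover have "eig ?j ?j = K * (n * (n - 1) / 4 + real ?j)" by (simp add: eig_def algebra_simps)
    ultimately show ?thesis
      unfolding B_def lc_apply H_square[OF f u, folded g_def] T_lc[OF secsD(1)[OF g] secsD(1)[OF g] u] by simp
  qed
  then show ?thesis using secs_lc[OF g g] by blast
qed

lemma foldr_secs: "f \<in> secs j \<Longrightarrow> foldr (\<lambda>s. B_op M \<gamma> P K s j) ss f \<in> secs j"
  by (induction ss) (simp_all add: B_op_secs_closed)

text \<open>Each factor contributes \<alpha>^2 by \<open>B_T\<close>. The accumulated power is left
  existential, because the right-hand side is going to be 0.\<close>

lemma foldr_T:
  assumes \<phi>: "\<phi> \<in> secs i" and f: "f \<in> secs (Suc i)" "\<And>u. u \<in> PTot P \<Longrightarrow> f u = T i \<phi> u"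
  shows "\<exists>r. \<forall>u\<in>PTot P. \<forall>is. foldr (\<lambda>s. B_op M \<gamma> P K s (Suc i)) ss f u is
    = r *\<^sub>R T i (foldr (\<lambda>s. B_op M \<gamma> P K s i) ss \<phi>) u is"
proof (induction ss)
  case Nil
  show ?case by (rule exI[of _ 1]) (simp add: f)
next
  case (Cons s ss)
  let ?X = "foldr (\<lambda>s. B_op M \<gamma> P K s (Suc i)) ss f" and ?Y = "foldr (\<lambda>s. B_op M \<gamma> P K s i) ss \<phi>"
  obtain r where r: "\<And>u is. u \<in> PTot P \<Longrightarrow> ?X u is = r *\<^sub>R T i ?Y u is" using Cons by blast
  have X: "?X \<in> secs (Suc i)" and Y: "?Y \<in> secs i" by (rule foldr_secs[OF f(1)], rule foldr_secs[OF \<phi>])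
  have "B_op M \<gamma> P K s (Suc i) ?X u is = (r * (m i / m (Suc i))\<^sup>2) *\<^sub>R T i (B_op M \<gamma> P K s i ?Y) u is"
    if u: "u \<in> PTot P" for u "is"
  proof -
    have "B_op M \<gamma> P K s (Suc i) ?X u is = B s (Suc i) ?X u is" by (simp add: B_op_secs[OF X u])
    also have "\<dots> = B s (Suc i) (lc r (T i ?Y) 0 (T i ?Y)) u is"
      by (subst B_cong[OF X _ u, of "lc r (T i ?Y) 0 (T i ?Y)"]) (auto simp: fun_eq_iff lc_apply r)
    also have "\<dots> = (r * (m i / m (Suc i))\<^sup>2) *\<^sub>R T i (B s i ?Y) u is"
      by (simp add: B_lc[OF T_secs[OF Y] T_secs[OF Y] u] B_T[OF Y u])
    also have "T i (B s i ?Y) u = T i (B_op M \<gamma> P K s i ?Y) u"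
      by (rule T_cong[OF secsD(1)[OF B_secs[OF Y]] _ u]) (simp add: B_op_secs[OF Y])
    finally show ?thesis .
  qed
  then show ?case by (intro exI[of _ "r * (m i / m (Suc i))\<^sup>2"]) simp
qed

text \<open>In rank 0 there is nothing to contract, so \<open>H 0\<close> is the Dirac operator
  itself and the vanishing of \<open>B 0 0\<close> is the Lichnerowicz formula.\<close>

lemma product_vanishes:
  "f \<in> secs j \<Longrightarrow> u \<in> PTot P \<Longrightarrow> foldr (\<lambda>s. B_op M \<gamma> P K s j) [0..<Suc j] f u = (\<lambda>is. 0)"
proof (induction j arbitrary: f u)
  case 0
  note f = 0(1) and u = 0(2)
  have DH: "D g v = H 0 g v" if g: "g \<in> secs 0" and v: "v \<in> PTot P" for g v
    using rank_0_cc[OF tensD(3)[OF D_tens[OF secsD(2)[OF g]] v]] by (simp add: H_def lc_def E_def C_def)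
  have "D (D f) u = D (H 0 f) u"
    by (rule D_cong[OF D_fields[OF secsD(1)[OF f]] _ u]) (rule DH[OF f])
  then have HH: "H 0 (H 0 f) u = D (D f) u" by (simp add: DH[OF H_secs[OF f] u])
  have "B 0 0 f u is = 0" for "is"
    using D_square_secs[OF f u, of "is"] m_pos[of 0] by (simp add: B_def lc_apply HH eig_def)
  then show ?case by (simp add: fun_eq_iff B_op_secs[OF f u])
next
  case (Suc i)
  note f = Suc(2) and u = Suc(3)
  let ?Bf = "B_op M \<gamma> P K (Suc i) (Suc i) f"
  obtain \<phi> where \<phi>: "\<phi> \<in> secs i" "\<And>u is. u \<in> PTot P \<Longrightarrow> B (Suc i) (Suc i) f u is = T i \<phi> u is"
    using B_diag[OF f] by blast
  let ?Y = "foldr (\<lambda>s. B_op M \<gamma> P K s i) [0..<Suc i] \<phi>"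
  have Bf: "?Bf u = T i \<phi> u" if "u \<in> PTot P" for u
    by (rule ext) (simp add: B_op_secs[OF f that] \<phi>(2)[OF that])
  obtain r where r: "\<And>u is. u \<in> PTot P \<Longrightarrow> foldr (\<lambda>s. B_op M \<gamma> P K s (Suc i)) [0..<Suc i] ?Bf u is = r *\<^sub>R T i ?Y u is"
    using foldr_T[OF \<phi>(1) B_op_secs_closed[OF f] Bf, of "[0..<Suc i]"] by blast
  have Y: "?Y \<in> secs i" by (rule foldr_secs[OF \<phi>(1)])
  \<comment> \<open>By the induction hypothesis \<open>?Y\<close> vanishes on the total space; the
    zero field is written as an \<open>lc\<close> so that \<open>T_lc\<close> applies.\<close>
  have "T i ?Y u = T i (lc 0 ?Y 0 ?Y) u"
    by (rule T_cong[OF secsD(1)[OF Y] _ u]) (simp only: Suc.IH[OF \<phi>(1)] lc_def, simp)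
  from fun_cong[OF this] have "T i ?Y u is = 0" for "is"
    unfolding T_lc[OF secsD(1)[OF Y] secsD(1)[OF Y] u] by simp
  then have "foldr (\<lambda>s. B_op M \<gamma> P K s (Suc i)) [0..<Suc i] ?Bf u is = 0" for "is"
    by (simp only: r[OF u]) simp
  \<comment> \<open>\<open>foldr\<close> applies the last entry first, so the factor with
    \<open>s = Suc i\<close> is the innermost one.\<close>
  moreover have "[0..<Suc (Suc i)] = [0..<Suc i] @ [Suc i]" by simp
  ultimately show ?case by (simp only: foldr_append foldr.simps comp_apply id_apply fun_eq_iff) simp
qed

end

theorem theorem5:
  fixes M :: "('m, 'n::finite) rmfd"
    and \<gamma> :: "('n, 's::finite) gammas"
    and P :: "('m, 'n, 'p, 's) spinstr"
    and c :: real and j :: nat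
    and f :: "('p, 'n, 's) field"
  assumes "CARD('n) \<ge> 3"
    and "riemannian_manifold M"
    and "constant_curvature M c"
    and "spinor_module \<gamma>"
    and "spin_structure M \<gamma> P"
    and "f \<in> S_sections M \<gamma> P j"
    and "u \<in> PTot P"
  shows "foldr (\<lambda>s. B_op M \<gamma> P c s j) [0..<Suc j] f u = (\<lambda>is. 0)"
proof -
  interpret space_form M \<gamma> P c "real CARD('n)"
    by unfold_locales (use assms in auto)
  have "f \<in> secs j"
    using assms(6) unfolding S_sections_def secs_def fields_def by (auto simp: fun_eq_iff)
  then show ?thesis by (rule product_vanishes[OF _ assms(7)])
qed

end
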